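(* Let $N\ge 3$, $\alpha\in(0,N)$, let $\Omega\subset\mathbb{R}^N$ be a smooth domain which is strictly star-shaped with respect to the origin, let $p\ge\frac{N+\alpha}{N-2}$ and $V\in C^1(\Omega)$. Let $u\in H^1_0(\Omega)\cap H^2(\Omega)\cap W^{1,\frac{2pN}{N+\alpha}}(\Omega)$ be a solution to $$-\Delta u+Vu=(I_\alpha\ast|u|^p)|u|^{p-2}u\ \text{ in }\Omega,\qquad u=0\ \text{ on }\partial\Omega.$$ Assume that $u^2V\in L^1(\Omega)$, $u^2\,\nabla V\cdot x\in L^1(\Omega)$ and $\int_\Omega u^2\,\nabla V\cdot x\,dx\ge 0$. Assume moreover that $V>0$ in $\Omega$ if $p=\frac{N+\alpha}{N-2}$, and that $V\ge 0$ in $\Omega$ if $p>\frac{N+\alpha}{N-2}$. Then $u\equiv 0$.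
   Context: $I_\alpha(x)=\frac{C_{N,\alpha}}{|x|^{N-\alpha}}$ with $C_{N,\alpha}=\frac{\Gamma(\frac{N-\alpha}{2})}{\Gamma(\frac{\alpha}{2})\pi^{N/2}2^\alpha}$ is the Riesz potential; for $f$ on $\Omega$, $I_\alpha\ast f$ means $I_\alpha\ast(\chi_\Omega f)$ on $\mathbb{R}^N$. A domain $\Omega$ is strictly star-shaped with respect to the origin if $x\cdot\nu(x)>0$ for all $x\in\partial\Omega$, where $\nu$ is the exterior unit normal. *)

theory Defs
  imports "HOL-Analysis.Analysis"
begin

definition pdiff :: "'a::euclidean_space \<Rightarrow> ('a \<Rightarrow> real) \<Rightarrow> 'a \<Rightarrow> real" where
  "pdiff b f x = frechet_derivative f (at x) b"

definition grad :: "('a::euclidean_space \<Rightarrow> real) \<Rightarrow> 'a \<Rightarrow> 'a" where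
  "grad f x = (\<Sum>b\<in>Basis. pdiff b f x *\<^sub>R b)"

inductive_set iter_partials :: "('a::euclidean_space \<Rightarrow> real) \<Rightarrow> ('a \<Rightarrow> real) set"
  for f where
  base: "f \<in> iter_partials f"
| step: "g \<in> iter_partials f \<Longrightarrow> b \<in> Basis \<Longrightarrow> pdiff b g \<in> iter_partials f"

text \<open>C-infinity on the whole space: every iterated partial derivative is differentiable
  (hence continuous) everywhere.\<close>
definition smooth_fun :: "('a::euclidean_space \<Rightarrow> real) \<Rightarrow> bool" where
  "smooth_fun f \<longleftrightarrow> (\<forall>g\<in>iter_partials f. g differentiable_on UNIV)"

definition test_fun :: "'a::euclidean_space set \<Rightarrow> ('a \<Rightarrow> real) \<Rightarrow> bool" where
  "test_fun \<Omega> \<phi> \<longleftrightarrow> smooth_fun \<phi> \<and> compact (closure {x. \<phi> x \<noteq> 0})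
      \<and> closure {x. \<phi> x \<noteq> 0} \<subseteq> \<Omega>"

text \<open>rho is a smooth global defining function of Omega: Omega = {rho < 0} and
  grad rho does not vanish on {rho = 0} (= the boundary of Omega).\<close>
definition defining_fun :: "'a::euclidean_space set \<Rightarrow> ('a \<Rightarrow> real) \<Rightarrow> bool" where
  "defining_fun \<Omega> \<rho> \<longleftrightarrow> smooth_fun \<rho> \<and> \<Omega> = {x. \<rho> x < 0}
      \<and> (\<forall>x. \<rho> x = 0 \<longrightarrow> grad \<rho> x \<noteq> 0)"

definition smooth_domain :: "'a::euclidean_space set \<Rightarrow> bool" where
  "smooth_domain \<Omega> \<longleftrightarrow> open \<Omega> \<and> connected \<Omega> \<and> \<Omega> \<noteq> {} \<and> (\<exists>\<rho>. defining_fun \<Omega> \<rho>)"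

text \<open>Exterior unit normal at a boundary point, computed from a defining function
  (independent of the choice of defining function).\<close>
definition ext_normal :: "('a::euclidean_space \<Rightarrow> real) \<Rightarrow> 'a \<Rightarrow> 'a" where
  "ext_normal \<rho> x = (1 / norm (grad \<rho> x)) *\<^sub>R grad \<rho> x"

definition strictly_star_shaped :: "'a::euclidean_space set \<Rightarrow> bool" where
  "strictly_star_shaped \<Omega> \<longleftrightarrow>
     (\<exists>\<rho>. defining_fun \<Omega> \<rho> \<and> (\<forall>x\<in>frontier \<Omega>. x \<bullet> ext_normal \<rho> x > 0))"

definition Lp_on :: "real \<Rightarrow> 'a::euclidean_space set \<Rightarrow> ('a \<Rightarrow> real) \<Rightarrow> bool" where
  "Lp_on q \<Omega> f \<longleftrightarrow> f \<in> borel_measurable (lebesgue_on \<Omega>)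
      \<and> integrable (lebesgue_on \<Omega>) (\<lambda>x. \<bar>f x\<bar> powr q)"

definition weak_pdiff :: "'a::euclidean_space set \<Rightarrow> 'a \<Rightarrow> ('a \<Rightarrow> real) \<Rightarrow> ('a \<Rightarrow> real) \<Rightarrow> bool" where
  "weak_pdiff \<Omega> b u g \<longleftrightarrow> (\<forall>\<phi>. test_fun \<Omega> \<phi> \<longrightarrow>
      integral\<^sup>L (lebesgue_on \<Omega>) (\<lambda>x. u x * pdiff b \<phi> x)
      = - integral\<^sup>L (lebesgue_on \<Omega>) (\<lambda>x. g x * \<phi> x))"

definition H10 :: "'a::euclidean_space set \<Rightarrow> ('a \<Rightarrow> real) \<Rightarrow> ('a \<Rightarrow> 'a \<Rightarrow> real) \<Rightarrow> bool" where
  "H10 \<Omega> u Du \<longleftrightarrow> Lp_on 2 \<Omega> u \<and> (\<forall>b\<in>Basis. weak_pdiff \<Omega> b u (Du b) \<and> Lp_on 2 \<Omega> (Du b))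
     \<and> (\<exists>\<phi>. (\<forall>k. test_fun \<Omega> (\<phi> k))
        \<and> (\<lambda>k. integral\<^sup>L (lebesgue_on \<Omega>) (\<lambda>x. (\<phi> k x - u x)\<^sup>2)) \<longlonglongrightarrow> 0
        \<and> (\<forall>b\<in>Basis. (\<lambda>k. integral\<^sup>L (lebesgue_on \<Omega>) (\<lambda>x. (pdiff b (\<phi> k) x - Du b x)\<^sup>2)) \<longlonglongrightarrow> 0))"

definition H2 :: "'a::euclidean_space set \<Rightarrow> ('a \<Rightarrow> real) \<Rightarrow> ('a \<Rightarrow> 'a \<Rightarrow> real)
                   \<Rightarrow> ('a \<Rightarrow> 'a \<Rightarrow> 'a \<Rightarrow> real) \<Rightarrow> bool" where
  "H2 \<Omega> u Du D2u \<longleftrightarrow> Lp_on 2 \<Omega> u \<and> (\<forall>b\<in>Basis. weak_pdiff \<Omega> b u (Du b) \<and> Lp_on 2 \<Omega> (Du b)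
     \<and> (\<forall>c\<in>Basis. weak_pdiff \<Omega> c (Du b) (D2u b c) \<and> Lp_on 2 \<Omega> (D2u b c)))"

definition W1q :: "real \<Rightarrow> 'a::euclidean_space set \<Rightarrow> ('a \<Rightarrow> real) \<Rightarrow> ('a \<Rightarrow> 'a \<Rightarrow> real) \<Rightarrow> bool" where
  "W1q q \<Omega> u Du \<longleftrightarrow> Lp_on q \<Omega> u \<and> (\<forall>b\<in>Basis. weak_pdiff \<Omega> b u (Du b) \<and> Lp_on q \<Omega> (Du b))"

definition riesz_const :: "nat \<Rightarrow> real \<Rightarrow> real" where
  "riesz_const N \<alpha> = Gamma ((real N - \<alpha>) / 2) / (Gamma (\<alpha> / 2) * pi powr (real N / 2) * 2 powr \<alpha>)"

definition riesz :: "real \<Rightarrow> 'a::euclidean_space \<Rightarrow> real" where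
  "riesz \<alpha> x = riesz_const DIM('a) \<alpha> / norm x powr (real DIM('a) - \<alpha>)"

definition riesz_conv :: "real \<Rightarrow> 'a::euclidean_space set \<Rightarrow> ('a \<Rightarrow> real) \<Rightarrow> 'a \<Rightarrow> real" where
  "riesz_conv \<alpha> \<Omega> f x = integral\<^sup>L (lebesgue_on \<Omega>) (\<lambda>y. riesz \<alpha> (x - y) * f y)"

end

theory Submission
  imports Defs
begin

text \<open>
  The proof is Pohozaev's: test the equation with \<open>x \<bullet> \<nabla>u\<close>, compare with the result of testing it with \<open>u\<close>, and read
  off from the signs of the coefficients that \<open>u = 0\<close>.  Star-shapedness enters as \<open>t \<Omega> \<subseteq> \<Omega>\<close> for
  \<open>0 \<le> t \<le> 1\<close>, and boundary traces are avoided altogether.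

  For the Laplacian, extend \<open>u\<close> by zero and test with the difference quotients \<open>(u (c x) - u x) / (c - 1)\<close>, \<open>c > 1\<close>.
  They lie in \<open>H\<^sup>1\<^sub>0 (\<Omega>)\<close> because dilation shrinks the support towards the origin, and the Cauchy-Schwarz
  inequality gives the sign that the boundary integral has in Pohozaev's identity.

  For the potential and for the nonlocal term, integrate by parts along almost every ray from the origin, on which
  \<open>u\<close> is absolutely continuous and vanishes where the ray leaves \<open>\<Omega>\<close>.  There is no boundary term although
  \<open>V\<close> may blow up at the boundary: the equation makes \<open>V u (x \<bullet> \<nabla>u)\<close> integrable, and this rules out a
  nonzero limit of \<open>V u\<^sup>2\<close>.

  The double integrals converge by the diagonal Hardy-Littlewood-Sobolev inequality: by symmetry only
  the pairs with \<open>F y \<le> F x\<close> matter, and for those the integral over \<open>y\<close> is bounded by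
  \<open>C F(x)\<^bsup>r - 1\<^esup>\<close> on splitting it at \<open>|x - y| = F(x)\<^bsup>-2/(N + \<alpha>)\<^esup>\<close>.  A Gaussian cut-off makes all functions integrable
  at infinity and is removed at the end.
\<close>

subsection \<open>Smooth functions and star-shaped sets\<close>

text \<open>\<Omega> may be unbounded and \<open>x\<close> is an unbounded multiplier, hence a
  cut-off. The radial derivative of a Gaussian costs only
  \<open>\<epsilon> |x|^2 exp (- \<epsilon> |x|^2)\<close>, at most 1 and pointwise null as
  \<epsilon> tends to 0, so dominated convergence removes it. Write \<open>A\<close>,
  \<open>B\<close>, \<open>C\<close> for the integrals of \<open>|grad u|^2\<close>,
  \<open>V u^2\<close> and \<open>u^2 (grad V . x)\<close>, and \<open>D\<close> for the double
  integral with its constant. In the limit the radial test gives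
  \<open>(N B + C) / 2 - (N + \<alpha>) D / (2 p) <= (2 - N) A / 2\<close>, and the test with
  \<open>u\<close> gives \<open>A + B = D\<close>. Eliminating \<open>D\<close> leaves the
  coefficients \<open>(N - 2) / 2 - q\<close> of \<open>A\<close> and \<open>N / 2 - q\<close> of
  \<open>B\<close>, with \<open>q = (N + \<alpha>) / (2 p)\<close>; the first is nonnegative exactly
  for \<open>p >= (N + \<alpha>) / (N - 2)\<close>. The factor \<open>(2 - N) / 2\<close> is half
  the derivative at \<open>c = 1\<close> of \<open>c^(2 - N)\<close>, the scaling of the Dirichlet
  energy. The factor \<open>(N + \<alpha>) / 2\<close> is \<open>N - (N - \<alpha>) / 2\<close>:
  symmetrising in \<open>x\<close> and \<open>y\<close> halves the radial derivative of the kernel.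
  It also cancels the extra singularity of that derivative, so the kernel is regularised until the
  symmetrisation is done.\<close>

lemma pdiff_eqI: "(f has_derivative D) (at x) \<Longrightarrow> pdiff b f x = D b"
  unfolding pdiff_def by (simp add: frechet_derivative_at[symmetric])

lemma has_derivative_grad:
  fixes f :: "'a::euclidean_space \<Rightarrow> real"
  assumes "f differentiable (at x)"
  shows "(f has_derivative (\<lambda>h. grad f x \<bullet> h)) (at x)"
proof -
  have d: "(f has_derivative frechet_derivative f (at x)) (at x)"
    using assms frechet_derivative_works by blast
  then interpret bounded_linear "frechet_derivative f (at x)" by (rule has_derivative_bounded_linear)
  have "frechet_derivative f (at x) h = grad f x \<bullet> h" for h
  proof -
    have "frechet_derivative f (at x) h = frechet_derivative f (at x) (\<Sum>b\<in>Basis. (h \<bullet> b) *\<^sub>R b)"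
      by (simp add: euclidean_representation)
    also have "\<dots> = (\<Sum>b\<in>Basis. (h \<bullet> b) * frechet_derivative f (at x) b)"
      by (simp add: sum scaleR)
    also have "\<dots> = grad f x \<bullet> h"
      by (simp add: grad_def pdiff_def inner_sum_left inner_commute[of h] mult.commute)
    finally show ?thesis .
  qed
  then have "frechet_derivative f (at x) = (\<lambda>h. grad f x \<bullet> h)" by (rule ext)
  with d show ?thesis by simp
qed

lemma grad_inner_Basis: "b \<in> Basis \<Longrightarrow> grad f x \<bullet> b = pdiff b f x"
  by (simp add: grad_def inner_sum_left inner_Basis if_distrib sum.delta cong: if_cong)

text \<open>Iterated partial derivatives never leave a class that is closed under
  \<open>pdiff\<close>, so smoothness follows from exhibiting an invariant class of differentiable
  functions. The closure properties below differ only in the class chosen.\<close>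

lemma smooth_fun_coinduct:
  assumes "f \<in> C" "\<And>g x. g \<in> C \<Longrightarrow> g differentiable (at x)"
    "\<And>g b. g \<in> C \<Longrightarrow> b \<in> Basis \<Longrightarrow> pdiff b g \<in> C"
  shows "smooth_fun f"
proof -
  have "g \<in> C" if "g \<in> iter_partials f" for g
    using that by induction (use assms in auto)
  then show ?thesis
    unfolding smooth_fun_def differentiable_on_def using assms(2) by blast
qed

lemma smooth_fun_differentiable: "smooth_fun f \<Longrightarrow> f differentiable (at x)"
  unfolding smooth_fun_def differentiable_on_def using iter_partials.base by blast

lemma smooth_fun_pdiff:
  assumes "smooth_fun f" "b \<in> Basis" shows "smooth_fun (pdiff b f)"
proof -
  have "g \<in> iter_partials f" if "g \<in> iter_partials (pdiff b f)" for g
    using that by induction (use assms in \<open>auto intro: iter_partials.intros\<close>)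
  then show ?thesis using assms unfolding smooth_fun_def by blast
qed

lemma smooth_fun_has_derivative:
  "smooth_fun f \<Longrightarrow> (f has_derivative (\<lambda>h. grad f x \<bullet> h)) (at x)"
  by (simp add: has_derivative_grad smooth_fun_differentiable)

lemma smooth_fun_continuous: "smooth_fun f \<Longrightarrow> continuous_on S f"
  by (meson continuous_at_imp_continuous_on differentiable_imp_continuous_within
      smooth_fun_differentiable)

lemma smooth_fun_grad_continuous: "smooth_fun f \<Longrightarrow> continuous_on S (grad f)"
  unfolding grad_def[abs_def]
  by (intro continuous_intros smooth_fun_continuous smooth_fun_pdiff)

lemma smooth_fun_ray:
  fixes f :: "'a::euclidean_space \<Rightarrow> real"
  assumes "smooth_fun f"
  shows "((\<lambda>t. f (t *\<^sub>R x)) has_real_derivative (grad f (t *\<^sub>R x) \<bullet> x)) (at t)"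
    and "continuous_on S (\<lambda>t. grad f (t *\<^sub>R x) \<bullet> x)"
proof -
  show "((\<lambda>t. f (t *\<^sub>R x)) has_real_derivative (grad f (t *\<^sub>R x) \<bullet> x)) (at t)"
    unfolding has_field_derivative_def
    by (rule has_derivative_eq_rhs[OF has_derivative_compose[where f = "\<lambda>t. t *\<^sub>R x", OF _ smooth_fun_has_derivative[OF assms]]])
       (auto intro!: derivative_eq_intros simp: fun_eq_iff)
  show "continuous_on S (\<lambda>t. grad f (t *\<^sub>R x) \<bullet> x)"
    by (intro continuous_intros continuous_on_compose2[OF smooth_fun_grad_continuous[OF assms, where S = UNIV]]) auto
qed

lemma pdiff_add:
  assumes "f differentiable (at x)" "g differentiable (at x)"
  shows "pdiff b (\<lambda>x. f x + g x) x = pdiff b f x + pdiff b g x"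
  using pdiff_eqI[OF has_derivative_add[OF has_derivative_grad[OF assms(1)] has_derivative_grad[OF assms(2)]]]
    pdiff_eqI[OF has_derivative_grad[OF assms(1)]] pdiff_eqI[OF has_derivative_grad[OF assms(2)]]
  by metis

lemma pdiff_mult:
  assumes "f differentiable (at x)" "g differentiable (at x)"
  shows "pdiff b (\<lambda>x. f x * g x) x = pdiff b f x * g x + f x * pdiff b g x"
  using pdiff_eqI[OF has_derivative_mult[OF has_derivative_grad[OF assms(1)] has_derivative_grad[OF assms(2)]], of b]
    pdiff_eqI[OF has_derivative_grad[OF assms(1)], of b] pdiff_eqI[OF has_derivative_grad[OF assms(2)], of b]
  by simp

lemma has_derivative_dilation:
  assumes "f differentiable (at (c *\<^sub>R x))"
  shows "((\<lambda>x. a * f (c *\<^sub>R x)) has_derivative (\<lambda>h. a * (grad f (c *\<^sub>R x) \<bullet> (c *\<^sub>R h)))) (at x)"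
  by (rule has_derivative_mult_right,
      rule has_derivative_compose[where f = "\<lambda>x. c *\<^sub>R x", OF _ has_derivative_grad[OF assms]])
     (auto intro!: derivative_eq_intros)

lemma smooth_fun_const: "smooth_fun (\<lambda>x::'a::euclidean_space. c::real)"
proof (rule smooth_fun_coinduct[where C = "range (\<lambda>c x. c)"])
  have "pdiff b (\<lambda>x::'a. c::real) = (\<lambda>x. 0)" for b c
    using pdiff_eqI[OF has_derivative_const] by auto
  then show "pdiff b g \<in> range (\<lambda>c x. c)" if "g \<in> range (\<lambda>c x. c)" for g :: "'a \<Rightarrow> real" and b
    using that by auto
qed auto

lemma smooth_fun_add:
  assumes "smooth_fun f" "smooth_fun g" shows "smooth_fun (\<lambda>x. f x + g x)"
proof (rule smooth_fun_coinduct[where C = "{(\<lambda>x. f x + g x) | f g. smooth_fun f \<and> smooth_fun g}"])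
  show "(\<lambda>x. f x + g x) \<in> {(\<lambda>x. f x + g x) | f g. smooth_fun f \<and> smooth_fun g}"
    using assms by auto
next
  fix h :: "'a \<Rightarrow> real" and x
  assume "h \<in> {(\<lambda>x. f x + g x) | f g. smooth_fun f \<and> smooth_fun g}"
  then show "h differentiable (at x)" by (auto intro: differentiable_add smooth_fun_differentiable)
next
  fix h :: "'a \<Rightarrow> real" and b :: 'a
  assume b: "b \<in> Basis" and "h \<in> {(\<lambda>x. f x + g x) | f g. smooth_fun f \<and> smooth_fun g}"
  then obtain f g where fg: "smooth_fun f" "smooth_fun g" "h = (\<lambda>x. f x + g x)" by auto
  then have "pdiff b h = (\<lambda>x. pdiff b f x + pdiff b g x)"
    by (auto simp: pdiff_add smooth_fun_differentiable)
  with fg b show "pdiff b h \<in> {(\<lambda>x. f x + g x) | f g. smooth_fun f \<and> smooth_fun g}"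
    using smooth_fun_pdiff by blast
qed

text \<open>Products alone are not invariant under \<open>pdiff\<close>, since Leibniz' rule
  produces a sum. Finite sums of products form the smallest convenient invariant class.\<close>

inductive_set prod_span :: "('a::euclidean_space \<Rightarrow> real) set" where
  prod: "smooth_fun f \<Longrightarrow> smooth_fun g \<Longrightarrow> (\<lambda>x. f x * g x) \<in> prod_span"
| add: "f \<in> prod_span \<Longrightarrow> g \<in> prod_span \<Longrightarrow> (\<lambda>x. f x + g x) \<in> prod_span"

lemma smooth_fun_mult:
  assumes "smooth_fun f" "smooth_fun g" shows "smooth_fun (\<lambda>x. f x * g x)"
proof (rule smooth_fun_coinduct[where C = prod_span])
  show "(\<lambda>x. f x * g x) \<in> prod_span" using assms by (rule prod_span.prod)
next
  show d: "h differentiable (at x)" if "h \<in> prod_span" for h :: "'a \<Rightarrow> real" and x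
    using that
    by induction (auto intro: differentiable_add differentiable_mult smooth_fun_differentiable)
  show "pdiff b h \<in> prod_span" if "h \<in> prod_span" "b \<in> Basis" for h :: "'a \<Rightarrow> real" and b
    using that
  proof induction
    case (prod f g)
    then have "pdiff b (\<lambda>x. f x * g x) = (\<lambda>x. (pdiff b f x * g x) + (f x * pdiff b g x))"
      by (auto simp: pdiff_mult smooth_fun_differentiable)
    with prod show ?case by (auto intro!: prod_span.intros smooth_fun_pdiff)
  next
    case (add f g)
    then have "pdiff b (\<lambda>x. f x + g x) = (\<lambda>x. pdiff b f x + pdiff b g x)"
      by (auto simp: pdiff_add d)
    with add show ?case by (auto intro!: prod_span.intros)
  qed
qed

text \<open>Each differentiation multiplies by \<open>c\<close>, so the invariant class needs the
  free factor \<open>a\<close>. With \<open>c = 1\<close> and \<open>a = - 1\<close> this also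
  yields negation, and with it differences of smooth functions.\<close>

lemma smooth_fun_scale:
  assumes "smooth_fun f" shows "smooth_fun (\<lambda>x. a * f (c *\<^sub>R x))"
proof (rule smooth_fun_coinduct[where C = "{(\<lambda>x. a * f (c *\<^sub>R x)) | a f. smooth_fun f}"])
  show "(\<lambda>x. a * f (c *\<^sub>R x)) \<in> {(\<lambda>x. a * f (c *\<^sub>R x)) | a f. smooth_fun f}"
    using assms by auto
next
  fix h :: "'a \<Rightarrow> real" and x
  assume "h \<in> {(\<lambda>x. a * f (c *\<^sub>R x)) | a f. smooth_fun f}"
  then obtain a f where "smooth_fun f" "h = (\<lambda>x. a * f (c *\<^sub>R x))" by auto
  then show "h differentiable (at x)"
    using has_derivative_dilation[of f c x a] smooth_fun_differentiable differentiable_def by blast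
next
  fix h :: "'a \<Rightarrow> real" and b :: 'a
  assume b: "b \<in> Basis" and "h \<in> {(\<lambda>x. a * f (c *\<^sub>R x)) | a f. smooth_fun f}"
  then obtain a f where f: "smooth_fun f" "h = (\<lambda>x. a * f (c *\<^sub>R x))" by auto
  have "pdiff b h x = (a * c) * pdiff b f (c *\<^sub>R x)" for x
    using pdiff_eqI[OF has_derivative_dilation[of f c x a]] f b
    by (simp add: smooth_fun_differentiable grad_inner_Basis)
  then have "pdiff b h = (\<lambda>x. (a * c) * pdiff b f (c *\<^sub>R x))" by (rule ext)
  with f b show "pdiff b h \<in> {(\<lambda>x. a * f (c *\<^sub>R x)) | a f. smooth_fun f}"
    using smooth_fun_pdiff by blast
qed

lemma smooth_fun_inner: "smooth_fun (\<lambda>x. x \<bullet> (b::'a::euclidean_space))"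
proof (rule smooth_fun_coinduct[where C = "insert (\<lambda>x. x \<bullet> b) (range (\<lambda>c x. c))"])
  have "pdiff c (\<lambda>x. x \<bullet> b) x = c \<bullet> b" for c x :: 'a
    by (rule pdiff_eqI) (auto intro!: derivative_eq_intros)
  then have "pdiff c (\<lambda>x. x \<bullet> b) = (\<lambda>x. c \<bullet> b)" for c by (rule ext)
  moreover have "pdiff b (\<lambda>x::'a. c::real) = (\<lambda>x. 0)" for b c
    using pdiff_eqI[OF has_derivative_const] by auto
  ultimately show "pdiff c g \<in> insert (\<lambda>x. x \<bullet> b) (range (\<lambda>c x. c))"
    if "g \<in> insert (\<lambda>x. x \<bullet> b) (range (\<lambda>c x. c))" for c g
    using that by auto
qed auto

lemma has_derivative_gauss:
  "((\<lambda>x::'a::euclidean_space. exp (- \<epsilon> * (norm x)\<^sup>2)) has_derivative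
     (\<lambda>h. (- 2 * \<epsilon> * exp (- \<epsilon> * (norm x)\<^sup>2)) * (x \<bullet> h))) (at x)"
  unfolding power2_norm_eq_inner
  by (auto intro!: derivative_eq_intros simp: inner_commute)

text \<open>Gaussian times smooth function is an invariant form: differentiation in direction
  \<open>b\<close> acts on the factor \<open>P\<close> alone, turning it into
  \<open>pdiff b P - 2 \<epsilon> (x . b) P\<close>.\<close>

lemma smooth_fun_gauss_mult:
  assumes "smooth_fun P"
  shows "smooth_fun (\<lambda>x::'a::euclidean_space. exp (- \<epsilon> * (norm x)\<^sup>2) * P x)"
proof -
  define E where "E = (\<lambda>x::'a. exp (- \<epsilon> * (norm x)\<^sup>2))"
  have dE: "(E has_derivative (\<lambda>h. (- 2 * \<epsilon> * E x) * (x \<bullet> h))) (at x)" for x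
    unfolding E_def by (rule has_derivative_gauss)
  have E: "E differentiable (at x)" "pdiff b E x = - 2 * \<epsilon> * (x \<bullet> b) * E x" for x b
    using pdiff_eqI[OF dE] by (auto intro: differentiableI[OF dE])
  have "smooth_fun (\<lambda>x. E x * P x)"
  proof (rule smooth_fun_coinduct[where C = "{(\<lambda>x. E x * P x) | P. smooth_fun P}"])
    show "(\<lambda>x. E x * P x) \<in> {(\<lambda>x. E x * P x) | P. smooth_fun P}" using assms by auto
  next
    fix h x assume "h \<in> {(\<lambda>x. E x * P x) | P. smooth_fun P}"
    then show "h differentiable (at x)"
      by (auto intro: differentiable_mult smooth_fun_differentiable E)
  next
    fix h and b :: 'a assume b: "b \<in> Basis" and "h \<in> {(\<lambda>x. E x * P x) | P. smooth_fun P}"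
    then obtain P where P: "smooth_fun P" "h = (\<lambda>x. E x * P x)" by auto
    have "pdiff b h x = E x * (((- 2 * \<epsilon>) * (x \<bullet> b)) * P x + pdiff b P x)" for x
      using P by (simp add: pdiff_mult E smooth_fun_differentiable algebra_simps)
    then have "pdiff b h = (\<lambda>x. E x * (((- 2 * \<epsilon>) * (x \<bullet> b)) * P x + pdiff b P x))" by (rule ext)
    moreover have "smooth_fun (\<lambda>x. ((- 2 * \<epsilon>) * (x \<bullet> b)) * P x + pdiff b P x)"
      by (intro smooth_fun_add smooth_fun_mult smooth_fun_const smooth_fun_inner smooth_fun_pdiff P b)
    ultimately show "pdiff b h \<in> {(\<lambda>x. E x * P x) | P. smooth_fun P}"
      by (intro CollectI exI[of _ "\<lambda>x. ((- 2 * \<epsilon>) * (x \<bullet> b)) * P x + pdiff b P x"] conjI)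
  qed
  then show ?thesis by (simp add: E_def)
qed

text \<open>If the segment from the origin to \<open>x\<close> left \<Omega>, there would be a last
  parameter \<open>T\<close> at which the defining function is nonnegative along it. The point
  \<open>T x\<close> lies on the boundary, and the condition on the normal makes the defining
  function increase strictly along the ray there, although it is negative immediately after
  \<open>T\<close>.\<close>

lemma strictly_star_shaped_scaleR:
  fixes \<Omega> :: "'a::euclidean_space set"
  assumes "strictly_star_shaped \<Omega>" "x \<in> \<Omega>" "0 \<le> t" "t \<le> 1"
  shows "t *\<^sub>R x \<in> \<Omega>"
proof (rule ccontr)
  assume nt: "t *\<^sub>R x \<notin> \<Omega>"
  obtain \<rho> where \<rho>: "smooth_fun \<rho>" "\<Omega> = {x. \<rho> x < 0}"
    and st: "\<And>x. x \<in> frontier \<Omega> \<Longrightarrow> x \<bullet> ext_normal \<rho> x > 0"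
    using assms(1) unfolding strictly_star_shaped_def defining_fun_def by blast
  define g where "g s = \<rho> (s *\<^sub>R x)" for s
  have gd: "(g has_real_derivative (grad \<rho> (s *\<^sub>R x) \<bullet> x)) (at s)" for s
    unfolding g_def has_field_derivative_def
    by (rule has_derivative_eq_rhs[OF has_derivative_compose[OF _ smooth_fun_has_derivative[OF \<rho>(1)]]])
       (auto intro!: derivative_eq_intros simp: fun_eq_iff)
  have gc: "continuous_on S g" for S
    by (meson DERIV_isCont continuous_at_imp_continuous_on gd)
  define A where "A = {s \<in> {0..1}. 0 \<le> g s}"
  have "A = {0..1} \<inter> {s. 0 \<le> g s}" unfolding A_def by auto
  then have "closed A"
    using closed_Collect_le[OF continuous_on_const gc] by auto
  moreover have "t \<in> A" using nt assms \<rho>(2) unfolding A_def g_def by auto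
  moreover have bdd: "bdd_above A" unfolding A_def by (auto intro: bdd_aboveI[of _ 1])
  ultimately have TA: "Sup A \<in> A" by (intro closed_contains_Sup) auto
  define T where "T = Sup A"
  have T: "0 \<le> T" "T \<le> 1" "0 \<le> g T" using TA unfolding T_def A_def by auto
  have g1: "g 1 < 0" using assms(2) \<rho>(2) unfolding g_def by simp
  have "T \<noteq> 1" using T(3) g1 by auto
  then have T1: "T < 1" using T(2) by simp
  have after: "g s < 0" if "T < s" "s \<le> 1" for s
  proof (rule ccontr)
    assume "\<not> g s < 0"
    then have "s \<in> A" using that T unfolding A_def by auto
    then have "s \<le> T" unfolding T_def using bdd by (rule cSup_upper)
    with that show False by simp
  qed
  have "T *\<^sub>R x \<in> frontier \<Omega>"
  proof -
    have "((\<lambda>s. s *\<^sub>R x) \<longlongrightarrow> T *\<^sub>R x) (at_right T)" by (auto intro!: tendsto_intros)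
    moreover have "\<forall>\<^sub>F s in at_right T. s *\<^sub>R x \<in> closure \<Omega>"
    proof (rule eventually_at_rightI[of T 1])
      show "s *\<^sub>R x \<in> closure \<Omega>" if "s \<in> {T<..<1}" for s
        using after[of s] that closure_subset[of \<Omega>] \<rho>(2) unfolding g_def by auto
    qed (rule T1)
    ultimately have "T *\<^sub>R x \<in> closure \<Omega>"
      by (intro Lim_in_closed_set[OF closed_closure, of "\<lambda>s. s *\<^sub>R x"]) auto
    moreover have "T *\<^sub>R x \<notin> interior \<Omega>"
      using T(3) interior_subset[of \<Omega>] \<rho>(2) unfolding g_def by auto
    ultimately show ?thesis unfolding frontier_def by auto
  qed
  from st[OF this] have pos: "T * (x \<bullet> grad \<rho> (T *\<^sub>R x)) / norm (grad \<rho> (T *\<^sub>R x)) > 0"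
    unfolding ext_normal_def by simp
  \<comment> \<open>At the origin the inner product with the normal vanishes, so the strict
    inequality keeps the origin off the boundary.\<close>
  then have "T \<noteq> 0" by auto
  then have "T > 0" using T(1) by simp
  with pos have "grad \<rho> (T *\<^sub>R x) \<bullet> x > 0"
    by (auto simp: zero_less_divide_iff zero_less_mult_iff inner_commute)
  with gd[of T] obtain d where d: "d > 0" "\<And>h. 0 < h \<Longrightarrow> h < d \<Longrightarrow> g T < g (T + h)"
    using DERIV_pos_inc_right by blast
  define h where "h = min (d/2) ((1 - T)/2)"
  have "0 < h" "h < d" "T + h \<le> 1" using d T1 unfolding h_def by (auto simp: min_def field_simps)
  then show False using d(2)[of h] after[of "T + h"] T(3) by auto
qed

lemma test_fun_zero_outside:
  assumes "test_fun \<Omega> \<phi>" "x \<notin> \<Omega>"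
  shows "\<phi> x = 0" "pdiff b \<phi> x = 0" "grad \<phi> x = 0"
proof -
  let ?S = "closure {x. \<phi> x \<noteq> 0}"
  have x: "x \<in> - ?S" and o: "open (- ?S)" using assms unfolding test_fun_def by auto
  have z: "\<phi> y = 0" if "y \<in> - ?S" for y
    using that closure_subset[of "{x. \<phi> x \<noteq> 0}"] by auto
  then show "\<phi> x = 0" using x by blast
  have "(\<phi> has_derivative (\<lambda>h. 0)) (at x)"
    by (rule has_derivative_transform_within_open[OF has_derivative_const[of 0] o x]) (rule z[symmetric])
  from pdiff_eqI[OF this] show "pdiff b \<phi> x = 0" for b by simp
  then show "grad \<phi> x = 0" unfolding grad_def by simp
qed

text \<open>The support of the dilated function is the old support multiplied by
  \<open>1 / c\<close>, hence still compact in a star-shaped \<Omega>. This is the function that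
  \<open>weak_laplacian_dilation\<close> inserts into the weak form of the Laplacian.\<close>

lemma test_fun_gauss_dilation:
  fixes \<Omega> :: "'a::euclidean_space set"
  assumes \<phi>: "test_fun \<Omega> \<phi>" and l: "1 \<le> c"
    and star: "\<And>x t. x \<in> \<Omega> \<Longrightarrow> 0 \<le> t \<Longrightarrow> t \<le> 1 \<Longrightarrow> t *\<^sub>R x \<in> \<Omega>"
  shows "test_fun \<Omega> (\<lambda>x. exp (- \<epsilon> * (norm x)\<^sup>2) * (\<phi> (c *\<^sub>R x) - \<phi> x))"
proof -
  let ?S = "closure {x. \<phi> x \<noteq> 0}"
  let ?f = "\<lambda>x. exp (- \<epsilon> * (norm x)\<^sup>2) * (\<phi> (c *\<^sub>R x) - \<phi> x)"
  have S: "smooth_fun \<phi>" "compact ?S" "?S \<subseteq> \<Omega>" using \<phi> unfolding test_fun_def by auto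
  have "smooth_fun (\<lambda>x. 1 * \<phi> (c *\<^sub>R x) + (- 1) * \<phi> (1 *\<^sub>R x))"
    by (intro smooth_fun_add smooth_fun_scale S)
  then have sm: "smooth_fun ?f" using smooth_fun_gauss_mult by force
  let ?T = "?S \<union> (\<lambda>x. (1/c) *\<^sub>R x) ` ?S"
  have cT: "compact ?T" using S by (auto intro!: compact_Un compact_scaling)
  have "(1/c) *\<^sub>R y \<in> \<Omega>" if "y \<in> ?S" for y
    by (rule star) (use that S l in auto)
  then have T\<Omega>: "?T \<subseteq> \<Omega>" using S by blast
  have "{x. ?f x \<noteq> 0} \<subseteq> ?T"
  proof
    fix x assume "x \<in> {x. ?f x \<noteq> 0}"
    then have "\<phi> (c *\<^sub>R x) \<noteq> 0 \<or> \<phi> x \<noteq> 0" by auto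
    then show "x \<in> ?T"
    proof
      assume "\<phi> (c *\<^sub>R x) \<noteq> 0"
      then have "c *\<^sub>R x \<in> ?S" using closure_subset[of "{x. \<phi> x \<noteq> 0}"] by auto
      moreover have "x = (1/c) *\<^sub>R (c *\<^sub>R x)" using l by simp
      ultimately show ?thesis by blast
    qed (use closure_subset[of "{x. \<phi> x \<noteq> 0}"] in auto)
  qed
  then have "closure {x. ?f x \<noteq> 0} \<subseteq> ?T"
    using compact_imp_closed[OF cT] by (intro closure_minimal)
  moreover from this have "compact (closure {x. ?f x \<noteq> 0})"
    using compact_Int_closed[OF cT closed_closure[of "{x. ?f x \<noteq> 0}"]] by (simp add: Int_absorb1)
  ultimately show ?thesis using sm T\<Omega> unfolding test_fun_def by blast
qed

section \<open>Domination, and dilations and reflections of Lebesgue measure\<close>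

lemma integrable_dominated:
  fixes f g :: "'b \<Rightarrow> real"
  assumes "integrable M g" "f \<in> borel_measurable M" "\<And>x. \<bar>f x\<bar> \<le> g x"
  shows "integrable M f"
  by (rule Bochner_Integration.integrable_bound[OF assms(1,2)])
     (auto intro!: AE_I2 order_trans[OF assms(3)])

lemma nn_integral_lborel_scaleR:
  fixes f :: "'a::euclidean_space \<Rightarrow> ennreal"
  assumes [measurable]: "f \<in> borel_measurable borel" and c: "c \<noteq> 0"
  shows "(\<integral>\<^sup>+x. f x \<partial>lborel) = ennreal (\<bar>c\<bar> ^ DIM('a)) * (\<integral>\<^sup>+x. f (c *\<^sub>R x) \<partial>lborel)"
  by (subst lborel_affine[OF c, of 0])
     (simp add: nn_integral_density nn_integral_distr nn_integral_cmult)

lemma integrable_lborel_scaleR: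
  fixes f :: "'a::euclidean_space \<Rightarrow> real"
  assumes f: "integrable lborel f" and c: "c \<noteq> 0"
  shows "integrable lborel (\<lambda>x. f (c *\<^sub>R x))"
proof -
  have [measurable]: "f \<in> borel_measurable borel" using f by auto
  have "(\<integral>\<^sup>+x. ennreal (norm (f x)) \<partial>lborel) < \<infinity>" using f unfolding integrable_iff_bounded by auto
  then have "ennreal (\<bar>c\<bar> ^ DIM('a)) * (\<integral>\<^sup>+x. ennreal (norm (f (c *\<^sub>R x))) \<partial>lborel) < \<infinity>"
    by (subst (asm) nn_integral_lborel_scaleR[OF _ c]) auto
  then have "(\<integral>\<^sup>+x. ennreal (norm (f (c *\<^sub>R x))) \<partial>lborel) < \<infinity>"
    using c by (auto simp: ennreal_mult_less_top)
  then show ?thesis by (auto simp: integrable_iff_bounded)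
qed

lemma integral_lborel_scaleR:
  fixes f :: "'a::euclidean_space \<Rightarrow> real"
  assumes [measurable]: "f \<in> borel_measurable borel" and c: "c \<noteq> 0"
  shows "(LBINT x. f x) = \<bar>c\<bar> ^ DIM('a) * (LBINT x. f (c *\<^sub>R x))"
  by (subst lborel_affine[OF c, of 0]) (simp add: integral_density integral_distr)

lemma nn_integral_lborel_diff:
  fixes f :: "'a::euclidean_space \<Rightarrow> ennreal"
  assumes [measurable]: "f \<in> borel_measurable borel"
  shows "(\<integral>\<^sup>+y. f (x - y) \<partial>lborel) = (\<integral>\<^sup>+z. f z \<partial>lborel)"
  by (subst (2) lborel_affine[of "-1" x])
     (simp_all add: nn_integral_density nn_integral_distr nn_integral_cmult)

subsection \<open>Integration along rays\<close>

text \<open>The ratio \<open>exp 1\<close> of the two radii gives the shell width 1 in the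
  logarithmic measure \<open>dt / t\<close>, so that the polar formula carries no normalising
  constant.\<close>

definition shell :: "'a::euclidean_space set" where
  "shell = {x. 1 \<le> norm x \<and> norm x \<le> exp 1}"

definition shellM :: "'a::euclidean_space measure" where
  "shellM = density lborel (indicator shell)"

definition rayM :: "nat \<Rightarrow> real measure" where
  "rayM n = density lborel (\<lambda>t. ennreal (indicator {0<..} t * t ^ (n - 1)))"

lemma shell_measurable [measurable]: "shell \<in> sets borel"
  unfolding shell_def by measurable

lemma sets_shellM [measurable_cong, simp]: "sets shellM = sets borel"
  by (simp add: shellM_def)

lemma sets_rayM [measurable_cong, simp]: "sets (rayM n) = sets borel"
  by (simp add: rayM_def)

lemma space_shellM [simp]: "space shellM = UNIV"
  by (simp add: shellM_def)

lemma space_rayM [simp]: "space (rayM n) = UNIV"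
  by (simp add: rayM_def)

lemma finite_measure_shellM: "finite_measure (shellM :: 'a::euclidean_space measure)"
proof
  have "emeasure (shellM :: 'a measure) (space shellM) = emeasure lborel (shell :: 'a set)"
    unfolding shellM_def by (simp add: emeasure_density)
  also have "\<dots> < \<infinity>"
    by (rule emeasure_bounded_finite) (auto simp: shell_def bounded_iff)
  finally show "emeasure (shellM :: 'a measure) (space shellM) \<noteq> \<infinity>" by simp
qed

lemma sigma_finite_rayM: "sigma_finite_measure (rayM n)"
  unfolding rayM_def by (subst sigma_finite_measure.sigma_finite_iff_density_finite[OF sigma_finite_lborel]) auto

lemma pair_sigma_finite_polar: "pair_sigma_finite (shellM :: 'a::euclidean_space measure) (rayM n)"
proof -
  interpret finite_measure "shellM :: 'a measure" by (rule finite_measure_shellM)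
  interpret r: sigma_finite_measure "rayM n" by (rule sigma_finite_rayM)
  show ?thesis ..
qed

lemma AE_rayM_iff: "(AE t in rayM n. P t) \<longleftrightarrow> (AE t in lborel. 0 < t \<longrightarrow> P t)"
  unfolding rayM_def by (subst AE_density) (auto intro!: AE_cong simp: indicator_def)

lemma integrable_rayM_iff:
  fixes f :: "real \<Rightarrow> real"
  assumes [measurable]: "f \<in> borel_measurable borel"
  shows "integrable (rayM n) f \<longleftrightarrow> integrable lborel (\<lambda>t. indicator {0<..} t * (t ^ (n - 1) * f t))"
  unfolding rayM_def by (subst integrable_density) (auto simp: indicator_def mult_ac)

lemma integral_rayM:
  fixes f :: "real \<Rightarrow> real"
  assumes [measurable]: "f \<in> borel_measurable borel"
  shows "integral\<^sup>L (rayM n) f = (LBINT t. indicator {0<..} t * (t ^ (n - 1) * f t))"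
  unfolding rayM_def by (subst integral_density) (auto simp: indicator_def mult_ac)

text \<open>Averaging over the shell replaces the surface measure of the sphere: for \<open>y \<noteq> 0\<close> the set of
  \<open>t > 0\<close> with \<open>y / t\<close> in the shell has measure one with respect to \<open>dt / t\<close>.\<close>

lemma nn_integral_polar:
  fixes f :: "'a::euclidean_space \<Rightarrow> ennreal"
  assumes [measurable]: "f \<in> borel_measurable borel"
  shows "(\<integral>\<^sup>+y. f y \<partial>lborel) = (\<integral>\<^sup>+x. \<integral>\<^sup>+t. f (t *\<^sub>R x) \<partial>rayM DIM('a) \<partial>shellM)"
proof -
  let ?N = "DIM('a)"
  let ?k = "\<lambda>(y::'a) t. indicator {0<..} t * indicator shell ((1/t) *\<^sub>R y) * ennreal (1/t)"
  have one: "(\<integral>\<^sup>+t. ?k y t \<partial>lborel) = 1" if "y \<noteq> 0" for y :: 'a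
  proof -
    let ?a = "norm y / exp 1" and ?b = "norm y"
    have a: "0 < ?a" "?a \<le> ?b" using that by (auto simp: divide_le_eq)
    have "(\<integral>\<^sup>+t. ?k y t \<partial>lborel) = (\<integral>\<^sup>+t. ennreal (1/t) * indicator {?a..?b} t \<partial>lborel)"
    proof (intro nn_integral_cong)
      fix t :: real
      have "0 < t" if "norm y / exp 1 \<le> t" using that a by linarith
      then show "?k y t = ennreal (1/t) * indicator {?a..?b} t"
        by (cases "0 < t") (auto simp: indicator_def shell_def le_divide_eq divide_le_eq mult.commute)
    qed
    also have "\<dots> = ennreal (ln ?b - ln ?a)"
      by (rule nn_integral_FTC_Icc) (use a in \<open>auto intro!: derivative_eq_intros\<close>)
    also have "ln ?b - ln ?a = 1" using that by (simp add: ln_div)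
    finally show ?thesis by simp
  qed
  \<comment> \<open>Insert the factor 1 just computed, exchange the integrals and substitute
    \<open>y = t x\<close>. The Jacobian \<open>t^N\<close> and the density \<open>1 / t\<close>
    combine to the weight \<open>t^(N - 1)\<close> of \<open>rayM\<close>.\<close>
  have "(\<integral>\<^sup>+y. f y \<partial>lborel) = (\<integral>\<^sup>+y. f y * (\<integral>\<^sup>+t. ?k y t \<partial>lborel) \<partial>lborel)"
    by (rule nn_integral_cong_AE) (use AE_lborel_singleton[of 0] in eventually_elim, simp add: one)
  also have "\<dots> = (\<integral>\<^sup>+y. \<integral>\<^sup>+t. f y * ?k y t \<partial>lborel \<partial>lborel)"
    by (intro nn_integral_cong nn_integral_cmult[symmetric]) measurable
  also have "\<dots> = (\<integral>\<^sup>+t. \<integral>\<^sup>+y. f y * ?k y t \<partial>lborel \<partial>lborel)"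
    by (rule lborel_pair.Fubini'[symmetric]) measurable
  also have "\<dots> = (\<integral>\<^sup>+t. \<integral>\<^sup>+x. indicator shell x * (f (t *\<^sub>R x) * ennreal (indicator {0<..} t * t ^ (?N - 1))) \<partial>lborel \<partial>lborel)"
  proof (rule nn_integral_cong)
    fix t :: real
    show "(\<integral>\<^sup>+y. f y * ?k y t \<partial>lborel)
      = (\<integral>\<^sup>+x. indicator shell x * (f (t *\<^sub>R x) * ennreal (indicator {0<..} t * t ^ (?N - 1))) \<partial>lborel)"
    proof (cases "0 < t")
      case True
      have e: "ennreal (t ^ ?N) * ennreal (1/t) = ennreal (t ^ (?N - 1))"
        using True by (cases "?N") (simp_all add: ennreal_mult[symmetric])
      have "(\<integral>\<^sup>+y. f y * ?k y t \<partial>lborel) = ennreal (t ^ ?N) * (\<integral>\<^sup>+x. f (t *\<^sub>R x) * ?k (t *\<^sub>R x) t \<partial>lborel)"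
        using True by (subst nn_integral_lborel_scaleR[of _ t]) auto
      also have "\<dots> = (\<integral>\<^sup>+x. ennreal (t ^ ?N) * (f (t *\<^sub>R x) * ?k (t *\<^sub>R x) t) \<partial>lborel)"
        by (intro nn_integral_cmult[symmetric]) measurable
      also have "\<dots> = (\<integral>\<^sup>+x. indicator shell x * (f (t *\<^sub>R x) * (ennreal (t ^ ?N) * ennreal (1/t))) \<partial>lborel)"
        using True by (intro nn_integral_cong) (simp add: mult.assoc mult.left_commute)
      finally show ?thesis using True by (simp add: e)
    qed simp
  qed
  also have "\<dots> = (\<integral>\<^sup>+x. \<integral>\<^sup>+t. indicator shell x * (f (t *\<^sub>R x) * ennreal (indicator {0<..} t * t ^ (?N - 1))) \<partial>lborel \<partial>lborel)"
    by (rule lborel_pair.Fubini') measurable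
  also have "\<dots> = (\<integral>\<^sup>+x. indicator shell x * (\<integral>\<^sup>+t. ennreal (indicator {0<..} t * t ^ (?N - 1)) * f (t *\<^sub>R x) \<partial>lborel) \<partial>lborel)"
    by (intro nn_integral_cong, subst nn_integral_cmult[symmetric])
       (auto intro!: nn_integral_cong simp: mult_ac)
  also have "\<dots> = (\<integral>\<^sup>+x. \<integral>\<^sup>+t. f (t *\<^sub>R x) \<partial>rayM DIM('a) \<partial>shellM)"
    unfolding shellM_def rayM_def
    by (subst nn_integral_density) (auto simp: nn_integral_density intro!: nn_integral_cong)
  finally show ?thesis .
qed

text \<open>With the polar formula in the form of an image measure, null sets and Bochner integrals
  pass to the rays by the general facts about \<open>distr\<close> and product measures.\<close>

lemma distr_polar:
  "distr (shellM \<Otimes>\<^sub>M rayM DIM('a)) borel (\<lambda>(x, t). t *\<^sub>R x) = (lborel :: 'a::euclidean_space measure)"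
proof (rule measure_eqI)
  interpret pair_sigma_finite "shellM :: 'a measure" "rayM DIM('a)" by (rule pair_sigma_finite_polar)
  fix A assume "A \<in> sets (distr (shellM \<Otimes>\<^sub>M rayM DIM('a)) borel (\<lambda>(x::'a, t). t *\<^sub>R x))"
  then have A[measurable]: "A \<in> sets borel" by simp
  have "emeasure lborel A = (\<integral>\<^sup>+y. indicator A y \<partial>lborel)" by simp
  also have "\<dots> = (\<integral>\<^sup>+x. \<integral>\<^sup>+t. indicator A (t *\<^sub>R x) \<partial>rayM DIM('a) \<partial>shellM)"
    by (rule nn_integral_polar) measurable
  also have "\<dots> = (\<integral>\<^sup>+z. indicator A (snd z *\<^sub>R fst z) \<partial>(shellM \<Otimes>\<^sub>M rayM DIM('a)))"
    using M2.nn_integral_fst[of "\<lambda>z. indicator A (snd z *\<^sub>R fst z)" shellM]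
    by (simp add: borel_prod)
  also have "\<dots> = (\<integral>\<^sup>+y. indicator A y \<partial>distr (shellM \<Otimes>\<^sub>M rayM DIM('a)) borel (\<lambda>(x::'a, t). t *\<^sub>R x))"
    by (subst nn_integral_distr) (auto simp: case_prod_beta)
  also have "\<dots> = emeasure (distr (shellM \<Otimes>\<^sub>M rayM DIM('a)) borel (\<lambda>(x::'a, t). t *\<^sub>R x)) A"
    by simp
  finally show "emeasure (distr (shellM \<Otimes>\<^sub>M rayM DIM('a)) borel (\<lambda>(x::'a, t). t *\<^sub>R x)) A = emeasure lborel A"
    by simp
qed simp

lemma measurable_polar [measurable]:
  "(\<lambda>(x::'a::euclidean_space, t). t *\<^sub>R x) \<in> shellM \<Otimes>\<^sub>M rayM n \<rightarrow>\<^sub>M borel"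
  by measurable

lemma AE_polar:
  assumes "AE y in lborel. P (y::'a::euclidean_space)"
  shows "AE x in shellM. AE t in rayM DIM('a). P (t *\<^sub>R x)"
proof -
  interpret pair_sigma_finite "shellM :: 'a measure" "rayM DIM('a)" by (rule pair_sigma_finite_polar)
  have "AE y in distr (shellM \<Otimes>\<^sub>M rayM DIM('a)) borel (\<lambda>(x::'a, t). t *\<^sub>R x). P y"
    unfolding distr_polar by (rule assms)
  from AE_distrD[OF measurable_polar this]
  have "AE z in shellM \<Otimes>\<^sub>M rayM DIM('a). P (snd z *\<^sub>R fst z)" by (simp add: case_prod_beta)
  from AE_pair[OF this] show ?thesis by simp
qed

lemma AE_polarD:
  assumes [measurable]: "Measurable.pred borel P"
    and "AE x in shellM. AE t in rayM DIM('a). P (t *\<^sub>R x)"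
  shows "AE y in lborel. P (y::'a::euclidean_space)"
proof -
  interpret pair_sigma_finite "shellM :: 'a measure" "rayM DIM('a)" by (rule pair_sigma_finite_polar)
  have "Measurable.pred (shellM \<Otimes>\<^sub>M rayM DIM('a)) (\<lambda>z. P (snd z *\<^sub>R fst z))"
    by measurable
  then have "AE z in shellM \<Otimes>\<^sub>M rayM DIM('a). P (snd z *\<^sub>R fst z)"
    by (intro AE_pair_measure) (use assms in \<open>auto simp: pred_def\<close>)
  then have "AE y in distr (shellM \<Otimes>\<^sub>M rayM DIM('a)) borel (\<lambda>(x::'a, t). t *\<^sub>R x). P y"
    by (subst AE_distr_iff) (auto simp: case_prod_beta)
  then show ?thesis unfolding distr_polar .
qed

lemma integrable_polar:
  fixes f :: "'a::euclidean_space \<Rightarrow> real"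
  assumes "integrable lborel f"
  shows "AE x in shellM. integrable (rayM DIM('a)) (\<lambda>t. f (t *\<^sub>R x))"
    and "integrable shellM (\<lambda>x. \<integral>t. f (t *\<^sub>R x) \<partial>rayM DIM('a))"
    and "(LBINT y. f y) = (\<integral>x. \<integral>t. f (t *\<^sub>R x) \<partial>rayM DIM('a) \<partial>shellM)"
proof -
  interpret pair_sigma_finite "shellM :: 'a measure" "rayM DIM('a)" by (rule pair_sigma_finite_polar)
  have [measurable]: "f \<in> borel_measurable borel" using assms by auto
  have i: "integrable (shellM \<Otimes>\<^sub>M rayM DIM('a)) (\<lambda>(x, t). f (t *\<^sub>R x))"
    using integrable_distr[OF measurable_polar[where n = "DIM('a)"], of f] assms
    unfolding distr_polar by (simp add: case_prod_beta')
  show "AE x in shellM. integrable (rayM DIM('a)) (\<lambda>t. f (t *\<^sub>R x))"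
    using AE_integrable_fst[OF i] by simp
  show "integrable shellM (\<lambda>x. \<integral>t. f (t *\<^sub>R x) \<partial>rayM DIM('a))"
    using integrable_fst[OF i] by simp
  have "(LBINT y. f y) = (\<integral>z. f (snd z *\<^sub>R fst z) \<partial>(shellM \<Otimes>\<^sub>M rayM DIM('a)))"
    by (subst distr_polar[symmetric], subst integral_distr) (auto simp: case_prod_beta)
  also have "\<dots> = (\<integral>x. \<integral>t. f (t *\<^sub>R x) \<partial>rayM DIM('a) \<partial>shellM)"
    using integral_fst[OF i] by (simp add: case_prod_beta')
  finally show "(LBINT y. f y) = (\<integral>x. \<integral>t. f (t *\<^sub>R x) \<partial>rayM DIM('a) \<partial>shellM)" .
qed

subsection \<open>The diagonal Hardy-Littlewood-Sobolev inequality\<close>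

text \<open>Along a ray the integrand is \<open>t^(N - 1 - s)\<close> up to a bounded factor,
  integrable at 0 because \<open>s < N\<close>. Homogeneity under the dilation by \<rho> then gives
  the radius \<rho> from the radius 1 with the same constant.\<close>

lemma nn_integral_powr_near_zero:
  fixes s :: real
  assumes "s < real DIM('a::euclidean_space)"
  obtains C where "0 \<le> C" and
    "\<And>\<rho>. 0 < \<rho> \<Longrightarrow> (\<integral>\<^sup>+z. ennreal (norm z powr - s) * indicator {z. norm z < \<rho>} z \<partial>(lborel :: 'a measure))
       \<le> ennreal (C * \<rho> powr (real DIM('a) - s))"
proof -
  let ?N = "real DIM('a)"
  let ?I = "\<integral>\<^sup>+z. ennreal (norm z powr - s) * indicator {z. norm z < 1} z \<partial>(lborel :: 'a measure)"
  \<comment> \<open>On the shell \<open>1 <= norm x <= exp 1\<close>, so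
    \<open>norm x powr - s\<close> is at most 1 for \<open>s >= 0\<close> and at most
    \<open>exp 1 powr - s\<close> otherwise.\<close>
  let ?a = "max 1 (exp 1 powr - s)"
  have N1: "DIM('a) \<ge> 1" by (simp add: Suc_leI)
  have "?I = (\<integral>\<^sup>+x. \<integral>\<^sup>+t. ennreal (norm (t *\<^sub>R x) powr - s) * indicator {z. norm z < 1} (t *\<^sub>R x) \<partial>rayM DIM('a) \<partial>(shellM::'a measure))"
    by (rule nn_integral_polar) measurable
  also have "\<dots> \<le> (\<integral>\<^sup>+x. \<integral>\<^sup>+t. ennreal ?a * (ennreal (t powr - s) * indicator {0..1} t) \<partial>rayM DIM('a) \<partial>(shellM::'a measure))"
  proof (rule nn_integral_mono_AE)
    have "AE x in (shellM::'a measure). x \<in> shell" unfolding shellM_def by (subst AE_density) (auto simp: indicator_def)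
    then show "AE x in (shellM::'a measure). (\<integral>\<^sup>+t. ennreal (norm (t *\<^sub>R x) powr - s) * indicator {z. norm z < 1} (t *\<^sub>R x) \<partial>rayM DIM('a))
        \<le> (\<integral>\<^sup>+t. ennreal ?a * (ennreal (t powr - s) * indicator {0..1} t) \<partial>rayM DIM('a))"
    proof eventually_elim
      case (elim x)
      then have x: "1 \<le> norm x" "norm x \<le> exp 1" by (auto simp: shell_def)
      have xs: "norm x powr - s \<le> ?a"
      proof (cases "s \<ge> 0")
        case True
        then have "norm x powr - s \<le> 1 powr - s" using x by (intro powr_mono2') auto
        then show ?thesis by simp
      next
        case False
        then have "norm x powr - s \<le> exp 1 powr - s" using x by (intro powr_mono2) auto
        then show ?thesis by simp
      qed
      show ?case
      proof (rule nn_integral_mono_AE, subst AE_rayM_iff, rule AE_I2, rule impI)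
        fix t :: real assume t: "0 < t"
        show "ennreal (norm (t *\<^sub>R x) powr - s) * indicator {z. norm z < 1} (t *\<^sub>R x)
          \<le> ennreal ?a * (ennreal (t powr - s) * indicator {0..1} t)"
        proof (cases "norm (t *\<^sub>R x) < 1")
          case True
          have "t * 1 \<le> t * norm x" using x t by (intro mult_left_mono) auto
          moreover have "t * norm x < 1" using True t by simp
          ultimately have "t \<le> 1" by linarith
          then show ?thesis using True t x xs
            by (auto simp: powr_mult ennreal_mult[symmetric] mult.commute intro!: ennreal_leI mult_right_mono)
        qed auto
      qed
    qed
  qed
  also have "\<dots> = ennreal ?a * (\<integral>\<^sup>+t. ennreal (t powr - s) * indicator {0..1} t \<partial>rayM DIM('a)) * emeasure shellM (space (shellM::'a measure))"
    by (subst nn_integral_cmult) auto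
  also have "(\<integral>\<^sup>+t. ennreal (t powr - s) * indicator {0..1} t \<partial>rayM DIM('a))
      = (\<integral>\<^sup>+t. ennreal (t powr (?N - 1 - s) * indicator {0..1} t) \<partial>lborel)"
    unfolding rayM_def
  proof (subst nn_integral_density, measurable, intro nn_integral_cong_AE)
    show "AE t in lborel. ennreal (indicator {0<..} t * t ^ (DIM('a) - 1)) * (ennreal (t powr - s) * indicator {0..1} t)
       = ennreal (t powr (?N - 1 - s) * indicator {0..1} t)"
      using AE_lborel_singleton[of 0]
    proof eventually_elim
      case (elim t)
      have "t ^ (DIM('a) - 1) * t powr - s = t powr (?N - 1 - s)" if "0 < t"
        using that N1 by (simp add: powr_realpow[symmetric] powr_add[symmetric] of_nat_diff)
      then show ?case using elim by (auto simp: indicator_def ennreal_mult[symmetric])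
    qed
  qed
  also have "\<dots> = ennreal (1 powr (?N - 1 - s + 1) / (?N - 1 - s + 1))"
  proof (rule nn_integral_has_integral_lborel)
    have "((\<lambda>t. t powr (?N - 1 - s)) has_integral (1 powr (?N - 1 - s + 1) / (?N - 1 - s + 1))) {0..1}"
      by (rule has_integral_powr_from_0) (use assms in auto)
    then show "((\<lambda>t. t powr (?N - 1 - s) * indicator {0..1} t) has_integral (1 powr (?N - 1 - s + 1) / (?N - 1 - s + 1))) UNIV"
      by (subst (asm) has_integral_restrict_UNIV[symmetric])
         (simp add: indicator_def of_bool_def if_distrib[of "\<lambda>z. _ * z"] cong: if_cong)
  qed auto
  finally have "?I \<le> ennreal ?a * ennreal (1 powr (?N - 1 - s + 1) / (?N - 1 - s + 1)) * emeasure shellM (space (shellM::'a measure))" .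
  also have "\<dots> < \<infinity>"
    using finite_measure.emeasure_finite[OF finite_measure_shellM, of "space (shellM::'a measure)"]
    by (simp add: ennreal_mult_eq_top_iff less_top[symmetric])
  finally have fin: "?I < \<infinity>" .
  then obtain C where C: "?I = ennreal C" "0 \<le> C" by (cases ?I rule: ennreal_cases) auto
  show ?thesis
  proof (rule that[OF C(2)])
    fix \<rho> :: real assume \<rho>: "0 < \<rho>"
    have "(\<integral>\<^sup>+z. ennreal (norm z powr - s) * indicator {z. norm z < \<rho>} z \<partial>(lborel :: 'a measure))
      = ennreal (\<rho> ^ DIM('a)) * (\<integral>\<^sup>+z. ennreal (norm (\<rho> *\<^sub>R z) powr - s) * indicator {z. norm z < \<rho>} (\<rho> *\<^sub>R z) \<partial>(lborel :: 'a measure))"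
      using \<rho> by (subst nn_integral_lborel_scaleR[of _ \<rho>]) auto
    also have "(\<integral>\<^sup>+z. ennreal (norm (\<rho> *\<^sub>R z) powr - s) * indicator {z. norm z < \<rho>} (\<rho> *\<^sub>R z) \<partial>(lborel :: 'a measure))
      = (\<integral>\<^sup>+z. ennreal (\<rho> powr - s) * (ennreal (norm z powr - s) * indicator {z. norm z < 1} z) \<partial>(lborel :: 'a measure))"
      using \<rho> by (intro nn_integral_cong) (auto simp: indicator_def powr_mult ennreal_mult[symmetric])
    also have "\<dots> = ennreal (\<rho> powr - s) * ennreal C"
      by (subst nn_integral_cmult) (auto simp: C)
    also have "ennreal (\<rho> ^ DIM('a)) * \<dots> = ennreal (C * \<rho> powr (?N - s))"
      using \<rho> C by (simp add: ennreal_mult[symmetric] powr_realpow[symmetric] powr_diff powr_minus field_simps)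
    finally show "(\<integral>\<^sup>+z. ennreal (norm z powr - s) * indicator {z. norm z < \<rho>} z \<partial>(lborel :: 'a measure))
      \<le> ennreal (C * \<rho> powr (?N - s))" by simp
  qed
qed

text \<open>The exponent \<open>2 N\<close> is the one that Young's inequality produces in the
  Hardy-Littlewood-Sobolev estimate. Along a ray it leaves \<open>t^(- N - 1)\<close>, and
  homogeneity gives the dependence on \<rho>. The lemma serves again for the integrability of
  Gaussians.\<close>

lemma nn_integral_powr_near_infinity:
  obtains C where "0 \<le> C" and
    "\<And>\<rho>. 0 < \<rho> \<Longrightarrow> (\<integral>\<^sup>+z. ennreal (norm z powr - (2 * real DIM('a))) * indicator {z. \<rho> \<le> norm z} z
        \<partial>(lborel :: 'a::euclidean_space measure)) \<le> ennreal (C * \<rho> powr - real DIM('a))"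
proof -
  let ?N = "real DIM('a)"
  let ?s = "2 * ?N"
  let ?I = "\<integral>\<^sup>+z. ennreal (norm z powr - ?s) * indicator {z. 1 \<le> norm z} z \<partial>(lborel :: 'a measure)"
  \<comment> \<open>If \<open>norm (t x) >= 1\<close> with \<open>norm x <= exp 1\<close>, then
    \<open>t >= 1 / exp 1\<close>. This keeps the radial integral away from 0.\<close>
  let ?a = "1 / exp (1::real)"
  have N1: "DIM('a) \<ge> 1" by (simp add: Suc_leI)
  have "?I = (\<integral>\<^sup>+x. \<integral>\<^sup>+t. ennreal (norm (t *\<^sub>R x) powr - ?s) * indicator {z. 1 \<le> norm z} (t *\<^sub>R x) \<partial>rayM DIM('a) \<partial>(shellM::'a measure))"
    by (rule nn_integral_polar) measurable
  also have "\<dots> \<le> (\<integral>\<^sup>+x. \<integral>\<^sup>+t. ennreal (t powr - ?s) * indicator {?a..} t \<partial>rayM DIM('a) \<partial>(shellM::'a measure))"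
  proof (rule nn_integral_mono_AE)
    have "AE x in (shellM::'a measure). x \<in> shell" unfolding shellM_def by (subst AE_density) (auto simp: indicator_def)
    then show "AE x in (shellM::'a measure). (\<integral>\<^sup>+t. ennreal (norm (t *\<^sub>R x) powr - ?s) * indicator {z. 1 \<le> norm z} (t *\<^sub>R x) \<partial>rayM DIM('a))
        \<le> (\<integral>\<^sup>+t. ennreal (t powr - ?s) * indicator {?a..} t \<partial>rayM DIM('a))"
    proof eventually_elim
      case (elim x)
      then have x: "1 \<le> norm x" "norm x \<le> exp 1" by (auto simp: shell_def)
      have xs: "norm x powr - ?s \<le> 1 powr - ?s" using x by (intro powr_mono2') auto
      show ?case
      proof (rule nn_integral_mono_AE, subst AE_rayM_iff, rule AE_I2, rule impI)
        fix t :: real assume t: "0 < t"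
        show "ennreal (norm (t *\<^sub>R x) powr - ?s) * indicator {z. 1 \<le> norm z} (t *\<^sub>R x)
          \<le> ennreal (t powr - ?s) * indicator {?a..} t"
        proof (cases "1 \<le> norm (t *\<^sub>R x)")
          case True
          have "t * norm x \<le> t * exp 1" using x t by (intro mult_left_mono) auto
          moreover have "1 \<le> t * norm x" using True t by simp
          ultimately have "1 \<le> t * exp 1" by linarith
          then have "?a \<le> t" by (simp add: divide_le_eq)
          then show ?thesis using True t x xs
            by (auto simp: powr_mult intro!: ennreal_leI mult_left_le)
        qed auto
      qed
    qed
  qed
  also have "\<dots> = (\<integral>\<^sup>+t. ennreal (t powr - ?s) * indicator {?a..} t \<partial>rayM DIM('a)) * emeasure shellM (space (shellM::'a measure))"
    by auto
  also have "(\<integral>\<^sup>+t. ennreal (t powr - ?s) * indicator {?a..} t \<partial>rayM DIM('a))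
      = (\<integral>\<^sup>+t. ennreal (t powr (- ?N - 1) * indicator {?a..} t) \<partial>lborel)"
    unfolding rayM_def
  proof (subst nn_integral_density, measurable, intro nn_integral_cong)
    fix t :: real
    show "ennreal (indicator {0<..} t * t ^ (DIM('a) - 1)) * (ennreal (t powr - ?s) * indicator {?a..} t)
       = ennreal (t powr (- ?N - 1) * indicator {?a..} t)"
    proof (cases "?a \<le> t")
      case True
      then have t: "0 < t" by (meson divide_pos_pos exp_gt_zero less_le_trans zero_less_one)
      have "t ^ (DIM('a) - 1) * t powr - ?s = t powr (- ?N - 1)"
        using t N1 by (simp add: powr_realpow[symmetric] powr_add[symmetric] of_nat_diff)
      then show ?thesis using True t by (auto simp: ennreal_mult[symmetric])
    qed auto
  qed
  also have "\<dots> = ennreal (- (?a powr (- ?N - 1 + 1) / (- ?N - 1 + 1)))"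
  proof (rule nn_integral_has_integral_lborel)
    have "((\<lambda>t. t powr (- ?N - 1)) has_integral (- (?a powr (- ?N - 1 + 1)) / (- ?N - 1 + 1))) {?a..}"
      by (rule has_integral_powr_to_inf) (use N1 in auto)
    then show "((\<lambda>t. t powr (- ?N - 1) * indicator {?a..} t) has_integral (- (?a powr (- ?N - 1 + 1) / (- ?N - 1 + 1)))) UNIV"
      by (subst (asm) has_integral_restrict_UNIV[symmetric])
         (simp add: indicator_def of_bool_def if_distrib[of "\<lambda>z. _ * z"] cong: if_cong)
  qed auto
  finally have "?I \<le> ennreal (- (?a powr (- ?N - 1 + 1) / (- ?N - 1 + 1))) * emeasure shellM (space (shellM::'a measure))" .
  also have "\<dots> < \<infinity>"
    using finite_measure.emeasure_finite[OF finite_measure_shellM, of "space (shellM::'a measure)"]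
    by (simp add: ennreal_mult_eq_top_iff less_top[symmetric])
  finally have fin: "?I < \<infinity>" .
  then obtain C where C: "?I = ennreal C" "0 \<le> C" by (cases ?I rule: ennreal_cases) auto
  show ?thesis
  proof (rule that[OF C(2)])
    fix \<rho> :: real assume \<rho>: "0 < \<rho>"
    have "(\<integral>\<^sup>+z. ennreal (norm z powr - ?s) * indicator {z. \<rho> \<le> norm z} z \<partial>(lborel :: 'a measure))
      = ennreal (\<rho> ^ DIM('a)) * (\<integral>\<^sup>+z. ennreal (norm (\<rho> *\<^sub>R z) powr - ?s) * indicator {z. \<rho> \<le> norm z} (\<rho> *\<^sub>R z) \<partial>(lborel :: 'a measure))"
      using \<rho> by (subst nn_integral_lborel_scaleR[of _ \<rho>]) auto
    also have "(\<integral>\<^sup>+z. ennreal (norm (\<rho> *\<^sub>R z) powr - ?s) * indicator {z. \<rho> \<le> norm z} (\<rho> *\<^sub>R z) \<partial>(lborel :: 'a measure))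
      = (\<integral>\<^sup>+z. ennreal (\<rho> powr - ?s) * (ennreal (norm z powr - ?s) * indicator {z. 1 \<le> norm z} z) \<partial>(lborel :: 'a measure))"
      using \<rho> by (intro nn_integral_cong) (auto simp: indicator_def powr_mult ennreal_mult[symmetric])
    also have "\<dots> = ennreal (\<rho> powr - ?s) * ennreal C"
      by (subst nn_integral_cmult) (auto simp: C)
    also have "ennreal (\<rho> ^ DIM('a)) * \<dots> = ennreal (C * \<rho> powr - ?N)"
    proof -
      have "\<rho> ^ DIM('a) * \<rho> powr - ?s = \<rho> powr - ?N"
        using \<rho> by (simp add: powr_realpow[symmetric] powr_add[symmetric])
      then show ?thesis using \<rho> C by (simp add: ennreal_mult[symmetric] mult_ac)
    qed
    finally show "(\<integral>\<^sup>+z. ennreal (norm z powr - ?s) * indicator {z. \<rho> \<le> norm z} z \<partial>(lborel :: 'a measure))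
      \<le> ennreal (C * \<rho> powr - ?N)" by simp
  qed
qed


theorem hardy_littlewood_sobolev_diagonal:
  fixes F :: "'a::euclidean_space \<Rightarrow> real"
  assumes \<alpha>: "0 < \<alpha>" "\<alpha> < real DIM('a)"
    and [measurable]: "F \<in> borel_measurable borel" and F0: "\<And>x. 0 \<le> F x"
    and Fr: "integrable lborel (\<lambda>x. F x powr (2 * real DIM('a) / (real DIM('a) + \<alpha>)))"
  shows "integrable (lborel \<Otimes>\<^sub>M lborel) (\<lambda>(x, y). F x * F y * norm (x - y) powr - (real DIM('a) - \<alpha>))"
proof -
  define N where "N = real DIM('a)"
  define s where "s = N - \<alpha>"
  define r where "r = 2 * N / (N + \<alpha>)"
  have pos: "0 < N" "0 < s" "s < N" "0 < N + \<alpha>" using \<alpha> by (auto simp: N_def s_def)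
  have r1: "r - 1 = s / (N + \<alpha>)" using pos by (simp add: r_def s_def field_simps)
  have r1pos: "0 < r - 1" unfolding r1 using pos by simp
  obtain C1 where C1: "0 \<le> C1"
    "\<And>\<rho>. 0 < \<rho> \<Longrightarrow> (\<integral>\<^sup>+z. ennreal (norm z powr - s) * indicator {z. norm z < \<rho>} z \<partial>(lborel :: 'a measure))
       \<le> ennreal (C1 * \<rho> powr (N - s))"
  proof (rule nn_integral_powr_near_zero[where 'a = 'a, folded N_def, OF pos(3)])
    fix C assume "0 \<le> C" "\<And>\<rho>. 0 < \<rho> \<Longrightarrow> (\<integral>\<^sup>+z. ennreal (norm z powr - s) * indicator {z. norm z < \<rho>} z \<partial>(lborel :: 'a measure))
       \<le> ennreal (C * \<rho> powr (N - s))"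
    then show thesis by (rule that)
  qed
  obtain C2 where C2: "0 \<le> C2"
    "\<And>\<rho>. 0 < \<rho> \<Longrightarrow> (\<integral>\<^sup>+z. ennreal (norm z powr - (2 * N)) * indicator {z. \<rho> \<le> norm z} z \<partial>(lborel :: 'a measure))
       \<le> ennreal (C2 * \<rho> powr - N)"
  proof (rule nn_integral_powr_near_infinity[where 'a = 'a, folded N_def])
    fix C assume "0 \<le> C" "\<And>\<rho>. 0 < \<rho> \<Longrightarrow> (\<integral>\<^sup>+z. ennreal (norm z powr - (2 * N)) * indicator {z. \<rho> \<le> norm z} z \<partial>(lborel :: 'a measure))
       \<le> ennreal (C * \<rho> powr - N)"
    then show thesis by (rule that)
  qed
  define I where "I = (LBINT x. F x powr r)"
  have I: "(\<integral>\<^sup>+x. ennreal (F x powr r) \<partial>lborel) = ennreal I" "0 \<le> I"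
    unfolding I_def using Fr by (auto intro!: nn_integral_eq_integral simp: r_def N_def)
  define k where "k z = norm z powr - s" for z :: 'a
  have [measurable]: "k \<in> borel_measurable borel" unfolding k_def by measurable
  have k0: "0 \<le> k z" for z unfolding k_def by simp
  define C where "C = C1 + I + C2"
  have C0: "0 \<le> C" using C1 C2 I unfolding C_def by simp
  \<comment> \<open>A weighted Young inequality with the conjugate exponents \<open>r\<close> and
    \<open>r / (r - 1)\<close>, obtained by comparing \<open>k z\<close> with
    \<open>(b F y)^(r - 1)\<close>. The power of the kernel is \<open>norm z powr - (2 N)\<close>
    because \<open>s r / (r - 1) = 2 N\<close>.\<close>
  have young: "F y * k z \<le> b powr (r - 1) * F y powr r + (1/b) * norm z powr - (2 * N)"
    if b: "0 < b" and z: "z \<noteq> 0" for y z and b :: real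
  proof (cases "F y = 0")
    case True then show ?thesis using b by (simp add: zero_le_mult_iff)
  next
    case False
    then have Fy: "0 < F y" using F0[of y] by simp
    show ?thesis
    proof (cases "k z \<le> (b * F y) powr (r - 1)")
      case True
      then have "F y * k z \<le> F y * (b * F y) powr (r - 1)" using Fy by simp
      also have "\<dots> = b powr (r - 1) * F y powr r"
        using Fy b by (simp add: powr_mult powr_mult_base powr_diff)
      finally show ?thesis using b by (simp add: add_increasing2)
    next
      case False
      have kp: "0 < k z" using z by (simp add: k_def)
      have "(b * F y) = ((b * F y) powr (r - 1)) powr (1 / (r - 1))"
        using b Fy r1pos by (simp add: powr_powr)
      also have "\<dots> \<le> k z powr (1 / (r - 1))"
        using False r1pos b Fy by (intro powr_mono2) auto
      finally have "F y \<le> (1/b) * k z powr (1 / (r - 1))" using b by (simp add: field_simps)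
      then have "F y * k z \<le> (1/b) * k z powr (1 / (r - 1)) * k z" using k0 by (rule mult_right_mono)
      also have "\<dots> = (1/b) * k z powr (1 / (r - 1) + 1)" using kp by (simp add: powr_add)
      also have "k z powr (1 / (r - 1) + 1) = norm z powr - (2 * N)"
      proof -
        have "s * (1 / (r - 1) + 1) = 2 * N" unfolding r1 using pos by (simp add: field_simps s_def)
        then have "- s * (1 / (r - 1) + 1) = - (2 * N)" by simp
        then show ?thesis unfolding k_def powr_powr by simp
      qed
      finally show ?thesis using b by (simp add: add_increasing)
    qed
  qed
  have key: "(\<integral>\<^sup>+y. ennreal (F y * k (x - y)) * indicator {y. F y \<le> F x} y \<partial>lborel) \<le> ennreal (C * F x powr (r - 1))"
    if b: "0 < F x" for x
  proof -
    let ?b = "F x"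
    \<comment> \<open>This radius balances the two regions: the near part
      \<open>b \<rho>^(N - s)\<close> and the far part \<open>\<rho>^(- N) / b\<close> both become
      \<open>b^(r - 1)\<close>, as \<open>e1\<close> and \<open>e2\<close> confirm.\<close>
    define \<rho> where "\<rho> = ?b powr (- 2 / (N + \<alpha>))"
    have \<rho>: "0 < \<rho>" unfolding \<rho>_def using b by simp
    have e1: "?b * \<rho> powr (N - s) = ?b powr (r - 1)"
    proof -
      have "?b * \<rho> powr (N - s) = ?b powr 1 * ?b powr (- 2 / (N + \<alpha>) * \<alpha>)"
        using b unfolding \<rho>_def by (simp add: powr_powr s_def)
      also have "\<dots> = ?b powr (1 + - 2 / (N + \<alpha>) * \<alpha>)" by (rule powr_add[symmetric])
      also have "1 + - 2 / (N + \<alpha>) * \<alpha> = r - 1" unfolding r1 s_def using pos by (simp add: field_simps)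
      finally show ?thesis .
    qed
    have e2: "(1/?b) * \<rho> powr - N = ?b powr (r - 1)"
    proof -
      have "(1/?b) * \<rho> powr - N = ?b powr (- 1) * ?b powr (- 2 / (N + \<alpha>) * - N)"
        using b unfolding \<rho>_def powr_powr by (simp add: powr_minus_divide)
      also have "\<dots> = ?b powr (- 1 + - 2 / (N + \<alpha>) * - N)" by (rule powr_add[symmetric])
      also have "- 1 + - 2 / (N + \<alpha>) * - N = r - 1" by (simp add: r_def)
      finally show ?thesis .
    qed
    have "(\<integral>\<^sup>+y. ennreal (F y * k (x - y)) * indicator {y. F y \<le> F x} y \<partial>lborel)
       \<le> (\<integral>\<^sup>+y. ennreal ?b * (ennreal (k (x - y)) * indicator {z. norm z < \<rho>} (x - y))
           + (ennreal (?b powr (r - 1)) * ennreal (F y powr r)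
           + ennreal (1/?b) * (ennreal (norm (x - y) powr - (2 * N)) * indicator {z. \<rho> \<le> norm z} (x - y))) \<partial>lborel)"
    proof (intro nn_integral_mono)
      fix y
      show "ennreal (F y * k (x - y)) * indicator {y. F y \<le> F x} y
         \<le> ennreal ?b * (ennreal (k (x - y)) * indicator {z. norm z < \<rho>} (x - y))
           + (ennreal (?b powr (r - 1)) * ennreal (F y powr r)
           + ennreal (1/?b) * (ennreal (norm (x - y) powr - (2 * N)) * indicator {z. \<rho> \<le> norm z} (x - y)))"
      proof (cases "F y \<le> F x")
        case False then show ?thesis by simp
      next
        case True
        show ?thesis
        proof (cases "norm (x - y) < \<rho>")
          case near: True
          have "ennreal (F y * k (x - y)) \<le> ennreal (?b * k (x - y))"
            using True k0 by (intro ennreal_leI mult_right_mono) auto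
          also have "\<dots> = ennreal ?b * ennreal (k (x - y))" using b k0 by (simp add: ennreal_mult)
          finally show ?thesis using near True by (simp add: add_increasing2)
        next
          case far: False
          then have "x - y \<noteq> 0" using \<rho> by auto
          from young[OF b this, of y]
          have "ennreal (F y * k (x - y)) \<le> ennreal (?b powr (r - 1) * F y powr r + (1/?b) * norm (x - y) powr - (2 * N))"
            by (rule ennreal_leI)
          also have "\<dots> = ennreal (?b powr (r - 1)) * ennreal (F y powr r) + ennreal (1/?b) * ennreal (norm (x - y) powr - (2 * N))"
            using b by (simp add: ennreal_mult[symmetric] ennreal_plus[symmetric] del: ennreal_plus)
          finally show ?thesis using far True by simp
        qed
      qed
    qed
    also have "\<dots> = ennreal ?b * (\<integral>\<^sup>+y. ennreal (k (x - y)) * indicator {z. norm z < \<rho>} (x - y) \<partial>lborel)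
        + (ennreal (?b powr (r - 1)) * ennreal I
        + ennreal (1/?b) * (\<integral>\<^sup>+y. ennreal (norm (x - y) powr - (2 * N)) * indicator {z. \<rho> \<le> norm z} (x - y) \<partial>lborel))"
      by (simp add: nn_integral_add nn_integral_cmult I(1)[symmetric])
    also have "(\<integral>\<^sup>+y. ennreal (k (x - y)) * indicator {z. norm z < \<rho>} (x - y) \<partial>lborel)
        = (\<integral>\<^sup>+z. ennreal (k z) * indicator {z. norm z < \<rho>} z \<partial>lborel)"
      by (rule nn_integral_lborel_diff) measurable
    also have "(\<integral>\<^sup>+y. ennreal (norm (x - y) powr - (2 * N)) * indicator {z. \<rho> \<le> norm z} (x - y) \<partial>lborel)
        = (\<integral>\<^sup>+z. ennreal (norm z powr - (2 * N)) * indicator {z. \<rho> \<le> norm z} z \<partial>(lborel::'a measure))"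
      by (rule nn_integral_lborel_diff[of "\<lambda>z. ennreal (norm z powr - (2 * N)) * indicator {z. \<rho> \<le> norm z} z"]) measurable
    also have "ennreal ?b * (\<integral>\<^sup>+z. ennreal (k z) * indicator {z. norm z < \<rho>} z \<partial>lborel)
        + (ennreal (?b powr (r - 1)) * ennreal I
        + ennreal (1/?b) * (\<integral>\<^sup>+z. ennreal (norm z powr - (2 * N)) * indicator {z. \<rho> \<le> norm z} z \<partial>(lborel::'a measure)))
      \<le> ennreal ?b * ennreal (C1 * \<rho> powr (N - s)) + (ennreal (?b powr (r - 1)) * ennreal I
        + ennreal (1/?b) * ennreal (C2 * \<rho> powr - N))"
      unfolding k_def by (intro add_mono mult_left_mono C1 C2 \<rho>) auto
    also have "\<dots> = ennreal (C1 * (?b * \<rho> powr (N - s)) + (?b powr (r - 1) * I + C2 * ((1/?b) * \<rho> powr - N)))"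
      using b C1 C2 I by (simp add: ennreal_mult[symmetric] ennreal_plus[symmetric] mult_ac del: ennreal_plus)
    also have "\<dots> = ennreal (C * F x powr (r - 1))"
      unfolding e1 e2 C_def by (simp add: algebra_simps)
    finally show ?thesis .
  qed
  define K where "K x y = ennreal (F x * F y * k (x - y))" for x y
  have [measurable]: "case_prod K \<in> borel_measurable (borel \<Otimes>\<^sub>M borel)" unfolding K_def by measurable
  have Ksym: "K x y = K y x" for x y
    unfolding K_def k_def by (simp add: norm_minus_commute mult_ac)
  let ?H = "\<lambda>x y. K x y * indicator {y. F y \<le> F x} y"
  have half: "(\<integral>\<^sup>+x. \<integral>\<^sup>+y. ?H x y \<partial>lborel \<partial>lborel) \<le> ennreal (C * I)"
  proof -
    have "(\<integral>\<^sup>+x. \<integral>\<^sup>+y. ?H x y \<partial>lborel \<partial>lborel) \<le> (\<integral>\<^sup>+x. ennreal C * ennreal (F x powr r) \<partial>lborel)"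
    proof (rule nn_integral_mono)
      fix x
      have "(\<integral>\<^sup>+y. ?H x y \<partial>lborel) = ennreal (F x) * (\<integral>\<^sup>+y. ennreal (F y * k (x - y)) * indicator {y. F y \<le> F x} y \<partial>lborel)"
        unfolding K_def
        by (subst nn_integral_cmult[symmetric]) (auto intro!: nn_integral_cong simp: F0 k0 ennreal_mult mult_ac)
      also have "\<dots> \<le> ennreal C * ennreal (F x powr r)"
      proof (cases "F x = 0")
        case False
        then have Fx: "0 < F x" using F0[of x] by simp
        then have "ennreal (F x) * (\<integral>\<^sup>+y. ennreal (F y * k (x - y)) * indicator {y. F y \<le> F x} y \<partial>lborel)
          \<le> ennreal (F x) * ennreal (C * F x powr (r - 1))"
          by (intro mult_left_mono key) auto
        also have "\<dots> = ennreal C * ennreal (F x powr r)"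
          using Fx C0 by (simp add: ennreal_mult[symmetric] powr_diff)
        finally show ?thesis .
      qed simp
      finally show "(\<integral>\<^sup>+y. ?H x y \<partial>lborel) \<le> ennreal C * ennreal (F x powr r)" .
    qed
    also have "\<dots> = ennreal (C * I)"
      using C0 I by (simp add: nn_integral_cmult ennreal_mult)
    finally show ?thesis .
  qed
  have "(\<integral>\<^sup>+x. \<integral>\<^sup>+y. K x y \<partial>lborel \<partial>lborel) \<le> (\<integral>\<^sup>+x. \<integral>\<^sup>+y. ?H x y + ?H y x \<partial>lborel \<partial>lborel)"
  proof (intro nn_integral_mono)
    fix x y
    show "K x y \<le> ?H x y + ?H y x"
      using Ksym[of x y] by (cases "F y \<le> F x") (auto simp: indicator_def)
  qed
  also have "\<dots> = (\<integral>\<^sup>+x. \<integral>\<^sup>+y. ?H x y \<partial>lborel \<partial>lborel) + (\<integral>\<^sup>+x. \<integral>\<^sup>+y. ?H y x \<partial>lborel \<partial>lborel)"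
    by (simp add: nn_integral_add)
  also have "(\<integral>\<^sup>+x. \<integral>\<^sup>+y. ?H y x \<partial>lborel \<partial>lborel) = (\<integral>\<^sup>+x. \<integral>\<^sup>+y. ?H x y \<partial>lborel \<partial>lborel)"
    by (rule lborel_pair.Fubini') measurable
  also have "(\<integral>\<^sup>+x. \<integral>\<^sup>+y. ?H x y \<partial>lborel \<partial>lborel) + (\<integral>\<^sup>+x. \<integral>\<^sup>+y. ?H x y \<partial>lborel \<partial>lborel) \<le> ennreal (C * I) + ennreal (C * I)"
    by (intro add_mono half)
  finally have fin: "(\<integral>\<^sup>+x. \<integral>\<^sup>+y. K x y \<partial>lborel \<partial>lborel) < \<infinity>" using le_less_trans by fastforce
  show ?thesis
  proof (rule integrableI_bounded)
    show "(\<lambda>(x, y). F x * F y * norm (x - y) powr - (real DIM('a) - \<alpha>)) \<in> borel_measurable (lborel \<Otimes>\<^sub>M lborel)"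
      by measurable
    have "(\<integral>\<^sup>+z. ennreal (norm (case z of (x, y) \<Rightarrow> F x * F y * norm (x - y) powr - (real DIM('a) - \<alpha>))) \<partial>(lborel \<Otimes>\<^sub>M lborel))
       = (\<integral>\<^sup>+z. case_prod K z \<partial>(lborel \<Otimes>\<^sub>M lborel))"
      by (intro nn_integral_cong) (auto simp: K_def k_def s_def N_def F0 abs_mult)
    also have "\<dots> = (\<integral>\<^sup>+x. \<integral>\<^sup>+y. K x y \<partial>lborel \<partial>lborel)"
      by (subst lborel.nn_integral_fst[symmetric]) auto
    finally show "(\<integral>\<^sup>+z. ennreal (norm (case z of (x, y) \<Rightarrow> F x * F y * norm (x - y) powr - (real DIM('a) - \<alpha>))) \<partial>(lborel \<Otimes>\<^sub>M lborel)) < \<infinity>"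
      using fin by simp
  qed
qed

section \<open>Calculus on a single ray\<close>

lemma integral_chain_rule_limit:
  fixes u v :: "real \<Rightarrow> real" and uk vk :: "nat \<Rightarrow> real \<Rightarrow> real"
  assumes ab: "a \<le> b"
    and uk: "\<And>k t. (uk k has_real_derivative vk k t) (at t)" "\<And>k. continuous_on UNIV (vk k)"
    and v: "integrable lborel (\<lambda>t. indicator {a..b} t * v t)"
    and vk: "(\<lambda>k. \<integral>t. indicator {a..b} t * \<bar>vk k t - v t\<bar> \<partial>lborel) \<longlonglongrightarrow> 0"
    and [measurable]: "v \<in> borel_measurable borel"
    and u: "\<And>t. t \<in> {a..b} \<Longrightarrow> (\<lambda>k. uk k t) \<longlonglongrightarrow> u t"
    and m: "\<And>t. t \<in> {a..b} \<Longrightarrow> (m has_real_derivative m' t) (at t)" "continuous_on {a..b} m'"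
    and \<Theta>: "\<And>s. (\<Theta> has_real_derivative \<Theta>' s) (at s)" "continuous_on UNIV \<Theta>'"
  shows "integrable lborel (\<lambda>t. indicator {a..b} t * (m' t * \<Theta> (u t) + m t * \<Theta>' (u t) * v t))"
    and "(LBINT t. indicator {a..b} t * (m' t * \<Theta> (u t) + m t * \<Theta>' (u t) * v t))
         = m b * \<Theta> (u b) - m a * \<Theta> (u a)"
proof -
  \<comment> \<open>The hypotheses express, through smooth approximations whose derivatives converge
    in \<open>L^1\<close>, that \<open>u\<close> is absolutely continuous with derivative
    \<open>v\<close>. The fundamental theorem is applied to \<open>m * \<Theta> (uk k)\<close> and
    both sides are passed to the limit.\<close>
  let ?I = "indicator {a..b} :: real \<Rightarrow> real"
  have ukc: "continuous_on S (uk k)" for k S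
    by (meson uk(1) DERIV_isCont continuous_at_imp_continuous_on)
  have [measurable]: "uk k \<in> borel_measurable borel" "vk k \<in> borel_measurable borel" for k
    using ukc uk(2) by (auto intro: borel_measurable_continuous_onI)
  have \<Theta>c: "continuous_on S \<Theta>" for S
    by (meson \<Theta>(1) DERIV_isCont continuous_at_imp_continuous_on)
  have [measurable]: "\<Theta> \<in> borel_measurable borel" "\<Theta>' \<in> borel_measurable borel"
    using \<Theta>c \<Theta>(2) by (auto intro: borel_measurable_continuous_onI)
  have mc: "continuous_on {a..b} m"
    by (meson m(1) DERIV_isCont continuous_at_imp_continuous_on)
  define mi mi' where "mi t = ?I t * m t" and "mi' t = ?I t * m' t" for t
  have [measurable]: "mi \<in> borel_measurable borel" "mi' \<in> borel_measurable borel"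
    using borel_measurable_continuous_on_indicator[OF _ mc] borel_measurable_continuous_on_indicator[OF _ m(2)]
    unfolding mi_def[abs_def] mi'_def[abs_def] by auto
  have vki: "integrable lborel (\<lambda>t. ?I t * vk k t)" for k
    using borel_integrable_compact[of "{a..b}" "vk k"] uk(2) continuous_on_subset by fastforce
  have vkvi: "integrable lborel (\<lambda>t. ?I t * \<bar>vk k t - v t\<bar>)" for k
    using Bochner_Integration.integrable_abs[OF Bochner_Integration.integrable_diff[OF vki[of k] v]]
    by (simp add: right_diff_distrib[symmetric] abs_mult)
  have "Bseq (\<lambda>k. uk k a)" using u[of a] ab convergentI convergent_imp_Bseq by auto
  then obtain B1 where B1: "\<And>k. \<bar>uk k a\<bar> \<le> B1" unfolding Bseq_def by auto
  have "Bseq (\<lambda>k. \<integral>t. ?I t * \<bar>vk k t - v t\<bar> \<partial>lborel)" using vk convergentI convergent_imp_Bseq by blast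
  then obtain B2 where B2: "\<And>k. \<bar>\<integral>t. ?I t * \<bar>vk k t - v t\<bar> \<partial>lborel\<bar> \<le> B2" unfolding Bseq_def by auto
  \<comment> \<open>A common bound for all \<open>uk k\<close> on \<open>{a..b}\<close>: the values
    at \<open>a\<close> are bounded because they converge, and the increments are controlled by the
    \<open>L^1\<close> norms of the derivatives. It confines \<Theta> and its derivative to a
    compact interval.\<close>
  define B where "B = B1 + (B2 + (LBINT t. ?I t * \<bar>v t\<bar>))"
  have vi: "integrable lborel (\<lambda>t. ?I t * \<bar>v t\<bar>)"
    using Bochner_Integration.integrable_abs[OF v] by (simp add: abs_mult)
  have FTC: "(LBINT t. indicator {a..x} t * f' t) = f x - f a"
    if "a \<le> x" "\<And>t. t \<in> {a..x} \<Longrightarrow> (f has_real_derivative f' t) (at t)" "continuous_on {a..x} f'"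
    for f f' :: "real \<Rightarrow> real" and x
  proof -
    have "(LBINT t. indicator {a..x} t *\<^sub>R f' t) = f x - f a"
      by (rule integral_FTC_Icc[OF that(1) _ that(3)])
         (use that in \<open>auto simp: has_real_derivative_iff_has_vector_derivative[symmetric] intro: has_field_derivative_at_within\<close>)
    then show ?thesis by simp
  qed
  have ukB: "\<bar>uk k x\<bar> \<le> B" if x: "x \<in> {a..b}" for k x
  proof -
    have "(LBINT t. indicator {a..x} t * vk k t) = uk k x - uk k a"
      by (rule FTC) (use x uk(1) continuous_on_subset[OF uk(2)] in auto)
    then have "\<bar>uk k x\<bar> \<le> \<bar>uk k a\<bar> + \<bar>\<integral>t. indicator {a..x} t * vk k t \<partial>lborel\<bar>" by linarith
    have vkx: "integrable lborel (\<lambda>t. indicator {a..x} t * vk k t)"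
      using borel_integrable_compact[of "{a..x}" "vk k"] continuous_on_subset[OF uk(2)] by simp
    have nb: "norm (LBINT t. indicator {a..x} t * vk k t) \<le> (LBINT t. ?I t * \<bar>vk k t - v t\<bar> + ?I t * \<bar>v t\<bar>)"
      by (rule Bochner_Integration.integral_norm_bound_integral)
         (use x vkvi[of k] vi vkx in \<open>auto simp: indicator_def\<close>)
    note \<open>\<bar>uk k x\<bar> \<le> _\<close>
    also have "\<bar>\<integral>t. indicator {a..x} t * vk k t \<partial>lborel\<bar> \<le> (LBINT t. ?I t * \<bar>vk k t - v t\<bar> + ?I t * \<bar>v t\<bar>)"
      using nb by simp
    also have "\<dots> = (LBINT t. ?I t * \<bar>vk k t - v t\<bar>) + (LBINT t. ?I t * \<bar>v t\<bar>)"
      using vkvi vi by simp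
    finally show ?thesis using B1[of k] B2[of k] unfolding B_def by linarith
  qed
  have uB: "\<bar>u x\<bar> \<le> B" if x: "x \<in> {a..b}" for x
    using LIMSEQ_le_const2[OF tendsto_rabs[OF u[OF x]]] ukB[OF x] by blast
  have "compact {-B..B}" by simp
  then have "bounded (\<Theta> ` {-B..B})" "bounded (\<Theta>' ` {-B..B})"
    using \<Theta>c continuous_on_subset[OF \<Theta>(2)] by (auto intro!: compact_imp_bounded compact_continuous_image)
  then obtain D1 D2 where D1: "\<And>s. \<bar>s\<bar> \<le> B \<Longrightarrow> \<bar>\<Theta> s\<bar> \<le> D1" and D2: "\<And>s. \<bar>s\<bar> \<le> B \<Longrightarrow> \<bar>\<Theta>' s\<bar> \<le> D2"
    unfolding bounded_iff by (metis abs_le_iff atLeastAtMost_iff image_eqI minus_le_iff real_norm_def)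
  have "bounded (m ` {a..b})" "bounded (m' ` {a..b})"
    using mc m(2) by (auto intro!: compact_imp_bounded compact_continuous_image)
  then obtain M1 M2 where M1: "\<And>t. t \<in> {a..b} \<Longrightarrow> \<bar>m t\<bar> \<le> M1" and M2: "\<And>t. t \<in> {a..b} \<Longrightarrow> \<bar>m' t\<bar> \<le> M2"
    unfolding bounded_iff by (metis image_eqI real_norm_def)
  have [simp]: "0 \<le> D1" "0 \<le> D2" "0 \<le> M1" "0 \<le> M2"
    using D1[of "u a"] D2[of "u a"] M1[of a] M2[of a] uB[of a] ab by (force)+
  have um[measurable]: "(\<lambda>t. ?I t * u t) \<in> borel_measurable borel"
    by (rule borel_measurable_LIMSEQ_real[where u = "\<lambda>k t. ?I t * uk k t"])
       (auto intro!: tendsto_eq_intros u simp: indicator_def)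
  have eqI: "?I t * (m' t * \<Theta> (u t)) = mi' t * \<Theta> (?I t * u t)"
    "?I t * (m t * \<Theta>' (u t) * v t) = mi t * \<Theta>' (?I t * u t) * v t" for t
    by (auto simp: indicator_def mi_def mi'_def)
  have eqk: "?I t * (m' t * \<Theta> (uk k t)) = mi' t * \<Theta> (uk k t)"
    "?I t * (m t * \<Theta>' (uk k t) * w) = mi t * \<Theta>' (uk k t) * w" for t k w
    by (auto simp: mi_def mi'_def)
  have [measurable]: "(\<lambda>t. ?I t * (m' t * \<Theta> (u t))) \<in> borel_measurable borel"
    "(\<lambda>t. ?I t * (m t * \<Theta>' (u t) * v t)) \<in> borel_measurable borel"
    unfolding eqI by measurable
  have [measurable]: "(\<lambda>t. ?I t * (m' t * \<Theta> (uk k t))) \<in> borel_measurable borel"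
    "(\<lambda>t. ?I t * (m t * \<Theta>' (uk k t) * v t)) \<in> borel_measurable borel"
    "(\<lambda>t. ?I t * (m t * \<Theta>' (uk k t) * vk k t)) \<in> borel_measurable borel"
    "(\<lambda>t. ?I t * (m t * \<Theta>' (uk k t) * (vk k t - v t))) \<in> borel_measurable borel" for k
    unfolding eqk by measurable
  have dom1: "integrable lborel (\<lambda>t. ?I t * (M2 * D1))"
    using borel_integrable_compact[of "{a..b}" "\<lambda>t. M2 * D1"] by simp
  have dom2: "integrable lborel (\<lambda>t. (M1 * D2) * (?I t * \<bar>v t\<bar>))" using vi by simp
  have b1: "norm (?I t * (m' t * \<Theta> s)) \<le> ?I t * (M2 * D1)" if "t \<in> {a..b} \<Longrightarrow> \<bar>s\<bar> \<le> B" for t s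
    using M2[of t] D1[OF that] by (cases "t \<in> {a..b}") (auto simp: abs_mult intro!: mult_mono)
  have b2: "norm (?I t * (m t * \<Theta>' s * w)) \<le> (M1 * D2) * (?I t * \<bar>w\<bar>)" if "t \<in> {a..b} \<Longrightarrow> \<bar>s\<bar> \<le> B" for t s w
    using M1[of t] D2[OF that] by (cases "t \<in> {a..b}") (auto simp: abs_mult intro!: mult_mono)
  have ib: "integrable lborel f" if "f \<in> borel_measurable borel" "integrable lborel g" "\<And>t. norm (f t) \<le> g t"
    for f g :: "real \<Rightarrow> real"
    by (rule integrable_dominated[OF that(2)]) (use that(1,3) in auto)
  have i1: "integrable lborel (\<lambda>t. ?I t * (m' t * \<Theta> (u t)))"
    by (rule ib[OF _ dom1 b1[OF uB]]) measurable
  have i2: "integrable lborel (\<lambda>t. ?I t * (m t * \<Theta>' (u t) * v t))"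
    by (rule ib[OF _ dom2 b2[OF uB]]) measurable
  show "integrable lborel (\<lambda>t. ?I t * (m' t * \<Theta> (u t) + m t * \<Theta>' (u t) * v t))"
    using Bochner_Integration.integrable_add[OF i1 i2] by (simp add: algebra_simps)
  have l1: "(\<lambda>k. \<integral>t. ?I t * (m' t * \<Theta> (uk k t)) \<partial>lborel) \<longlonglongrightarrow> (LBINT t. ?I t * (m' t * \<Theta> (u t)))"
  proof (rule integral_dominated_convergence[OF _ _ dom1])
    show "AE t in lborel. (\<lambda>k. ?I t * (m' t * \<Theta> (uk k t))) \<longlonglongrightarrow> ?I t * (m' t * \<Theta> (u t))"
      by (rule AE_I2)
         (auto simp: indicator_def intro!: tendsto_mult tendsto_const isCont_tendsto_compose[OF DERIV_isCont[OF \<Theta>(1)]] u)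
    show "AE t in lborel. norm (?I t * (m' t * \<Theta> (uk k t))) \<le> ?I t * (M2 * D1)" for k
      by (intro AE_I2 b1 ukB)
  qed measurable
  have \<Theta>'cont: "isCont \<Theta>' s" for s using \<Theta>(2) by (simp add: continuous_on_eq_continuous_at)
  have l2: "(\<lambda>k. \<integral>t. ?I t * (m t * \<Theta>' (uk k t) * v t) \<partial>lborel) \<longlonglongrightarrow> (LBINT t. ?I t * (m t * \<Theta>' (u t) * v t))"
  proof (rule integral_dominated_convergence[OF _ _ dom2])
    show "AE t in lborel. (\<lambda>k. ?I t * (m t * \<Theta>' (uk k t) * v t)) \<longlonglongrightarrow> ?I t * (m t * \<Theta>' (u t) * v t)"
      by (rule AE_I2)
         (auto simp: indicator_def intro!: tendsto_mult tendsto_const isCont_tendsto_compose[OF \<Theta>'cont] u)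
    show "AE t in lborel. norm (?I t * (m t * \<Theta>' (uk k t) * v t)) \<le> (M1 * D2) * (?I t * \<bar>v t\<bar>)" for k
      by (intro AE_I2 b2 ukB)
  qed measurable
  have dom3: "integrable lborel (\<lambda>t. (M1 * D2) * (?I t * \<bar>vk k t - v t\<bar>))" for k using vkvi by simp
  have i3: "integrable lborel (\<lambda>t. ?I t * (m t * \<Theta>' (uk k t) * (vk k t - v t)))" for k
    by (rule ib[OF _ dom3[of k] b2[OF ukB]]) measurable
  have l3: "(\<lambda>k. \<integral>t. ?I t * (m t * \<Theta>' (uk k t) * (vk k t - v t)) \<partial>lborel) \<longlonglongrightarrow> 0"
  proof (rule Lim_null_comparison)
    show "(\<lambda>k. (M1 * D2) * (LBINT t. ?I t * \<bar>vk k t - v t\<bar>)) \<longlonglongrightarrow> 0"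
      using tendsto_mult_right_zero[OF vk] by simp
    have "norm (LBINT t. ?I t * (m t * \<Theta>' (uk k t) * (vk k t - v t))) \<le> (LBINT t. (M1 * D2) * (?I t * \<bar>vk k t - v t\<bar>))" for k
      by (rule Bochner_Integration.integral_norm_bound_integral[OF i3 dom3]) (intro b2 ukB)
    then show "\<forall>\<^sub>F k in sequentially. norm (LBINT t. ?I t * (m t * \<Theta>' (uk k t) * (vk k t - v t)))
       \<le> (M1 * D2) * (LBINT t. ?I t * \<bar>vk k t - v t\<bar>)" by simp
  qed
  have j1: "integrable lborel (\<lambda>t. ?I t * (m' t * \<Theta> (uk k t)))" for k
    by (rule ib[OF _ dom1 b1[OF ukB]]) measurable
  have j2: "integrable lborel (\<lambda>t. ?I t * (m t * \<Theta>' (uk k t) * v t))" for k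
    by (rule ib[OF _ dom2 b2[OF ukB]]) measurable
  \<comment> \<open>Writing \<open>vk k = v + (vk k - v)\<close> separates the two modes of
    convergence: with the fixed \<open>v\<close> dominated convergence applies, and the last
    integral is bounded by a constant times the \<open>L^1\<close> distance of the
    derivatives.\<close>
  have ftc: "m b * \<Theta> (uk k b) - m a * \<Theta> (uk k a) = (LBINT t. ?I t * (m' t * \<Theta> (uk k t)))
     + (LBINT t. ?I t * (m t * \<Theta>' (uk k t) * v t))
     + (LBINT t. ?I t * (m t * \<Theta>' (uk k t) * (vk k t - v t)))" for k
  proof -
    have "(LBINT t. ?I t * (m' t * \<Theta> (uk k t) + (\<Theta>' (uk k t) * vk k t) * m t)) = m b * \<Theta> (uk k b) - m a * \<Theta> (uk k a)"
    proof (rule FTC[OF ab])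
      fix t assume "t \<in> {a..b}"
      then show "((\<lambda>t. m t * \<Theta> (uk k t)) has_real_derivative (m' t * \<Theta> (uk k t) + (\<Theta>' (uk k t) * vk k t) * m t)) (at t)"
        by (intro DERIV_mult m DERIV_chain2[OF \<Theta>(1) uk(1)])
    qed (intro continuous_intros m(2) mc continuous_on_compose2[OF \<Theta>c[of UNIV]] continuous_on_compose2[OF \<Theta>(2)] ukc
           continuous_on_subset[OF uk(2)]; auto)+
    also have "(\<lambda>t. ?I t * (m' t * \<Theta> (uk k t) + (\<Theta>' (uk k t) * vk k t) * m t)) =
       (\<lambda>t. ?I t * (m' t * \<Theta> (uk k t)) + ?I t * (m t * \<Theta>' (uk k t) * v t) + ?I t * (m t * \<Theta>' (uk k t) * (vk k t - v t)))"
      by (auto simp: fun_eq_iff algebra_simps)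
    finally show ?thesis using j1[of k] j2[of k] i3[of k] by simp
  qed
  have "(\<lambda>k. m b * \<Theta> (uk k b) - m a * \<Theta> (uk k a)) \<longlonglongrightarrow> m b * \<Theta> (u b) - m a * \<Theta> (u a)"
    by (intro tendsto_intros isCont_tendsto_compose[OF DERIV_isCont[OF \<Theta>(1)]] u) (use ab in auto)
  moreover have "(\<lambda>k. m b * \<Theta> (uk k b) - m a * \<Theta> (uk k a)) \<longlonglongrightarrow>
     (LBINT t. ?I t * (m' t * \<Theta> (u t))) + (LBINT t. ?I t * (m t * \<Theta>' (u t) * v t)) + 0"
    unfolding ftc by (intro tendsto_add l1 l2 l3)
  ultimately have "m b * \<Theta> (u b) - m a * \<Theta> (u a) = (LBINT t. ?I t * (m' t * \<Theta> (u t))) + (LBINT t. ?I t * (m t * \<Theta>' (u t) * v t))"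
    using LIMSEQ_unique by fastforce
  also have "\<dots> = (LBINT t. ?I t * (m' t * \<Theta> (u t)) + ?I t * (m t * \<Theta>' (u t) * v t))"
    using i1 i2 by simp
  finally show "(LBINT t. ?I t * (m' t * \<Theta> (u t) + m t * \<Theta>' (u t) * v t)) = m b * \<Theta> (u b) - m a * \<Theta> (u a)"
    by (simp add: algebra_simps)
qed


text \<open>No boundary term survives.  At \<open>0\<close> and at \<open>\<infinity>\<close> this is because \<open>dt / t\<close> has infinite mass; at a finite
  end point \<open>R\<close> of \<open>J\<close> because \<open>u R = 0\<close>: if \<open>m * \<Theta> (u)\<close> stayed away from \<open>0\<close> near \<open>R\<close>, then
  integrability of \<open>m * \<Theta>' (u) * v\<close> would make \<open>(\<Theta> (u))' / \<Theta> (u)\<close> integrable there.\<close>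

lemma integral_by_parts_ray:
  fixes u v :: "real \<Rightarrow> real" and uk vk :: "nat \<Rightarrow> real \<Rightarrow> real"
  assumes J: "open J" "J \<subseteq> {0<..}" "J \<noteq> {}" "\<And>s t. t \<in> J \<Longrightarrow> 0 < s \<Longrightarrow> s \<le> t \<Longrightarrow> s \<in> J"
    and uk: "\<And>k t. (uk k has_real_derivative vk k t) (at t)" "\<And>k. continuous_on UNIV (vk k)"
    and v: "\<And>a b. 0 < a \<Longrightarrow> integrable lborel (\<lambda>t. indicator {a..b} t * v t)"
    and vk: "\<And>a b. 0 < a \<Longrightarrow> (\<lambda>k. \<integral>t. indicator {a..b} t * \<bar>vk k t - v t\<bar> \<partial>lborel) \<longlonglongrightarrow> 0"
    and vm: "v \<in> borel_measurable borel"
    and u: "\<And>t. 0 < t \<Longrightarrow> (\<lambda>k. uk k t) \<longlonglongrightarrow> u t"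
    and u0: "\<And>t. 0 < t \<Longrightarrow> t \<notin> J \<Longrightarrow> u t = 0"
    and m: "\<And>t. t \<in> J \<Longrightarrow> (m has_real_derivative m' t) (at t)" "continuous_on J m'"
    and \<Theta>: "\<And>s. (\<Theta> has_real_derivative \<Theta>' s) (at s)" "continuous_on UNIV \<Theta>'" "\<Theta> 0 = 0" "\<And>s. 0 \<le> \<Theta> s"
    and int1: "integrable lborel (\<lambda>t. indicator J t * (m' t * \<Theta> (u t)))"
    and int2: "integrable lborel (\<lambda>t. indicator J t * (m t * \<Theta>' (u t) * v t))"
    and int3: "integrable lborel (\<lambda>t. indicator J t * (m t * \<Theta> (u t) / t))"
  shows "(LBINT t. indicator J t * (m' t * \<Theta> (u t) + m t * \<Theta>' (u t) * v t)) = 0"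
proof -
  define \<psi> where "\<psi> t = m' t * \<Theta> (u t) + m t * \<Theta>' (u t) * v t" for t
  define \<Psi> where "\<Psi> t = m t * \<Theta> (u t)" for t
  have int\<psi>: "integrable lborel (\<lambda>t. indicator J t * \<psi> t)"
    using Bochner_Integration.integrable_add[OF int1 int2] unfolding \<psi>_def by (simp add: algebra_simps)
  have sub: "{a..b} \<subseteq> J" if "0 < a" "b \<in> J" for a b
    using J(4)[OF that(2)] that(1) by auto
  have chain: "(LBINT t. indicator {a..b} t * \<psi> t) = \<Psi> b - \<Psi> a" if "0 < a" "a \<le> b" "b \<in> J" for a b
    unfolding \<psi>_def \<Psi>_def
  proof (rule integral_chain_rule_limit(2)[OF that(2) uk v[OF that(1)] vk[OF that(1)] vm])
    show "continuous_on {a..b} m'" using m(2) sub[OF that(1,3)] continuous_on_subset by blast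
  qed (use that u m sub[OF that(1,3)] \<Theta> in \<open>auto\<close>)
  have chainT: "integrable lborel (\<lambda>t. indicator {a..b} t * (\<Theta>' (u t) * v t))"
    "(LBINT t. indicator {a..b} t * (\<Theta>' (u t) * v t)) = \<Theta> (u b) - \<Theta> (u a)" if "0 < a" "a \<le> b" for a b
    using integral_chain_rule_limit[where m = "\<lambda>_. 1" and m' = "\<lambda>_. 0", OF that(2) uk v[OF that(1)] vk[OF that(1)] vm, of u \<Theta> \<Theta>']
      that u \<Theta> by auto
  define I where "I = (LBINT t. \<bar>indicator J t * (\<Psi> t / t)\<bar>)"
  \<comment> \<open>The quantitative form of the infinite mass of \<open>dt / t\<close>: keeping
    \<open>\<bar>\<Psi>\<bar>\<close> above \<open>c\<close> on \<open>{s..S}\<close> uses up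
    \<open>c ln (S / s)\<close> of the finite amount \<open>I\<close>.\<close>
  have logb: "c * ln (S / s) \<le> I" if "0 < s" "s \<le> S" "S \<in> J" "\<And>t. t \<in> {s..S} \<Longrightarrow> c \<le> \<bar>\<Psi> t\<bar>" "0 < c" for c s S
  proof -
    have "(LBINT t. indicator {s..S} t *\<^sub>R (c / t)) = c * ln S - c * ln s"
      using that by (intro integral_FTC_Icc)
         (auto intro!: derivative_eq_intros continuous_intros simp: has_real_derivative_iff_has_vector_derivative[symmetric])
    then have "c * ln (S / s) = (LBINT t. indicator {s..S} t * (c / t))"
      using that by (simp add: ln_div algebra_simps)
    also have "\<dots> \<le> I" unfolding I_def
    proof (rule integral_mono)
      show "integrable lborel (\<lambda>t. indicator {s..S} t * (c / t))"
      proof -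
        have "continuous_on {s..S} (\<lambda>t. c / t)" using that(1) by (auto intro!: continuous_intros)
        then show ?thesis using borel_integrable_compact[of "{s..S}" "\<lambda>t. c / t"] by simp
      qed
      show "integrable lborel (\<lambda>t. \<bar>indicator J t * (\<Psi> t / t)\<bar>)"
        using int3 unfolding \<Psi>_def by (intro Bochner_Integration.integrable_abs) simp
      fix t
      show "indicator {s..S} t * (c / t) \<le> \<bar>indicator J t * (\<Psi> t / t)\<bar>"
        using that sub[OF that(1,3)] by (cases "t \<in> {s..S}") (auto simp: abs_mult divide_right_mono)
    qed
    finally show ?thesis .
  qed
  have near0: "\<exists>t. 0 < t \<and> t < \<delta> \<and> t \<in> J \<and> \<bar>\<Psi> t\<bar> < c" if "0 < c" "0 < \<delta>" for c \<delta>
  proof (rule ccontr)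
    assume "\<not> ?thesis"
    then have n: "\<And>t. 0 < t \<Longrightarrow> t < \<delta> \<Longrightarrow> t \<in> J \<Longrightarrow> c \<le> \<bar>\<Psi> t\<bar>" by force
    obtain j where j: "j \<in> J" "0 < j" using J by auto
    define S where "S = min j (\<delta> / 2)"
    have S: "0 < S" "S < \<delta>" "S \<in> J" using j that J(4)[OF j(1)] by (auto simp: S_def min_def)
    \<comment> \<open>Chosen so that \<open>c ln (S / s)\<close> equals
      \<open>\<bar>I\<bar> + 1\<close>, more than is available. The same choice with
      \<open>S\<close> in place of \<open>s\<close> handles an unbounded \<open>J\<close>.\<close>
    define s where "s = S * exp (- ((\<bar>I\<bar> + 1) / c))"
    have s: "0 < s" "s \<le> S" using S that by (auto simp: s_def mult_le_cancel_left1 intro!: mult_left_le)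
    have "c * ln (S / s) \<le> I"
      by (rule logb) (use s S n that J(4)[OF S(3)] in auto)
    moreover have "ln (S / s) = (\<bar>I\<bar> + 1) / c" using S by (simp add: s_def ln_div ln_mult)
    ultimately show False using that by auto
  qed
  have nearR: "\<exists>t\<in>J. r \<le> t \<and> \<bar>\<Psi> t\<bar> < c" if c: "0 < c" and r: "r \<in> J" for c r
  proof (rule ccontr)
    assume "\<not> ?thesis"
    then have n: "\<And>t. t \<in> J \<Longrightarrow> r \<le> t \<Longrightarrow> c \<le> \<bar>\<Psi> t\<bar>" by force
    have r0: "0 < r" using r J by auto
    show False
    proof (cases "bdd_above J")
      case False
      define S where "S = r * exp ((\<bar>I\<bar> + 1) / c)"
      have S: "r \<le> S" "0 < S" using r0 c by (auto simp: S_def mult_le_cancel_left1)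
      obtain j where "j \<in> J" "S < j" using False unfolding bdd_above_def by (meson not_le)
      then have SJ: "S \<in> J" using J(4) S by auto
      have "c * ln (S / r) \<le> I"
        by (rule logb) (use r0 S SJ n c sub[OF r0 SJ] in auto)
      moreover have "ln (S / r) = (\<bar>I\<bar> + 1) / c" using r0 by (simp add: S_def ln_div ln_mult)
      ultimately show False using c by auto
    next
      case True
      define R where "R = Sup J"
      have up: "t \<le> R" if "t \<in> J" for t unfolding R_def using True that by (simp add: cSup_upper)
      have RJ: "R \<notin> J"
      proof
        assume "R \<in> J"
        then obtain e where "e > 0" "ball R e \<subseteq> J" using J(1) openE by blast
        then have "R + e/2 \<in> J" by (auto simp: dist_real_def subset_iff)
        with up \<open>e > 0\<close> show False by fastforce
      qed
      have below: "t \<in> J" if t: "0 < t" "t < R" for t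
      proof -
        obtain j where "j \<in> J" "t < j"
          by (rule less_cSupE[of t J]) (use t J(3) in \<open>auto simp: R_def\<close>)
        then show ?thesis using J(4) t by auto
      qed
      have rR: "r < R" using up[OF r] RJ r by (cases "r = R") auto
      have R0: "0 < R" using r0 rR by simp
      have uR: "\<Theta> (u R) = 0" using u0[OF R0 RJ] \<Theta>(3) by simp
      \<comment> \<open>The integrable function whose tail towards the finite end point
        \<open>R\<close> is made at most \<open>c / 2\<close> by moving \<open>t1\<close> close to
        \<open>R\<close>.\<close>
      define e where "e t = indicator J t * \<bar>m t * \<Theta>' (u t) * v t\<bar>" for t
      have e: "integrable lborel e"
        using Bochner_Integration.integrable_abs[OF int2] unfolding e_def by (simp add: abs_mult)
      have e0: "0 \<le> e t" for t unfolding e_def by simp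
      have [measurable]: "e \<in> borel_measurable borel" using e by auto
      have "(\<lambda>n. \<integral>t. indicator {R - 1 / Suc n..} t * e t \<partial>lborel) \<longlonglongrightarrow> (\<integral>t. 0 \<partial>(lborel :: real measure))"
      proof (rule integral_dominated_convergence[OF _ _ e])
        show "AE t in lborel. (\<lambda>n. indicator {R - 1 / Suc n..} t * e t) \<longlonglongrightarrow> 0"
        proof (rule AE_I2)
          fix t
          show "(\<lambda>n. indicator {R - 1 / Suc n..} t * e t) \<longlonglongrightarrow> 0"
          proof (cases "t \<in> J")
            case True
            then have "t < R" using up RJ by (metis less_eq_real_def)
            then obtain n0 where n0: "1 / Suc n0 < R - t" using nat_approx_posE[of "R - t"] by auto
            have "\<forall>\<^sub>F n in sequentially. indicator {R - 1 / Suc n..} t * e t = 0"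
              unfolding eventually_sequentially
            proof (intro exI[of _ n0] allI impI)
              fix n assume "n0 \<le> n"
              then have "1 / real (Suc n) \<le> 1 / Suc n0" by (simp add: frac_le)
              then show "indicator {R - 1 / Suc n..} t * e t = 0" using n0 by (auto simp: indicator_def)
            qed
            then show ?thesis by (rule tendsto_eventually)
          qed (simp add: e_def)
        qed
        show "AE t in lborel. norm (indicator {R - 1 / Suc n..} t * e t) \<le> e t" for n
          by (rule AE_I2) (use e0 in \<open>auto simp: indicator_def\<close>)
      qed auto
      then have "(\<lambda>n. \<integral>t. indicator {R - 1 / Suc n..} t * e t \<partial>lborel) \<longlonglongrightarrow> 0" by simp
      from order_tendstoD(2)[OF this, of "c/2"] c
      obtain n1 where n1: "(LBINT t. indicator {R - 1 / Suc n1..} t * e t) < c/2"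
        unfolding eventually_sequentially by auto
      define t1 where "t1 = max r (R - 1 / Suc n1)"
      have t1: "r \<le> t1" "t1 < R" "0 < t1" using r0 rR by (auto simp: t1_def)
      have e2: "(LBINT t. indicator {t1..} t * e t) \<le> c/2"
      proof -
        have "(LBINT t. indicator {t1..} t * e t) \<le> (LBINT t. indicator {R - 1 / Suc n1..} t * e t)"
          by (rule integral_mono)
             (use e e0 in \<open>auto simp: t1_def indicator_def intro!: Bochner_Integration.integrable_bound[OF e]\<close>)
        then show ?thesis using n1 by simp
      qed
      define T where "T t = \<Theta> (u t)" for t
      have Tint: "T t = - (LBINT s. indicator {t..R} s * (\<Theta>' (u s) * v s))" if "t \<in> {t1..<R}" for t
        using chainT(2)[of t R] that t1 uR unfolding T_def by auto
      have absi: "integrable lborel (\<lambda>s. indicator {t..R} s * \<bar>\<Theta>' (u s) * v s\<bar>)" if "0 < t" "t \<le> R" for t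
        using Bochner_Integration.integrable_abs[OF chainT(1)[OF that]] by (simp add: abs_mult)
      have Tb: "T t \<le> (LBINT s. indicator {t..R} s * \<bar>\<Theta>' (u s) * v s\<bar>)" if "t \<in> {t1..<R}" for t
      proof -
        have "T t = (LBINT s. - (indicator {t..R} s * (\<Theta>' (u s) * v s)))" using Tint[OF that] by simp
        also have "\<dots> \<le> (LBINT s. indicator {t..R} s * \<bar>\<Theta>' (u s) * v s\<bar>)"
          by (rule integral_mono) (use that t1 chainT(1)[of t R] absi[of t] in \<open>auto simp: indicator_def\<close>)
        finally show ?thesis .
      qed
      define B where "B = (LBINT s. indicator {t1..R} s * \<bar>\<Theta>' (u s) * v s\<bar>)"
      have TB: "T t \<le> B" if "t \<in> {t1..<R}" for t
      proof -
        have "(LBINT s. indicator {t..R} s * \<bar>\<Theta>' (u s) * v s\<bar>) \<le> B" unfolding B_def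
          by (rule integral_mono) (use that t1 absi[of t] absi[of t1] in \<open>auto simp: indicator_def\<close>)
        with Tb[OF that] show ?thesis by simp
      qed
      have T0: "0 \<le> T t" for t unfolding T_def by (rule \<Theta>(4))
      define Ts where "Ts = Sup (T ` {t1..<R})"
      have bdd: "bdd_above (T ` {t1..<R})" using TB by (auto intro!: bdd_aboveI[of _ B])
      have TTs: "T t \<le> Ts" if "t \<in> {t1..<R}" for t unfolding Ts_def using bdd that by (auto intro!: cSup_upper)
      have ne: "T ` {t1..<R} \<noteq> {}" using t1 by auto
      have Ts0: "0 \<le> Ts" using TTs[of t1] T0[of t1] t1 by auto
      \<comment> \<open>An absorption argument that avoids dividing by \<open>\<Theta> (u)\<close>.
        Since \<open>c <= \<bar>m\<bar> T\<close>, the derivative of \<open>T\<close> is bounded by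
        \<open>(Ts / c) e\<close>, and the tail of \<open>e\<close> is at most \<open>c / 2\<close>.
        As \<open>T\<close> vanishes at \<open>R\<close>, its supremum \<open>Ts\<close> is at most
        half of itself.\<close>
      have "T t \<le> Ts / 2" if t: "t \<in> {t1..<R}" for t
      proof -
        have "T t \<le> (LBINT s. indicator {t..R} s * \<bar>\<Theta>' (u s) * v s\<bar>)" by (rule Tb[OF t])
        also have "\<dots> \<le> (LBINT s. (Ts / c) * (indicator {t1..} s * e s))"
        proof (rule integral_mono_AE)
          show "integrable lborel (\<lambda>s. indicator {t..R} s * \<bar>\<Theta>' (u s) * v s\<bar>)" using absi t t1 by auto
          show "integrable lborel (\<lambda>s. (Ts / c) * (indicator {t1..} s * e s))"
            by (intro integrable_mult_right Bochner_Integration.integrable_bound[OF e]) (auto simp: indicator_def)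
          show "AE s in lborel. indicator {t..R} s * \<bar>\<Theta>' (u s) * v s\<bar> \<le> (Ts / c) * (indicator {t1..} s * e s)"
            using AE_lborel_singleton[of R]
          proof eventually_elim
            case (elim s)
            show ?case
            proof (cases "s \<in> {t..R}")
              case True
              then have s: "s \<in> {t1..<R}" "s \<in> J" "r \<le> s" using elim t t1 below[of s] by auto
              have "c * \<bar>\<Theta>' (u s) * v s\<bar> \<le> \<bar>\<Psi> s\<bar> * \<bar>\<Theta>' (u s) * v s\<bar>" using n[OF s(2,3)] by (intro mult_right_mono) auto
              also have "\<dots> = T s * e s" using s T0[of s] unfolding \<Psi>_def e_def T_def by (simp add: abs_mult)
              also have "\<dots> \<le> Ts * e s" using TTs[OF s(1)] e0 by (intro mult_right_mono) auto
              finally have "\<bar>\<Theta>' (u s) * v s\<bar> \<le> Ts / c * e s" using c by (simp add: field_simps)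
              then show ?thesis using True s by auto
            qed (use Ts0 c e0 in auto)
          qed
        qed
        also have "\<dots> = (Ts / c) * (LBINT s. indicator {t1..} s * e s)" by simp
        also have "\<dots> \<le> (Ts / c) * (c/2)" using e2 Ts0 c by (intro mult_left_mono) auto
        finally show ?thesis using c by simp
      qed
      then have "Ts \<le> Ts / 2" unfolding Ts_def by (intro cSup_least[OF ne]) auto
      then have "Ts = 0" using Ts0 by simp
      then have "T t1 = 0" using TTs[of t1] T0[of t1] t1 by auto
      then have "\<Psi> t1 = 0" unfolding T_def \<Psi>_def by simp
      moreover have "c \<le> \<bar>\<Psi> t1\<bar>" using n t1 below by auto
      ultimately show False using c by simp
    qed
  qed
  obtain j where j: "j \<in> J" "0 < j" using J by auto
  have "\<exists>a. 0 < a \<and> a < min j (1 / Suc n) \<and> a \<in> J \<and> \<bar>\<Psi> a\<bar> < 1 / Suc n" for n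
    using near0[of "1 / Suc n" "min j (1 / Suc n)"] j by auto
  then obtain a where a: "\<And>n. 0 < a n" "\<And>n. a n < j" "\<And>n. a n < 1 / Suc n" "\<And>n. \<bar>\<Psi> (a n)\<bar> < 1 / Suc n"
    by (metis min_less_iff_conj)
  \<comment> \<open>Points of \<open>J\<close> that exceed every fixed element of \<open>J\<close>
    eventually, whether \<open>J\<close> is bounded or not. Choosing \<open>b n\<close> beyond
    \<open>r n\<close> makes the intervals \<open>{a n..b n}\<close> exhaust
    \<open>J\<close>.\<close>
  define r where "r n = (if bdd_above J then max j (Sup J - 1 / Suc n) else max j (Suc n))" for n
  have rJ: "r n \<in> J" for n
  proof (cases "bdd_above J")
    case True
    have "Sup J - 1 / Suc n < Sup J" by simp
    then obtain i where "i \<in> J" "Sup J - 1 / Suc n < i" using less_cSupE[of _ J] J(3) by blast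
    then show ?thesis using True J(4)[OF \<open>i \<in> J\<close>] j J(2) unfolding r_def by (auto simp: max_def)
  next
    case False
    then obtain i where "i \<in> J" "real (Suc n) < i" unfolding bdd_above_def by (meson not_le)
    then show ?thesis using False J(4)[OF \<open>i \<in> J\<close>] j unfolding r_def by (auto simp: max_def)
  qed
  have "\<exists>b\<in>J. r n \<le> b \<and> \<bar>\<Psi> b\<bar> < 1 / Suc n" for n
    by (rule nearR[OF _ rJ]) simp
  then obtain b where b: "\<And>n. b n \<in> J" "\<And>n. r n \<le> b n" "\<And>n. \<bar>\<Psi> (b n)\<bar> < 1 / Suc n" by metis
  have jr: "j \<le> r n" for n unfolding r_def by simp
  have ab: "a n \<le> b n" for n using a(2)[of n] b(2)[of n] jr[of n] by linarith
  have lim: "(\<lambda>n. \<integral>t. indicator {a n..b n} t * (indicator J t * \<psi> t) \<partial>lborel) \<longlonglongrightarrow> (LBINT t. indicator J t * \<psi> t)"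
  proof (rule integral_dominated_convergence[where w = "\<lambda>t. \<bar>indicator J t * \<psi> t\<bar>"])
    show "AE t in lborel. (\<lambda>n. indicator {a n..b n} t * (indicator J t * \<psi> t)) \<longlonglongrightarrow> indicator J t * \<psi> t"
    proof (rule AE_I2)
      fix t
      show "(\<lambda>n. indicator {a n..b n} t * (indicator J t * \<psi> t)) \<longlonglongrightarrow> indicator J t * \<psi> t"
      proof (cases "t \<in> J")
        case True
        then have t0: "0 < t" using J by auto
        obtain n0 where n0: "1 / Suc n0 < t" using nat_approx_posE[OF t0] by auto
        have ea: "a n \<le> t" if "n0 \<le> n" for n
        proof -
          have "1 / real (Suc n) \<le> 1 / Suc n0" using that by (simp add: frac_le)
          then show ?thesis using a(3)[of n] n0 by linarith
        qed
        have "\<exists>n1. \<forall>n\<ge>n1. t \<le> r n"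
        proof (cases "bdd_above J")
          case bd: True
          have "t < Sup J"
          proof -
            obtain ee where "ee > 0" "ball t ee \<subseteq> J" using J(1) True openE by blast
            then have "t + ee/2 \<in> J" by (auto simp: dist_real_def subset_iff)
            then have "t + ee/2 \<le> Sup J" using bd by (simp add: cSup_upper)
            with \<open>ee > 0\<close> show ?thesis by simp
          qed
          then obtain n1 where n1: "1 / Suc n1 < Sup J - t" using nat_approx_posE[of "Sup J - t"] by auto
          have "t \<le> r n" if "n1 \<le> n" for n
          proof -
            have "1 / real (Suc n) \<le> 1 / Suc n1" using that by (simp add: frac_le)
            then show ?thesis using n1 bd unfolding r_def by auto
          qed
          then show ?thesis by blast
        next
          case False
          obtain n1 :: nat where "t \<le> real n1" using real_arch_simple by blast
          then have "t \<le> r n" if "n1 \<le> n" for n using that False unfolding r_def by (auto simp: le_max_iff_disj)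
          then show ?thesis by blast
        qed
        then obtain n1 where n1: "\<And>n. n1 \<le> n \<Longrightarrow> t \<le> r n" by blast
        have "\<forall>\<^sub>F n in sequentially. indicator {a n..b n} t * (indicator J t * \<psi> t) = indicator J t * \<psi> t"
          unfolding eventually_sequentially
        proof (intro exI[of _ "max n0 n1"] allI impI)
          fix n assume "max n0 n1 \<le> n"
          then have "a n \<le> t" "t \<le> b n" using ea[of n] n1[of n] b(2)[of n] by auto
          then show "indicator {a n..b n} t * (indicator J t * \<psi> t) = indicator J t * \<psi> t" by simp
        qed
        then show ?thesis by (rule tendsto_eventually)
      qed simp
    qed
    show "AE t in lborel. norm (indicator {a n..b n} t * (indicator J t * \<psi> t)) \<le> \<bar>indicator J t * \<psi> t\<bar>" for n
      by (rule AE_I2) (auto simp: indicator_def)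
    show "integrable lborel (\<lambda>t. \<bar>indicator J t * \<psi> t\<bar>)" using int\<psi> by (rule Bochner_Integration.integrable_abs)
    show "(\<lambda>t. indicator J t * \<psi> t) \<in> borel_measurable lborel" using int\<psi> by (rule borel_measurable_integrable)
    then show "(\<lambda>t. indicator {a n..b n} t * (indicator J t * \<psi> t)) \<in> borel_measurable lborel" for n by measurable
  qed
  have eq: "(LBINT t. indicator {a n..b n} t * (indicator J t * \<psi> t)) = \<Psi> (b n) - \<Psi> (a n)" for n
  proof -
    have "(LBINT t. indicator {a n..b n} t * (indicator J t * \<psi> t)) = (LBINT t. indicator {a n..b n} t * \<psi> t)"
      using sub[OF a(1) b(1), of n n] by (intro Bochner_Integration.integral_cong) (auto simp: indicator_def)
    then show ?thesis using chain[OF a(1) ab b(1)] by simp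
  qed
  have "(\<lambda>n. \<Psi> (b n)) \<longlonglongrightarrow> 0"
    by (rule Lim_null_comparison[OF _ LIMSEQ_Suc[OF lim_1_over_n]])
       (use b(3) in \<open>auto intro!: always_eventually less_imp_le\<close>)
  moreover have "(\<lambda>n. \<Psi> (a n)) \<longlonglongrightarrow> 0"
    by (rule Lim_null_comparison[OF _ LIMSEQ_Suc[OF lim_1_over_n]])
       (use a(4) in \<open>auto intro!: always_eventually less_imp_le\<close>)
  ultimately have "(\<lambda>n. \<Psi> (b n) - \<Psi> (a n)) \<longlonglongrightarrow> 0 - 0" by (intro tendsto_diff)
  then have "(LBINT t. indicator J t * \<psi> t) = 0"
    using lim unfolding eq by (metis LIMSEQ_unique diff_0_right)
  then show ?thesis unfolding \<psi>_def .
qed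

subsection \<open>Square integrable functions\<close>

lemma integrable_mult_L2:
  fixes f g :: "'b \<Rightarrow> real"
  assumes [measurable]: "f \<in> borel_measurable M" "g \<in> borel_measurable M"
    and f: "integrable M (\<lambda>x. (f x)\<^sup>2)" and g: "integrable M (\<lambda>x. (g x)\<^sup>2)"
  shows "integrable M (\<lambda>x. f x * g x)"
proof (rule integrable_dominated[where g = "\<lambda>x. (f x)\<^sup>2 + (g x)\<^sup>2"])
  show "\<bar>f x * g x\<bar> \<le> (f x)\<^sup>2 + (g x)\<^sup>2" for x
  proof -
    have "2 * (\<bar>f x\<bar> * \<bar>g x\<bar>) \<le> (f x)\<^sup>2 + (g x)\<^sup>2"
      using sum_squares_bound[of "\<bar>f x\<bar>" "\<bar>g x\<bar>"] by simp
    moreover have "0 \<le> \<bar>f x\<bar> * \<bar>g x\<bar>" by simp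
    ultimately show ?thesis unfolding abs_mult by linarith
  qed
qed (use f g in auto)

lemma Cauchy_Schwarz_integral:
  fixes f g :: "'b \<Rightarrow> real"
  assumes [measurable]: "f \<in> borel_measurable M" "g \<in> borel_measurable M"
    and f: "integrable M (\<lambda>x. (f x)\<^sup>2)" and g: "integrable M (\<lambda>x. (g x)\<^sup>2)"
  shows "(\<integral>x. \<bar>f x * g x\<bar> \<partial>M) \<le> sqrt (\<integral>x. (f x)\<^sup>2 \<partial>M) * sqrt (\<integral>x. (g x)\<^sup>2 \<partial>M)"
proof -
  define A B C where "A = (\<integral>x. (f x)\<^sup>2 \<partial>M)" and "B = (\<integral>x. (g x)\<^sup>2 \<partial>M)" and "C = (\<integral>x. \<bar>f x * g x\<bar> \<partial>M)"
  have pos: "0 \<le> A" "0 \<le> B" "0 \<le> C" unfolding A_def B_def C_def by auto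
  have fg: "integrable M (\<lambda>x. \<bar>f x * g x\<bar>)"
    using integrable_mult_L2[OF assms] by (rule Bochner_Integration.integrable_abs)
  have q: "0 \<le> s\<^sup>2 * A - 2 * s * C + B" for s
  proof -
    have "0 \<le> (\<integral>x. (s * \<bar>f x\<bar> - \<bar>g x\<bar>)\<^sup>2 \<partial>M)" by simp
    also have "(\<lambda>x. (s * \<bar>f x\<bar> - \<bar>g x\<bar>)\<^sup>2) = (\<lambda>x. s\<^sup>2 * (f x)\<^sup>2 - 2 * s * \<bar>f x * g x\<bar> + (g x)\<^sup>2)"
      by (auto simp: fun_eq_iff power2_diff power_mult_distrib abs_mult)
    also have "(\<integral>x. s\<^sup>2 * (f x)\<^sup>2 - 2 * s * \<bar>f x * g x\<bar> + (g x)\<^sup>2 \<partial>M) = s\<^sup>2 * A - 2 * s * C + B"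
      unfolding A_def B_def C_def using f g fg by simp
    finally show ?thesis .
  qed
  have "C\<^sup>2 \<le> A * B"
  proof (cases "A = 0")
    case True
    have "C = 0"
    proof (rule ccontr)
      assume "C \<noteq> 0"
      \<comment> \<open>For \<open>A = 0\<close> the quadratic form degenerates to
        \<open>B - 2 s C\<close>, and this \<open>s\<close> gives it the value
        \<open>- 1\<close>.\<close>
      then show False using q[of "(B + 1) / (2 * C)"] True by simp
    qed
    then show ?thesis using True by simp
  next
    case False
    have "0 \<le> (C / A)\<^sup>2 * A - 2 * (C / A) * C + B" by (rule q)
    also have "\<dots> = B - C\<^sup>2 / A" using False by (simp add: field_simps power2_eq_square)
    finally show ?thesis using False pos by (simp add: field_simps)
  qed
  then have "C \<le> sqrt (A * B)" using pos by (simp add: real_le_rsqrt)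
  then show ?thesis unfolding A_def B_def C_def by (simp add: real_sqrt_mult)
qed

lemma tendsto_integral_mult_L2:
  fixes f :: "nat \<Rightarrow> 'b \<Rightarrow> real" and g :: "'b \<Rightarrow> real"
  assumes [measurable]: "\<And>k. f k \<in> borel_measurable M" "g \<in> borel_measurable M"
    and f: "\<And>k. integrable M (\<lambda>x. (f k x)\<^sup>2)" and g: "integrable M (\<lambda>x. (g x)\<^sup>2)"
    and lim: "(\<lambda>k. \<integral>x. (f k x)\<^sup>2 \<partial>M) \<longlonglongrightarrow> 0"
  shows "(\<lambda>k. \<integral>x. \<bar>f k x * g x\<bar> \<partial>M) \<longlonglongrightarrow> 0" "(\<lambda>k. \<integral>x. f k x * g x \<partial>M) \<longlonglongrightarrow> 0"
proof -
  have "(\<lambda>k. sqrt (\<integral>x. (f k x)\<^sup>2 \<partial>M) * sqrt (\<integral>x. (g x)\<^sup>2 \<partial>M)) \<longlonglongrightarrow> sqrt 0 * sqrt (\<integral>x. (g x)\<^sup>2 \<partial>M)"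
    by (intro tendsto_intros lim)
  then have l: "(\<lambda>k. sqrt (\<integral>x. (f k x)\<^sup>2 \<partial>M) * sqrt (\<integral>x. (g x)\<^sup>2 \<partial>M)) \<longlonglongrightarrow> 0" by simp
  show a: "(\<lambda>k. \<integral>x. \<bar>f k x * g x\<bar> \<partial>M) \<longlonglongrightarrow> 0"
    by (rule Lim_null_comparison[OF _ l])
       (use Cauchy_Schwarz_integral[OF assms(1,2) f g] in \<open>auto intro!: always_eventually\<close>)
  show "(\<lambda>k. \<integral>x. f k x * g x \<partial>M) \<longlonglongrightarrow> 0"
    by (rule Lim_null_comparison[OF _ a]) (auto intro!: always_eventually integral_abs_bound)
qed

lemma integrable_power2_diff:
  fixes f g :: "'b \<Rightarrow> 'c::euclidean_space"
  assumes [measurable]: "f \<in> borel_measurable M" "g \<in> borel_measurable M"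
    and f: "integrable M (\<lambda>x. (norm (f x))\<^sup>2)" and g: "integrable M (\<lambda>x. (norm (g x))\<^sup>2)"
  shows "integrable M (\<lambda>x. (norm (f x - g x))\<^sup>2)"
proof (rule integrable_dominated[where g = "\<lambda>x. 2 * (norm (f x))\<^sup>2 + 2 * (norm (g x))\<^sup>2"])
  show "\<bar>(norm (f x - g x))\<^sup>2\<bar> \<le> 2 * (norm (f x))\<^sup>2 + 2 * (norm (g x))\<^sup>2" for x
  proof -
    have "(norm (f x - g x))\<^sup>2 \<le> (norm (f x) + norm (g x))\<^sup>2"
      by (intro power_mono norm_triangle_ineq4) auto
    also have "\<dots> \<le> 2 * (norm (f x))\<^sup>2 + 2 * (norm (g x))\<^sup>2"
      using sum_squares_bound[of "norm (f x)" "norm (g x)"] by (simp add: power2_sum)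
    finally show ?thesis by simp
  qed
qed (use f g in auto)

lemma test_fun_borel:
  assumes "test_fun \<Omega> \<phi>"
  shows "\<phi> \<in> borel_measurable borel" "grad \<phi> \<in> borel_measurable borel" "pdiff b \<phi> \<in> borel_measurable borel"
proof -
  have s: "smooth_fun \<phi>" using assms unfolding test_fun_def by simp
  then show "\<phi> \<in> borel_measurable borel" "grad \<phi> \<in> borel_measurable borel"
    by (auto intro!: borel_measurable_continuous_onI smooth_fun_grad_continuous intro: smooth_fun_continuous)
  have "pdiff b \<phi> = (\<lambda>x. grad \<phi> x \<bullet> b)"
    using pdiff_eqI[OF smooth_fun_has_derivative[OF s]] by auto
  moreover have "(\<lambda>x. grad \<phi> x \<bullet> b) \<in> borel_measurable borel"
    by (rule borel_measurable_continuous_onI) (intro continuous_intros smooth_fun_grad_continuous s)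
  ultimately show "pdiff b \<phi> \<in> borel_measurable borel" by simp
qed

lemma test_fun_integrable:
  fixes f :: "'a::euclidean_space \<Rightarrow> real"
  assumes "test_fun \<Omega> \<phi>" "continuous_on UNIV f" "\<And>x. \<phi> x = 0 \<Longrightarrow> grad \<phi> x = 0 \<Longrightarrow> f x = 0"
  shows "integrable lborel f"
proof -
  let ?S = "closure {x. \<phi> x \<noteq> 0}"
  have S: "compact ?S" using assms unfolding test_fun_def by auto
  have t: "test_fun ?S \<phi>" using assms unfolding test_fun_def by auto
  have "integrable lborel (\<lambda>x. indicator ?S x *\<^sub>R f x)"
    using borel_integrable_compact[OF S continuous_on_subset[OF assms(2)]] by simp
  moreover have "(\<lambda>x. indicator ?S x *\<^sub>R f x) = f"
  proof
    fix x show "indicator ?S x *\<^sub>R f x = f x"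
      using assms(3)[OF test_fun_zero_outside(1,3)[OF t, of x]] by (cases "x \<in> ?S") (simp_all del: closure_eq_empty)
  qed
  ultimately show ?thesis by simp
qed

lemma test_fun_integrable_square:
  assumes "test_fun \<Omega> \<phi>"
  shows "integrable lborel (\<lambda>x. (\<phi> x)\<^sup>2)" "integrable lborel (\<lambda>x. (norm (grad \<phi> x))\<^sup>2)"
proof -
  have s: "smooth_fun \<phi>" using assms unfolding test_fun_def by simp
  have c: "continuous_on UNIV (\<lambda>x. (\<phi> x)\<^sup>2)" "continuous_on UNIV (\<lambda>x. (norm (grad \<phi> x))\<^sup>2)"
    by (intro continuous_on_power continuous_on_norm smooth_fun_continuous smooth_fun_grad_continuous s)+
  show "integrable lborel (\<lambda>x. (\<phi> x)\<^sup>2)" "integrable lborel (\<lambda>x. (norm (grad \<phi> x))\<^sup>2)"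
    by (rule test_fun_integrable[OF assms c(1)], simp) (rule test_fun_integrable[OF assms c(2)], simp)
qed

subsection \<open>Functions in \<open>H\<^sup>1\<^sub>0\<close> of a star-shaped set along rays\<close>

text \<open>A function of the zero-trace Sobolev space as Borel functions on the whole space.
  Extension by zero turns every integral into one over \<open>lborel\<close> and makes dilations
  available. \<open>G\<close> plays the gradient and is tied to \<open>U\<close> through the common
  approximating sequence.\<close>

locale star_H10 =
  fixes \<Omega> :: "'a::euclidean_space set" and U :: "'a \<Rightarrow> real" and G :: "'a \<Rightarrow> 'a"
    and \<phi> :: "nat \<Rightarrow> 'a \<Rightarrow> real"
  assumes open_\<Omega>: "open \<Omega>" and nonempty_\<Omega>: "\<Omega> \<noteq> {}"
    and star: "\<And>x t. x \<in> \<Omega> \<Longrightarrow> 0 \<le> t \<Longrightarrow> t \<le> 1 \<Longrightarrow> t *\<^sub>R x \<in> \<Omega>"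
    and U_borel [measurable]: "U \<in> borel_measurable borel"
    and G_borel [measurable]: "G \<in> borel_measurable borel"
    and U_L2: "integrable lborel (\<lambda>x. (U x)\<^sup>2)"
    and G_L2: "integrable lborel (\<lambda>x. (norm (G x))\<^sup>2)"
    and U_outside: "\<And>x. x \<notin> \<Omega> \<Longrightarrow> U x = 0" and G_outside: "\<And>x. x \<notin> \<Omega> \<Longrightarrow> G x = 0"
    and \<phi>_test: "\<And>k. test_fun \<Omega> (\<phi> k)"
    and \<phi>_U: "(\<lambda>k. \<integral>x. (\<phi> k x - U x)\<^sup>2 \<partial>lborel) \<longlonglongrightarrow> 0"
    and \<phi>_G: "(\<lambda>k. \<integral>x. (norm (grad (\<phi> k) x - G x))\<^sup>2 \<partial>lborel) \<longlonglongrightarrow> 0"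
begin

lemma \<phi>_smooth: "smooth_fun (\<phi> k)"
  using \<phi>_test unfolding test_fun_def by simp

lemma \<phi>_borel [measurable]: "\<phi> k \<in> borel_measurable borel" "grad (\<phi> k) \<in> borel_measurable borel"
  using test_fun_borel[OF \<phi>_test] by auto

lemma \<phi>_U_integrable: "integrable lborel (\<lambda>x. (\<phi> k x - U x)\<^sup>2)"
  using integrable_power2_diff[of "\<phi> k" lborel U] test_fun_integrable_square[OF \<phi>_test] U_L2 by simp

lemma \<phi>_G_integrable: "integrable lborel (\<lambda>x. (norm (grad (\<phi> k) x - G x))\<^sup>2)"
  using integrable_power2_diff[of "grad (\<phi> k)" lborel G] test_fun_integrable_square[OF \<phi>_test] G_L2 by simp

lemma \<Omega>_borel [measurable]: "\<Omega> \<in> sets borel"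
  using open_\<Omega> by simp

text \<open>Describes \<open>u\<close> as the absolutely continuous version of \<open>U\<close> on
  the ray through \<open>x\<close>, with derivative \<open>G (t *\<^sub>R x) \<bullet> x\<close>, in
  the form needed by \<open>integral_chain_rule_limit\<close>. The intervals start at
  \<open>a > 0\<close> because the polar weight \<open>t^(N - 1)\<close> gives no control near the
  origin.\<close>

definition ray_representative :: "(nat \<Rightarrow> nat) \<Rightarrow> 'a \<Rightarrow> (real \<Rightarrow> real) \<Rightarrow> bool" where
  "ray_representative r x u \<longleftrightarrow> u \<in> borel_measurable borel \<and>
       (\<forall>a b. 0 < a \<longrightarrow> integrable lborel (\<lambda>t. indicator {a..b} t * (G (t *\<^sub>R x) \<bullet> x))) \<and>
       (\<forall>a b. 0 < a \<longrightarrow> (\<lambda>k. \<integral>t. indicator {a..b} t * \<bar>grad (\<phi> (r k)) (t *\<^sub>R x) \<bullet> x - G (t *\<^sub>R x) \<bullet> x\<bar> \<partial>lborel) \<longlonglongrightarrow> 0) \<and>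
       (\<forall>t>0. (\<lambda>k. \<phi> (r k) (t *\<^sub>R x)) \<longlonglongrightarrow> u t) \<and>
       (AE t in rayM DIM('a). U (t *\<^sub>R x) = u t)"

text \<open>In polar coordinates the \<open>L^2\<close> distance of the gradients is an integral
  over rays, so along a subsequence it tends to 0 on almost every ray. A second extraction gives
  pointwise convergence almost everywhere on almost every ray; together with convergence of the
  derivatives, one such point on the ray forces convergence at every \<open>t > 0\<close>.\<close>

lemma ray_approximation:
  obtains r :: "nat \<Rightarrow> nat" where
    "AE x in shellM. \<exists>u. ray_representative r x u"
proof -
  let ?N = "DIM('a)"
  define Q where "Q k x = (\<integral>t. (norm (grad (\<phi> k) (t *\<^sub>R x) - G (t *\<^sub>R x)))\<^sup>2 \<partial>rayM ?N)" for k x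
  have Qi: "integrable shellM (Q k)" for k
    unfolding Q_def using integrable_polar(2)[OF \<phi>_G_integrable] by simp
  have "(\<integral>x. norm (Q k x) \<partial>shellM) = (LBINT x. (norm (grad (\<phi> k) x - G x))\<^sup>2)" for k
    using integrable_polar(3)[OF \<phi>_G_integrable, of k] unfolding Q_def by simp
  then have "(\<lambda>k. \<integral>x. norm (Q k x) \<partial>shellM) \<longlonglongrightarrow> 0" using \<phi>_G by simp
  from tendsto_L1_AE_subseq[OF Qi this] obtain r1 where
    r1: "strict_mono r1" "AE x in shellM. (\<lambda>k. Q (r1 k) x) \<longlonglongrightarrow> 0" by blast
  have "(\<lambda>k. \<integral>x. norm ((\<phi> (r1 k) x - U x)\<^sup>2) \<partial>lborel) \<longlonglongrightarrow> 0"
    using LIMSEQ_subseq_LIMSEQ[OF \<phi>_U r1(1)] by (simp add: o_def)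
  from tendsto_L1_AE_subseq[OF \<phi>_U_integrable this] obtain r2 where
    r2: "strict_mono r2" "AE y in lborel. (\<lambda>k. (\<phi> (r1 (r2 k)) y - U y)\<^sup>2) \<longlonglongrightarrow> 0" by blast
  define r where "r k = r1 (r2 k)" for k
  have "AE y in lborel. (\<lambda>k. \<phi> (r k) y) \<longlonglongrightarrow> U y"
    using r2(2)
  proof eventually_elim
    case (elim y)
    then have "(\<lambda>k. sqrt ((\<phi> (r k) y - U y)\<^sup>2)) \<longlonglongrightarrow> sqrt 0" unfolding r_def by (intro tendsto_real_sqrt)
    then have "(\<lambda>k. \<phi> (r k) y - U y) \<longlonglongrightarrow> 0" by (simp add: tendsto_rabs_zero_iff)
    then show ?case by (simp add: LIM_zero_iff)
  qed
  from AE_polar[OF this] have AE1: "AE x in shellM. AE t in rayM ?N. (\<lambda>k. \<phi> (r k) (t *\<^sub>R x)) \<longlonglongrightarrow> U (t *\<^sub>R x)" .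
  have AE2: "AE x in shellM. \<forall>k. integrable (rayM ?N) (\<lambda>t. (norm (grad (\<phi> k) (t *\<^sub>R x) - G (t *\<^sub>R x)))\<^sup>2)"
    unfolding AE_all_countable using integrable_polar(1)[OF \<phi>_G_integrable] by simp
  have AE3: "AE x in shellM. integrable (rayM ?N) (\<lambda>t. (norm (G (t *\<^sub>R x)))\<^sup>2)"
    using integrable_polar(1)[OF G_L2] by simp
  have AE4: "AE x in (shellM :: 'a measure). x \<in> shell"
    unfolding shellM_def by (subst AE_density) (auto simp: indicator_def)
  show thesis
  proof (rule that[of r])
    show "AE x in shellM. \<exists>u. ray_representative r x u"
      using AE1 AE2 AE3 AE4 r1(2)
    proof eventually_elim
      case (elim x)
      have xn: "norm x \<le> exp 1" using elim(4) by (simp add: shell_def)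
      have Qlim: "(\<lambda>k. Q (r k) x) \<longlonglongrightarrow> 0"
        using LIMSEQ_subseq_LIMSEQ[OF elim(5) r2(1)] unfolding r_def by (simp add: o_def)
      define v where "v t = G (t *\<^sub>R x) \<bullet> x" for t
      define vk where "vk k t = grad (\<phi> (r k)) (t *\<^sub>R x) \<bullet> x" for k t
      have [measurable]: "v \<in> borel_measurable borel" "vk k \<in> borel_measurable borel" for k
        unfolding v_def vk_def by measurable
      \<comment> \<open>On \<open>{a..b}\<close> the weight \<open>t^(N - 1)\<close> is at least
        \<open>a^(N - 1)\<close>, and \<open>norm x <= exp 1\<close> on the shell. These two facts
        produce the constant \<open>(exp 1)^2 / a^(N - 1)\<close>.\<close>
      have bound: "integrable lborel (\<lambda>t. (indicator {a..b} t * (H (t *\<^sub>R x) \<bullet> x))\<^sup>2) \<and>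
         (LBINT t. (indicator {a..b} t * (H (t *\<^sub>R x) \<bullet> x))\<^sup>2) \<le> (exp 1)\<^sup>2 / a ^ (?N - 1) * (\<integral>t. (norm (H (t *\<^sub>R x)))\<^sup>2 \<partial>rayM ?N)"
        if a: "0 < a" and [measurable]: "H \<in> borel_measurable borel" and i: "integrable (rayM ?N) (\<lambda>t. (norm (H (t *\<^sub>R x)))\<^sup>2)"
        for a b and H :: "'a \<Rightarrow> 'a"
      proof -
        define g where "g t = (exp 1)\<^sup>2 / a ^ (?N - 1) * (indicator {0<..} t * (t ^ (?N - 1) * (norm (H (t *\<^sub>R x)))\<^sup>2))" for t
        have gi: "integrable lborel g" unfolding g_def
          using i by (intro integrable_mult_right) (subst (asm) integrable_rayM_iff, auto)
        have le: "\<bar>(indicator {a..b} t * (H (t *\<^sub>R x) \<bullet> x))\<^sup>2\<bar> \<le> g t" for t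
        proof (cases "t \<in> {a..b}")
          case True
          have "(H (t *\<^sub>R x) \<bullet> x)\<^sup>2 \<le> (norm (H (t *\<^sub>R x)) * norm x)\<^sup>2"
            by (subst power2_abs[symmetric]) (intro power_mono Cauchy_Schwarz_ineq2; simp)
          also have "\<dots> \<le> (norm (H (t *\<^sub>R x)))\<^sup>2 * (exp 1)\<^sup>2"
            unfolding power_mult_distrib using xn by (intro mult_left_mono power_mono) auto
          also have "\<dots> = (exp 1)\<^sup>2 / a ^ (?N - 1) * (a ^ (?N - 1) * (norm (H (t *\<^sub>R x)))\<^sup>2)"
            using a by simp
          also have "\<dots> \<le> (exp 1)\<^sup>2 / a ^ (?N - 1) * (t ^ (?N - 1) * (norm (H (t *\<^sub>R x)))\<^sup>2)"
            using a True by (intro mult_left_mono mult_right_mono power_mono) auto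
          finally show ?thesis using True a unfolding g_def by simp
        next
          case False
          then show ?thesis using a unfolding g_def by (auto simp: indicator_def)
        qed
        have fi: "integrable lborel (\<lambda>t. (indicator {a..b} t * (H (t *\<^sub>R x) \<bullet> x))\<^sup>2)"
          by (rule integrable_dominated[OF gi _ le]) measurable
        have "(LBINT t. (indicator {a..b} t * (H (t *\<^sub>R x) \<bullet> x))\<^sup>2) \<le> (LBINT t. g t)"
          by (rule integral_mono[OF fi gi]) (use le in auto)
        also have "\<dots> = (exp 1)\<^sup>2 / a ^ (?N - 1) * (\<integral>t. (norm (H (t *\<^sub>R x)))\<^sup>2 \<partial>rayM ?N)"
          unfolding g_def by (subst integral_rayM) auto
        finally show ?thesis using fi by simp
      qed
      have ind2: "integrable lborel (\<lambda>t. (indicator {a..b} t :: real)\<^sup>2)" for a b :: real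
      proof -
        have "(\<lambda>t. (indicator {a..b} t :: real)\<^sup>2) = indicator {a..b}" by (auto simp: indicator_def)
        then show ?thesis using borel_integrable_compact[of "{a..b}" "\<lambda>_. 1::real"] by simp
      qed
      have vi: "integrable lborel (\<lambda>t. indicator {a..b} t * v t)" if "0 < a" for a b
      proof -
        have "integrable lborel (\<lambda>t. indicator {a..b} t * (indicator {a..b} t * v t))"
          by (rule integrable_mult_L2) (use bound[OF that _ elim(3), of b] ind2 in \<open>auto simp: v_def\<close>)
        then show ?thesis by (simp add: mult.assoc[symmetric] indicator_inter_arith[symmetric])
      qed
      have vklim: "(\<lambda>k. \<integral>t. indicator {a..b} t * \<bar>vk k t - v t\<bar> \<partial>lborel) \<longlonglongrightarrow> 0" if a: "0 < a" for a b
      proof -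
        define f where "f k t = indicator {a..b} t * ((\<lambda>y. grad (\<phi> (r k)) y - G y) (t *\<^sub>R x) \<bullet> x)" for k t
        have [measurable]: "f k \<in> borel_measurable borel" for k unfolding f_def by measurable
        have fb: "integrable lborel (\<lambda>t. (f k t)\<^sup>2) \<and> (LBINT t. (f k t)\<^sup>2) \<le> (exp 1)\<^sup>2 / a ^ (?N - 1) * Q (r k) x" for k
          unfolding f_def Q_def by (rule bound[OF a]) (use elim(2) in auto)
        have f2: "(\<lambda>k. \<integral>t. (f k t)\<^sup>2 \<partial>lborel) \<longlonglongrightarrow> 0"
          by (rule Lim_null_comparison[OF _ tendsto_mult_right_zero[OF Qlim, of "(exp 1)\<^sup>2 / a ^ (?N - 1)"]])
             (use fb in \<open>auto intro!: always_eventually\<close>)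
        have "(\<lambda>k. \<integral>t. \<bar>f k t * indicator {a..b} t\<bar> \<partial>lborel) \<longlonglongrightarrow> 0"
          by (rule tendsto_integral_mult_L2[OF _ _ _ ind2 f2]) (use fb in auto)
        moreover have "\<bar>f k t * indicator {a..b} t\<bar> = indicator {a..b} t * \<bar>vk k t - v t\<bar>" for k t
          unfolding f_def vk_def v_def by (auto simp: indicator_def inner_diff_left)
        ultimately show ?thesis by simp
      qed
      have dphi: "((\<lambda>t. \<phi> (r k) (t *\<^sub>R x)) has_real_derivative vk k t) (at t)" for k t
        unfolding vk_def by (rule smooth_fun_ray(1)[OF \<phi>_smooth])
      have vkc: "continuous_on S (vk k)" for k S
        unfolding vk_def by (rule smooth_fun_ray(2)[OF \<phi>_smooth])
      \<comment> \<open>Almost everywhere convergence supplies an actual parameter \<open>t0\<close>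
        because the interval from 0 to 1 is not a null set.\<close>
      have "\<not> (AE t in lborel. \<not> (0 < t \<and> t < (1::real)))"
      proof
        assume "AE t in lborel. \<not> (0 < t \<and> t < (1::real))"
        then have "emeasure lborel {0<..<1::real} = 0"
          by (subst (asm) AE_iff_measurable[OF _ refl]) (auto simp: greaterThanLessThan_def greaterThan_def lessThan_def Int_def)
        then show False by simp
      qed
      then obtain t0 where t0: "0 < t0" "(\<lambda>k. \<phi> (r k) (t0 *\<^sub>R x)) \<longlonglongrightarrow> U (t0 *\<^sub>R x)"
      proof -
        assume "\<not> (AE t in lborel. \<not> (0 < t \<and> t < (1::real)))"
        moreover have "AE t in lborel. 0 < t \<longrightarrow> (\<lambda>k. \<phi> (r k) (t *\<^sub>R x)) \<longlonglongrightarrow> U (t *\<^sub>R x)"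
          using elim(1) by (simp add: AE_rayM_iff)
        ultimately have "\<exists>t>0. (\<lambda>k. \<phi> (r k) (t *\<^sub>R x)) \<longlonglongrightarrow> U (t *\<^sub>R x)"
        proof (rule_tac ccontr)
          assume n: "\<not> (AE t in lborel. \<not> (0 < t \<and> t < (1::real)))"
            and ae: "AE t in lborel. 0 < t \<longrightarrow> (\<lambda>k. \<phi> (r k) (t *\<^sub>R x)) \<longlonglongrightarrow> U (t *\<^sub>R x)"
            and c: "\<not> (\<exists>t>0. (\<lambda>k. \<phi> (r k) (t *\<^sub>R x)) \<longlonglongrightarrow> U (t *\<^sub>R x))"
          from ae have "AE t in lborel. \<not> (0 < t \<and> t < (1::real))"
            by eventually_elim (use c in blast)
          with n show False by simp
        qed
        then show thesis using that by blast
      qed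
      have FTC: "(LBINT s. indicator {a..b} s * vk k s) = \<phi> (r k) (b *\<^sub>R x) - \<phi> (r k) (a *\<^sub>R x)" if "a \<le> b" for a b k
      proof -
        have "(LBINT s. indicator {a..b} s *\<^sub>R vk k s) = \<phi> (r k) (b *\<^sub>R x) - \<phi> (r k) (a *\<^sub>R x)"
          by (rule integral_FTC_Icc[OF that _ vkc])
             (auto simp: has_real_derivative_iff_has_vector_derivative[symmetric] intro!: has_field_derivative_at_within dphi)
        then show ?thesis by simp
      qed
      have FTClim: "(\<lambda>k. \<phi> (r k) (b *\<^sub>R x) - \<phi> (r k) (a *\<^sub>R x)) \<longlonglongrightarrow> (LBINT s. indicator {a..b} s * v s)"
        if "0 < a" "a \<le> b" for a b
      proof -
        have vki: "integrable lborel (\<lambda>s. indicator {a..b} s * vk k s)" for k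
          using borel_integrable_compact[of "{a..b}" "vk k"] vkc by simp
        have "(\<lambda>k. (LBINT s. indicator {a..b} s * vk k s) - (LBINT s. indicator {a..b} s * v s)) \<longlonglongrightarrow> 0"
        proof (rule Lim_null_comparison[OF always_eventually vklim[OF that(1)]], rule allI)
          fix k
          have "(LBINT s. indicator {a..b} s * vk k s) - (LBINT s. indicator {a..b} s * v s)
            = (LBINT s. indicator {a..b} s * (vk k s - v s))"
            using vki[of k] vi[OF that(1), of b] by (simp add: right_diff_distrib)
          also have "norm \<dots> \<le> (LBINT s. norm (indicator {a..b} s * (vk k s - v s)))" by (rule integral_norm_bound)
          finally show "norm ((LBINT s. indicator {a..b} s * vk k s) - (LBINT s. indicator {a..b} s * v s))
             \<le> (LBINT s. indicator {a..b} s * \<bar>vk k s - v s\<bar>)" by (simp add: abs_mult)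
        qed
        then show ?thesis unfolding FTC[OF that(2)] by (simp add: LIM_zero_iff)
      qed
      \<comment> \<open>The increment between \<open>t0\<close> and \<open>t\<close> converges by
        the fundamental theorem, and the value at \<open>t0\<close> converges; the two cases are the
        two orders of \<open>t0\<close> and \<open>t\<close>.\<close>
      have conv: "convergent (\<lambda>k. \<phi> (r k) (t *\<^sub>R x))" if t: "0 < t" for t
      proof (cases "t0 \<le> t")
        case True
        from tendsto_add[OF t0(2) FTClim[OF t0(1) True]] show ?thesis by (auto simp: convergent_def)
      next
        case False
        then have "t \<le> t0" by simp
        from tendsto_diff[OF t0(2) FTClim[OF t this]] show ?thesis by (auto simp: convergent_def)
      qed
      define u where "u t = lim (\<lambda>k. \<phi> (r k) (t *\<^sub>R x))" for t
      have ulim: "(\<lambda>k. \<phi> (r k) (t *\<^sub>R x)) \<longlonglongrightarrow> u t" if "0 < t" for t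
        unfolding u_def using conv[OF that] by (simp add: convergent_LIMSEQ_iff)
      have um: "u \<in> borel_measurable borel" unfolding u_def by measurable
      have "AE t in rayM ?N. U (t *\<^sub>R x) = u t"
        using elim(1) unfolding AE_rayM_iff
        by eventually_elim (use ulim LIMSEQ_unique in blast)
      then show ?case
        using um vi vklim ulim unfolding v_def vk_def ray_representative_def by (intro exI[of _ u]) auto
    qed
  qed
qed


text \<open>The divergence of \<open>M \<Theta>(U) x\<close> integrates to zero. On the ray through
  \<open>x\<close> the multiplier \<open>m t = t^N M(t x)\<close> has the derivative
  \<open>t^(N - 1) (N M(t x) + DM(t x) . t x)\<close>, which is the polar weight times the factor on
  the right. Thus \<open>integral_by_parts_ray\<close> makes the integral over almost every ray
  vanish.\<close>

lemma radial_integration_by_parts: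
  fixes M :: "'a \<Rightarrow> real" and DM :: "'a \<Rightarrow> 'a" and \<Theta> \<Theta>' :: "real \<Rightarrow> real"
  assumes M: "\<And>x. x \<in> \<Omega> \<Longrightarrow> (M has_derivative (\<lambda>h. DM x \<bullet> h)) (at x)" "continuous_on \<Omega> DM"
    and \<Theta>: "\<And>s. (\<Theta> has_real_derivative \<Theta>' s) (at s)" "continuous_on UNIV \<Theta>'" "\<Theta> 0 = 0" "\<And>s. 0 \<le> \<Theta> s"
    and i1: "integrable lborel (\<lambda>x. indicator \<Omega> x * (M x * \<Theta> (U x)))"
    and i2: "integrable lborel (\<lambda>x. indicator \<Omega> x * ((DM x \<bullet> x) * \<Theta> (U x)))"
    and i3: "integrable lborel (\<lambda>x. indicator \<Omega> x * (M x * \<Theta>' (U x) * (G x \<bullet> x)))"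
  shows "(LBINT x. indicator \<Omega> x * (M x * \<Theta>' (U x) * (G x \<bullet> x)))
       = - (LBINT x. indicator \<Omega> x * ((real DIM('a) * M x + DM x \<bullet> x) * \<Theta> (U x)))"
proof -
  let ?N = "DIM('a)"
  define M\<Omega> where "M\<Omega> x = indicator \<Omega> x * M x" for x
  define R\<Omega> where "R\<Omega> x = indicator \<Omega> x * (DM x \<bullet> x)" for x
  have Mc: "continuous_on \<Omega> M"
    using M(1) has_derivative_continuous continuous_at_imp_continuous_on by blast
  have [measurable]: "M\<Omega> \<in> borel_measurable borel" "R\<Omega> \<in> borel_measurable borel"
    using borel_measurable_continuous_on_indicator[OF \<Omega>_borel Mc]
      borel_measurable_continuous_on_indicator[OF \<Omega>_borel continuous_on_inner[OF M(2) continuous_on_id]]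
    unfolding M\<Omega>_def R\<Omega>_def by auto
  have \<Theta>c: "continuous_on S \<Theta>" for S
    by (meson \<Theta>(1) DERIV_isCont continuous_at_imp_continuous_on)
  have [measurable]: "\<Theta> \<in> borel_measurable borel" "\<Theta>' \<in> borel_measurable borel"
    using \<Theta>c \<Theta>(2) by (auto intro: borel_measurable_continuous_onI)
  have i1': "integrable lborel (\<lambda>x. M\<Omega> x * \<Theta> (U x))" using i1 unfolding M\<Omega>_def by (simp add: mult.assoc)
  have i2': "integrable lborel (\<lambda>x. R\<Omega> x * \<Theta> (U x))" using i2 unfolding R\<Omega>_def by (simp add: mult.assoc)
  have i3': "integrable lborel (\<lambda>x. M\<Omega> x * \<Theta>' (U x) * (G x \<bullet> x))" using i3 unfolding M\<Omega>_def by (simp add: mult.assoc)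
  define h where "h x = M\<Omega> x * \<Theta>' (U x) * (G x \<bullet> x) + (real ?N * (M\<Omega> x * \<Theta> (U x)) + R\<Omega> x * \<Theta> (U x))" for x
  have hi: "integrable lborel h" unfolding h_def using i1' i2' i3' by auto
  have zero: "0 \<in> \<Omega>" using nonempty_\<Omega> star[of _ 0] by auto
  obtain r where r: "AE x in shellM. \<exists>u. ray_representative r x u"
    by (rule ray_approximation)
  have "AE x in shellM. (\<integral>t. h (t *\<^sub>R x) \<partial>rayM ?N) = 0"
    using r integrable_polar(1)[OF i1'] integrable_polar(1)[OF i2'] integrable_polar(1)[OF i3']
  proof eventually_elim
    case (elim x)
    then obtain u where [measurable]: "u \<in> borel_measurable borel"
      and v: "\<And>a b. 0 < a \<Longrightarrow> integrable lborel (\<lambda>t. indicator {a..b} t * (G (t *\<^sub>R x) \<bullet> x))"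
      and vk: "\<And>a b. 0 < a \<Longrightarrow> (\<lambda>k. \<integral>t. indicator {a..b} t * \<bar>grad (\<phi> (r k)) (t *\<^sub>R x) \<bullet> x - G (t *\<^sub>R x) \<bullet> x\<bar> \<partial>lborel) \<longlonglongrightarrow> 0"
      and ulim: "\<And>t. 0 < t \<Longrightarrow> (\<lambda>k. \<phi> (r k) (t *\<^sub>R x)) \<longlonglongrightarrow> u t"
      and Uu: "AE t in rayM ?N. U (t *\<^sub>R x) = u t" unfolding ray_representative_def by blast
    define J where "J = {t. 0 < t \<and> t *\<^sub>R x \<in> \<Omega>}"
    have Jopen: "open J"
    proof -
      have "J = {0<..} \<inter> (\<lambda>t. t *\<^sub>R x) -` \<Omega>" unfolding J_def by auto
      moreover have "open ((\<lambda>t. t *\<^sub>R x) -` \<Omega>)"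
        by (rule open_vimage[OF open_\<Omega>]) (intro continuous_intros)
      ultimately show ?thesis by auto
    qed
    have [measurable]: "J \<in> sets borel" using Jopen by simp
    have J0: "J \<subseteq> {0<..}" unfolding J_def by auto
    have Jne: "J \<noteq> {}"
    proof -
      have "((\<lambda>t. t *\<^sub>R x) \<longlongrightarrow> 0 *\<^sub>R x) (at_right 0)" by (intro tendsto_intros)
      then have "\<forall>\<^sub>F t in at_right 0. t *\<^sub>R x \<in> \<Omega>"
        using topological_tendstoD[OF _ open_\<Omega>] zero by fastforce
      moreover have "\<forall>\<^sub>F t in at_right (0::real). 0 < t" by (rule eventually_at_right_less)
      ultimately have "\<forall>\<^sub>F t in at_right 0. t \<in> J" by eventually_elim (simp add: J_def)
      then show ?thesis using eventually_happens'[OF trivial_limit_at_right_real] by blast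
    qed
    have Jdown: "s \<in> J" if "t \<in> J" "0 < s" "s \<le> t" for s t
      using star[of "t *\<^sub>R x" "s / t"] that unfolding J_def by auto
    define m where "m t = t ^ ?N * M (t *\<^sub>R x)" for t
    define m' where "m' t = real ?N * t ^ (?N - 1) * M (t *\<^sub>R x) + t ^ ?N * (DM (t *\<^sub>R x) \<bullet> x)" for t
    have tN: "t ^ ?N = t ^ (?N - 1) * t" for t :: real by (cases ?N) auto
    have dm: "(m has_real_derivative m' t) (at t)" if "t \<in> J" for t
    proof -
      have "((\<lambda>t. M (t *\<^sub>R x)) has_real_derivative (DM (t *\<^sub>R x) \<bullet> x)) (at t)"
        unfolding has_field_derivative_def
        by (rule has_derivative_eq_rhs[OF has_derivative_compose[where f = "\<lambda>t. t *\<^sub>R x", OF _ M(1)]])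
           (use that in \<open>auto intro!: derivative_eq_intros simp: fun_eq_iff J_def\<close>)
      then show ?thesis unfolding m_def m'_def
        by (auto intro!: derivative_eq_intros)
    qed
    have m'c: "continuous_on J m'"
      unfolding m'_def
      by (intro continuous_intros continuous_on_compose2[OF Mc] continuous_on_compose2[OF M(2)]) (auto simp: J_def)
    have u0: "u t = 0" if "0 < t" "t \<notin> J" for t
    proof -
      have "t *\<^sub>R x \<notin> \<Omega>" using that unfolding J_def by auto
      then have "\<phi> k (t *\<^sub>R x) = 0" for k using test_fun_zero_outside[OF \<phi>_test] by simp
      then show ?thesis using ulim[OF that(1)] by (simp add: LIMSEQ_const_iff)
    qed
    have tr: "integrable lborel (\<lambda>t. indicator {0<..} t * (t ^ (?N - 1) * b t))"
      if "integrable (rayM ?N) a" "b \<in> borel_measurable borel" "AE t in rayM ?N. a t = b t" for a b :: "real \<Rightarrow> real"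
    proof -
      have am: "a \<in> borel_measurable (rayM ?N)" using that(1) by auto
      have "integrable (rayM ?N) b"
        using that(1) integrable_cong_AE[OF am _ that(3)] that(2) by (simp cong: measurable_cong_sets)
      then show ?thesis by (subst (asm) integrable_rayM_iff) (use that(2) in auto)
    qed
    have e1: "integrable lborel (\<lambda>t. indicator {0<..} t * (t ^ (?N - 1) * (M\<Omega> (t *\<^sub>R x) * \<Theta> (u t))))"
      by (rule tr[OF elim(2)]) (use Uu in \<open>measurable, auto\<close>)
    have e2: "integrable lborel (\<lambda>t. indicator {0<..} t * (t ^ (?N - 1) * (R\<Omega> (t *\<^sub>R x) * \<Theta> (u t))))"
      by (rule tr[OF elim(3)]) (use Uu in \<open>measurable, auto\<close>)
    have e3: "integrable lborel (\<lambda>t. indicator {0<..} t * (t ^ (?N - 1) * (M\<Omega> (t *\<^sub>R x) * \<Theta>' (u t) * (G (t *\<^sub>R x) \<bullet> (t *\<^sub>R x)))))"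
      by (rule tr[OF elim(4)]) (use Uu in \<open>measurable, auto\<close>)
    \<comment> \<open>Division by \<open>t\<close> leaves exactly the polar weight. Integrability of
      \<open>M * \<Theta> (U)\<close> on \<Omega> is therefore the \<open>dt / t\<close> condition
      that excludes boundary terms at 0 and at infinity.\<close>
    have q1: "indicator J t * (m t * \<Theta> (u t) / t) = indicator {0<..} t * (t ^ (?N - 1) * (M\<Omega> (t *\<^sub>R x) * \<Theta> (u t)))" for t
      by (auto simp: indicator_def J_def m_def M\<Omega>_def tN)
    have q2: "indicator J t * (m' t * \<Theta> (u t)) = real ?N * (indicator {0<..} t * (t ^ (?N - 1) * (M\<Omega> (t *\<^sub>R x) * \<Theta> (u t))))
       + indicator {0<..} t * (t ^ (?N - 1) * (R\<Omega> (t *\<^sub>R x) * \<Theta> (u t)))" for t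
      by (auto simp: indicator_def J_def m'_def M\<Omega>_def R\<Omega>_def tN algebra_simps)
    have q3: "indicator J t * (m t * \<Theta>' (u t) * (G (t *\<^sub>R x) \<bullet> x)) =
       indicator {0<..} t * (t ^ (?N - 1) * (M\<Omega> (t *\<^sub>R x) * \<Theta>' (u t) * (G (t *\<^sub>R x) \<bullet> (t *\<^sub>R x))))" for t
      by (auto simp: indicator_def J_def m_def M\<Omega>_def tN)
    note dphi = smooth_fun_ray(1)[OF \<phi>_smooth] and vkc = smooth_fun_ray(2)[OF \<phi>_smooth]
    have "(LBINT t. indicator J t * (m' t * \<Theta> (u t) + m t * \<Theta>' (u t) * (G (t *\<^sub>R x) \<bullet> x))) = 0"
    proof (rule integral_by_parts_ray[OF Jopen J0 Jne Jdown dphi vkc v vk _ ulim u0 dm m'c \<Theta>])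
      show "integrable lborel (\<lambda>t. indicator J t * (m' t * \<Theta> (u t)))" unfolding q2 using e1 e2 by auto
      show "integrable lborel (\<lambda>t. indicator J t * (m t * \<Theta>' (u t) * (G (t *\<^sub>R x) \<bullet> x)))" unfolding q3 by (rule e3)
      show "integrable lborel (\<lambda>t. indicator J t * (m t * \<Theta> (u t) / t))" unfolding q1 by (rule e1)
    qed auto
    also have "(LBINT t. indicator J t * (m' t * \<Theta> (u t) + m t * \<Theta>' (u t) * (G (t *\<^sub>R x) \<bullet> x)))
      = (LBINT t. indicator {0<..} t * (t ^ (?N - 1) * h (t *\<^sub>R x)))"
    proof (rule integral_cong_AE)
      have "(\<lambda>t. indicator J t * (m' t * \<Theta> (u t) + m t * \<Theta>' (u t) * (G (t *\<^sub>R x) \<bullet> x)))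
         = (\<lambda>t. real ?N * (indicator {0<..} t * (t ^ (?N - 1) * (M\<Omega> (t *\<^sub>R x) * \<Theta> (u t))))
       + indicator {0<..} t * (t ^ (?N - 1) * (R\<Omega> (t *\<^sub>R x) * \<Theta> (u t)))
       + indicator {0<..} t * (t ^ (?N - 1) * (M\<Omega> (t *\<^sub>R x) * \<Theta>' (u t) * (G (t *\<^sub>R x) \<bullet> (t *\<^sub>R x)))))"
        unfolding distrib_left[of "indicator J _"] q2 q3 by simp
      then show "(\<lambda>t. indicator J t * (m' t * \<Theta> (u t) + m t * \<Theta>' (u t) * (G (t *\<^sub>R x) \<bullet> x))) \<in> borel_measurable lborel"
        by simp
      show "(\<lambda>t. indicator {0<..} t * (t ^ (?N - 1) * h (t *\<^sub>R x))) \<in> borel_measurable lborel"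
        unfolding h_def by measurable
      show "AE t in lborel. indicator J t * (m' t * \<Theta> (u t) + m t * \<Theta>' (u t) * (G (t *\<^sub>R x) \<bullet> x))
         = indicator {0<..} t * (t ^ (?N - 1) * h (t *\<^sub>R x))"
        using Uu unfolding AE_rayM_iff
      proof eventually_elim
        case (elim t)
        show ?case
        proof (cases "0 < t")
          case True
          then show ?thesis using elim unfolding distrib_left[of "indicator J _"] q2 q3 h_def
            by (simp add: algebra_simps)
        qed (auto simp: J_def)
      qed
    qed
    also have "\<dots> = (\<integral>t. h (t *\<^sub>R x) \<partial>rayM ?N)"
      by (subst integral_rayM) (auto simp: h_def)
    finally show ?case by simp
  qed
  then have "(\<integral>x. \<integral>t. h (t *\<^sub>R x) \<partial>rayM ?N \<partial>shellM) = 0"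
    by (subst integral_cong_AE[where g = "\<lambda>_. 0"]) (auto intro: borel_measurable_integrable integrable_polar(2)[OF hi])
  then have "(LBINT x. h x) = 0" using integrable_polar(3)[OF hi] by simp
  moreover have "(LBINT x. h x) = (LBINT x. M\<Omega> x * \<Theta>' (U x) * (G x \<bullet> x))
     + (LBINT x. real ?N * (M\<Omega> x * \<Theta> (U x)) + R\<Omega> x * \<Theta> (U x))"
    unfolding h_def using i1' i2' i3' by (intro Bochner_Integration.integral_add) auto
  moreover have "(\<lambda>x. M\<Omega> x * \<Theta>' (U x) * (G x \<bullet> x)) = (\<lambda>x. indicator \<Omega> x * (M x * \<Theta>' (U x) * (G x \<bullet> x)))"
    "(\<lambda>x. real ?N * (M\<Omega> x * \<Theta> (U x)) + R\<Omega> x * \<Theta> (U x)) = (\<lambda>x. indicator \<Omega> x * ((real ?N * M x + DM x \<bullet> x) * \<Theta> (U x)))"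
    by (auto simp: fun_eq_iff M\<Omega>_def R\<Omega>_def algebra_simps)
  ultimately show ?thesis by simp
qed

text \<open>On almost every ray the representative is constant, and a nonzero constant is not square
  integrable against \<open>t^(N - 1)\<close> on the half-line. Thanks to the extension by zero this
  covers bounded and unbounded \<Omega> alike, without Poincare's inequality.\<close>

lemma AE_zero_if_gradient_zero:
  assumes "AE x in lborel. G x = 0"
  shows "AE x in lborel. U x = 0"
proof (rule AE_polarD)
  let ?N = "DIM('a)"
  show "Measurable.pred borel (\<lambda>x. U x = 0)" by measurable
  obtain r where r: "AE x in shellM. \<exists>u. ray_representative r x u"
    by (rule ray_approximation)
  show "AE x in shellM. AE t in rayM ?N. U (t *\<^sub>R x) = 0"
    using r AE_polar[OF assms] integrable_polar(1)[OF U_L2]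
  proof eventually_elim
    case (elim x)
    then obtain u where [measurable]: "u \<in> borel_measurable borel"
      and v: "\<And>a b. 0 < a \<Longrightarrow> integrable lborel (\<lambda>t. indicator {a..b} t * (G (t *\<^sub>R x) \<bullet> x))"
      and vk: "\<And>a b. 0 < a \<Longrightarrow> (\<lambda>k. \<integral>t. indicator {a..b} t * \<bar>grad (\<phi> (r k)) (t *\<^sub>R x) \<bullet> x - G (t *\<^sub>R x) \<bullet> x\<bar> \<partial>lborel) \<longlonglongrightarrow> 0"
      and ulim: "\<And>t. 0 < t \<Longrightarrow> (\<lambda>k. \<phi> (r k) (t *\<^sub>R x)) \<longlonglongrightarrow> u t"
      and Uu: "AE t in rayM ?N. U (t *\<^sub>R x) = u t" unfolding ray_representative_def by blast
    note dphi = smooth_fun_ray(1)[OF \<phi>_smooth] and vkc = smooth_fun_ray(2)[OF \<phi>_smooth]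
    have G0: "AE t in lborel. 0 < t \<longrightarrow> G (t *\<^sub>R x) = 0" using elim(2) by (simp add: AE_rayM_iff)
    have const: "u b = u a" if "0 < a" "a \<le> b" for a b
    proof -
      have "(LBINT t. indicator {a..b} t * (0 * u t + 1 * 1 * (G (t *\<^sub>R x) \<bullet> x))) = 1 * u b - 1 * u a"
        by (rule integral_chain_rule_limit(2)[where \<Theta> = "\<lambda>s. s" and \<Theta>' = "\<lambda>s. 1" and m = "\<lambda>_. 1" and m' = "\<lambda>_. 0",
              OF that(2) dphi vkc v[OF that(1)] vk[OF that(1)]]) (use that ulim in auto)
      moreover have "(LBINT t. indicator {a..b} t * (0 * u t + 1 * 1 * (G (t *\<^sub>R x) \<bullet> x))) = (\<integral>t. 0 \<partial>(lborel :: real measure))"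
      proof (rule integral_cong_AE)
        show "AE t in lborel. indicator {a..b} t * (0 * u t + 1 * 1 * (G (t *\<^sub>R x) \<bullet> x)) = 0"
          using G0 by eventually_elim (use that(1) in \<open>auto simp: indicator_def\<close>)
      qed measurable
      ultimately show ?thesis by simp
    qed
    have u1: "u t = u 1" if "0 < t" for t
    proof (cases "t \<le> 1")
      case True show ?thesis using const[OF that True] by (rule sym)
    next
      case False then show ?thesis using const[of 1 t] by simp
    qed
    have "integrable (rayM ?N) (\<lambda>t. (u 1)\<^sup>2)"
    proof -
      have "AE t in rayM ?N. (U (t *\<^sub>R x))\<^sup>2 = (u 1)\<^sup>2"
        using Uu unfolding AE_rayM_iff by eventually_elim (metis u1)
      from integrable_cong_AE[OF _ _ this] elim(3) show ?thesis by simp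
    qed
    then have i: "integrable lborel (\<lambda>t. indicator {0<..} t * (t ^ (?N - 1) * (u 1)\<^sup>2))"
      by (subst (asm) integrable_rayM_iff) auto
    have "u 1 = 0"
    proof (rule ccontr)
      assume nz: "u 1 \<noteq> 0"
      define c where "c = (LBINT t. indicator {0<..} t * (t ^ (?N - 1) * (u 1)\<^sup>2))"
      \<comment> \<open>This length makes the integral of \<open>(u 1)^2\<close> over
        \<open>{1..S}\<close> equal to \<open>\<bar>c\<bar> + 1\<close>, beyond the total
        \<open>c\<close>.\<close>
      define S where "S = 1 + (\<bar>c\<bar> + 1) / (u 1)\<^sup>2"
      have S: "1 \<le> S" unfolding S_def by simp
      have "(u 1)\<^sup>2 * (S - 1) = (LBINT t. indicator {1..S} t * (u 1)\<^sup>2)"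
        using S by simp
      also have "\<dots> \<le> c" unfolding c_def
      proof (rule integral_mono[OF _ i])
        show "integrable lborel (\<lambda>t. indicator {1..S} t * (u 1)\<^sup>2)"
          using borel_integrable_compact[of "{1..S}" "\<lambda>_. (u 1)\<^sup>2"] by simp
        show "indicator {1..S} t * (u 1)\<^sup>2 \<le> indicator {0<..} t * (t ^ (?N - 1) * (u 1)\<^sup>2)" for t
          by (cases "t \<in> {1..S}") (auto simp: mult_le_cancel_right1 indicator_def)
      qed
      finally show False using nz unfolding S_def by simp
    qed
    with u1 have uz: "0 < t \<Longrightarrow> u t = 0" for t by metis
    show ?case using Uu unfolding AE_rayM_iff by eventually_elim (auto dest: uz)
  qed
qed

end

subsection \<open>Gaussian cut-off\<close>

definition gauss :: "real \<Rightarrow> 'a::euclidean_space \<Rightarrow> real" where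
  "gauss \<epsilon> x = exp (- \<epsilon> * (norm x)\<^sup>2)"

lemma gauss_borel [measurable]: "gauss \<epsilon> \<in> borel_measurable borel"
  unfolding gauss_def[abs_def] by measurable

lemma gauss_pos: "0 < gauss \<epsilon> x"
  by (simp add: gauss_def)

lemma gauss_le_1: "0 \<le> \<epsilon> \<Longrightarrow> gauss \<epsilon> x \<le> 1"
  by (simp add: gauss_def)

text \<open>One half of the Gaussian absorbs a power of \<open>norm x\<close>, and the other half
  remains to provide decay.\<close>

lemma gauss_half: "gauss \<epsilon> x = gauss (\<epsilon>/2) x * gauss (\<epsilon>/2) x"
  unfolding gauss_def exp_add[symmetric] by simp

lemma mult_exp_minus_le_1: "z * exp (- z) \<le> (1::real)"
proof -
  have "z \<le> exp z" using exp_ge_add_one_self[of z] by linarith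
  then show ?thesis by (simp add: exp_minus field_simps)
qed

text \<open>The bound does not depend on \<epsilon>, which is what dominated convergence needs for
  the terms created by differentiating the cut-off.\<close>

lemma norm_sq_gauss_le: "\<epsilon> * (norm x)\<^sup>2 * gauss \<epsilon> x \<le> 1"
  using mult_exp_minus_le_1[of "\<epsilon> * (norm x)\<^sup>2"] unfolding gauss_def by simp

lemma norm_gauss_le:
  assumes "0 < \<epsilon>" shows "norm x * gauss \<epsilon> x \<le> 1 + 1/\<epsilon>"
proof -
  have "norm x \<le> 1 + (norm x)\<^sup>2"
    using self_le_power[of "norm x" 2] by (cases "norm x \<le> 1") (auto simp: add_increasing2)
  then have "norm x * gauss \<epsilon> x \<le> (1 + (norm x)\<^sup>2) * gauss \<epsilon> x"
    using gauss_pos[of \<epsilon> x] by (intro mult_right_mono) auto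
  also have "\<dots> = gauss \<epsilon> x + (1/\<epsilon>) * (\<epsilon> * (norm x)\<^sup>2 * gauss \<epsilon> x)"
    using assms by (simp add: algebra_simps)
  also have "\<dots> \<le> 1 + (1/\<epsilon>) * 1"
    using assms by (intro add_mono mult_left_mono norm_sq_gauss_le gauss_le_1) auto
  finally show ?thesis by simp
qed

lemma exp_minus_le_fact_power:
  fixes z :: real
  assumes z: "0 < z" shows "exp (- z) \<le> fact n / z ^ n"
proof -
  have "z ^ n / fact n = (\<Sum>k\<in>{n}. inverse (fact k) * z ^ k)" by (simp add: field_simps)
  also have "\<dots> \<le> (\<Sum>k. inverse (fact k) * z ^ k)"
    by (rule sum_le_suminf) (use z summable_exp[of z] in \<open>auto intro!: mult_nonneg_nonneg zero_le_power\<close>)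
  also have "\<dots> = exp z" unfolding exp_def by (simp add: field_simps)
  finally show ?thesis using z by (simp add: exp_minus field_simps)
qed

text \<open>Outside the unit ball the term of order \<open>N\<close> of the exponential series
  dominates the Gaussian by a multiple of \<open>norm x powr - (2 N)\<close>, with the constant
  \<open>fact N / \<epsilon> ^ N\<close>; that power is integrable at infinity by
  \<open>nn_integral_powr_near_infinity\<close>.\<close>

lemma integrable_gauss:
  assumes e: "0 < \<epsilon>"
  shows "integrable lborel (gauss \<epsilon> :: 'a::euclidean_space \<Rightarrow> real)"
proof (rule integrableI_bounded)
  let ?N = "DIM('a)"
  define C where "C = fact ?N / \<epsilon> ^ ?N"
  have C0: "0 \<le> C" using e by (simp add: C_def)
  have far: "gauss \<epsilon> x \<le> C * norm x powr - (2 * real ?N)" if "1 \<le> norm x" for x :: 'a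
  proof -
    let ?z = "\<epsilon> * (norm x)\<^sup>2"
    have z: "0 < ?z" using e that by (intro mult_pos_pos) auto
    have "exp (- ?z) \<le> fact ?N / ?z ^ ?N" using z by (rule exp_minus_le_fact_power)
    also have "\<dots> = C * norm x powr - (2 * real ?N)"
    proof -
      have "norm x powr (2 * real ?N) = (norm x) powr real (2 * ?N)" by simp
      also have "\<dots> = ((norm x)\<^sup>2) ^ ?N"
        unfolding power_mult[symmetric] using that by (intro powr_realpow) auto
      finally show ?thesis
        by (simp add: C_def power_mult_distrib powr_minus field_simps)
    qed
    finally show ?thesis by (simp add: gauss_def)
  qed
  obtain C2 where C2: "(\<integral>\<^sup>+z. ennreal (norm z powr - (2 * real ?N)) * indicator {z. 1 \<le> norm z} z
        \<partial>(lborel :: 'a measure)) \<le> ennreal C2"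
  proof (rule nn_integral_powr_near_infinity[where 'a = 'a])
    fix B assume "\<And>\<rho>. 0 < \<rho> \<Longrightarrow> (\<integral>\<^sup>+z. ennreal (norm z powr - (2 * real ?N)) * indicator {z. \<rho> \<le> norm z} z
        \<partial>(lborel :: 'a measure)) \<le> ennreal (B * \<rho> powr - real ?N)"
    from this[of 1] show thesis by (intro that[of "B * 1 powr - real ?N"]) simp
  qed
  have "(\<integral>\<^sup>+x. ennreal (norm (gauss \<epsilon> x)) \<partial>(lborel :: 'a measure))
     \<le> (\<integral>\<^sup>+x. indicator (cball 0 1) x + ennreal C * (ennreal (norm x powr - (2 * real ?N)) * indicator {z. 1 \<le> norm z} x) \<partial>(lborel :: 'a measure))"
  proof (rule nn_integral_mono)
    fix x :: 'a
    show "ennreal (norm (gauss \<epsilon> x)) \<le> indicator (cball 0 1) x + ennreal C * (ennreal (norm x powr - (2 * real ?N)) * indicator {z. 1 \<le> norm z} x)"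
    proof (cases "1 \<le> norm x")
      case True
      then have "ennreal (norm (gauss \<epsilon> x)) \<le> ennreal C * ennreal (norm x powr - (2 * real ?N))"
        using far[OF True] gauss_pos[of \<epsilon> x] C0 by (simp add: ennreal_mult[symmetric] ennreal_leI)
      then show ?thesis using True by (simp add: add_increasing)
    next
      case False
      then have "ennreal (norm (gauss \<epsilon> x)) \<le> ennreal 1"
        using gauss_le_1[of \<epsilon> x] gauss_pos[of \<epsilon> x] e by (intro ennreal_leI) auto
      then show ?thesis using False by simp
    qed
  qed
  also have "\<dots> = emeasure lborel (cball 0 1 :: 'a set) + ennreal C * (\<integral>\<^sup>+z. ennreal (norm z powr - (2 * real ?N)) * indicator {z. 1 \<le> norm z} z \<partial>(lborel :: 'a measure))"
  proof -
    have [measurable]: "cball 0 1 \<in> sets (borel :: 'a measure)" by simp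
    show ?thesis by (subst nn_integral_add) (auto simp: nn_integral_cmult)
  qed
  also have "\<dots> < \<infinity>"
    using C2 emeasure_bounded_finite[of "cball 0 1 :: 'a set"]
    by (auto simp: ennreal_mult_less_top intro: le_less_trans[OF _ ennreal_less_top])
  finally show "(\<integral>\<^sup>+x. ennreal (norm (gauss \<epsilon> x)) \<partial>(lborel :: 'a measure)) < \<infinity>" .
qed simp

lemma integrable_bounded_mult:
  fixes f g :: "'b \<Rightarrow> real"
  assumes "integrable M f" "g \<in> borel_measurable M" "\<And>x. \<bar>g x\<bar> \<le> C"
  shows "integrable M (\<lambda>x. g x * f x)"
proof (rule integrable_dominated[where g = "\<lambda>x. C * \<bar>f x\<bar>"])
  show "\<bar>g x * f x\<bar> \<le> C * \<bar>f x\<bar>" for x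
    unfolding abs_mult using assms(3) by (intro mult_right_mono) auto
qed (use assms in auto)

lemma integrable_norm_gauss_square:
  assumes e: "0 < \<epsilon>"
  shows "integrable lborel (\<lambda>x::'a::euclidean_space. (norm x * gauss \<epsilon> x)\<^sup>2)"
proof -
  have "integrable lborel (\<lambda>x::'a. (norm x * gauss (\<epsilon>/2) x)\<^sup>2 * gauss \<epsilon> x)"
  proof (rule integrable_bounded_mult[OF integrable_gauss[OF e], where C = "(1 + 1/(\<epsilon>/2))\<^sup>2"])
    fix x :: 'a
    show "\<bar>(norm x * gauss (\<epsilon>/2) x)\<^sup>2\<bar> \<le> (1 + 1/(\<epsilon>/2))\<^sup>2"
      using norm_gauss_le[of "\<epsilon>/2" x] e gauss_pos[of "\<epsilon>/2" x] by (simp add: power_mono)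
  qed measurable
  moreover have "(norm x * gauss (\<epsilon>/2) x)\<^sup>2 * gauss \<epsilon> x = (norm x * gauss \<epsilon> x)\<^sup>2" for x :: 'a
    using gauss_half[of \<epsilon> x] by (simp add: power2_eq_square)
  ultimately show ?thesis by simp
qed

section \<open>Difference quotients under dilation\<close>

lemma tendsto_integral_inner_L2:
  fixes f :: "nat \<Rightarrow> 'b \<Rightarrow> 'c::euclidean_space" and g :: "'b \<Rightarrow> 'c"
  assumes [measurable]: "\<And>k. f k \<in> borel_measurable M" "g \<in> borel_measurable M"
    and f: "\<And>k. integrable M (\<lambda>x. (norm (f k x))\<^sup>2)" and g: "integrable M (\<lambda>x. (norm (g x))\<^sup>2)"
    and lim: "(\<lambda>k. \<integral>x. (norm (f k x))\<^sup>2 \<partial>M) \<longlonglongrightarrow> 0"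
  shows "(\<lambda>k. \<integral>x. f k x \<bullet> g x \<partial>M) \<longlonglongrightarrow> 0"
proof (rule Lim_null_comparison[OF always_eventually tendsto_integral_mult_L2(1)[OF _ _ f g lim]], rule allI)
  fix k
  have i: "integrable M (\<lambda>x. \<bar>norm (f k x) * norm (g x)\<bar>)"
    by (intro Bochner_Integration.integrable_abs integrable_mult_L2 f g) measurable
  have "norm (\<integral>x. f k x \<bullet> g x \<partial>M) \<le> (\<integral>x. norm (f k x \<bullet> g x) \<partial>M)" by (rule integral_norm_bound)
  also have "\<dots> \<le> (\<integral>x. \<bar>norm (f k x) * norm (g x)\<bar> \<partial>M)"
  proof (rule integral_mono[OF _ i])
    show "integrable M (\<lambda>x. norm (f k x \<bullet> g x))"
      by (rule integrable_dominated[OF i]) (auto simp: Cauchy_Schwarz_ineq2)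
  qed (auto simp: Cauchy_Schwarz_ineq2)
  finally show "norm (\<integral>x. f k x \<bullet> g x \<partial>M) \<le> (\<integral>x. \<bar>norm (f k x) * norm (g x)\<bar> \<partial>M)" .
qed measurable

lemma integrable_inner_L2:
  fixes f g :: "'b \<Rightarrow> 'c::euclidean_space"
  assumes [measurable]: "f \<in> borel_measurable M" "g \<in> borel_measurable M"
    and f: "integrable M (\<lambda>x. (norm (f x))\<^sup>2)" and g: "integrable M (\<lambda>x. (norm (g x))\<^sup>2)"
  shows "integrable M (\<lambda>x. f x \<bullet> g x)"
proof (rule integrable_dominated[where g = "\<lambda>x. \<bar>norm (f x) * norm (g x)\<bar>"])
  show "integrable M (\<lambda>x. \<bar>norm (f x) * norm (g x)\<bar>)"
    by (intro Bochner_Integration.integrable_abs integrable_mult_L2 f g) measurable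
qed (auto simp: Cauchy_Schwarz_ineq2)

text \<open>The difference is the integral over \<open>s\<close> from 1 to \<open>c\<close> of the
  radial derivative at \<open>s x\<close>. For each \<open>s\<close> the Cauchy-Schwarz inequality
  applies, and a dilation by \<open>s >= 1\<close> does not increase the \<open>L^2\<close> norm of
  the gradient. What matters is that the bound is linear in \<open>c - 1\<close> and sees \<psi>
  only through its gradient.\<close>

lemma test_fun_difference_quotient_bound:
  fixes P :: "'a::euclidean_space \<Rightarrow> real"
  assumes \<psi>: "test_fun \<Omega> \<psi>" and c: "1 < c" and [measurable]: "P \<in> borel_measurable borel"
    and P: "integrable lborel (\<lambda>x. (norm x * P x)\<^sup>2)"
  shows "(\<integral>\<^sup>+x. ennreal (\<bar>P x\<bar> * \<bar>\<psi> (c *\<^sub>R x) - \<psi> x\<bar>) \<partial>lborel)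
     \<le> ennreal ((c - 1) * (sqrt (LBINT x. (norm x * P x)\<^sup>2) * sqrt (LBINT x. (norm (grad \<psi> x))\<^sup>2)))"
proof -
  have s: "smooth_fun \<psi>" using \<psi> unfolding test_fun_def by simp
  note [measurable] = test_fun_borel[OF \<psi>]
  define K where "K = sqrt (LBINT x. (norm x * P x)\<^sup>2) * sqrt (LBINT x. (norm (grad \<psi> x))\<^sup>2)"
  have K0: "0 \<le> K" by (simp add: K_def)
  have pt: "ennreal (\<bar>P x\<bar> * \<bar>\<psi> (c *\<^sub>R x) - \<psi> x\<bar>)
     \<le> (\<integral>\<^sup>+s. indicator {1..c} s * ennreal (\<bar>(norm x * P x) * norm (grad \<psi> (s *\<^sub>R x))\<bar>) \<partial>lborel)" for x
  proof -
    note gc = smooth_fun_ray(2)[OF s, of _ x]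
    have gn: "continuous_on S (\<lambda>s. norm (grad \<psi> (s *\<^sub>R x)))" for S
      by (intro continuous_intros continuous_on_compose2[OF smooth_fun_grad_continuous[OF s, where S = UNIV]]) auto
    have "(LBINT t. indicator {1..c} t *\<^sub>R (grad \<psi> (t *\<^sub>R x) \<bullet> x)) = \<psi> (c *\<^sub>R x) - \<psi> (1 *\<^sub>R x)"
    proof (rule integral_FTC_Icc[OF _ _ gc])
      fix t
      from smooth_fun_ray(1)[OF s, of x t] show "((\<lambda>t. \<psi> (t *\<^sub>R x)) has_vector_derivative (grad \<psi> (t *\<^sub>R x) \<bullet> x)) (at t within {1..c})"
        by (simp add: has_real_derivative_iff_has_vector_derivative[symmetric] has_field_derivative_at_within)
    qed (use c in auto)
    then have eq: "\<psi> (c *\<^sub>R x) - \<psi> x = (LBINT t. indicator {1..c} t * (grad \<psi> (t *\<^sub>R x) \<bullet> x))" by simp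
    have i2: "integrable lborel (\<lambda>t. indicator {1..c} t * (norm x * norm (grad \<psi> (t *\<^sub>R x))))"
      using borel_integrable_compact[of "{1..c}" "\<lambda>t. norm x * norm (grad \<psi> (t *\<^sub>R x))"] gn
      by (simp add: continuous_on_mult_left)
    have i1: "integrable lborel (\<lambda>t. indicator {1..c} t * (grad \<psi> (t *\<^sub>R x) \<bullet> x))"
      using borel_integrable_compact[of "{1..c}" "\<lambda>t. grad \<psi> (t *\<^sub>R x) \<bullet> x"] gc by simp
    have "norm (\<psi> (c *\<^sub>R x) - \<psi> x) \<le> (LBINT t. indicator {1..c} t * (norm x * norm (grad \<psi> (t *\<^sub>R x))))"
      unfolding eq
      by (rule Bochner_Integration.integral_norm_bound_integral[OF i1 i2])
         (use Cauchy_Schwarz_ineq2 in \<open>auto simp: indicator_def mult.commute[of "norm x"]\<close>)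
    then have "\<bar>P x\<bar> * \<bar>\<psi> (c *\<^sub>R x) - \<psi> x\<bar> \<le> \<bar>P x\<bar> * (LBINT t. indicator {1..c} t * (norm x * norm (grad \<psi> (t *\<^sub>R x))))"
      by (intro mult_left_mono) auto
    also have "\<dots> = (LBINT t. \<bar>P x\<bar> * (indicator {1..c} t * (norm x * norm (grad \<psi> (t *\<^sub>R x)))))" by simp
    finally have "ennreal (\<bar>P x\<bar> * \<bar>\<psi> (c *\<^sub>R x) - \<psi> x\<bar>) \<le> ennreal \<dots>" by (rule ennreal_leI)
    also have "\<dots> = (\<integral>\<^sup>+t. ennreal (\<bar>P x\<bar> * (indicator {1..c} t * (norm x * norm (grad \<psi> (t *\<^sub>R x))))) \<partial>lborel)"
      by (rule nn_integral_eq_integral[symmetric]) (use i2 in auto)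
    also have "\<dots> = (\<integral>\<^sup>+s. indicator {1..c} s * ennreal (\<bar>(norm x * P x) * norm (grad \<psi> (s *\<^sub>R x))\<bar>) \<partial>lborel)"
      by (intro nn_integral_cong) (auto simp: indicator_def abs_mult mult_ac)
    finally show ?thesis .
  qed
  have inner: "(\<integral>\<^sup>+x. ennreal (\<bar>(norm x * P x) * norm (grad \<psi> (s *\<^sub>R x))\<bar>) \<partial>lborel) \<le> ennreal K" if s: "1 \<le> s" for s
  proof -
    have g: "integrable lborel (\<lambda>x. (norm (grad \<psi> (s *\<^sub>R x)))\<^sup>2)"
      using integrable_lborel_scaleR[OF test_fun_integrable_square(2)[OF \<psi>], of s] s by simp
    have "(LBINT x. (norm (grad \<psi> x))\<^sup>2) = s ^ DIM('a) * (LBINT x. (norm (grad \<psi> (s *\<^sub>R x)))\<^sup>2)"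
      using s by (subst integral_lborel_scaleR[of _ s]) auto
    moreover have "1 * (LBINT x. (norm (grad \<psi> (s *\<^sub>R x)))\<^sup>2) \<le> s ^ DIM('a) * (LBINT x. (norm (grad \<psi> (s *\<^sub>R x)))\<^sup>2)"
      using s by (intro mult_right_mono) auto
    ultimately have le: "(LBINT x. (norm (grad \<psi> (s *\<^sub>R x)))\<^sup>2) \<le> (LBINT x. (norm (grad \<psi> x))\<^sup>2)" by simp
    have i: "integrable lborel (\<lambda>x. \<bar>(norm x * P x) * norm (grad \<psi> (s *\<^sub>R x))\<bar>)"
      by (intro Bochner_Integration.integrable_abs integrable_mult_L2 P g) measurable
    have "(LBINT x. \<bar>(norm x * P x) * norm (grad \<psi> (s *\<^sub>R x))\<bar>)
      \<le> sqrt (LBINT x. (norm x * P x)\<^sup>2) * sqrt (LBINT x. (norm (grad \<psi> (s *\<^sub>R x)))\<^sup>2)"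
      by (rule Cauchy_Schwarz_integral[OF _ _ P g]) measurable
    also have "\<dots> \<le> K" unfolding K_def using le by (intro mult_left_mono real_sqrt_le_mono) auto
    finally show ?thesis using nn_integral_eq_integral[OF i] by (simp add: ennreal_leI)
  qed
  have "(\<integral>\<^sup>+x. ennreal (\<bar>P x\<bar> * \<bar>\<psi> (c *\<^sub>R x) - \<psi> x\<bar>) \<partial>lborel)
     \<le> (\<integral>\<^sup>+x. \<integral>\<^sup>+s. indicator {1..c} s * ennreal (\<bar>(norm x * P x) * norm (grad \<psi> (s *\<^sub>R x))\<bar>) \<partial>lborel \<partial>lborel)"
    by (rule nn_integral_mono) (rule pt)
  also have "\<dots> = (\<integral>\<^sup>+s. \<integral>\<^sup>+x. indicator {1..c} s * ennreal (\<bar>(norm x * P x) * norm (grad \<psi> (s *\<^sub>R x))\<bar>) \<partial>lborel \<partial>lborel)"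
    by (rule lborel_pair.Fubini'[symmetric]) measurable
  also have "\<dots> \<le> (\<integral>\<^sup>+s. ennreal K * indicator {1..c} s \<partial>lborel)"
  proof (rule nn_integral_mono)
    fix s
    show "(\<integral>\<^sup>+x. indicator {1..c} s * ennreal (\<bar>(norm x * P x) * norm (grad \<psi> (s *\<^sub>R x))\<bar>) \<partial>lborel) \<le> ennreal K * indicator {1..c} s"
      using inner[of s] by (cases "s \<in> {1..c}") (auto simp: nn_integral_cmult)
  qed
  also have "\<dots> = ennreal ((c - 1) * K)"
    using c K0 by (simp add: nn_integral_cmult ennreal_mult[symmetric] mult.commute)
  finally show ?thesis unfolding K_def .
qed


text \<open>Here \<open>q c\<close> is the weight on \<open>|G|^2\<close> after the substitution
  that removes the dilation from \<open>c^2 |G (c x)|^2\<close>. Its derivative at 1 supplies both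
  the factor \<open>2 - N\<close> and the cut-off error of the Laplacian estimate; the uniform bound
  makes the passage to the limit dominated.\<close>

lemma gauss_dilation_quotient:
  fixes y :: "'a::euclidean_space"
  assumes e: "0 < \<epsilon>" and N: "2 \<le> DIM('a)"
  defines "q \<equiv> \<lambda>s::real. s\<^sup>2 / s ^ DIM('a) * gauss \<epsilon> ((1/s) *\<^sub>R y)"
  shows "1 < c \<Longrightarrow> \<bar>(q c - q 1) / (c - 1)\<bar> \<le> real DIM('a)"
    and "((\<lambda>c. (q c - q 1) / (c - 1)) \<longlongrightarrow> (2 - real DIM('a) + 2 * \<epsilon> * (norm y)\<^sup>2) * gauss \<epsilon> y) (at_right 1)"
proof -
  let ?N = "DIM('a)"
  obtain n where n: "?N = n + 2" using N by (metis add.commute le_Suc_ex)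
  define p where "p s = s powr (- real n) * exp (- \<epsilon> * (norm y)\<^sup>2 / s\<^sup>2)" for s :: real
  have qp: "q s = p s" if "0 < s" for s
    using that unfolding q_def p_def gauss_def n
    by (simp add: power_add power_mult_distrib powr_minus powr_realpow power_divide divide_simps power2_eq_square)
  define p' where "p' s = (- real n * s powr (- real n - 1) + s powr (- real n) * (2 * \<epsilon> * (norm y)\<^sup>2 / s ^ 3)) * exp (- \<epsilon> * (norm y)\<^sup>2 / s\<^sup>2)" for s :: real
  have dp: "(p has_real_derivative p' s) (at s)" if "0 < s" for s
    unfolding p_def p'_def using that
    by (auto intro!: derivative_eq_intros simp: power2_eq_square power3_eq_cube field_simps)
  have p'b: "\<bar>p' s\<bar> \<le> real ?N" if s: "1 \<le> s" for s
  proof -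
    let ?z = "\<epsilon> * (norm y)\<^sup>2 / s\<^sup>2"
    have z0: "0 \<le> ?z" using e by simp
    define X Y where "X = real n * s powr (- real n - 1) * exp (- ?z)"
      and "Y = 2 * (s powr (- real n) * (1 / s)) * (?z * exp (- ?z))"
    have "p' s = - X + Y"
      unfolding p'_def X_def Y_def using s by (simp add: field_simps power2_eq_square power3_eq_cube)
    moreover have "0 \<le> X" unfolding X_def by simp
    moreover have "0 \<le> Y" unfolding Y_def using z0 s by (intro mult_nonneg_nonneg) auto
    ultimately have "\<bar>p' s\<bar> \<le> X + Y" by linarith
    then have "\<bar>p' s\<bar> \<le> real n * s powr (- real n - 1) * exp (- ?z) + 2 * (s powr (- real n) * (1 / s)) * (?z * exp (- ?z))"
      unfolding X_def Y_def .
    \<comment> \<open>The power contributes \<open>n = N - 2\<close>, and differentiating the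
      exponential contributes 2 because \<open>z exp (- z) <= 1\<close>. Together they give
      \<open>N\<close>, whatever \<open>y\<close> and \<epsilon> are.\<close>
    also have "\<dots> \<le> real n * 1 * 1 + 2 * (1 * 1) * 1"
    proof (intro add_mono mult_mono mult_exp_minus_le_1)
      show "s powr (- real n - 1) \<le> 1" "s powr (- real n) \<le> 1"
        using powr_mono[of "- real n - 1" 0 s] powr_mono[of "- real n" 0 s] s by auto
    qed (use z0 s e in auto)
    finally show ?thesis unfolding n by simp
  qed
  show "\<bar>(q c - q 1) / (c - 1)\<bar> \<le> real ?N" if c: "1 < c"
  proof -
    obtain z where z: "1 < z" "z < c" "p c - p 1 = (c - 1) * p' z"
      using MVT2[of 1 c p p'] c dp by auto
    then have "(q c - q 1) / (c - 1) = p' z" using c by (simp add: qp)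
    then show ?thesis using p'b[of z] z by simp
  qed
  have p1: "p' 1 = (2 - real ?N + 2 * \<epsilon> * (norm y)\<^sup>2) * gauss \<epsilon> y"
    unfolding p'_def gauss_def n by simp
  have "((\<lambda>c. (p c - p 1) / (c - 1)) \<longlongrightarrow> p' 1) (at 1)"
    using dp[of 1] unfolding has_field_derivative_iff by simp
  then have "((\<lambda>c. (p c - p 1) / (c - 1)) \<longlongrightarrow> p' 1) (at_right 1)"
    by (rule tendsto_mono[OF at_le, rotated]) simp
  moreover have "\<forall>\<^sub>F c in at_right 1. (p c - p 1) / (c - 1) = (q c - q 1) / (c - 1)"
    by (rule eventually_at_rightI[of 1 2]) (auto simp: qp)
  ultimately show "((\<lambda>c. (q c - q 1) / (c - 1)) \<longlongrightarrow> (2 - real DIM('a) + 2 * \<epsilon> * (norm y)\<^sup>2) * gauss \<epsilon> y) (at_right 1)"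
    unfolding p1 by (rule Lim_transform_eventually)
qed

lemma test_fun_diff:
  assumes "test_fun \<Omega> \<phi>" "test_fun \<Omega> \<psi>"
  shows "test_fun \<Omega> (\<lambda>x. \<phi> x - \<psi> x)" "grad (\<lambda>x. \<phi> x - \<psi> x) x = grad \<phi> x - grad \<psi> x"
proof -
  have S: "smooth_fun \<phi>" "smooth_fun \<psi>" using assms unfolding test_fun_def by auto
  have "smooth_fun (\<lambda>x. \<phi> x + (- 1) * \<psi> (1 *\<^sub>R x))"
    by (intro smooth_fun_add smooth_fun_scale S)
  then have s: "smooth_fun (\<lambda>x. \<phi> x - \<psi> x)" by simp
  let ?T = "closure {x. \<phi> x \<noteq> 0} \<union> closure {x. \<psi> x \<noteq> 0}"
  have cT: "compact ?T" "?T \<subseteq> \<Omega>" using assms unfolding test_fun_def by (auto intro!: compact_Un)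
  have "{x. \<phi> x - \<psi> x \<noteq> 0} \<subseteq> ?T"
  proof
    fix x assume "x \<in> {x. \<phi> x - \<psi> x \<noteq> 0}"
    then have "x \<in> {x. \<phi> x \<noteq> 0} \<or> x \<in> {x. \<psi> x \<noteq> 0}" by auto
    then show "x \<in> ?T"
    proof (elim disjE)
      assume "x \<in> {x. \<phi> x \<noteq> 0}"
      then show "x \<in> ?T" using closure_subset[of "{x. \<phi> x \<noteq> 0}"] by (intro UnI1) (rule subsetD)
    next
      assume "x \<in> {x. \<psi> x \<noteq> 0}"
      then show "x \<in> ?T" using closure_subset[of "{x. \<psi> x \<noteq> 0}"] by (intro UnI2) (rule subsetD)
    qed
  qed
  then have sub: "closure {x. \<phi> x - \<psi> x \<noteq> 0} \<subseteq> ?T"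
    using compact_imp_closed[OF cT(1)] by (intro closure_minimal)
  then have "compact (closure {x. \<phi> x - \<psi> x \<noteq> 0})"
    using compact_Int_closed[OF cT(1) closed_closure[of "{x. \<phi> x - \<psi> x \<noteq> 0}"]] by (simp add: Int_absorb1)
  then show "test_fun \<Omega> (\<lambda>x. \<phi> x - \<psi> x)" using s sub cT(2) unfolding test_fun_def by blast
  have "((\<lambda>x. \<phi> x - \<psi> x) has_derivative (\<lambda>h. grad \<phi> x \<bullet> h - grad \<psi> x \<bullet> h)) (at x)"
    by (intro has_derivative_diff smooth_fun_has_derivative S)
  from pdiff_eqI[OF this] have p: "pdiff b (\<lambda>x. \<phi> x - \<psi> x) x = grad \<phi> x \<bullet> b - grad \<psi> x \<bullet> b" for b .
  show "grad (\<lambda>x. \<phi> x - \<psi> x) x = grad \<phi> x - grad \<psi> x"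
    by (rule euclidean_eqI) (simp only: grad_inner_Basis[of _ "\<lambda>x. \<phi> x - \<psi> x"] p inner_diff_left)
qed

context star_H10
begin

lemma dilation_L2:
  assumes c: "c \<noteq> 0"
  shows "integrable lborel (\<lambda>x. (U (c *\<^sub>R x))\<^sup>2)" "integrable lborel (\<lambda>x. (norm (G (c *\<^sub>R x)))\<^sup>2)"
    "integrable lborel (\<lambda>x. (\<phi> k (c *\<^sub>R x) - U (c *\<^sub>R x))\<^sup>2)"
    "integrable lborel (\<lambda>x. (norm (grad (\<phi> k) (c *\<^sub>R x) - G (c *\<^sub>R x)))\<^sup>2)"
    "(\<lambda>k. \<integral>x. (\<phi> k (c *\<^sub>R x) - U (c *\<^sub>R x))\<^sup>2 \<partial>lborel) \<longlonglongrightarrow> 0"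
    "(\<lambda>k. \<integral>x. (norm (grad (\<phi> k) (c *\<^sub>R x) - G (c *\<^sub>R x)))\<^sup>2 \<partial>lborel) \<longlonglongrightarrow> 0"
proof -
  show "integrable lborel (\<lambda>x. (U (c *\<^sub>R x))\<^sup>2)" "integrable lborel (\<lambda>x. (norm (G (c *\<^sub>R x)))\<^sup>2)"
    "integrable lborel (\<lambda>x. (\<phi> k (c *\<^sub>R x) - U (c *\<^sub>R x))\<^sup>2)"
    "integrable lborel (\<lambda>x. (norm (grad (\<phi> k) (c *\<^sub>R x) - G (c *\<^sub>R x)))\<^sup>2)"
    using integrable_lborel_scaleR[OF U_L2 c] integrable_lborel_scaleR[OF G_L2 c]
      integrable_lborel_scaleR[OF \<phi>_U_integrable c] integrable_lborel_scaleR[OF \<phi>_G_integrable c] by auto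
  have e1: "(LBINT x. (\<phi> k (c *\<^sub>R x) - U (c *\<^sub>R x))\<^sup>2) = (LBINT x. (\<phi> k x - U x)\<^sup>2) / \<bar>c\<bar> ^ DIM('a)" for k
    using c by (subst integral_lborel_scaleR[of "\<lambda>x. (\<phi> k x - U x)\<^sup>2", OF _ c]) auto
  have e2: "(LBINT x. (norm (grad (\<phi> k) (c *\<^sub>R x) - G (c *\<^sub>R x)))\<^sup>2) = (LBINT x. (norm (grad (\<phi> k) x - G x))\<^sup>2) / \<bar>c\<bar> ^ DIM('a)" for k
    using c by (subst integral_lborel_scaleR[of "\<lambda>x. (norm (grad (\<phi> k) x - G x))\<^sup>2", OF _ c]) auto
  show "(\<lambda>k. \<integral>x. (\<phi> k (c *\<^sub>R x) - U (c *\<^sub>R x))\<^sup>2 \<partial>lborel) \<longlonglongrightarrow> 0"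
    unfolding e1 using tendsto_divide[OF \<phi>_U tendsto_const, of "\<bar>c\<bar> ^ DIM('a)"] c by simp
  show "(\<lambda>k. \<integral>x. (norm (grad (\<phi> k) (c *\<^sub>R x) - G (c *\<^sub>R x)))\<^sup>2 \<partial>lborel) \<longlonglongrightarrow> 0"
    unfolding e2 using tendsto_divide[OF \<phi>_G tendsto_const, of "\<bar>c\<bar> ^ DIM('a)"] c by simp
qed

text \<open>\<open>test_fun_difference_quotient_bound\<close> holds for
  \<open>\<phi> k - \<phi> j\<close>, and \<open>j\<close> tends to infinity on both sides. After
  division by \<open>c - 1\<close> the cost of replacing \<open>U\<close> by \<open>\<phi> k\<close>
  is independent of the dilation, which permits exchanging the two limits.\<close>

lemma difference_quotient_bound:
  assumes c: "1 < c" and [measurable]: "P \<in> borel_measurable borel"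
    and P2: "integrable lborel (\<lambda>x. (P x)\<^sup>2)" and P: "integrable lborel (\<lambda>x. (norm x * P x)\<^sup>2)"
  shows "\<bar>\<integral>x. P x * ((\<phi> k (c *\<^sub>R x) - \<phi> k x) - (U (c *\<^sub>R x) - U x)) \<partial>lborel\<bar>
     \<le> (c - 1) * (sqrt (LBINT x. (norm x * P x)\<^sup>2) * sqrt (LBINT x. (norm (grad (\<phi> k) x - G x))\<^sup>2))"
proof -
  have c0: "c \<noteq> 0" using c by simp
  define K where "K = sqrt (LBINT x. (norm x * P x)\<^sup>2)"
  have b: "\<bar>\<integral>x. P x * ((\<phi> k (c *\<^sub>R x) - \<phi> k x) - (\<phi> j (c *\<^sub>R x) - \<phi> j x)) \<partial>lborel\<bar>
     \<le> (c - 1) * (K * sqrt (LBINT x. (norm (grad (\<phi> k) x - grad (\<phi> j) x))\<^sup>2))" for j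
  proof -
    note t = test_fun_diff[OF \<phi>_test[of k] \<phi>_test[of j]]
    have "(\<integral>\<^sup>+x. ennreal (norm (P x * ((\<phi> k (c *\<^sub>R x) - \<phi> k x) - (\<phi> j (c *\<^sub>R x) - \<phi> j x)))) \<partial>lborel)
       \<le> ennreal ((c - 1) * (K * sqrt (LBINT x. (norm (grad (\<phi> k) x - grad (\<phi> j) x))\<^sup>2)))" (is "?l \<le> ennreal ?r")
    proof -
      have "norm (P x * ((\<phi> k (c *\<^sub>R x) - \<phi> k x) - (\<phi> j (c *\<^sub>R x) - \<phi> j x)))
        = \<bar>P x\<bar> * \<bar>\<phi> k (c *\<^sub>R x) - \<phi> j (c *\<^sub>R x) - (\<phi> k x - \<phi> j x)\<bar>" for x
        unfolding real_norm_def abs_mult by (intro arg_cong2[where f = "(*)"] arg_cong[where f = abs]) auto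
      then show ?thesis
        using test_fun_difference_quotient_bound[OF t(1) c _ P] unfolding K_def t(2) by simp
    qed
    have r0: "0 \<le> ?r" using c by (simp add: K_def)
    have "ennreal (norm (LBINT x. P x * ((\<phi> k (c *\<^sub>R x) - \<phi> k x) - (\<phi> j (c *\<^sub>R x) - \<phi> j x)))) \<le> ?l"
      by (rule integral_norm_bound_ennreal)
         (rule integrableI_bounded, measurable, use \<open>?l \<le> ennreal ?r\<close> in \<open>auto intro: le_less_trans[OF _ ennreal_less_top]\<close>)
    also note \<open>?l \<le> ennreal ?r\<close>
    finally show ?thesis using r0 by (subst (asm) ennreal_le_iff) auto
  qed
  have l1: "(\<lambda>j. \<integral>x. P x * ((\<phi> k (c *\<^sub>R x) - \<phi> k x) - (\<phi> j (c *\<^sub>R x) - \<phi> j x)) \<partial>lborel)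
     \<longlonglongrightarrow> (LBINT x. P x * ((\<phi> k (c *\<^sub>R x) - \<phi> k x) - (U (c *\<^sub>R x) - U x)))"
  proof -
    have i1: "integrable lborel (\<lambda>x. (\<phi> j (c *\<^sub>R x) - U (c *\<^sub>R x)) * P x)" for j
      by (rule integrable_mult_L2[OF _ _ dilation_L2(3)[OF c0] P2]) measurable
    have i2: "integrable lborel (\<lambda>x. (\<phi> j x - U x) * P x)" for j
      by (rule integrable_mult_L2[OF _ _ \<phi>_U_integrable P2]) measurable
    have z1: "(\<lambda>j. \<integral>x. (\<phi> j (c *\<^sub>R x) - U (c *\<^sub>R x)) * P x \<partial>lborel) \<longlonglongrightarrow> 0"
      by (rule tendsto_integral_mult_L2(2)[OF _ _ dilation_L2(3)[OF c0] P2 dilation_L2(5)[OF c0]]) measurable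
    have z2: "(\<lambda>j. \<integral>x. (\<phi> j x - U x) * P x \<partial>lborel) \<longlonglongrightarrow> 0"
      by (rule tendsto_integral_mult_L2(2)[OF _ _ \<phi>_U_integrable P2 \<phi>_U]) measurable
    define L where "L = (LBINT x. P x * ((\<phi> k (c *\<^sub>R x) - \<phi> k x) - (U (c *\<^sub>R x) - U x)))"
    have iL: "integrable lborel (\<lambda>x. P x * ((\<phi> k (c *\<^sub>R x) - \<phi> k x) - (U (c *\<^sub>R x) - U x)))"
      using Bochner_Integration.integrable_diff[OF i1[of k] i2[of k]] by (simp add: algebra_simps)
    have "(LBINT x. P x * ((\<phi> k (c *\<^sub>R x) - \<phi> k x) - (\<phi> j (c *\<^sub>R x) - \<phi> j x)))
       = L - ((LBINT x. (\<phi> j (c *\<^sub>R x) - U (c *\<^sub>R x)) * P x) - (LBINT x. (\<phi> j x - U x) * P x))" for j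
    proof -
      have "(LBINT x. P x * ((\<phi> k (c *\<^sub>R x) - \<phi> k x) - (\<phi> j (c *\<^sub>R x) - \<phi> j x)))
        = (LBINT x. P x * ((\<phi> k (c *\<^sub>R x) - \<phi> k x) - (U (c *\<^sub>R x) - U x)) -
            ((\<phi> j (c *\<^sub>R x) - U (c *\<^sub>R x)) * P x - (\<phi> j x - U x) * P x))"
        by (rule Bochner_Integration.integral_cong) (auto simp: algebra_simps)
      also have "\<dots> = L - ((LBINT x. (\<phi> j (c *\<^sub>R x) - U (c *\<^sub>R x)) * P x) - (LBINT x. (\<phi> j x - U x) * P x))"
        unfolding L_def using iL i1[of j] i2[of j] by simp
      finally show ?thesis .
    qed
    then show ?thesis
      using tendsto_diff[OF tendsto_const[of L] tendsto_diff[OF z1 z2]] unfolding L_def by simp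
  qed
  have l2: "(\<lambda>j. \<integral>x. (norm (grad (\<phi> k) x - grad (\<phi> j) x))\<^sup>2 \<partial>lborel) \<longlonglongrightarrow> (LBINT x. (norm (grad (\<phi> k) x - G x))\<^sup>2)"
  proof -
    have z: "(\<lambda>j. \<integral>x. (grad (\<phi> j) x - G x) \<bullet> (grad (\<phi> k) x - G x) \<partial>lborel) \<longlonglongrightarrow> 0"
      by (rule tendsto_integral_inner_L2[OF _ _ \<phi>_G_integrable \<phi>_G_integrable \<phi>_G]) measurable
    have iz: "integrable lborel (\<lambda>x. (grad (\<phi> j) x - G x) \<bullet> (grad (\<phi> k) x - G x))" for j
      by (rule integrable_inner_L2[OF _ _ \<phi>_G_integrable \<phi>_G_integrable]) measurable
    have "(LBINT x. (norm (grad (\<phi> k) x - grad (\<phi> j) x))\<^sup>2) = (LBINT x. (norm (grad (\<phi> k) x - G x))\<^sup>2)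
       - 2 * (LBINT x. (grad (\<phi> j) x - G x) \<bullet> (grad (\<phi> k) x - G x)) + (LBINT x. (norm (grad (\<phi> j) x - G x))\<^sup>2)" for j
    proof -
      have "(norm (grad (\<phi> k) x - grad (\<phi> j) x))\<^sup>2 = (norm (grad (\<phi> k) x - G x))\<^sup>2
        - 2 * ((grad (\<phi> j) x - G x) \<bullet> (grad (\<phi> k) x - G x)) + (norm (grad (\<phi> j) x - G x))\<^sup>2" for x
        unfolding power2_norm_eq_inner by (simp add: inner_diff inner_commute algebra_simps)
      then show ?thesis using iz[of j] \<phi>_G_integrable by simp
    qed
    then show ?thesis
      using tendsto_add[OF tendsto_diff[OF tendsto_const tendsto_mult[OF tendsto_const z]] \<phi>_G, of "\<integral>x. (norm (grad (\<phi> k) x - G x))\<^sup>2 \<partial>lborel" 2]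
      by simp
  qed
  have "\<bar>\<integral>x. P x * ((\<phi> k (c *\<^sub>R x) - \<phi> k x) - (U (c *\<^sub>R x) - U x)) \<partial>lborel\<bar>
     \<le> (c - 1) * (K * sqrt (LBINT x. (norm (grad (\<phi> k) x - G x))\<^sup>2))"
    by (rule LIMSEQ_le[OF tendsto_rabs[OF l1] tendsto_mult[OF tendsto_const tendsto_mult[OF tendsto_const tendsto_real_sqrt[OF l2]]]])
       (use b in blast)
  then show ?thesis unfolding K_def .
qed

end

text \<open>The exchange of limits: \<open>n\<close> stands for the dilation and \<open>k\<close>
  for the approximation, and the error \<open>d k\<close> is uniform in \<open>n\<close>.\<close>

lemma tendsto_uniform_approx:
  fixes A :: "nat \<Rightarrow> real"
  assumes AB: "\<And>n k. \<bar>A n - B n k\<bar> \<le> d k" and B: "\<And>k. (\<lambda>n. B n k) \<longlonglongrightarrow> b k"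
    and b: "\<And>k. \<bar>b k - l\<bar> \<le> d k" and d: "d \<longlonglongrightarrow> 0"
  shows "A \<longlonglongrightarrow> l"
proof (rule LIMSEQ_I)
  fix r :: real assume r: "0 < r"
  obtain k where k: "d k < r / 3"
    using order_tendstoD(2)[OF d, of "r/3"] r unfolding eventually_sequentially by auto
  obtain n0 where n0: "\<And>n. n \<ge> n0 \<Longrightarrow> norm (B n k - b k) < r / 3"
    using LIMSEQ_D[OF B[of k], of "r/3"] r by auto
  show "\<exists>n0. \<forall>n\<ge>n0. norm (A n - l) < r"
  proof (intro exI[of _ n0] allI impI)
    fix n assume "n \<ge> n0"
    then have "norm (B n k - b k) < r / 3" by (rule n0)
    then show "norm (A n - l) < r" using AB[of n k] b[of k] k unfolding real_norm_def by linarith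
  qed
qed

context star_H10
begin

lemma gauss_radial_L2:
  assumes e: "0 < \<epsilon>"
  shows "integrable lborel (\<lambda>x. (gauss \<epsilon> x * (G x \<bullet> x))\<^sup>2)"
proof (rule integrable_dominated[where g = "\<lambda>x. (1 + 1/\<epsilon>)\<^sup>2 * (norm (G x))\<^sup>2"])
  fix x :: 'a
  have "\<bar>gauss \<epsilon> x * (G x \<bullet> x)\<bar> \<le> gauss \<epsilon> x * (norm (G x) * norm x)"
    unfolding abs_mult using gauss_pos[of \<epsilon> x] by (intro mult_mono Cauchy_Schwarz_ineq2) auto
  also have "\<dots> = (norm x * gauss \<epsilon> x) * norm (G x)" by simp
  also have "\<dots> \<le> (1 + 1/\<epsilon>) * norm (G x)" by (intro mult_right_mono norm_gauss_le e) simp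
  finally have "\<bar>gauss \<epsilon> x * (G x \<bullet> x)\<bar>\<^sup>2 \<le> ((1 + 1/\<epsilon>) * norm (G x))\<^sup>2" by (intro power_mono) auto
  then show "\<bar>(gauss \<epsilon> x * (G x \<bullet> x))\<^sup>2\<bar> \<le> (1 + 1/\<epsilon>)\<^sup>2 * (norm (G x))\<^sup>2"
    by (subst abs_power2) (simp only: power_mult_distrib power2_abs)
qed (use G_L2 in auto)

abbreviation dil :: "nat \<Rightarrow> real" where "dil n \<equiv> 1 + 1 / real (Suc n)"

lemma dil_at_right: "filterlim dil (at_right 1) sequentially"
proof -
  have "dil \<longlonglongrightarrow> 1 + 0" by (intro tendsto_add tendsto_const LIMSEQ_Suc[OF lim_1_over_n])
  then show ?thesis by (auto intro!: filterlim_atI always_eventually simp: filterlim_at)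
qed

text \<open>Weak convergence to the radial derivative. For a test function it is dominated
  convergence, since a compactly supported gradient is bounded and the quotient is at most a
  multiple of \<open>norm x\<close>; this uses \<open>norm x * P x\<close> in \<open>L^1\<close>.
  The transfer to \<open>U\<close> uses \<open>P\<close> and \<open>norm x * P x\<close> in
  \<open>L^2\<close>.\<close>

lemma difference_quotient_tendsto:
  assumes [measurable]: "P \<in> borel_measurable borel"
    and P2: "integrable lborel (\<lambda>x. (P x)\<^sup>2)" and Px2: "integrable lborel (\<lambda>x. (norm x * P x)\<^sup>2)"
    and Px: "integrable lborel (\<lambda>x. norm x * P x)"
  shows "(\<lambda>n. \<integral>x. P x * ((U (dil n *\<^sub>R x) - U x) / (dil n - 1)) \<partial>lborel) \<longlonglongrightarrow> (LBINT x. P x * (G x \<bullet> x))"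
proof (rule tendsto_uniform_approx)
  define K where "K = sqrt (LBINT x. (norm x * P x)\<^sup>2)"
  define d where "d k = K * sqrt (LBINT x. (norm (grad (\<phi> k) x - G x))\<^sup>2)" for k
  have K0: "0 \<le> K" by (simp add: K_def)
  have pd: "1 < dil n" for n by simp
  have iU: "integrable lborel (\<lambda>x. P x * ((U (dil n *\<^sub>R x) - U x) / (dil n - 1)))" for n
  proof -
    have n0: "dil n \<noteq> 0" using pd[of n] by linarith
    have "integrable lborel (\<lambda>x. P x * U (dil n *\<^sub>R x))" "integrable lborel (\<lambda>x. P x * U x)"
      by (rule integrable_mult_L2[OF _ _ P2 dilation_L2(1)[OF n0]], measurable)
         (rule integrable_mult_L2[OF _ _ P2 U_L2], measurable)
    then have "integrable lborel (\<lambda>x. (1 / (dil n - 1)) * (P x * U (dil n *\<^sub>R x) - P x * U x))" by auto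
    then show ?thesis by (simp add: algebra_simps diff_divide_distrib)
  qed
  have i\<phi>: "integrable lborel (\<lambda>x. P x * ((\<phi> k (dil n *\<^sub>R x) - \<phi> k x) / (dil n - 1)))" for n k
  proof -
    have n0: "dil n \<noteq> 0" using pd[of n] by linarith
    have "integrable lborel (\<lambda>x. (\<phi> k (dil n *\<^sub>R x))\<^sup>2)"
      using integrable_lborel_scaleR[OF test_fun_integrable_square(1)[OF \<phi>_test] n0] .
    then have "integrable lborel (\<lambda>x. P x * \<phi> k (dil n *\<^sub>R x))" "integrable lborel (\<lambda>x. P x * \<phi> k x)"
      by (rule integrable_mult_L2[OF _ _ P2, rotated -1], measurable)
         (rule integrable_mult_L2[OF _ _ P2 test_fun_integrable_square(1)[OF \<phi>_test]], measurable)
    then have "integrable lborel (\<lambda>x. (1 / (dil n - 1)) * (P x * \<phi> k (dil n *\<^sub>R x) - P x * \<phi> k x))" by auto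
    then show ?thesis by (simp add: algebra_simps diff_divide_distrib)
  qed
  show "\<bar>(LBINT x. P x * ((U (dil n *\<^sub>R x) - U x) / (dil n - 1))) - (LBINT x. P x * ((\<phi> k (dil n *\<^sub>R x) - \<phi> k x) / (dil n - 1)))\<bar> \<le> d k" for n k
  proof -
    have "(LBINT x. P x * ((\<phi> k (dil n *\<^sub>R x) - \<phi> k x) / (dil n - 1))) - (LBINT x. P x * ((U (dil n *\<^sub>R x) - U x) / (dil n - 1)))
      = (LBINT x. P x * ((\<phi> k (dil n *\<^sub>R x) - \<phi> k x) / (dil n - 1)) - P x * ((U (dil n *\<^sub>R x) - U x) / (dil n - 1)))"
      using iU[of n] i\<phi>[of k n] by simp
    also have "\<dots> = (LBINT x. (1 / (dil n - 1)) * (P x * ((\<phi> k (dil n *\<^sub>R x) - \<phi> k x) - (U (dil n *\<^sub>R x) - U x))))"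
      by (rule Bochner_Integration.integral_cong) (auto simp: algebra_simps diff_divide_distrib)
    also have "\<dots> = (1 / (dil n - 1)) * (LBINT x. P x * ((\<phi> k (dil n *\<^sub>R x) - \<phi> k x) - (U (dil n *\<^sub>R x) - U x)))"
      by (rule integral_mult_right_zero)
    finally have "\<bar>(LBINT x. P x * ((U (dil n *\<^sub>R x) - U x) / (dil n - 1))) - (LBINT x. P x * ((\<phi> k (dil n *\<^sub>R x) - \<phi> k x) / (dil n - 1)))\<bar>
      = (1 / (dil n - 1)) * \<bar>\<integral>x. P x * ((\<phi> k (dil n *\<^sub>R x) - \<phi> k x) - (U (dil n *\<^sub>R x) - U x)) \<partial>lborel\<bar>"
      by (subst abs_minus_commute) (simp add: abs_mult)
    also have "\<dots> \<le> (1 / (dil n - 1)) * ((dil n - 1) * d k)"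
      unfolding d_def K_def
      by (intro mult_left_mono difference_quotient_bound[OF pd _ P2 Px2]) auto
    also have "\<dots> = d k" by simp
    finally show ?thesis .
  qed
  show "(\<lambda>n. \<integral>x. P x * ((\<phi> k (dil n *\<^sub>R x) - \<phi> k x) / (dil n - 1)) \<partial>lborel) \<longlonglongrightarrow> (LBINT x. P x * (grad (\<phi> k) x \<bullet> x))" for k
  proof -
    let ?S = "closure {x. \<phi> k x \<noteq> 0}"
    have S: "compact ?S" "test_fun ?S (\<phi> k)" using \<phi>_test[of k] unfolding test_fun_def by auto
    have "compact (grad (\<phi> k) ` ?S)"
      by (rule compact_continuous_image[OF smooth_fun_grad_continuous[OF \<phi>_smooth] S(1)])
    then obtain B where B: "\<And>x. x \<in> ?S \<Longrightarrow> norm (grad (\<phi> k) x) \<le> B" "0 < B"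
      using compact_imp_bounded bounded_pos by (metis image_eqI)
    have B': "norm (grad (\<phi> k) x) \<le> B" for x
    proof (cases "x \<in> ?S")
      case False
      from test_fun_zero_outside(3)[OF S(2) False] B(2) show ?thesis by simp
    qed (rule B(1))
    have lip: "norm (\<phi> k x - \<phi> k y) \<le> B * norm (x - y)" for x y
      by (rule differentiable_bound[OF convex_UNIV, of "\<phi> k" "\<lambda>x h. grad (\<phi> k) x \<bullet> h"])
         (auto intro!: has_derivative_at_withinI smooth_fun_has_derivative[OF \<phi>_smooth] onorm_le
            order_trans[OF Cauchy_Schwarz_ineq2] mult_right_mono B')
    show ?thesis
    proof (rule integral_dominated_convergence[where w = "\<lambda>x. B * \<bar>norm x * P x\<bar>"])
      show "integrable lborel (\<lambda>x. B * \<bar>norm x * P x\<bar>)" using Px by auto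
      show "AE x in lborel. norm (P x * ((\<phi> k (dil n *\<^sub>R x) - \<phi> k x) / (dil n - 1))) \<le> B * \<bar>norm x * P x\<bar>" for n
      proof (rule AE_I2)
        fix x
        have "\<bar>\<phi> k (dil n *\<^sub>R x) - \<phi> k x\<bar> \<le> B * norm (dil n *\<^sub>R x - x)" using lip[of "dil n *\<^sub>R x" x] by simp
        also have "dil n *\<^sub>R x - x = (dil n - 1) *\<^sub>R x" by (simp add: algebra_simps)
        finally have "\<bar>\<phi> k (dil n *\<^sub>R x) - \<phi> k x\<bar> \<le> B * norm ((dil n - 1) *\<^sub>R x)" .
        moreover have "a / (c - 1) \<le> B * norm x" if "a \<le> B * norm ((c - 1) *\<^sub>R x)" "1 < c" for a c :: real
          using that by (simp add: divide_le_eq mult_ac)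
        ultimately have "\<bar>\<phi> k (dil n *\<^sub>R x) - \<phi> k x\<bar> / (dil n - 1) \<le> B * norm x"
          using pd[of n] by blast
        then have "\<bar>P x\<bar> * (\<bar>\<phi> k (dil n *\<^sub>R x) - \<phi> k x\<bar> / (dil n - 1)) \<le> \<bar>P x\<bar> * (B * norm x)"
          by (intro mult_left_mono) auto
        then show "norm (P x * ((\<phi> k (dil n *\<^sub>R x) - \<phi> k x) / (dil n - 1))) \<le> B * \<bar>norm x * P x\<bar>"
          using pd[of n] by (simp add: abs_mult mult_ac)
      qed
      show "AE x in lborel. (\<lambda>n. P x * ((\<phi> k (dil n *\<^sub>R x) - \<phi> k x) / (dil n - 1))) \<longlonglongrightarrow> P x * (grad (\<phi> k) x \<bullet> x)"
      proof (rule AE_I2)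
        fix x
        from smooth_fun_ray(1)[OF \<phi>_smooth, of k x 1] have "((\<lambda>t. (\<phi> k (t *\<^sub>R x) - \<phi> k x) / (t - 1)) \<longlongrightarrow> (grad (\<phi> k) x \<bullet> x)) (at 1)"
          unfolding has_field_derivative_iff by simp
        then have "((\<lambda>t. (\<phi> k (t *\<^sub>R x) - \<phi> k x) / (t - 1)) \<longlongrightarrow> (grad (\<phi> k) x \<bullet> x)) (at_right 1)"
          by (rule tendsto_mono[OF at_le, rotated]) simp
        from filterlim_compose[OF this dil_at_right]
        show "(\<lambda>n. P x * ((\<phi> k (dil n *\<^sub>R x) - \<phi> k x) / (dil n - 1))) \<longlonglongrightarrow> P x * (grad (\<phi> k) x \<bullet> x)"
          by (intro tendsto_mult tendsto_const)
      qed
    qed measurable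
  qed
  show "\<bar>(LBINT x. P x * (grad (\<phi> k) x \<bullet> x)) - (LBINT x. P x * (G x \<bullet> x))\<bar> \<le> d k" for k
  proof -
    have xP: "(norm (P x *\<^sub>R x))\<^sup>2 = (norm x * P x)\<^sup>2" for x by (simp add: power_mult_distrib)
    have i1: "integrable lborel (\<lambda>x. (P x *\<^sub>R x) \<bullet> grad (\<phi> k) x)" "integrable lborel (\<lambda>x. (P x *\<^sub>R x) \<bullet> G x)"
      by (rule integrable_inner_L2[OF _ _ _ test_fun_integrable_square(2)[OF \<phi>_test]], measurable, simp only: xP Px2)
         (rule integrable_inner_L2[OF _ _ _ G_L2], measurable, simp only: xP Px2)
    have "(LBINT x. P x * (grad (\<phi> k) x \<bullet> x)) - (LBINT x. P x * (G x \<bullet> x))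
       = (LBINT x. (P x *\<^sub>R x) \<bullet> grad (\<phi> k) x - (P x *\<^sub>R x) \<bullet> G x)"
      using i1 by (simp add: inner_commute)
    also have "\<bar>\<dots>\<bar> \<le> (LBINT x. \<bar>(P x *\<^sub>R x) \<bullet> grad (\<phi> k) x - (P x *\<^sub>R x) \<bullet> G x\<bar>)"
      by (rule integral_abs_bound)
    also have "\<dots> \<le> (LBINT x. \<bar>(norm x * P x) * norm (grad (\<phi> k) x - G x)\<bar>)"
    proof (rule integral_mono)
      show "integrable lborel (\<lambda>x. \<bar>(P x *\<^sub>R x) \<bullet> grad (\<phi> k) x - (P x *\<^sub>R x) \<bullet> G x\<bar>)" using i1 by auto
      show "integrable lborel (\<lambda>x. \<bar>(norm x * P x) * norm (grad (\<phi> k) x - G x)\<bar>)"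
        by (intro Bochner_Integration.integrable_abs integrable_mult_L2 Px2 \<phi>_G_integrable) measurable
      show "\<bar>(P x *\<^sub>R x) \<bullet> grad (\<phi> k) x - (P x *\<^sub>R x) \<bullet> G x\<bar> \<le> \<bar>(norm x * P x) * norm (grad (\<phi> k) x - G x)\<bar>" for x
        using Cauchy_Schwarz_ineq2[of "P x *\<^sub>R x" "grad (\<phi> k) x - G x"]
        by (simp add: inner_diff_right abs_mult mult_ac)
    qed
    also have "\<dots> \<le> d k" unfolding d_def K_def
      by (rule Cauchy_Schwarz_integral[OF _ _ Px2 \<phi>_G_integrable]) measurable
    finally show ?thesis .
  qed
  show "d \<longlonglongrightarrow> 0"
    unfolding d_def using tendsto_mult[OF tendsto_const[of K] tendsto_real_sqrt[OF \<phi>_G]] by simp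
qed

end

section \<open>The Laplacian tested with dilation differences\<close>

locale star_H2 = star_H10 \<Omega> U G \<phi>
  for \<Omega> :: "'a::euclidean_space set" and U :: "'a \<Rightarrow> real" and G :: "'a \<Rightarrow> 'a" and \<phi> :: "nat \<Rightarrow> 'a \<Rightarrow> real" +
  fixes L :: "'a \<Rightarrow> real"
  assumes L_borel [measurable]: "L \<in> borel_measurable borel"
    and L_L2: "integrable lborel (\<lambda>x. (L x)\<^sup>2)"
    and weak_laplacian: "\<And>\<psi>. test_fun \<Omega> \<psi> \<Longrightarrow> (LBINT x. G x \<bullet> grad \<psi> x) = - (LBINT x. L x * \<psi> x)"
    and dim: "3 \<le> DIM('a)"
begin

text \<open>\<open>U\<close> is an admissible test function by density: both sides of
  \<open>weak_laplacian\<close> are continuous along \<open>\<phi> k\<close> because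
  \<open>L\<close> and \<open>G\<close> are square integrable.\<close>

lemma energy_identity: "- (LBINT x. L x * U x) = (LBINT x. (norm (G x))\<^sup>2)"
proof (rule LIMSEQ_unique)
  have i: "integrable lborel (\<lambda>x. L x * U x)" "integrable lborel (\<lambda>x. (\<phi> k x - U x) * L x)" for k
    by (rule integrable_mult_L2[OF _ _ L_L2 U_L2], measurable)
       (rule integrable_mult_L2[OF _ _ \<phi>_U_integrable L_L2], measurable)
  have "(\<lambda>k. \<integral>x. (\<phi> k x - U x) * L x \<partial>lborel) \<longlonglongrightarrow> 0"
    by (rule tendsto_integral_mult_L2(2)[OF _ _ \<phi>_U_integrable L_L2 \<phi>_U]) measurable
  then have "(\<lambda>k. - ((LBINT x. L x * U x) + (LBINT x. (\<phi> k x - U x) * L x))) \<longlonglongrightarrow> - ((LBINT x. L x * U x) + 0)"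
    by (intro tendsto_intros)
  moreover have "(LBINT x. L x * \<phi> k x) = (LBINT x. L x * U x) + (LBINT x. (\<phi> k x - U x) * L x)" for k
  proof -
    have "(LBINT x. L x * \<phi> k x) = (LBINT x. L x * U x + (\<phi> k x - U x) * L x)"
      by (rule Bochner_Integration.integral_cong) (auto simp: algebra_simps)
    then show ?thesis using i by simp
  qed
  ultimately show "(\<lambda>k. - (LBINT x. L x * \<phi> k x)) \<longlonglongrightarrow> - (LBINT x. L x * U x)" by simp
  have j: "integrable lborel (\<lambda>x. (grad (\<phi> k) x - G x) \<bullet> G x)" for k
    by (rule integrable_inner_L2[OF _ _ \<phi>_G_integrable G_L2]) measurable
  have "(\<lambda>k. \<integral>x. (grad (\<phi> k) x - G x) \<bullet> G x \<partial>lborel) \<longlonglongrightarrow> 0"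
    by (rule tendsto_integral_inner_L2[OF _ _ \<phi>_G_integrable G_L2 \<phi>_G]) measurable
  then have "(\<lambda>k. (LBINT x. (norm (G x))\<^sup>2) + (LBINT x. (grad (\<phi> k) x - G x) \<bullet> G x)) \<longlonglongrightarrow> (LBINT x. (norm (G x))\<^sup>2) + 0"
    by (intro tendsto_intros)
  moreover have "- (LBINT x. L x * \<phi> k x) = (LBINT x. (norm (G x))\<^sup>2) + (LBINT x. (grad (\<phi> k) x - G x) \<bullet> G x)" for k
  proof -
    have "(LBINT x. G x \<bullet> grad (\<phi> k) x) = (LBINT x. (norm (G x))\<^sup>2 + (grad (\<phi> k) x - G x) \<bullet> G x)"
      unfolding power2_norm_eq_inner inner_diff_left
      by (rule Bochner_Integration.integral_cong) (auto simp: inner_commute)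
    then show ?thesis using j[of k] G_L2 weak_laplacian[OF \<phi>_test, of k] by simp
  qed
  ultimately show "(\<lambda>k. - (LBINT x. L x * \<phi> k x)) \<longlonglongrightarrow> (LBINT x. (norm (G x))\<^sup>2)" by simp
qed


text \<open>\<open>X\<close> is \<open>G\<close> paired with the formal gradient of
  \<open>gauss \<epsilon> x * (U (c *\<^sub>R x) - U x)\<close>, its second summand coming from the
  gradient of the Gaussian. The identity holds for the test functions built from
  \<open>\<phi> k\<close> and survives the limit in \<open>k\<close> for fixed
  \<open>c\<close>.\<close>

lemma weak_laplacian_dilation:
  assumes e: "0 < \<epsilon>" and c: "1 < c"
  defines "X \<equiv> \<lambda>x. gauss \<epsilon> x * (c * (G x \<bullet> G (c *\<^sub>R x)) - (norm (G x))\<^sup>2)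
               - 2 * \<epsilon> * (gauss \<epsilon> x * (G x \<bullet> x) * (U (c *\<^sub>R x) - U x))"
  shows "integrable lborel X"
    and "(LBINT x. X x) = - (LBINT x. L x * gauss \<epsilon> x * (U (c *\<^sub>R x) - U x))"
proof -
  have c0: "c \<noteq> 0" using c by simp
  let ?z = "gauss \<epsilon> :: 'a \<Rightarrow> real"
  define w where "w x = ?z x * (G x \<bullet> x)" for x
  have [measurable]: "w \<in> borel_measurable borel" unfolding w_def by measurable
  have z1: "\<bar>?z x\<bar> \<le> 1" for x using gauss_le_1[of \<epsilon> x] gauss_pos[of \<epsilon> x] e by simp
  have zG: "integrable lborel (\<lambda>x. (norm (?z x *\<^sub>R G x))\<^sup>2)"
  proof (rule integrable_dominated[OF G_L2])
    show "\<bar>(norm (?z x *\<^sub>R G x))\<^sup>2\<bar> \<le> (norm (G x))\<^sup>2" for x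
      using z1[of x] by (simp add: mult_left_le_one_le power_mono)
  qed measurable
  have zL: "integrable lborel (\<lambda>x. (L x * ?z x)\<^sup>2)"
  proof (rule integrable_dominated[OF L_L2])
    show "\<bar>(L x * ?z x)\<^sup>2\<bar> \<le> (L x)\<^sup>2" for x
      using z1[of x] less_imp_le[OF gauss_pos[of \<epsilon> x]] by (simp add: power_mult_distrib mult_left_le power_le_one)
  qed measurable
  have w2: "integrable lborel (\<lambda>x. (w x)\<^sup>2)"
    unfolding w_def by (rule gauss_radial_L2[OF e])
  define \<psi> where "\<psi> k x = ?z x * (\<phi> k (c *\<^sub>R x) - \<phi> k x)" for k x
  have t\<psi>: "test_fun \<Omega> (\<psi> k)" for k
    unfolding \<psi>_def gauss_def by (rule test_fun_gauss_dilation[OF \<phi>_test _ star]) (use c in auto)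
  have g\<psi>: "grad (\<psi> k) x = ?z x *\<^sub>R (c *\<^sub>R grad (\<phi> k) (c *\<^sub>R x) - grad (\<phi> k) x) - (2 * \<epsilon> * ?z x * (\<phi> k (c *\<^sub>R x) - \<phi> k x)) *\<^sub>R x" for k x
  proof -
    have d1: "((\<lambda>x. \<phi> k (c *\<^sub>R x)) has_derivative (\<lambda>h. grad (\<phi> k) (c *\<^sub>R x) \<bullet> (c *\<^sub>R h))) (at x)"
      using has_derivative_dilation[where a = 1 and c = c and x = x and f = "\<phi> k", OF smooth_fun_differentiable[OF \<phi>_smooth]] by simp
    have d2: "(?z has_derivative (\<lambda>h. (- 2 * \<epsilon> * ?z x) * (x \<bullet> h))) (at x)"
      unfolding gauss_def[abs_def] by (rule has_derivative_gauss)
    have "(\<psi> k has_derivative (\<lambda>h. ?z x * (grad (\<phi> k) (c *\<^sub>R x) \<bullet> (c *\<^sub>R h) - grad (\<phi> k) x \<bullet> h) + (- 2 * \<epsilon> * ?z x) * (x \<bullet> h) * (\<phi> k (c *\<^sub>R x) - \<phi> k x))) (at x)"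
      unfolding \<psi>_def[abs_def]
      by (rule has_derivative_mult[OF d2 has_derivative_diff[OF d1 smooth_fun_has_derivative[OF \<phi>_smooth]]])
    from pdiff_eqI[OF this] have p: "pdiff b (\<psi> k) x = ?z x * (grad (\<phi> k) (c *\<^sub>R x) \<bullet> (c *\<^sub>R b) - grad (\<phi> k) x \<bullet> b) + (- 2 * \<epsilon> * ?z x) * (x \<bullet> b) * (\<phi> k (c *\<^sub>R x) - \<phi> k x)" for b .
    show ?thesis
      by (rule euclidean_eqI) (simp only: grad_inner_Basis[of _ "\<psi> k"] p, simp add: inner_diff_left algebra_simps)
  qed
  \<comment> \<open>The four errors made on replacing \<open>\<phi> k\<close> by \<open>U\<close>
    and \<open>grad (\<phi> k)\<close> by \<open>G\<close>. Each pairs a sequence that is null in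
    \<open>L^2\<close> with a fixed square integrable function.\<close>
  define E1 where "E1 k x = (grad (\<phi> k) (c *\<^sub>R x) - G (c *\<^sub>R x)) \<bullet> (?z x *\<^sub>R G x)" for k x
  define E2 where "E2 k x = (grad (\<phi> k) x - G x) \<bullet> (?z x *\<^sub>R G x)" for k x
  define E3 where "E3 k x = (\<phi> k (c *\<^sub>R x) - U (c *\<^sub>R x)) * w x" for k x
  define E4 where "E4 k x = (\<phi> k x - U x) * w x" for k x
  have iE: "integrable lborel (E1 k)" "integrable lborel (E2 k)" "integrable lborel (E3 k)" "integrable lborel (E4 k)" for k
    unfolding E1_def E2_def E3_def E4_def
    by (rule integrable_inner_L2[OF _ _ dilation_L2(4)[OF c0] zG], measurable)
       (rule integrable_inner_L2[OF _ _ \<phi>_G_integrable zG], measurable,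
        rule integrable_mult_L2[OF _ _ dilation_L2(3)[OF c0] w2], measurable,
        rule integrable_mult_L2[OF _ _ \<phi>_U_integrable w2], measurable)
  have lE: "(\<lambda>k. \<integral>x. E1 k x \<partial>lborel) \<longlonglongrightarrow> 0" "(\<lambda>k. \<integral>x. E2 k x \<partial>lborel) \<longlonglongrightarrow> 0"
    "(\<lambda>k. \<integral>x. E3 k x \<partial>lborel) \<longlonglongrightarrow> 0" "(\<lambda>k. \<integral>x. E4 k x \<partial>lborel) \<longlonglongrightarrow> 0"
    unfolding E1_def E2_def E3_def E4_def
    by (rule tendsto_integral_inner_L2[OF _ _ dilation_L2(4)[OF c0] zG dilation_L2(6)[OF c0]], measurable)
       (rule tendsto_integral_inner_L2[OF _ _ \<phi>_G_integrable zG \<phi>_G], measurable,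
        rule tendsto_integral_mult_L2(2)[OF _ _ dilation_L2(3)[OF c0] w2 dilation_L2(5)[OF c0]], measurable,
        rule tendsto_integral_mult_L2(2)[OF _ _ \<phi>_U_integrable w2 \<phi>_U], measurable)
  have Xeq: "G x \<bullet> grad (\<psi> k) x = X x + (c * E1 k x - E2 k x - 2 * \<epsilon> * (E3 k x - E4 k x))" for k x
    unfolding X_def E1_def E2_def E3_def E4_def g\<psi> w_def power2_norm_eq_inner
    by (simp add: inner_diff_left inner_diff_right inner_commute algebra_simps)
  have i0: "integrable lborel (\<lambda>x. (?z x *\<^sub>R G x) \<bullet> G (c *\<^sub>R x))" "integrable lborel (\<lambda>x. (?z x *\<^sub>R G x) \<bullet> G x)"
    "integrable lborel (\<lambda>x. w x * U (c *\<^sub>R x))" "integrable lborel (\<lambda>x. w x * U x)"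
    by (rule integrable_inner_L2[OF _ _ zG dilation_L2(2)[OF c0]], measurable)
       (rule integrable_inner_L2[OF _ _ zG G_L2], measurable,
        rule integrable_mult_L2[OF _ _ w2 dilation_L2(1)[OF c0]], measurable,
        rule integrable_mult_L2[OF _ _ w2 U_L2], measurable)
  have "X = (\<lambda>x. c * ((?z x *\<^sub>R G x) \<bullet> G (c *\<^sub>R x)) - (?z x *\<^sub>R G x) \<bullet> G x - 2 * \<epsilon> * (w x * U (c *\<^sub>R x) - w x * U x))"
    unfolding X_def w_def power2_norm_eq_inner by (auto simp: fun_eq_iff algebra_simps)
  then show iX: "integrable lborel X" using i0 by simp
  have "(LBINT x. G x \<bullet> grad (\<psi> k) x) = (LBINT x. X x) + (c * (LBINT x. E1 k x) - (LBINT x. E2 k x)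
      - 2 * \<epsilon> * ((LBINT x. E3 k x) - (LBINT x. E4 k x)))" for k
    unfolding Xeq using iX iE[of k] by simp
  then have lim1: "(\<lambda>k. \<integral>x. G x \<bullet> grad (\<psi> k) x \<partial>lborel) \<longlonglongrightarrow> (LBINT x. X x)"
    using tendsto_add[OF tendsto_const tendsto_diff[OF tendsto_diff[OF tendsto_mult[OF tendsto_const lE(1)] lE(2)]
       tendsto_mult[OF tendsto_const tendsto_diff[OF lE(3,4)]]], of "\<integral>x. X x \<partial>lborel" c "2 * \<epsilon>"] by simp
  have i5: "integrable lborel (\<lambda>x. (\<phi> k (c *\<^sub>R x) - U (c *\<^sub>R x)) * (L x * ?z x))" "integrable lborel (\<lambda>x. (\<phi> k x - U x) * (L x * ?z x))"
    "integrable lborel (\<lambda>x. U (c *\<^sub>R x) * (L x * ?z x))" "integrable lborel (\<lambda>x. U x * (L x * ?z x))" for k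
    by (rule integrable_mult_L2[OF _ _ dilation_L2(3)[OF c0] zL], measurable)
       (rule integrable_mult_L2[OF _ _ \<phi>_U_integrable zL], measurable,
        rule integrable_mult_L2[OF _ _ dilation_L2(1)[OF c0] zL], measurable,
        rule integrable_mult_L2[OF _ _ U_L2 zL], measurable)
  have l5: "(\<lambda>k. \<integral>x. (\<phi> k (c *\<^sub>R x) - U (c *\<^sub>R x)) * (L x * ?z x) \<partial>lborel) \<longlonglongrightarrow> 0"
    "(\<lambda>k. \<integral>x. (\<phi> k x - U x) * (L x * ?z x) \<partial>lborel) \<longlonglongrightarrow> 0"
    by (rule tendsto_integral_mult_L2(2)[OF _ _ dilation_L2(3)[OF c0] zL dilation_L2(5)[OF c0]], measurable)
       (rule tendsto_integral_mult_L2(2)[OF _ _ \<phi>_U_integrable zL \<phi>_U], measurable)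
  have eqU: "(LBINT x. L x * ?z x * (U (c *\<^sub>R x) - U x)) = (LBINT x. U (c *\<^sub>R x) * (L x * ?z x)) - (LBINT x. U x * (L x * ?z x))"
    using Bochner_Integration.integral_diff[OF i5(3,4)] by (simp add: algebra_simps)
  have "(LBINT x. L x * \<psi> k x) = (LBINT x. L x * ?z x * (U (c *\<^sub>R x) - U x))
      + ((LBINT x. (\<phi> k (c *\<^sub>R x) - U (c *\<^sub>R x)) * (L x * ?z x)) - (LBINT x. (\<phi> k x - U x) * (L x * ?z x)))" for k
  proof -
    have "(LBINT x. L x * \<psi> k x) = (LBINT x. (U (c *\<^sub>R x) * (L x * ?z x) - U x * (L x * ?z x))
       + ((\<phi> k (c *\<^sub>R x) - U (c *\<^sub>R x)) * (L x * ?z x) - (\<phi> k x - U x) * (L x * ?z x)))"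
      by (rule Bochner_Integration.integral_cong) (auto simp: \<psi>_def algebra_simps)
    then show ?thesis using i5 unfolding eqU by simp
  qed
  then have lim2: "(\<lambda>k. - (LBINT x. L x * \<psi> k x)) \<longlonglongrightarrow> - (LBINT x. L x * ?z x * (U (c *\<^sub>R x) - U x))"
    using tendsto_minus[OF tendsto_add[OF tendsto_const tendsto_diff[OF l5]], of "\<integral>x. L x * ?z x * (U (c *\<^sub>R x) - U x) \<partial>lborel"] by simp
  show "(LBINT x. X x) = - (LBINT x. L x * ?z x * (U (c *\<^sub>R x) - U x))"
    using LIMSEQ_unique[OF lim1[unfolded weak_laplacian[OF t\<psi>]] lim2] .
qed

text \<open>Testing with \<open>U (c x) - U x\<close> for \<open>c > 1\<close>, which is admissible because the dilated function is supported in
  \<open>\<Omega>\<close>, and bounding \<open>c G(x) \<bullet> G(c x)\<close> by the arithmetic mean of the squares replaces the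
  boundary integral of Pohozaev's identity by an inequality of the right sign.\<close>

lemma pohozaev_inequality_laplacian:
  assumes e: "0 < \<epsilon>"
  shows "- (LBINT x. L x * gauss \<epsilon> x * (G x \<bullet> x))
     \<le> (LBINT x. ((1 - real DIM('a) / 2 + \<epsilon> * (norm x)\<^sup>2) * gauss \<epsilon> x) * (norm (G x))\<^sup>2)"
proof -
  let ?z = "gauss \<epsilon> :: 'a \<Rightarrow> real"
  let ?N = "DIM('a)"
  \<comment> \<open>The factor \<open>c^2\<close> belongs to the square of \<open>c G (c x)\<close>,
    and \<open>c^(- N)\<close> is the Jacobian of the substitution that undoes the dilation.\<close>
  define q where "q c y = c\<^sup>2 / c ^ ?N * ?z ((1/c) *\<^sub>R y)" for c :: real and y
  define w where "w x = ?z x * (G x \<bullet> x)" for x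
  have [measurable]: "w \<in> borel_measurable borel" "q c \<in> borel_measurable borel" for c
    unfolding w_def q_def by measurable
  have z1: "0 \<le> ?z x" "?z x \<le> 1" for x using gauss_le_1[of \<epsilon> x] gauss_pos[of \<epsilon> x] e by auto
  have q1: "q 1 y = ?z y" for y unfolding q_def by simp
  have qb: "1 < c \<Longrightarrow> \<bar>(q c y - q 1 y) / (c - 1)\<bar> \<le> real ?N" for c y
    unfolding q_def using gauss_dilation_quotient(1)[OF e, of c y] dim by simp
  have ql: "((\<lambda>c. (q c y - q 1 y) / (c - 1)) \<longlongrightarrow> (2 - real ?N + 2 * \<epsilon> * (norm y)\<^sup>2) * ?z y) (at_right 1)" for y
    unfolding q_def using gauss_dilation_quotient(2)[OF e, of y] dim by simp
  have ineq: "- (LBINT x. L x * ?z x * ((U (c *\<^sub>R x) - U x) / (c - 1)))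
     \<le> (1/2) * (LBINT x. ((q c x - q 1 x) / (c - 1)) * (norm (G x))\<^sup>2) - 2 * \<epsilon> * (LBINT x. w x * ((U (c *\<^sub>R x) - U x) / (c - 1)))"
    if c: "1 < c" for c
  proof -
    have c0: "c \<noteq> 0" "0 < c - 1" using c by auto
    define X where "X = (\<lambda>x. ?z x * (c * (G x \<bullet> G (c *\<^sub>R x)) - (norm (G x))\<^sup>2)
               - 2 * \<epsilon> * (?z x * (G x \<bullet> x) * (U (c *\<^sub>R x) - U x)))"
    note X = weak_laplacian_dilation[OF e c, folded X_def]
    have i1: "integrable lborel (\<lambda>x. ?z x * (norm (G (c *\<^sub>R x)))\<^sup>2)" "integrable lborel (\<lambda>x. ?z x * (norm (G x))\<^sup>2)"
      by (rule integrable_bounded_mult[OF dilation_L2(2)[OF c0(1)], of _ 1], measurable, use z1 in simp)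
         (rule integrable_bounded_mult[OF G_L2, of _ 1], measurable, use z1 in simp)
    have i2: "integrable lborel (\<lambda>x. w x * (U (c *\<^sub>R x) - U x))"
    proof -
      have w2: "integrable lborel (\<lambda>x. (w x)\<^sup>2)"
        unfolding w_def by (rule gauss_radial_L2[OF e])
      have "integrable lborel (\<lambda>x. w x * U (c *\<^sub>R x))" "integrable lborel (\<lambda>x. w x * U x)"
        by (rule integrable_mult_L2[OF _ _ w2 dilation_L2(1)[OF c0(1)]], measurable)
           (rule integrable_mult_L2[OF _ _ w2 U_L2], measurable)
      then show ?thesis by (simp add: right_diff_distrib)
    qed
    have "(LBINT x. X x) \<le> (LBINT x. (1/2) * (c\<^sup>2 * (?z x * (norm (G (c *\<^sub>R x)))\<^sup>2) - ?z x * (norm (G x))\<^sup>2) - 2 * \<epsilon> * (w x * (U (c *\<^sub>R x) - U x)))"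
    proof (rule integral_mono[OF X(1)])
      show "integrable lborel (\<lambda>x. (1/2) * (c\<^sup>2 * (?z x * (norm (G (c *\<^sub>R x)))\<^sup>2) - ?z x * (norm (G x))\<^sup>2) - 2 * \<epsilon> * (w x * (U (c *\<^sub>R x) - U x)))"
        using i1 i2 by auto
      fix x
      have "2 * (c * (G x \<bullet> G (c *\<^sub>R x))) \<le> (norm (G x))\<^sup>2 + (norm (c *\<^sub>R G (c *\<^sub>R x)))\<^sup>2"
      proof -
        have "G x \<bullet> (c *\<^sub>R G (c *\<^sub>R x)) \<le> norm (G x) * norm (c *\<^sub>R G (c *\<^sub>R x))" by (rule norm_cauchy_schwarz)
        then show ?thesis using sum_squares_bound[of "norm (G x)" "norm (c *\<^sub>R G (c *\<^sub>R x))"] by (simp del: norm_scaleR)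
      qed
      also have "(norm (c *\<^sub>R G (c *\<^sub>R x)))\<^sup>2 = c\<^sup>2 * (norm (G (c *\<^sub>R x)))\<^sup>2" by (simp add: power_mult_distrib)
      finally have "c * (G x \<bullet> G (c *\<^sub>R x)) - (norm (G x))\<^sup>2 \<le> (1/2) * (c\<^sup>2 * (norm (G (c *\<^sub>R x)))\<^sup>2 - (norm (G x))\<^sup>2)" by simp
      then have "?z x * (c * (G x \<bullet> G (c *\<^sub>R x)) - (norm (G x))\<^sup>2) \<le> ?z x * ((1/2) * (c\<^sup>2 * (norm (G (c *\<^sub>R x)))\<^sup>2 - (norm (G x))\<^sup>2))"
        using z1(1) by (rule mult_left_mono)
      then show "X x \<le> (1/2) * (c\<^sup>2 * (?z x * (norm (G (c *\<^sub>R x)))\<^sup>2) - ?z x * (norm (G x))\<^sup>2) - 2 * \<epsilon> * (w x * (U (c *\<^sub>R x) - U x))"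
        unfolding X_def w_def by (simp add: algebra_simps)
    qed
    also have "\<dots> = (1/2) * (c\<^sup>2 * (LBINT x. ?z x * (norm (G (c *\<^sub>R x)))\<^sup>2) - (LBINT x. ?z x * (norm (G x))\<^sup>2))
        - 2 * \<epsilon> * (LBINT x. w x * (U (c *\<^sub>R x) - U x))"
      using i1 i2 by simp
    \<comment> \<open>The substitution moves the dilation from \<open>G\<close>, which need not be
      differentiable, to the smooth Gaussian. The difference quotient in \<open>c\<close> then falls
      on the weight \<open>q\<close> alone.\<close>
    also have "c\<^sup>2 * (LBINT x. ?z x * (norm (G (c *\<^sub>R x)))\<^sup>2) = (LBINT x. q c x * (norm (G x))\<^sup>2)"
    proof -
      have "(LBINT x. q c x * (norm (G x))\<^sup>2) = c ^ ?N * (LBINT x. q c (c *\<^sub>R x) * (norm (G (c *\<^sub>R x)))\<^sup>2)"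
        using c by (subst integral_lborel_scaleR[OF _ c0(1)]) auto
      also have "(\<lambda>x. q c (c *\<^sub>R x) * (norm (G (c *\<^sub>R x)))\<^sup>2) = (\<lambda>x. (c\<^sup>2 / c ^ ?N) * (?z x * (norm (G (c *\<^sub>R x)))\<^sup>2))"
        using c unfolding q_def by (auto simp: fun_eq_iff)
      finally show ?thesis using c by simp
    qed
    also have "(LBINT x. ?z x * (norm (G x))\<^sup>2) = (LBINT x. q 1 x * (norm (G x))\<^sup>2)" by (simp add: q1)
    finally have main: "- (LBINT x. L x * ?z x * (U (c *\<^sub>R x) - U x))
      \<le> (1/2) * ((LBINT x. q c x * (norm (G x))\<^sup>2) - (LBINT x. q 1 x * (norm (G x))\<^sup>2)) - 2 * \<epsilon> * (LBINT x. w x * (U (c *\<^sub>R x) - U x))"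
      unfolding X(2) .
    have iq: "integrable lborel (\<lambda>x. q c x * (norm (G x))\<^sup>2)" "integrable lborel (\<lambda>x. q 1 x * (norm (G x))\<^sup>2)"
    proof -
      show "integrable lborel (\<lambda>x. q c x * (norm (G x))\<^sup>2)"
        by (rule integrable_bounded_mult[OF G_L2, of _ "c\<^sup>2 / c ^ ?N"])
           (use c z1 in \<open>auto simp: q_def abs_mult divide_right_mono mult_left_le\<close>)
      show "integrable lborel (\<lambda>x. q 1 x * (norm (G x))\<^sup>2)" using i1(2) by (simp add: q1)
    qed
    have dq: "(LBINT x. q c x * (norm (G x))\<^sup>2) - (LBINT x. q 1 x * (norm (G x))\<^sup>2)
        = (c - 1) * (LBINT x. ((q c x - q 1 x) / (c - 1)) * (norm (G x))\<^sup>2)"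
    proof -
      have "(LBINT x. q c x * (norm (G x))\<^sup>2) - (LBINT x. q 1 x * (norm (G x))\<^sup>2)
         = (LBINT x. (c - 1) * (((q c x - q 1 x) / (c - 1)) * (norm (G x))\<^sup>2))"
      proof -
        have "(c - 1) * (((q c x - q 1 x) / (c - 1)) * (norm (G x))\<^sup>2) = q c x * (norm (G x))\<^sup>2 - q 1 x * (norm (G x))\<^sup>2" for x
          using c0(2) unfolding left_diff_distrib[of "q c x", symmetric] mult.assoc[symmetric]
          by (metis less_numeral_extra(3) nonzero_mult_div_cancel_left times_divide_eq_right)
        then show ?thesis using iq by simp
      qed
      then show ?thesis by simp
    qed
    have dU: "(LBINT x. f x * (U (c *\<^sub>R x) - U x)) = (c - 1) * (LBINT x. f x * ((U (c *\<^sub>R x) - U x) / (c - 1)))" for f :: "'a \<Rightarrow> real"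
      using c0 by (subst integral_mult_right_zero[symmetric]) (simp add: mult.left_commute)
    have alg: "d * - A \<le> d * (1/2 * B - 2 * \<epsilon> * C)" if "- (d * A) \<le> 1/2 * (d * B) - 2 * \<epsilon> * (d * C)" for d A B C :: real
      using that by (simp add: algebra_simps)
    have "(c - 1) * - (LBINT x. L x * ?z x * ((U (c *\<^sub>R x) - U x) / (c - 1)))
      \<le> (c - 1) * ((1/2) * (LBINT x. ((q c x - q 1 x) / (c - 1)) * (norm (G x))\<^sup>2) - 2 * \<epsilon> * (LBINT x. w x * ((U (c *\<^sub>R x) - U x) / (c - 1))))"
      by (rule alg[OF main[unfolded dq dU[of "\<lambda>x. L x * ?z x"] dU[of w]]])
    then show ?thesis using c0(2) by (simp only: mult_le_cancel_left_pos)
  qed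
  have Lz: "integrable lborel (\<lambda>x. (L x * ?z x)\<^sup>2)" "integrable lborel (\<lambda>x. (norm x * (L x * ?z x))\<^sup>2)" "integrable lborel (\<lambda>x. norm x * (L x * ?z x))"
  proof -
    have "integrable lborel (\<lambda>x. (?z x)\<^sup>2 * (L x)\<^sup>2)"
      by (rule integrable_bounded_mult[OF L_L2, of _ 1]) (use z1 in \<open>auto simp: power_le_one\<close>)
    then show "integrable lborel (\<lambda>x. (L x * ?z x)\<^sup>2)" by (simp add: power_mult_distrib mult.commute)
    have "integrable lborel (\<lambda>x. (norm x * ?z x)\<^sup>2 * (L x)\<^sup>2)"
      by (rule integrable_bounded_mult[OF L_L2, of _ "(1 + 1/\<epsilon>)\<^sup>2"])
         (use z1 norm_gauss_le[OF e] in \<open>auto intro!: power_mono mult_nonneg_nonneg\<close>)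
    then show "integrable lborel (\<lambda>x. (norm x * (L x * ?z x))\<^sup>2)" by (simp add: power_mult_distrib mult_ac)
    have "integrable lborel (\<lambda>x. L x * (norm x * ?z x))"
      by (rule integrable_mult_L2[OF _ _ L_L2 integrable_norm_gauss_square[OF e]]) measurable
    then show "integrable lborel (\<lambda>x. norm x * (L x * ?z x))" by (simp add: mult_ac)
  qed
  have wz: "integrable lborel (\<lambda>x. (w x)\<^sup>2)" "integrable lborel (\<lambda>x. (norm x * w x)\<^sup>2)" "integrable lborel (\<lambda>x. norm x * w x)"
  proof -
    have wb: "\<bar>w x\<bar> \<le> ?z x * norm x * norm (G x)" for x
      using mult_left_mono[OF Cauchy_Schwarz_ineq2[of "G x" x] z1(1)[of x]] z1[of x]
      unfolding w_def abs_mult by (simp add: mult_ac)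
    have e2: "0 < \<epsilon>/2" using e by simp
    show "integrable lborel (\<lambda>x. (w x)\<^sup>2)"
      unfolding w_def by (rule gauss_radial_L2[OF e])
    have b2: "norm x * (?z x * norm x) \<le> 1/\<epsilon>" for x
      using norm_sq_gauss_le[of \<epsilon> x] e by (simp add: field_simps power2_eq_square)
    show "integrable lborel (\<lambda>x. (norm x * w x)\<^sup>2)"
    proof (rule integrable_dominated[where g = "\<lambda>x. (1/\<epsilon>)\<^sup>2 * (norm (G x))\<^sup>2"])
      fix x
      have "norm x * \<bar>w x\<bar> \<le> (norm x * (?z x * norm x)) * norm (G x)"
        using mult_left_mono[OF wb[of x], of "norm x"] by (simp add: mult_ac)
      also have "\<dots> \<le> (1/\<epsilon>) * norm (G x)" by (intro mult_right_mono b2) simp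
      finally have "(norm x * \<bar>w x\<bar>)\<^sup>2 \<le> ((1/\<epsilon>) * norm (G x))\<^sup>2" by (intro power_mono) auto
      then show "\<bar>(norm x * w x)\<^sup>2\<bar> \<le> (1/\<epsilon>)\<^sup>2 * (norm (G x))\<^sup>2"        by (subst abs_power2) (simp only: power_mult_distrib power2_abs)
    qed (use G_L2 in auto)
    \<comment> \<open>Since \<open>w\<close> contains another factor \<open>norm x\<close>, the
      Gaussian is split: one half bounds one factor \<open>norm x\<close>, and the other makes the
      second a square integrable partner of \<open>norm (G x)\<close>.\<close>
    show "integrable lborel (\<lambda>x. norm x * w x)"
    proof (rule integrable_dominated[where g = "\<lambda>x. (1 + 1/(\<epsilon>/2)) * ((norm x * gauss (\<epsilon>/2) x) * norm (G x))"])
      show "integrable lborel (\<lambda>x. (1 + 1/(\<epsilon>/2)) * ((norm x * gauss (\<epsilon>/2) x) * norm (G x)))"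
        by (intro integrable_mult_right integrable_mult_L2 integrable_norm_gauss_square e2 G_L2) measurable
      fix x
      have "norm x * \<bar>w x\<bar> \<le> norm x * (?z x * norm x * norm (G x))" by (intro mult_left_mono wb) simp
      also have "\<dots> = (norm x * gauss (\<epsilon>/2) x) * ((norm x * gauss (\<epsilon>/2) x) * norm (G x))"
        using gauss_half[of \<epsilon> x] by (simp add: mult_ac)
      also have "\<dots> \<le> (1 + 1/(\<epsilon>/2)) * ((norm x * gauss (\<epsilon>/2) x) * norm (G x))"
        by (intro mult_right_mono norm_gauss_le e2 mult_nonneg_nonneg) (auto simp: less_imp_le[OF gauss_pos])
      finally show "\<bar>norm x * w x\<bar> \<le> (1 + 1/(\<epsilon>/2)) * ((norm x * gauss (\<epsilon>/2) x) * norm (G x))" by (simp add: abs_mult)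
    qed measurable
  qed
  have lim1: "(\<lambda>n. - (LBINT x. L x * ?z x * ((U (dil n *\<^sub>R x) - U x) / (dil n - 1)))) \<longlonglongrightarrow> - (LBINT x. L x * ?z x * (G x \<bullet> x))"
    by (rule tendsto_minus, rule difference_quotient_tendsto[OF _ Lz]) measurable
  have lim2: "(\<lambda>n. \<integral>x. w x * ((U (dil n *\<^sub>R x) - U x) / (dil n - 1)) \<partial>lborel) \<longlonglongrightarrow> (LBINT x. w x * (G x \<bullet> x))"
    by (rule difference_quotient_tendsto[OF _ wz]) measurable
  have lim3: "(\<lambda>n. \<integral>x. ((q (dil n) x - q 1 x) / (dil n - 1)) * (norm (G x))\<^sup>2 \<partial>lborel) \<longlonglongrightarrow> (LBINT x. ((2 - real ?N + 2 * \<epsilon> * (norm x)\<^sup>2) * ?z x) * (norm (G x))\<^sup>2)"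
  proof (rule integral_dominated_convergence[where w = "\<lambda>x. real ?N * (norm (G x))\<^sup>2"])
    show "AE x in lborel. (\<lambda>n. ((q (dil n) x - q 1 x) / (dil n - 1)) * (norm (G x))\<^sup>2) \<longlonglongrightarrow> ((2 - real ?N + 2 * \<epsilon> * (norm x)\<^sup>2) * ?z x) * (norm (G x))\<^sup>2"
      by (intro AE_I2 tendsto_mult tendsto_const filterlim_compose[OF ql dil_at_right])
    show "AE x in lborel. norm (((q (dil n) x - q 1 x) / (dil n - 1)) * (norm (G x))\<^sup>2) \<le> real ?N * (norm (G x))\<^sup>2" for n
    proof (rule AE_I2)
      fix x
      have "1 < dil n" by simp
      from qb[OF this, of x] show "norm (((q (dil n) x - q 1 x) / (dil n - 1)) * (norm (G x))\<^sup>2) \<le> real ?N * (norm (G x))\<^sup>2"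
        unfolding real_norm_def abs_mult[of _ "(norm (G x))\<^sup>2"] by (simp only: abs_power2, intro mult_right_mono) auto
    qed
  qed (use G_L2 in \<open>auto\<close>)
  have "- (LBINT x. L x * ?z x * (G x \<bullet> x))
     \<le> (1/2) * (LBINT x. ((2 - real ?N + 2 * \<epsilon> * (norm x)\<^sup>2) * ?z x) * (norm (G x))\<^sup>2) - 2 * \<epsilon> * (LBINT x. w x * (G x \<bullet> x))"
    by (rule LIMSEQ_le[OF lim1 tendsto_diff[OF tendsto_mult[OF tendsto_const lim3] tendsto_mult[OF tendsto_const lim2]]])
       (intro exI[of _ 0] allI impI ineq, simp)
  \<comment> \<open>This term comes from the gradient of the Gaussian and is
    \<open>2 \<epsilon>\<close> times the integral of \<open>gauss \<epsilon> x (G x . x)^2\<close>.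
    It enters with a minus sign on the right, so the upper bound survives without it.\<close>
  moreover have "0 \<le> 2 * \<epsilon> * (LBINT x. w x * (G x \<bullet> x))"
  proof (rule mult_nonneg_nonneg[OF _ integral_nonneg_AE], use e in simp, rule AE_I2)
    fix x
    have "w x * (G x \<bullet> x) = ?z x * (G x \<bullet> x)\<^sup>2" by (simp add: w_def power2_eq_square)
    then show "0 \<le> w x * (G x \<bullet> x)" using z1 by simp
  qed
  moreover have "(1/2) * (LBINT x. ((2 - real ?N + 2 * \<epsilon> * (norm x)\<^sup>2) * ?z x) * (norm (G x))\<^sup>2)
     = (LBINT x. ((1 - real ?N / 2 + \<epsilon> * (norm x)\<^sup>2) * ?z x) * (norm (G x))\<^sup>2)"
    by (subst integral_mult_right_zero[symmetric]) (auto intro!: Bochner_Integration.integral_cong simp: field_simps)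
  ultimately show ?thesis by linarith
qed

end

subsection \<open>The nonlocal term\<close>

text \<open>The signed power \<open>|t|^(q - 1) t\<close>. With \<open>q = p - 1\<close> it is the
  nonlinearity \<open>|u|^(p - 2) u\<close>, written without the exponent \<open>p - 2\<close>,
  which is negative for \<open>p < 2\<close>.\<close>

definition spow :: "real \<Rightarrow> real \<Rightarrow> real" where
  "spow q t = sgn t * \<bar>t\<bar> powr q"

lemma spow_0 [simp]: "spow q 0 = 0"
  by (simp add: spow_def)

lemma continuous_on_spow:
  assumes "0 < q" shows "continuous_on S (spow q)"
proof -
  have "spow q = (\<lambda>t. max t 0 powr q - max (- t) 0 powr q)"
    by (auto simp: spow_def fun_eq_iff sgn_if max_def)
  moreover have "continuous_on S (\<lambda>t. max t 0 powr q - max (- t) 0 powr q)"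
    using assms by (intro continuous_on_diff continuous_on_powr' continuous_intros) auto
  ultimately show ?thesis by simp
qed

lemma spow_borel [measurable]: "spow q \<in> borel_measurable borel"
  unfolding spow_def[abs_def] by measurable

lemma has_derivative_abs_powr:
  assumes p: "1 < p"
  shows "((\<lambda>t. \<bar>t\<bar> powr p / p) has_real_derivative spow (p - 1) t) (at t)"
proof (cases t "0::real" rule: linorder_cases)
  case greater
  have "((\<lambda>t. t powr p / p) has_real_derivative spow (p - 1) t) (at t)"
    using greater p by (auto intro!: derivative_eq_intros simp: spow_def)
  then show ?thesis
    by (rule has_field_derivative_transform_within_open[of _ _ _ "{0<..}"]) (use greater in auto)
next
  case less
  have "((\<lambda>t. (- t) powr p / p) has_real_derivative spow (p - 1) t) (at t)"
    using less p by (auto intro!: derivative_eq_intros simp: spow_def)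
  then show ?thesis
    by (rule has_field_derivative_transform_within_open[of _ _ _ "{..<0}"]) (use less in auto)
next
  case equal
  have "((\<lambda>h. (\<bar>h\<bar> powr p / p - 0) / (h - 0)) \<longlongrightarrow> 0) (at 0)"
  proof (rule Lim_null_comparison)
    have "isCont (spow (p - 1)) 0"
      using continuous_on_spow[of "p - 1" UNIV] p by (simp add: continuous_on_eq_continuous_at)
    then have "((\<lambda>h. spow (p - 1) h) \<longlongrightarrow> 0) (at 0)" by (simp add: isCont_def)
    then show "((\<lambda>h. \<bar>spow (p - 1) h\<bar>) \<longlongrightarrow> 0) (at 0)" by (rule tendsto_rabs_zero)
    have "norm ((\<bar>h\<bar> powr p / p - 0) / (h - 0)) \<le> \<bar>spow (p - 1) h\<bar>" for h
    proof (cases "h = 0")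
      case False
      have "norm ((\<bar>h\<bar> powr p / p - 0) / (h - 0)) = \<bar>h\<bar> powr (p - 1) / p"
        using False p by (simp add: abs_mult powr_diff field_simps)
      also have "\<dots> \<le> \<bar>h\<bar> powr (p - 1)" using p by (simp add: divide_le_eq mult_le_cancel_left1)
      finally show ?thesis using False by (simp add: spow_def abs_mult)
    qed simp
    then show "\<forall>\<^sub>F h in at 0. norm ((\<bar>h\<bar> powr p / p - 0) / (h - 0)) \<le> \<bar>spow (p - 1) h\<bar>" by simp
  qed
  then show ?thesis using equal p by (simp add: has_field_derivative_iff)
qed

lemma AE_lborel_pair_neq: "AE z in lborel \<Otimes>\<^sub>M lborel. fst z \<noteq> (snd z :: 'a::euclidean_space)"
proof (rule lborel_pair.AE_pair_measure)
  have "Measurable.pred (lborel \<Otimes>\<^sub>M lborel) (\<lambda>z. fst z \<noteq> (snd z :: 'a))" by measurable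
  then show "{z \<in> space (lborel \<Otimes>\<^sub>M lborel). fst z \<noteq> (snd z :: 'a)} \<in> sets (lborel \<Otimes>\<^sub>M lborel)"
    by (simp add: pred_def)
  show "AE x in lborel. AE y in lborel. fst (x, y) \<noteq> (snd (x, y) :: 'a)"
    using AE_lborel_singleton by (auto simp: eq_commute)
qed

text \<open>A regularised Riesz kernel. For \<open>\<delta> > 0\<close> it is bounded and
  differentiable, so that \<open>radial_integration_by_parts\<close> accepts it as a multiplier;
  away from the origin it is dominated by \<open>norm z powr - s\<close> and tends to it as \<delta>
  tends to 0.\<close>

definition kreg :: "real \<Rightarrow> real \<Rightarrow> 'a::euclidean_space \<Rightarrow> real" where
  "kreg s \<delta> z = ((norm z)\<^sup>2 + \<delta>) powr (- s / 2)"

lemma kreg_borel [measurable]: "kreg s \<delta> \<in> borel_measurable borel"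
  unfolding kreg_def[abs_def] by measurable

lemma kreg_nonneg: "0 \<le> kreg s \<delta> z"
  by (simp add: kreg_def)

lemma kreg_0: "z \<noteq> 0 \<Longrightarrow> kreg s 0 z = norm z powr - s"
  by (simp add: kreg_def powr_powr flip: powr_numeral)

lemma kreg_le:
  assumes "0 \<le> s" "0 \<le> \<delta>" "z \<noteq> 0" shows "kreg s \<delta> z \<le> norm z powr - s"
proof -
  have "kreg s \<delta> z \<le> kreg s 0 z"
    unfolding kreg_def using assms by (intro powr_mono2') auto
  then show ?thesis using kreg_0[OF assms(3)] by simp
qed

lemma kreg_le_const:
  assumes "0 \<le> s" "0 < \<delta>" shows "kreg s \<delta> z \<le> \<delta> powr (- s / 2)"
  unfolding kreg_def using assms by (intro powr_mono2') auto

lemma tendsto_kreg: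
  assumes "z \<noteq> 0" "d \<longlonglongrightarrow> 0"
  shows "(\<lambda>n. kreg s (d n) z) \<longlonglongrightarrow> norm z powr - s"
proof -
  have "(\<lambda>n. ((norm z)\<^sup>2 + d n) powr (- s / 2)) \<longlonglongrightarrow> ((norm z)\<^sup>2 + 0) powr (- s / 2)"
    using assms by (intro tendsto_powr tendsto_intros) auto
  then show ?thesis using kreg_0[OF assms(1), of s] by (simp add: kreg_def)
qed

lemma norm_div_le:
  fixes a :: real
  assumes "0 \<le> a" "0 < \<delta>" shows "a / (a\<^sup>2 + \<delta>) \<le> 1 / sqrt \<delta>"
proof -
  have "0 \<le> (a - sqrt \<delta>)\<^sup>2" by simp
  then have "2 * (a * sqrt \<delta>) \<le> a\<^sup>2 + \<delta>" using assms by (simp add: power2_diff)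
  moreover have "0 \<le> a * sqrt \<delta>" using assms by simp
  ultimately have "a * sqrt \<delta> \<le> a\<^sup>2 + \<delta>" by linarith
  then show ?thesis using assms by (simp add: divide_simps add_pos_nonneg add_nonneg_pos)
qed

lemma has_derivative_kreg:
  assumes "0 < \<delta>"
  shows "((\<lambda>x. kreg s \<delta> (x - y)) has_derivative
     (\<lambda>h. (- s * kreg s \<delta> (x - y) / ((norm (x - y))\<^sup>2 + \<delta>)) * ((x - y) \<bullet> h))) (at x)"
proof -
  let ?g = "\<lambda>x. (norm (x - y))\<^sup>2 + \<delta>"
  have pos: "0 < ?g x" for x using assms by (simp add: add_nonneg_pos)
  have d1: "(?g has_derivative (\<lambda>h. 2 * ((x - y) \<bullet> h))) (at x)"
    unfolding power2_norm_eq_inner by (auto intro!: derivative_eq_intros simp: inner_commute)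
  have d2: "((\<lambda>t. t powr (- s / 2)) has_derivative (\<lambda>h. ((- s / 2) * ?g x powr (- s / 2 - 1)) * h)) (at (?g x))"
    using has_real_derivative_powr[OF pos[of x], of "- s / 2"] unfolding has_field_derivative_def .
  have "((\<lambda>x. kreg s \<delta> (x - y)) has_derivative (\<lambda>h. ((- s / 2) * ?g x powr (- s / 2 - 1)) * (2 * ((x - y) \<bullet> h)))) (at x)"
    unfolding kreg_def by (rule has_derivative_compose[OF d1 d2])
  moreover have "?g x powr (- s / 2 - 1) = kreg s \<delta> (x - y) / ?g x"
    using pos[of x] by (simp add: kreg_def powr_diff)
  ultimately show ?thesis by (simp add: mult_ac)
qed

text \<open>The derivative has norm at most \<open>gauss + 2 \<epsilon> |x|^2 gauss\<close>, hence
  at most \<open>1 + 2\<close>, for every \<epsilon>. Paired with \<open>x - y\<close> this yields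
  the factor \<open>|x - y|^2\<close> that compensates the derivative of the kernel after
  symmetrisation.\<close>

lemma gauss_scaleR_lipschitz:
  assumes e: "0 \<le> \<epsilon>"
  shows "norm (gauss \<epsilon> x *\<^sub>R x - gauss \<epsilon> y *\<^sub>R (y::'a::euclidean_space)) \<le> 3 * norm (x - y)"
proof (rule differentiable_bound[OF convex_UNIV])
  let ?D = "\<lambda>x h. gauss \<epsilon> x *\<^sub>R h + ((- 2 * \<epsilon> * gauss \<epsilon> x) * (x \<bullet> h)) *\<^sub>R x"
  fix x :: 'a
  have "(gauss \<epsilon> has_derivative (\<lambda>h. (- 2 * \<epsilon> * gauss \<epsilon> x) * (x \<bullet> h))) (at x)"
    unfolding gauss_def[abs_def] by (rule has_derivative_gauss)
  from has_derivative_scaleR[OF this has_derivative_ident]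
  show "((\<lambda>x. gauss \<epsilon> x *\<^sub>R x) has_derivative ?D x) (at x within UNIV)" by simp
  show "onorm (?D x) \<le> 3"
  proof (rule onorm_le)
    fix h
    have "norm (?D x h) \<le> gauss \<epsilon> x * norm h + 2 * \<epsilon> * gauss \<epsilon> x * \<bar>x \<bullet> h\<bar> * norm x"
      using norm_triangle_ineq[of "gauss \<epsilon> x *\<^sub>R h" "((- 2 * \<epsilon> * gauss \<epsilon> x) * (x \<bullet> h)) *\<^sub>R x"] gauss_pos[of \<epsilon> x] e
      by (simp add: abs_mult)
    also have "\<dots> \<le> 1 * norm h + 2 * \<epsilon> * gauss \<epsilon> x * (norm x * norm h) * norm x"
      using gauss_pos[of \<epsilon> x] e
      by (intro add_mono mult_right_mono mult_left_mono Cauchy_Schwarz_ineq2 gauss_le_1) auto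
    also have "\<dots> = norm h + 2 * (\<epsilon> * (norm x)\<^sup>2 * gauss \<epsilon> x) * norm h" by (simp add: power2_eq_square)
    also have "\<dots> \<le> norm h + 2 * 1 * norm h"
      by (intro add_mono mult_right_mono mult_left_mono norm_sq_gauss_le) auto
    finally show "norm (?D x h) \<le> 3 * norm h" by simp
  qed
qed auto

section \<open>Double integrals with the Riesz kernel\<close>

locale star_choquard = star_H10 \<Omega> U G \<phi>
  for \<Omega> :: "'a::euclidean_space set" and U :: "'a \<Rightarrow> real" and G :: "'a \<Rightarrow> 'a" and \<phi> :: "nat \<Rightarrow> 'a \<Rightarrow> real" +
  fixes \<alpha> p :: real
  assumes \<alpha>_pos: "0 < \<alpha>" and \<alpha>_less: "\<alpha> < real DIM('a)" and p_gt_1: "1 < p"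
    and U_Lq: "integrable lborel (\<lambda>x. \<bar>U x\<bar> powr (2 * p * real DIM('a) / (real DIM('a) + \<alpha>)))"
    and G_Lq: "integrable lborel (\<lambda>x. norm (G x) powr (2 * p * real DIM('a) / (real DIM('a) + \<alpha>)))"
begin

definition s :: real where "s = real DIM('a) - \<alpha>"
definition r :: real where "r = 2 * real DIM('a) / (real DIM('a) + \<alpha>)"
definition f :: "'a \<Rightarrow> real" where "f x = \<bar>U x\<bar> powr p"
text \<open>A single majorant for the energy density and for the radial derivative term. The Sobolev
  exponent of the theorem is \<open>p r\<close>, with \<open>r\<close> the diagonal
  Hardy-Littlewood-Sobolev exponent, so \<open>F\<close> lies in \<open>L^r\<close> and one
  application of that inequality dominates all double integrals.\<close>

definition F :: "'a \<Rightarrow> real" where "F x = \<bar>U x\<bar> powr p + norm (G x) powr p"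
definition k :: "'a \<Rightarrow> real" where "k z = norm z powr - s"

lemma s_pos: "0 < s" and r_gt_1: "1 < r"
  using \<alpha>_pos \<alpha>_less by (auto simp: s_def r_def)

lemma borel_defs [measurable]:
  "f \<in> borel_measurable borel" "F \<in> borel_measurable borel" "k \<in> borel_measurable borel"
  unfolding f_def F_def k_def by measurable

lemma F_nonneg: "0 \<le> F x" and f_nonneg: "0 \<le> f x" and f_le_F: "f x \<le> F x" and k_nonneg: "0 \<le> k z"
  by (auto simp: F_def f_def k_def)

lemma F_powr_r: "integrable lborel (\<lambda>x. F x powr r)"
proof (rule integrable_dominated)
  let ?q = "2 * p * real DIM('a) / (real DIM('a) + \<alpha>)"
  have q: "?q = p * r" by (simp add: r_def)
  show "integrable lborel (\<lambda>x. 2 powr r * (\<bar>U x\<bar> powr ?q + norm (G x) powr ?q))"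
    using U_Lq G_Lq by auto
  fix x
  define a b where "a = \<bar>U x\<bar> powr p" and "b = norm (G x) powr p"
  have ab: "0 \<le> a" "0 \<le> b" by (auto simp: a_def b_def)
  have "(a + b) powr r \<le> (2 * max a b) powr r"
    using ab r_gt_1 by (intro powr_mono2) (auto simp: max_def)
  also have "\<dots> = 2 powr r * (max a b powr r)" using ab by (simp add: powr_mult)
  also have "max a b powr r \<le> a powr r + b powr r" by (auto simp: max_def)
  finally show "\<bar>F x powr r\<bar> \<le> 2 powr r * (\<bar>U x\<bar> powr ?q + norm (G x) powr ?q)"
    unfolding F_def a_def b_def q powr_powr by simp
qed measurable

text \<open>Whichever of \<open>\<bar>U x\<bar>\<close> and \<open>norm (G x)\<close> is larger, its
  power \<open>p\<close> bounds \<open>\<bar>U x\<bar> powr (p - 1) * norm (G x)\<close>. The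
  remaining factor \<open>norm x\<close> is left to the Gaussian.\<close>

lemma spow_mult_le:
  "\<bar>spow (p - 1) (U x) * (G x \<bullet> x)\<bar> \<le> norm x * F x"
proof -
  have 1: "\<bar>U x\<bar> powr (p - 1) * norm (G x) \<le> F x"
  proof (cases "norm (G x) \<le> \<bar>U x\<bar>")
    case True
    have "\<bar>U x\<bar> powr (p - 1) * norm (G x) \<le> \<bar>U x\<bar> powr (p - 1) * \<bar>U x\<bar>" using True by (intro mult_left_mono) auto
    also have "\<dots> = \<bar>U x\<bar> powr p" by (cases "U x = 0") (auto simp: powr_diff)
    also have "\<dots> \<le> F x" by (simp add: F_def)
    finally show ?thesis .
  next
    case False
    have "\<bar>U x\<bar> powr (p - 1) * norm (G x) \<le> norm (G x) powr (p - 1) * norm (G x)"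
      using False p_gt_1 by (intro mult_right_mono powr_mono2) auto
    also have "\<dots> = norm (G x) powr p" by (cases "G x = 0") (auto simp: powr_diff)
    also have "\<dots> \<le> F x" by (simp add: F_def)
    finally show ?thesis .
  qed
  have "\<bar>spow (p - 1) (U x) * (G x \<bullet> x)\<bar> \<le> \<bar>U x\<bar> powr (p - 1) * (norm (G x) * norm x)"
    unfolding abs_mult by (intro mult_mono Cauchy_Schwarz_ineq2) (auto simp: spow_def abs_mult abs_sgn_eq)
  also have "\<dots> \<le> norm x * F x" using mult_left_mono[OF 1, of "norm x"] by (simp add: mult_ac)
  finally show ?thesis .
qed

lemma majorant_energy_integrable: "integrable (lborel \<Otimes>\<^sub>M lborel) (\<lambda>(y, x). F y * F x * k (x - y))"
proof -
  have "integrable (lborel \<Otimes>\<^sub>M lborel) (\<lambda>(y, x). F y * F x * norm (y - x) powr - s)"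
    unfolding s_def
    by (rule hardy_littlewood_sobolev_diagonal[OF \<alpha>_pos \<alpha>_less _ F_nonneg]) (use F_powr_r in \<open>auto simp: r_def\<close>)
  then show ?thesis by (simp add: k_def norm_minus_commute)
qed

text \<open>The bound is asked for off the diagonal, a null set, because on it \<open>k\<close>
  takes the default value \<open>0 powr - s = 0\<close> while the regularised kernel is
  positive.\<close>

lemma pair_dominated:
  assumes [measurable]: "H \<in> borel_measurable (lborel \<Otimes>\<^sub>M lborel)"
    and b: "\<And>x y. x \<noteq> y \<Longrightarrow> \<bar>H (y, x)\<bar> \<le> C * (F y * F x * k (x - y))"
  shows "integrable (lborel \<Otimes>\<^sub>M lborel) H"
proof (rule Bochner_Integration.integrable_bound)
  show "integrable (lborel \<Otimes>\<^sub>M lborel) (\<lambda>z. C * (case z of (y, x) \<Rightarrow> F y * F x * k (x - y)))"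
    by (intro integrable_mult_right majorant_energy_integrable)
  show "AE z in lborel \<Otimes>\<^sub>M lborel. norm (H z) \<le> norm (C * (case z of (y, x) \<Rightarrow> F y * F x * k (x - y)))"
    using AE_lborel_pair_neq
  proof eventually_elim
    case (elim z)
    then show ?case using b[of "snd z" "fst z"] by (auto simp: case_prod_beta)
  qed
qed measurable

lemma pair_tendsto:
  assumes [measurable]: "\<And>n. H n \<in> borel_measurable (lborel \<Otimes>\<^sub>M lborel)" "H' \<in> borel_measurable (lborel \<Otimes>\<^sub>M lborel)"
    and b: "\<And>n x y. x \<noteq> y \<Longrightarrow> \<bar>H n (y, x)\<bar> \<le> C * (F y * F x * k (x - y))"
    and l: "\<And>x y. x \<noteq> y \<Longrightarrow> (\<lambda>n. H n (y, x)) \<longlonglongrightarrow> H' (y, x)"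
  shows "(\<lambda>n. \<integral>z. H n z \<partial>(lborel \<Otimes>\<^sub>M lborel)) \<longlonglongrightarrow> (\<integral>z. H' z \<partial>(lborel \<Otimes>\<^sub>M lborel))"
proof (rule integral_dominated_convergence)
  show "integrable (lborel \<Otimes>\<^sub>M lborel) (\<lambda>z. C * (case z of (y, x) \<Rightarrow> F y * F x * k (x - y)))"
    by (intro integrable_mult_right majorant_energy_integrable)
  show "AE z in lborel \<Otimes>\<^sub>M lborel. (\<lambda>n. H n z) \<longlonglongrightarrow> H' z"
    using AE_lborel_pair_neq
  proof eventually_elim
    case (elim z)
    then show ?case using l[of "snd z" "fst z"] by simp
  qed
  show "AE z in lborel \<Otimes>\<^sub>M lborel. norm (H n z) \<le> C * (case z of (y, x) \<Rightarrow> F y * F x * k (x - y))" for n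
    using AE_lborel_pair_neq
  proof eventually_elim
    case (elim z)
    then show ?case using b[of "snd z" "fst z" n] by (simp add: case_prod_beta)
  qed
qed measurable

lemma F_le: "F x \<le> 1 + F x powr r"
proof (cases "F x \<le> 1")
  case False
  then have "F x powr 1 \<le> F x powr r" using r_gt_1 by (intro powr_mono) auto
  then show ?thesis using False by simp
qed (simp add: add_increasing2)

lemma gauss_F_integrable:
  assumes e: "0 < \<epsilon>" shows "integrable lborel (\<lambda>x. gauss \<epsilon> x * F x)"
proof (rule integrable_dominated[where g = "\<lambda>x. gauss \<epsilon> x + F x powr r"])
  fix x :: 'a
  have g: "0 \<le> gauss \<epsilon> x" "gauss \<epsilon> x \<le> 1" using gauss_pos[of \<epsilon> x] gauss_le_1[of \<epsilon> x] e by auto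
  have "gauss \<epsilon> x * F x \<le> gauss \<epsilon> x * (1 + F x powr r)" using g F_le by (intro mult_left_mono) auto
  also have "\<dots> \<le> gauss \<epsilon> x + F x powr r" using g by (simp add: distrib_left mult_left_le_one_le)
  finally show "\<bar>gauss \<epsilon> x * F x\<bar> \<le> gauss \<epsilon> x + F x powr r" using g F_nonneg[of x] by simp
qed (use integrable_gauss[OF e] F_powr_r in auto)


text \<open>For fixed \<open>y\<close> this is \<open>radial_integration_by_parts\<close> with the
  multiplier \<open>kreg s \<delta> (x - y) * gauss \<epsilon> x\<close> and
  \<open>\<Theta> t = \<bar>t\<bar> powr p / p\<close>. The two terms besides \<open>N\<close> are
  the radial derivatives of the Gaussian and of the kernel.\<close>

lemma regularised_identity:
  assumes e: "0 < \<epsilon>" and d: "0 < \<delta>"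
  shows "p * (LBINT x. kreg s \<delta> (x - y) * gauss \<epsilon> x * (spow (p - 1) (U x) * (G x \<bullet> x)))
     = - (LBINT x. (real DIM('a) - 2 * \<epsilon> * (norm x)\<^sup>2) * gauss \<epsilon> x * kreg s \<delta> (x - y) * f x
          - s * (gauss \<epsilon> x * (x \<bullet> (x - y)) * (kreg s \<delta> (x - y) / ((norm (x - y))\<^sup>2 + \<delta>)) * f x))"
proof -
  let ?N = "real DIM('a)"
  let ?z = "gauss \<epsilon> :: 'a \<Rightarrow> real" and ?h = "gauss (\<epsilon>/2) :: 'a \<Rightarrow> real"
  define K where "K x = kreg s \<delta> (x - y)" for x
  define K' where "K' x = K x / ((norm (x - y))\<^sup>2 + \<delta>)" for x
  define M where "M x = K x * ?z x" for x
  define DM where "DM x = (- s * ?z x * K' x) *\<^sub>R (x - y) - (2 * \<epsilon> * ?z x * K x) *\<^sub>R x" for x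
  define \<Theta> where "\<Theta> t = \<bar>t\<bar> powr p / p" for t
  have [measurable]: "K \<in> borel_measurable borel" "K' \<in> borel_measurable borel" "M \<in> borel_measurable borel"
    "DM \<in> borel_measurable borel" "\<Theta> \<in> borel_measurable borel"
    unfolding K'_def K_def M_def DM_def \<Theta>_def by measurable
  have pos: "0 < (norm (x - y))\<^sup>2 + \<delta>" for x using d by (simp add: add_nonneg_pos)
  have dM: "(M has_derivative (\<lambda>h. DM x \<bullet> h)) (at x)" for x
  proof -
    have d1: "(?z has_derivative (\<lambda>h. (- 2 * \<epsilon> * ?z x) * (x \<bullet> h))) (at x)"
      unfolding gauss_def[abs_def] by (rule has_derivative_gauss)
    have d2: "(K has_derivative (\<lambda>h. (- s * K x / ((norm (x - y))\<^sup>2 + \<delta>)) * ((x - y) \<bullet> h))) (at x)"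
      unfolding K_def[abs_def] by (rule has_derivative_kreg[OF d])
    show ?thesis unfolding M_def[abs_def]
      by (rule has_derivative_eq_rhs[OF has_derivative_mult[OF d2 d1]])
         (simp add: fun_eq_iff DM_def K'_def inner_diff_left algebra_simps diff_divide_distrib)
  qed
  have Kc: "continuous_on \<Omega> K" unfolding K_def[abs_def]
    by (intro continuous_at_imp_continuous_on ballI has_derivative_continuous[OF has_derivative_kreg[OF d]])
  have DMc: "continuous_on \<Omega> DM"
    unfolding DM_def K'_def gauss_def
    by (intro continuous_intros Kc) (use pos in \<open>auto simp: less_imp_neq[symmetric] dest: less_imp_neq\<close>)
  \<comment> \<open>Half of the Gaussian swallows \<open>norm x\<close> and its square. The
    constants are those of \<open>norm_gauss_le\<close> and \<open>norm_sq_gauss_le\<close> with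
    \<open>\<epsilon> / 2\<close> for \<epsilon>, and the other half makes \<open>F\<close>
    integrable.\<close>
  have z: "0 \<le> ?z x" "0 \<le> ?h x" "?z x \<le> ?h x" "norm x * ?z x \<le> (1 + 1/(\<epsilon>/2)) * ?h x" "(norm x)\<^sup>2 * ?z x \<le> (2/\<epsilon>) * ?h x" for x
  proof -
    have h: "?z x = ?h x * ?h x" by (rule gauss_half)
    have h1: "?h x \<le> 1" "0 \<le> ?h x" using gauss_le_1[of "\<epsilon>/2" x] gauss_pos[of "\<epsilon>/2" x] e by auto
    then show "0 \<le> ?h x" "0 \<le> ?z x" by (auto simp: h)
    show "?z x \<le> ?h x" unfolding h using h1 by (simp add: mult_left_le)
    have "norm x * ?z x = (norm x * ?h x) * ?h x" by (simp add: h)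
    also have "\<dots> \<le> (1 + 1/(\<epsilon>/2)) * ?h x" using h1 e by (intro mult_right_mono norm_gauss_le) auto
    finally show "norm x * ?z x \<le> (1 + 1/(\<epsilon>/2)) * ?h x" .
    have "(norm x)\<^sup>2 * ?z x = (2/\<epsilon>) * (\<epsilon>/2 * (norm x)\<^sup>2 * ?h x) * ?h x" using e by (simp add: h)
    also have "\<dots> \<le> (2/\<epsilon>) * 1 * ?h x" using h1 e by (intro mult_right_mono mult_left_mono norm_sq_gauss_le) auto
    finally show "(norm x)\<^sup>2 * ?z x \<le> (2/\<epsilon>) * ?h x" by simp
  qed
  define m where "m = \<delta> powr (- s / 2)"
  have K: "0 \<le> K x" "K x \<le> m" for x
    unfolding K_def m_def using kreg_nonneg kreg_le_const[OF less_imp_le[OF s_pos] d] by auto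
  have m0: "0 \<le> m" by (simp add: m_def)
  have K'b: "K' x * norm (x - y) \<le> m * (1 / sqrt \<delta>)" for x
  proof -
    have "K' x * norm (x - y) = K x * (norm (x - y) / ((norm (x - y))\<^sup>2 + \<delta>))" by (simp add: K'_def)
    also have "\<dots> \<le> m * (1 / sqrt \<delta>)" using K m0 d by (intro mult_mono norm_div_le) auto
    finally show ?thesis .
  qed
  have K'0: "0 \<le> K' x" for x unfolding K'_def using K pos[of x] by (simp add: less_imp_le)
  have hF: "integrable lborel (\<lambda>x. C * (?h x * F x))" for C
    by (intro integrable_mult_right gauss_F_integrable) (use e in simp)
  have i1: "integrable lborel (\<lambda>x. M x * \<Theta> (U x))"
  proof (rule integrable_dominated[OF hF[of "m/p"]])
    fix x
    have "\<bar>M x * \<Theta> (U x)\<bar> = (K x * ?z x) * (f x / p)" using K z p_gt_1 f_nonneg[of x] by (simp add: M_def \<Theta>_def f_def abs_mult)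
    also have "\<dots> \<le> (m * ?h x) * (F x / p)" using K z p_gt_1 m0 f_nonneg[of x] f_le_F[of x] by (intro mult_mono divide_right_mono) auto
    finally show "\<bar>M x * \<Theta> (U x)\<bar> \<le> m/p * (?h x * F x)" by simp
  qed measurable
  have i3: "integrable lborel (\<lambda>x. M x * spow (p - 1) (U x) * (G x \<bullet> x))"
  proof (rule integrable_dominated[OF hF[of "m * (1 + 1/(\<epsilon>/2))"]])
    fix x
    have "\<bar>M x * spow (p - 1) (U x) * (G x \<bullet> x)\<bar> = (K x * ?z x) * \<bar>spow (p - 1) (U x) * (G x \<bullet> x)\<bar>"
      using K z by (simp add: M_def abs_mult)
    also have "\<dots> \<le> (m * ?z x) * (norm x * F x)"
      using K z m0 spow_mult_le[of x] by (intro mult_mono) auto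
    also have "\<dots> = m * (norm x * ?z x) * F x" by simp
    also have "\<dots> \<le> m * ((1 + 1/(\<epsilon>/2)) * ?h x) * F x"
      using m0 z F_nonneg[of x] by (intro mult_right_mono mult_left_mono) auto
    finally show "\<bar>M x * spow (p - 1) (U x) * (G x \<bullet> x)\<bar> \<le> m * (1 + 1/(\<epsilon>/2)) * (?h x * F x)" by (simp add: mult_ac)
  qed measurable
  have i2: "integrable lborel (\<lambda>x. (DM x \<bullet> x) * \<Theta> (U x))"
  proof (rule integrable_dominated[OF hF[of "(s * (m * (1 / sqrt \<delta>)) * (1 + 1/(\<epsilon>/2)) + 2 * \<epsilon> * m * (2/\<epsilon>)) * (1/p)"]])
    fix x
    have "DM x \<bullet> x = - (s * ?z x * K' x * ((x - y) \<bullet> x)) - 2 * \<epsilon> * ?z x * K x * (x \<bullet> x)"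
      unfolding DM_def inner_diff_left[of "_ *\<^sub>R _"] by (simp add: mult.assoc)
    then have "\<bar>DM x \<bullet> x\<bar> \<le> \<bar>s * ?z x * K' x * ((x - y) \<bullet> x)\<bar> + \<bar>2 * \<epsilon> * ?z x * K x * (x \<bullet> x)\<bar>" by linarith
    also have "\<dots> \<le> s * ?z x * K' x * (norm (x - y) * norm x) + 2 * \<epsilon> * ?z x * K x * (norm x)\<^sup>2"
    proof (rule add_mono)
      have "\<bar>s * ?z x * K' x * ((x - y) \<bullet> x)\<bar> = s * ?z x * K' x * \<bar>(x - y) \<bullet> x\<bar>"
        using s_pos z[of x] K'0[of x] by (simp add: abs_mult)
      also have "\<dots> \<le> s * ?z x * K' x * (norm (x - y) * norm x)"
        using s_pos z[of x] K'0[of x] by (intro mult_left_mono Cauchy_Schwarz_ineq2) auto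
      finally show "\<bar>s * ?z x * K' x * ((x - y) \<bullet> x)\<bar> \<le> s * ?z x * K' x * (norm (x - y) * norm x)" .
      show "\<bar>2 * \<epsilon> * ?z x * K x * (x \<bullet> x)\<bar> \<le> 2 * \<epsilon> * ?z x * K x * (norm x)\<^sup>2"
        using e z[of x] K[of x] by (simp add: abs_mult power2_norm_eq_inner)
    qed
    also have "\<dots> = s * (K' x * norm (x - y)) * (norm x * ?z x) + 2 * \<epsilon> * K x * ((norm x)\<^sup>2 * ?z x)" by (simp add: mult_ac)
    also have "\<dots> \<le> s * (m * (1 / sqrt \<delta>)) * ((1 + 1/(\<epsilon>/2)) * ?h x) + 2 * \<epsilon> * m * ((2/\<epsilon>) * ?h x)"
    proof (rule add_mono)
      show "s * (K' x * norm (x - y)) * (norm x * ?z x) \<le> s * (m * (1 / sqrt \<delta>)) * ((1 + 1/(\<epsilon>/2)) * ?h x)"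
        by (rule mult_mono[OF mult_left_mono[OF K'b] z(4)]) (use s_pos m0 d z[of x] in auto)
      show "2 * \<epsilon> * K x * ((norm x)\<^sup>2 * ?z x) \<le> 2 * \<epsilon> * m * ((2/\<epsilon>) * ?h x)"
        by (rule mult_mono[OF mult_left_mono[OF K(2)] z(5)]) (use e m0 z[of x] in auto)
    qed
    finally have b: "\<bar>DM x \<bullet> x\<bar> \<le> (s * (m * (1 / sqrt \<delta>)) * (1 + 1/(\<epsilon>/2)) + 2 * \<epsilon> * m * (2/\<epsilon>)) * ?h x" (is "_ \<le> ?C * _")
      by (simp only: distrib_right mult.assoc)
    have C0: "0 \<le> ?C" using s_pos m0 d e by (intro add_nonneg_nonneg mult_nonneg_nonneg) auto
    have "\<bar>(DM x \<bullet> x) * \<Theta> (U x)\<bar> = \<bar>DM x \<bullet> x\<bar> * (f x / p)" using p_gt_1 f_nonneg[of x] by (simp add: abs_mult \<Theta>_def f_def)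
    also have "\<dots> \<le> (?C * ?h x) * (F x / p)"
      using b C0 z[of x] f_le_F[of x] f_nonneg[of x] p_gt_1 by (intro mult_mono divide_right_mono) auto
    finally show "\<bar>(DM x \<bullet> x) * \<Theta> (U x)\<bar> \<le> ?C * (1/p) * (?h x * F x)" by simp
  qed measurable
  have \<Theta>0: "x \<notin> \<Omega> \<Longrightarrow> \<Theta> (U x) = 0" "x \<notin> \<Omega> \<Longrightarrow> spow (p - 1) (U x) = 0" for x
    by (auto simp: U_outside \<Theta>_def)
  have ind: "indicator \<Omega> x * (a * \<Theta> (U x)) = a * \<Theta> (U x)"
    "indicator \<Omega> x * (a * spow (p - 1) (U x) * b) = a * spow (p - 1) (U x) * b" for x a b
    using \<Theta>0[of x] by (auto simp: indicator_def)
  have "(LBINT x. indicator \<Omega> x * (M x * spow (p - 1) (U x) * (G x \<bullet> x)))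
       = - (LBINT x. indicator \<Omega> x * ((?N * M x + DM x \<bullet> x) * \<Theta> (U x)))"
  proof (rule radial_integration_by_parts[OF dM DMc])
    show "(\<Theta> has_real_derivative spow (p - 1) t) (at t)" for t
      unfolding \<Theta>_def[abs_def] by (rule has_derivative_abs_powr[OF p_gt_1])
    show "continuous_on UNIV (spow (p - 1))" using p_gt_1 by (intro continuous_on_spow) simp
    show "\<Theta> 0 = 0" "0 \<le> \<Theta> t" for t using p_gt_1 by (auto simp: \<Theta>_def)
  qed (simp_all only: ind i1 i2 i3)
  then have eq: "(LBINT x. M x * spow (p - 1) (U x) * (G x \<bullet> x)) = - (LBINT x. (?N * M x + DM x \<bullet> x) * \<Theta> (U x))"
    unfolding ind .
  have pt: "p * ((?N * M x + DM x \<bullet> x) * \<Theta> (U x)) = (?N - 2 * \<epsilon> * (norm x)\<^sup>2) * ?z x * kreg s \<delta> (x - y) * f x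
          - s * (?z x * (x \<bullet> (x - y)) * (kreg s \<delta> (x - y) / ((norm (x - y))\<^sup>2 + \<delta>)) * f x)" for x
  proof -
    have dmx: "DM x \<bullet> x = - (s * ?z x * K' x * (x \<bullet> (x - y))) - 2 * \<epsilon> * ?z x * K x * (norm x)\<^sup>2"
      unfolding DM_def inner_diff_left[of "_ *\<^sub>R _"] power2_norm_eq_inner by (simp add: mult.assoc inner_commute)
    have "p * \<Theta> (U x) = f x" using p_gt_1 by (simp add: \<Theta>_def f_def)
    then have pf: "p * ((?N * M x + DM x \<bullet> x) * \<Theta> (U x)) = (?N * M x + DM x \<bullet> x) * f x" by (simp add: mult.left_commute)
    have alg: "(n * (\<kappa> * z) + (- (s * z * \<kappa>' * i) - 2 * \<epsilon> * z * \<kappa> * q)) * g = (n - 2 * \<epsilon> * q) * z * \<kappa> * g - s * (z * i * \<kappa>' * g)"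
      for n \<kappa> \<kappa>' z i q g :: real by (simp add: algebra_simps)
    show ?thesis unfolding pf unfolding dmx M_def K_def[symmetric] K'_def[symmetric] by (rule alg)
  qed
  have "p * (LBINT x. M x * spow (p - 1) (U x) * (G x \<bullet> x)) = - (LBINT x. p * ((?N * M x + DM x \<bullet> x) * \<Theta> (U x)))"
    unfolding eq by simp
  then show ?thesis unfolding pt unfolding M_def K_def by (simp add: mult.assoc)
qed

text \<open>The identity for fixed \<open>y\<close> is integrated against \<open>f y\<close>. In the
  term with the derivative of the kernel, exchanging \<open>x\<close> and \<open>y\<close> flips the
  sign of \<open>x - y\<close>, so averaging both versions replaces the Gaussian-weighted
  \<open>x\<close> by half the difference of the weighted \<open>x\<close> and \<open>y\<close>.
  This is of size \<open>|x - y|\<close>, and \<delta> can tend to 0 under the majorant.\<close>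

lemma choquard_identity:
  assumes e: "0 < \<epsilon>"
  shows "integrable (lborel \<Otimes>\<^sub>M lborel) (\<lambda>(y, x). f y * (k (x - y) * gauss \<epsilon> x * (spow (p - 1) (U x) * (G x \<bullet> x))))"
    and "p * (\<integral>(y, x). f y * (k (x - y) * gauss \<epsilon> x * (spow (p - 1) (U x) * (G x \<bullet> x))) \<partial>(lborel \<Otimes>\<^sub>M lborel))
     = - (\<integral>(y, x). f y * f x * k (x - y) * ((real DIM('a) - 2 * \<epsilon> * (norm x)\<^sup>2) * gauss \<epsilon> x
          - s / 2 * ((gauss \<epsilon> x *\<^sub>R x - gauss \<epsilon> y *\<^sub>R y) \<bullet> (x - y)) / (norm (x - y))\<^sup>2) \<partial>(lborel \<Otimes>\<^sub>M lborel))"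
proof -
  let ?N = "real DIM('a)"
  let ?z = "gauss \<epsilon> :: 'a \<Rightarrow> real"
  let ?P = "lborel \<Otimes>\<^sub>M lborel :: ('a \<times> 'a) measure"
  define h where "h x = spow (p - 1) (U x) * (G x \<bullet> x)" for x
  have [measurable]: "h \<in> borel_measurable borel" unfolding h_def by measurable
  have z: "0 \<le> ?z x" "?z x \<le> 1" "norm x * ?z x \<le> 1 + 1/\<epsilon>" "\<bar>(?N - 2 * \<epsilon> * (norm x)\<^sup>2) * ?z x\<bar> \<le> ?N + 2" for x
  proof -
    show z1: "0 \<le> ?z x" "?z x \<le> 1" "norm x * ?z x \<le> 1 + 1/\<epsilon>"
      using gauss_pos[of \<epsilon> x] gauss_le_1[of \<epsilon> x] norm_gauss_le[OF e, of x] e by auto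
    have "(?N - 2 * \<epsilon> * (norm x)\<^sup>2) * ?z x = ?N * ?z x - 2 * (\<epsilon> * (norm x)\<^sup>2 * ?z x)" by (simp add: algebra_simps)
    moreover have "0 \<le> \<epsilon> * (norm x)\<^sup>2 * ?z x" using z1 e by simp
    moreover have "0 \<le> ?N * ?z x" "?N * ?z x \<le> ?N" using z1 by (auto simp: mult_left_le)
    ultimately show "\<bar>(?N - 2 * \<epsilon> * (norm x)\<^sup>2) * ?z x\<bar> \<le> ?N + 2" using norm_sq_gauss_le[of \<epsilon> x] by linarith
  qed
  have zh: "\<bar>?z x * h x\<bar> \<le> (1 + 1/\<epsilon>) * F x" for x
  proof -
    have "\<bar>?z x * h x\<bar> \<le> ?z x * (norm x * F x)"
      unfolding abs_mult[of "?z x"] h_def using z spow_mult_le[of x] by (intro mult_mono) auto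
    also have "\<dots> \<le> (1 + 1/\<epsilon>) * F x" using mult_right_mono[OF z(3)[of x] F_nonneg[of x]] by (simp add: mult_ac)
    finally show ?thesis .
  qed
  define A where "A \<delta> = (\<lambda>(y, x). f y * (kreg s \<delta> (x - y) * ?z x * h x))" for \<delta>
  define A0 where "A0 = (\<lambda>(y, x). f y * (k (x - y) * ?z x * h x))"
  define B where "B \<delta> = (\<lambda>(y, x). f y * f x * (kreg s \<delta> (x - y) * ((?N - 2 * \<epsilon> * (norm x)\<^sup>2) * ?z x)))" for \<delta>
  define B0 where "B0 = (\<lambda>(y, x). f y * f x * (k (x - y) * ((?N - 2 * \<epsilon> * (norm x)\<^sup>2) * ?z x)))"
  define D where "D \<delta> = (\<lambda>(y, x). f y * (?z x * (x \<bullet> (x - y)) * (kreg s \<delta> (x - y) / ((norm (x - y))\<^sup>2 + \<delta>)) * f x))" for \<delta>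
  define E where "E \<delta> = (\<lambda>(y, x). f y * f x * (kreg s \<delta> (x - y) * (((?z x *\<^sub>R x - ?z y *\<^sub>R y) \<bullet> (x - y)) / ((norm (x - y))\<^sup>2 + \<delta>))))" for \<delta>
  define E0 where "E0 = (\<lambda>(y, x). f y * f x * (k (x - y) * (((?z x *\<^sub>R x - ?z y *\<^sub>R y) \<bullet> (x - y)) / (norm (x - y))\<^sup>2)))"
  have [measurable]: "A \<delta> \<in> borel_measurable ?P" "A0 \<in> borel_measurable ?P" "B \<delta> \<in> borel_measurable ?P"
    "B0 \<in> borel_measurable ?P" "D \<delta> \<in> borel_measurable ?P" "E \<delta> \<in> borel_measurable ?P" "E0 \<in> borel_measurable ?P" for \<delta>
    unfolding A_def A0_def B_def B0_def D_def E_def E0_def by measurable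
  have kk: "0 \<le> kreg s \<delta> z" "z \<noteq> 0 \<Longrightarrow> 0 \<le> \<delta> \<Longrightarrow> kreg s \<delta> z \<le> k z" for \<delta> and z :: 'a
    using kreg_nonneg kreg_le[OF less_imp_le[OF s_pos]] unfolding k_def by auto
  have bA: "\<bar>A \<delta> (y, x)\<bar> \<le> (1 + 1/\<epsilon>) * (F y * F x * k (x - y))" if "x \<noteq> y" "0 \<le> \<delta>" for \<delta> x y
  proof -
    have "\<bar>A \<delta> (y, x)\<bar> = f y * kreg s \<delta> (x - y) * \<bar>?z x * h x\<bar>" unfolding A_def using f_nonneg[of y] kk by (simp add: abs_mult)
    also have "\<dots> \<le> F y * k (x - y) * ((1 + 1/\<epsilon>) * F x)"
      using that kk zh[of x] f_nonneg[of y] f_le_F[of y] F_nonneg[of y] k_nonneg[of "x - y"] by (intro mult_mono) auto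
    finally show ?thesis by (simp add: mult_ac)
  qed
  have bA0: "\<bar>A0 (y, x)\<bar> \<le> (1 + 1/\<epsilon>) * (F y * F x * k (x - y))" for x y
  proof -
    have "\<bar>A0 (y, x)\<bar> = f y * k (x - y) * \<bar>?z x * h x\<bar>" unfolding A0_def using f_nonneg[of y] k_nonneg by (simp add: abs_mult)
    also have "\<dots> \<le> F y * k (x - y) * ((1 + 1/\<epsilon>) * F x)"
      using zh[of x] f_nonneg[of y] f_le_F[of y] F_nonneg[of y] k_nonneg[of "x - y"] by (intro mult_mono) auto
    finally show ?thesis by (simp add: mult_ac)
  qed
  have fF: "0 \<le> f y * f x" "f y * f x \<le> F y * F x" for x y
    using f_nonneg f_le_F F_nonneg by (auto intro!: mult_mono)
  have gen: "\<bar>f y * f x * (kreg s \<delta> (x - y) * c)\<bar> \<le> C * (F y * F x * k (x - y))" if "x \<noteq> y" "0 \<le> \<delta>" "\<bar>c\<bar> \<le> C" for x y c C \<delta>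
  proof -
    have "\<bar>f y * f x * (kreg s \<delta> (x - y) * c)\<bar> = (f y * f x) * (kreg s \<delta> (x - y) * \<bar>c\<bar>)"
      using f_nonneg kk by (simp add: abs_mult)
    also have "\<dots> \<le> (F y * F x) * (k (x - y) * C)"
      using that kk f_le_F f_nonneg F_nonneg k_nonneg by (intro mult_mono mult_nonneg_nonneg) auto
    finally show ?thesis by (simp add: mult_ac)
  qed
  have bB: "\<bar>B \<delta> (y, x)\<bar> \<le> (?N + 2) * (F y * F x * k (x - y))" if "x \<noteq> y" "0 \<le> \<delta>" for \<delta> x y
    unfolding B_def using gen[OF that z(4)] by simp
  have bE: "\<bar>E \<delta> (y, x)\<bar> \<le> 3 * (F y * F x * k (x - y))" if "x \<noteq> y" "0 \<le> \<delta>" for \<delta> x y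
  proof -
    have n: "0 < (norm (x - y))\<^sup>2" using that by simp
    have "\<bar>(?z x *\<^sub>R x - ?z y *\<^sub>R y) \<bullet> (x - y)\<bar> \<le> 3 * norm (x - y) * norm (x - y)"
      by (rule order_trans[OF Cauchy_Schwarz_ineq2 mult_right_mono[OF gauss_scaleR_lipschitz]]) (use e in auto)
    also have "\<dots> \<le> 3 * ((norm (x - y))\<^sup>2 + \<delta>)" using that by (simp add: power2_eq_square)
    finally have "\<bar>((?z x *\<^sub>R x - ?z y *\<^sub>R y) \<bullet> (x - y)) / ((norm (x - y))\<^sup>2 + \<delta>)\<bar> \<le> 3"
      using n that by (simp add: abs_div_pos[symmetric] divide_le_eq add_pos_nonneg)
    from gen[OF that this] show ?thesis unfolding E_def by simp
  qed
  \<comment> \<open>This bound degenerates as \<delta> tends to 0. It provides integrability for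
    fixed \<delta>, enough to exchange the variables and pass to \<open>E\<close>, whose bound is
    uniform.\<close>
  have bD: "\<bar>D \<delta> (y, x)\<bar> \<le> ((1 + 1/\<epsilon>) * (1 / sqrt \<delta>)) * (F y * F x * k (x - y))" if "x \<noteq> y" "0 < \<delta>" for \<delta> x y
  proof -
    have "\<bar>(?z x * (x \<bullet> (x - y))) / ((norm (x - y))\<^sup>2 + \<delta>)\<bar> \<le> (?z x * norm x) * (norm (x - y) / ((norm (x - y))\<^sup>2 + \<delta>))"
    proof -
      have "\<bar>?z x * (x \<bullet> (x - y))\<bar> \<le> ?z x * (norm x * norm (x - y))"
        unfolding abs_mult using z by (intro mult_mono Cauchy_Schwarz_ineq2) auto
      then show ?thesis using that by (simp add: abs_mult divide_right_mono add_nonneg_pos mult.assoc)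
    qed
    also have "\<dots> \<le> (1 + 1/\<epsilon>) * (1 / sqrt \<delta>)"
      using z[of x] that e by (intro mult_mono norm_div_le) (auto simp: mult.commute)
    finally have "\<bar>(?z x * (x \<bullet> (x - y))) / ((norm (x - y))\<^sup>2 + \<delta>)\<bar> \<le> (1 + 1/\<epsilon>) * (1 / sqrt \<delta>)" .
    from gen[OF that(1) less_imp_le[OF that(2)] this] show ?thesis unfolding D_def by (simp add: mult_ac)
  qed
  have iA: "integrable ?P (A \<delta>)" and iB: "integrable ?P (B \<delta>)" and iE: "integrable ?P (E \<delta>)" if "0 \<le> \<delta>" for \<delta>
    by (rule pair_dominated[OF _ bA], measurable, use that in simp)
       (rule pair_dominated[OF _ bB], measurable, use that in simp, rule pair_dominated[OF _ bE], measurable, use that in simp)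
  have iD: "integrable ?P (D \<delta>)" if "0 < \<delta>" for \<delta>
    by (rule pair_dominated[OF _ bD]) (use that in auto)
  show "integrable ?P (\<lambda>(y, x). f y * (k (x - y) * ?z x * (spow (p - 1) (U x) * (G x \<bullet> x))))"
    using pair_dominated[OF _ bA0] unfolding A0_def h_def by simp
  have swap: "(\<integral>z. D \<delta> z \<partial>?P) = (\<integral>z. E \<delta> z \<partial>?P) / 2" if d: "0 < \<delta>" for \<delta>
  proof -
    have "(\<integral>z. D \<delta> z \<partial>?P) = (\<integral>(x, y). D \<delta> (y, x) \<partial>?P)"
      by (rule lborel_pair.integral_product_swap[symmetric]) measurable
    moreover have iD': "integrable ?P (\<lambda>(x, y). D \<delta> (y, x))"
      by (rule lborel_pair.integrable_product_swap[OF iD[OF d]])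
    ultimately have "2 * (\<integral>z. D \<delta> z \<partial>?P) = (\<integral>z. D \<delta> z + (case z of (x, y) \<Rightarrow> D \<delta> (y, x)) \<partial>?P)"
      using iD[OF d] by simp
    also have "\<dots> = (\<integral>z. E \<delta> z \<partial>?P)"
    proof (rule Bochner_Integration.integral_cong[OF refl])
      fix w :: "'a \<times> 'a"
      obtain y x where w: "w = (y, x)" by (cases w)
      define q where "q = kreg s \<delta> (x - y) / ((norm (x - y))\<^sup>2 + \<delta>)"
      have q': "kreg s \<delta> (y - x) / ((norm (y - x))\<^sup>2 + \<delta>) = q"
        unfolding q_def kreg_def by (simp add: norm_minus_commute)
      have "D \<delta> (y, x) = f y * f x * q * (?z x * (x \<bullet> (x - y)))" unfolding D_def q_def by (simp add: mult_ac)
      moreover have "D \<delta> (x, y) = f y * f x * q * (?z y * (y \<bullet> (y - x)))" unfolding D_def q'[symmetric] by (simp add: mult_ac)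
      moreover have "E \<delta> (y, x) = f y * f x * q * ((?z x *\<^sub>R x - ?z y *\<^sub>R y) \<bullet> (x - y))" unfolding E_def q_def by (simp add: mult_ac)
      moreover have "?z x * (x \<bullet> (x - y)) + ?z y * (y \<bullet> (y - x)) = (?z x *\<^sub>R x - ?z y *\<^sub>R y) \<bullet> (x - y)"
        by (simp add: inner_diff_left inner_diff_right algebra_simps)
      ultimately show "D \<delta> w + (case w of (x, y) \<Rightarrow> D \<delta> (y, x)) = E \<delta> w" unfolding w by (simp flip: distrib_left)
    qed
    finally show ?thesis by simp
  qed
  have id\<delta>: "p * (\<integral>z. A \<delta> z \<partial>?P) = - ((\<integral>z. B \<delta> z \<partial>?P) - s / 2 * (\<integral>z. E \<delta> z \<partial>?P))" if d: "0 < \<delta>" for \<delta>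
  proof -
    have "p * (\<integral>z. A \<delta> z \<partial>?P) = (LBINT y. f y * (p * (LBINT x. kreg s \<delta> (x - y) * ?z x * h x)))"
    proof -
      have "(\<integral>z. A \<delta> z \<partial>?P) = (LBINT y. f y * (LBINT x. kreg s \<delta> (x - y) * ?z x * h x))"
        using lborel_pair.integral_fst'[OF iA[of \<delta>]] d unfolding A_def by simp
      then have "p * (\<integral>z. A \<delta> z \<partial>?P) = (LBINT y. p * (f y * (LBINT x. kreg s \<delta> (x - y) * ?z x * h x)))"
        by (simp only: integral_mult_right_zero)
      then show ?thesis by (simp only: mult.left_commute)
    qed
    also have "\<dots> = (LBINT y. - (LBINT x. B \<delta> (y, x) - s * D \<delta> (y, x)))"
    proof (rule Bochner_Integration.integral_cong[OF refl])
      fix y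
      have "f y * (p * (LBINT x. kreg s \<delta> (x - y) * ?z x * h x))
        = - (f y * (LBINT x. (?N - 2 * \<epsilon> * (norm x)\<^sup>2) * ?z x * kreg s \<delta> (x - y) * f x
          - s * (?z x * (x \<bullet> (x - y)) * (kreg s \<delta> (x - y) / ((norm (x - y))\<^sup>2 + \<delta>)) * f x)))"
        unfolding h_def regularised_identity[OF e d, of y] by simp
      also have "\<dots> = - (LBINT x. f y * ((?N - 2 * \<epsilon> * (norm x)\<^sup>2) * ?z x * kreg s \<delta> (x - y) * f x
          - s * (?z x * (x \<bullet> (x - y)) * (kreg s \<delta> (x - y) / ((norm (x - y))\<^sup>2 + \<delta>)) * f x)))"
        by simp
      also have "(\<lambda>x. f y * ((?N - 2 * \<epsilon> * (norm x)\<^sup>2) * ?z x * kreg s \<delta> (x - y) * f x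
          - s * (?z x * (x \<bullet> (x - y)) * (kreg s \<delta> (x - y) / ((norm (x - y))\<^sup>2 + \<delta>)) * f x))) = (\<lambda>x. B \<delta> (y, x) - s * D \<delta> (y, x))"
        unfolding B_def D_def by (simp add: fun_eq_iff right_diff_distrib mult_ac)
      finally show "f y * (p * (LBINT x. kreg s \<delta> (x - y) * ?z x * h x)) = - (LBINT x. B \<delta> (y, x) - s * D \<delta> (y, x))" .
    qed
    also have "\<dots> = - (\<integral>z. B \<delta> z - s * D \<delta> z \<partial>?P)"
      using lborel_pair.integral_fst'[of "\<lambda>z. B \<delta> z - s * D \<delta> z"] iB[of \<delta>] iD[OF d] d by simp
    also have "\<dots> = - ((\<integral>z. B \<delta> z \<partial>?P) - s * (\<integral>z. D \<delta> z \<partial>?P))" using iB[of \<delta>] iD[OF d] d by simp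
    finally show ?thesis unfolding swap[OF d] by simp
  qed
  define dl where "dl n = 1 / real (Suc n)" for n
  have dl: "dl \<longlonglongrightarrow> 0" "0 < dl n" "0 \<le> dl n" for n
    unfolding dl_def using LIMSEQ_Suc[OF lim_1_over_n] by auto
  have lk: "(\<lambda>n. kreg s (dl n) z) \<longlonglongrightarrow> k z" if "z \<noteq> 0" for z :: 'a
    unfolding k_def by (rule tendsto_kreg[OF that dl(1)])
  have lA: "(\<lambda>n. \<integral>z. A (dl n) z \<partial>?P) \<longlonglongrightarrow> (\<integral>z. A0 z \<partial>?P)"
    by (rule pair_tendsto[OF _ _ bA[OF _ dl(3)]], measurable) (auto simp: A_def A0_def intro!: tendsto_intros lk)
  have lB: "(\<lambda>n. \<integral>z. B (dl n) z \<partial>?P) \<longlonglongrightarrow> (\<integral>z. B0 z \<partial>?P)"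
    by (rule pair_tendsto[OF _ _ bB[OF _ dl(3)]], measurable) (auto simp: B_def B0_def intro!: tendsto_intros lk)
  have lE: "(\<lambda>n. \<integral>z. E (dl n) z \<partial>?P) \<longlonglongrightarrow> (\<integral>z. E0 z \<partial>?P)"
  proof (rule pair_tendsto[OF _ _ bE[OF _ dl(3)]])
    fix x y :: 'a assume xy: "x \<noteq> y"
    have "(\<lambda>n. (norm (x - y))\<^sup>2 + dl n) \<longlonglongrightarrow> (norm (x - y))\<^sup>2 + 0" by (intro tendsto_intros dl)
    then have "(\<lambda>n. ((?z x *\<^sub>R x - ?z y *\<^sub>R y) \<bullet> (x - y)) / ((norm (x - y))\<^sup>2 + dl n)) \<longlonglongrightarrow> ((?z x *\<^sub>R x - ?z y *\<^sub>R y) \<bullet> (x - y)) / (norm (x - y))\<^sup>2"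
      using xy by (intro tendsto_divide tendsto_const) auto
    then show "(\<lambda>n. E (dl n) (y, x)) \<longlonglongrightarrow> E0 (y, x)"
      unfolding E_def E0_def prod.case using xy by (intro tendsto_mult tendsto_const lk) auto
  qed measurable
  have "(\<lambda>n. p * (\<integral>z. A (dl n) z \<partial>?P)) \<longlonglongrightarrow> p * (\<integral>z. A0 z \<partial>?P)" by (intro tendsto_intros lA)
  moreover have "(\<lambda>n. p * (\<integral>z. A (dl n) z \<partial>?P)) \<longlonglongrightarrow> - ((\<integral>z. B0 z \<partial>?P) - s / 2 * (\<integral>z. E0 z \<partial>?P))"
    unfolding id\<delta>[OF dl(2)] by (intro tendsto_intros lB lE)
  ultimately have "p * (\<integral>z. A0 z \<partial>?P) = - ((\<integral>z. B0 z \<partial>?P) - s / 2 * (\<integral>z. E0 z \<partial>?P))"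
    by (rule LIMSEQ_unique)
  also have "(\<integral>z. B0 z \<partial>?P) - s / 2 * (\<integral>z. E0 z \<partial>?P) = (\<integral>z. B0 z - s / 2 * E0 z \<partial>?P)"
  proof -
    have "\<bar>B0 (y, x)\<bar> \<le> (?N + 2) * (F y * F x * k (x - y))" "\<bar>E0 (y, x)\<bar> \<le> 3 * (F y * F x * k (x - y))" if "x \<noteq> y" for x y
      using bB[OF that, of 0] bE[OF that, of 0] that unfolding B_def B0_def E_def E0_def by (simp_all add: kreg_0 k_def)
    then have "integrable ?P B0" "integrable ?P E0" by (auto intro!: pair_dominated)
    then show ?thesis by simp
  qed
  also have "(\<lambda>z. B0 z - s / 2 * E0 z) = (\<lambda>(y, x). f y * f x * k (x - y) * ((?N - 2 * \<epsilon> * (norm x)\<^sup>2) * ?z x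
          - s / 2 * ((?z x *\<^sub>R x - ?z y *\<^sub>R y) \<bullet> (x - y)) / (norm (x - y))\<^sup>2))"
    unfolding B0_def E0_def by (auto simp: fun_eq_iff right_diff_distrib mult_ac)
  finally show "p * (\<integral>(y, x). f y * (k (x - y) * ?z x * (spow (p - 1) (U x) * (G x \<bullet> x))) \<partial>?P)
     = - (\<integral>(y, x). f y * f x * k (x - y) * ((?N - 2 * \<epsilon> * (norm x)\<^sup>2) * ?z x
          - s / 2 * ((?z x *\<^sub>R x - ?z y *\<^sub>R y) \<bullet> (x - y)) / (norm (x - y))\<^sup>2) \<partial>?P)"
    unfolding A0_def h_def .
qed

end

lemma tendsto_gauss_0: "d \<longlonglongrightarrow> 0 \<Longrightarrow> (\<lambda>n. gauss (d n) x) \<longlonglongrightarrow> 1"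
  unfolding gauss_def by (auto intro!: tendsto_eq_intros)

section \<open>Pohozaev's inequality for solutions\<close>

locale choquard_solution =
  star_H2 \<Omega> U G \<phi> L + star_choquard \<Omega> U G \<phi> \<alpha> p
  for \<Omega> :: "'a::euclidean_space set" and U :: "'a \<Rightarrow> real" and G :: "'a \<Rightarrow> 'a" and \<phi> :: "nat \<Rightarrow> 'a \<Rightarrow> real"
    and L :: "'a \<Rightarrow> real" and \<alpha> p :: real +
  fixes V :: "'a \<Rightarrow> real" and gradV :: "'a \<Rightarrow> 'a" and cR :: real
  assumes V_deriv: "\<And>x. x \<in> \<Omega> \<Longrightarrow> (V has_derivative (\<lambda>h. gradV x \<bullet> h)) (at x)"
    and gradV_cont: "continuous_on \<Omega> gradV"
    and UV: "integrable lborel (\<lambda>x. indicator \<Omega> x * ((U x)\<^sup>2 * V x))"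
    and UGV: "integrable lborel (\<lambda>x. indicator \<Omega> x * ((U x)\<^sup>2 * (gradV x \<bullet> x)))"
    and equation: "AE x in lborel. x \<in> \<Omega> \<longrightarrow>
        - L x + V x * U x = cR * (LBINT y. k (x - y) * f y) * spow (p - 1) (U x)"
begin

definition g :: "'a \<Rightarrow> real" where "g x = (LBINT y. k (x - y) * f y)"

definition D0 :: real where "D0 = (\<integral>(y, x). f y * f x * k (x - y) \<partial>(lborel \<Otimes>\<^sub>M lborel))"

lemma g_borel [measurable]: "g \<in> borel_measurable borel"
  unfolding g_def by measurable

lemma riesz_energy_integrable: "integrable (lborel \<Otimes>\<^sub>M lborel) (\<lambda>(y, x). f y * f x * k (x - y))"
proof (rule pair_dominated[where C = 1])
  fix x y
  have "f y * f x * k (x - y) \<le> F y * F x * k (x - y)"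
    using f_nonneg f_le_F F_nonneg k_nonneg by (intro mult_right_mono mult_mono) auto
  then show "\<bar>case (y, x) of (y, x) \<Rightarrow> f y * f x * k (x - y)\<bar> \<le> 1 * (F y * F x * k (x - y))"
    using f_nonneg[of x] f_nonneg[of y] k_nonneg[of "x - y"] by (simp add: abs_mult)
qed measurable

lemma riesz_potential_energy: "integrable lborel (\<lambda>x. g x * f x)" "(LBINT x. g x * f x) = D0"
proof -
  have e: "(LBINT y. f y * f x * k (x - y)) = g x * f x" for x
  proof -
    have "(LBINT y. f y * f x * k (x - y)) = (LBINT y. f x * (k (x - y) * f y))"
      by (rule Bochner_Integration.integral_cong) (auto simp: mult_ac)
    then show ?thesis by (simp add: g_def)
  qed
  show "integrable lborel (\<lambda>x. g x * f x)"
    using lborel_pair.integrable_snd[OF riesz_energy_integrable] by (simp add: e)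
  show "(LBINT x. g x * f x) = D0"
    using lborel_pair.integral_snd[OF riesz_energy_integrable] by (simp add: e D0_def)
qed

lemma riesz_potential_radial:
  assumes e: "0 < \<epsilon>"
  shows "integrable lborel (\<lambda>x. g x * (gauss \<epsilon> x * (spow (p - 1) (U x) * (G x \<bullet> x))))"
    and "(LBINT x. g x * (gauss \<epsilon> x * (spow (p - 1) (U x) * (G x \<bullet> x))))
      = (\<integral>(y, x). f y * (k (x - y) * gauss \<epsilon> x * (spow (p - 1) (U x) * (G x \<bullet> x))) \<partial>(lborel \<Otimes>\<^sub>M lborel))"
proof -
  let ?h = "\<lambda>x. spow (p - 1) (U x) * (G x \<bullet> x)"
  have eq: "(LBINT y. f y * (k (x - y) * gauss \<epsilon> x * ?h x)) = g x * (gauss \<epsilon> x * ?h x)" for x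
  proof -
    have "(LBINT y. f y * (k (x - y) * gauss \<epsilon> x * ?h x)) = (LBINT y. (gauss \<epsilon> x * ?h x) * (k (x - y) * f y))"
      by (rule Bochner_Integration.integral_cong) (auto simp: mult_ac)
    also have "\<dots> = (gauss \<epsilon> x * ?h x) * g x" unfolding g_def by (rule integral_mult_right_zero)
    finally show ?thesis by (simp add: mult_ac)
  qed
  show "integrable lborel (\<lambda>x. g x * (gauss \<epsilon> x * ?h x))"
    using lborel_pair.integrable_snd[OF choquard_identity(1)[OF e]] by (simp only: eq)
  show "(LBINT x. g x * (gauss \<epsilon> x * ?h x)) = (\<integral>(y, x). f y * (k (x - y) * gauss \<epsilon> x * ?h x) \<partial>(lborel \<Otimes>\<^sub>M lborel))"
    using lborel_pair.integral_snd[OF choquard_identity(1)[OF e]] by (simp only: eq)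
qed

lemma equation': "AE x in lborel. x \<in> \<Omega> \<longrightarrow> V x * U x = L x + cR * g x * spow (p - 1) (U x)"
  using equation by eventually_elim (auto simp: g_def)

lemma Vc: "continuous_on \<Omega> V"
  using V_deriv has_derivative_continuous continuous_at_imp_continuous_on by blast

text \<open>Continuity of \<open>V\<close> is known on \<Omega> only and its values elsewhere are
  arbitrary, so measurability is always claimed together with the indicator.\<close>

lemma V_borel [measurable]: "(\<lambda>x. indicator \<Omega> x * V x) \<in> borel_measurable borel"
  using borel_measurable_continuous_on_indicator[OF \<Omega>_borel Vc] by simp

text \<open>The equation multiplied by \<open>U\<close>. It expresses the double integral through
  the gradient and potential terms and so eliminates it from the final inequality.\<close>

lemma energy: "(LBINT x. (norm (G x))\<^sup>2) + (LBINT x. indicator \<Omega> x * ((U x)\<^sup>2 * V x)) = cR * D0"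
proof -
  have i: "integrable lborel (\<lambda>x. L x * U x)" by (rule integrable_mult_L2[OF _ _ L_L2 U_L2]) measurable
  have "(LBINT x. indicator \<Omega> x * ((U x)\<^sup>2 * V x)) = (LBINT x. L x * U x + cR * (g x * f x))"
  proof (rule integral_cong_AE)
    show "AE x in lborel. indicator \<Omega> x * ((U x)\<^sup>2 * V x) = L x * U x + cR * (g x * f x)"
      using equation'
    proof eventually_elim
      case (elim x)
      show ?case
      proof (cases "x \<in> \<Omega>")
        case True
        then have "(V x * U x) * U x = (L x + cR * g x * spow (p - 1) (U x)) * U x" using elim by simp
        moreover have "spow (p - 1) (U x) * U x = f x"
          by (cases "U x = 0") (auto simp: spow_def f_def powr_diff sgn_if)
        ultimately show ?thesis using True by (simp add: power2_eq_square algebra_simps)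
      qed (auto simp: U_outside f_def)
    qed
  qed (use UV in auto)
  also have "\<dots> = (LBINT x. L x * U x) + cR * D0" using i riesz_potential_energy by simp
  finally show ?thesis using energy_identity by simp
qed

text \<open>The equation exchanges the Laplacian term for the nonlocal term and \<open>V U\<close>,
  both tested with the Gaussian-weighted radial derivative. The one with \<open>V U\<close> is then
  evaluated by \<open>radial_integration_by_parts\<close> with the multiplier
  \<open>gauss \<epsilon> x * V x\<close> and \<open>\<Theta> t = t^2 / 2\<close>.\<close>

lemma potential_identity:
  assumes e: "0 < \<epsilon>"
  shows "- (LBINT x. L x * gauss \<epsilon> x * (G x \<bullet> x)) =
     cR * (LBINT x. g x * (gauss \<epsilon> x * (spow (p - 1) (U x) * (G x \<bullet> x))))
     + 1/2 * (LBINT x. gauss \<epsilon> x * (real DIM('a) * (indicator \<Omega> x * ((U x)\<^sup>2 * V x)) + indicator \<Omega> x * ((U x)\<^sup>2 * (gradV x \<bullet> x)))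
            - 2 * (\<epsilon> * (norm x)\<^sup>2 * gauss \<epsilon> x) * (indicator \<Omega> x * ((U x)\<^sup>2 * V x)))"
proof -
  let ?z = "gauss \<epsilon> :: 'a \<Rightarrow> real"
  let ?N = "real DIM('a)"
  define M where "M x = ?z x * V x" for x
  define DM where "DM x = ?z x *\<^sub>R gradV x - (2 * \<epsilon> * ?z x * V x) *\<^sub>R x" for x
  have z: "0 \<le> ?z x" "?z x \<le> 1" "\<bar>\<epsilon> * (norm x)\<^sup>2 * ?z x\<bar> \<le> 1" for x
    using gauss_pos[of \<epsilon> x] gauss_le_1[of \<epsilon> x] norm_sq_gauss_le[of \<epsilon> x] e by (auto simp: abs_mult)
  have dM: "(M has_derivative (\<lambda>h. DM x \<bullet> h)) (at x)" if "x \<in> \<Omega>" for x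
  proof -
    have d1: "(?z has_derivative (\<lambda>h. (- 2 * \<epsilon> * ?z x) * (x \<bullet> h))) (at x)"
      unfolding gauss_def[abs_def] by (rule has_derivative_gauss)
    show ?thesis unfolding M_def[abs_def]
      by (rule has_derivative_eq_rhs[OF has_derivative_mult[OF d1 V_deriv[OF that]]])
         (simp add: fun_eq_iff DM_def inner_diff_left algebra_simps)
  qed
  have DMc: "continuous_on \<Omega> DM"
    unfolding DM_def gauss_def by (intro continuous_intros gradV_cont Vc)
  have j1: "integrable lborel (\<lambda>x. ?z x * (indicator \<Omega> x * ((U x)\<^sup>2 * V x)))"
    "integrable lborel (\<lambda>x. ?z x * (indicator \<Omega> x * ((U x)\<^sup>2 * (gradV x \<bullet> x))))"
    "integrable lborel (\<lambda>x. (\<epsilon> * (norm x)\<^sup>2 * ?z x) * (indicator \<Omega> x * ((U x)\<^sup>2 * V x)))"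
    by (rule integrable_bounded_mult[OF UV, of _ 1], measurable, use z in simp)
       (rule integrable_bounded_mult[OF UGV, of _ 1], measurable, use z in simp,
        rule integrable_bounded_mult[OF UV, of _ 1], measurable, use z in simp)
  have Lw: "integrable lborel (\<lambda>x. L x * (?z x * (G x \<bullet> x)))"
    by (rule integrable_mult_L2[OF _ _ L_L2 gauss_radial_L2[OF e]]) measurable
  have rhs: "integrable lborel (\<lambda>x. L x * (?z x * (G x \<bullet> x)) + cR * (g x * (?z x * (spow (p - 1) (U x) * (G x \<bullet> x)))))"
    using Lw riesz_potential_radial(1)[OF e] by auto
  \<comment> \<open>Integrability of \<open>V U (G . x)\<close> is not among the hypotheses on
    \<open>V\<close>. The left side is integrable, its first term as a product of square integrable
    functions and its second by \<open>riesz_potential_radial\<close>, and the equation identifies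
    the two sides.\<close>
  have ae: "AE x in lborel. L x * (?z x * (G x \<bullet> x)) + cR * (g x * (?z x * (spow (p - 1) (U x) * (G x \<bullet> x))))
      = indicator \<Omega> x * (M x * U x * (G x \<bullet> x))"
    using equation'
  proof eventually_elim
    case (elim x)
    show ?case
    proof (cases "x \<in> \<Omega>")
      case True
      then have "(V x * U x) * (?z x * (G x \<bullet> x)) = (L x + cR * g x * spow (p - 1) (U x)) * (?z x * (G x \<bullet> x))" using elim by simp
      then show ?thesis using True unfolding M_def by (simp add: algebra_simps)
    qed (auto simp: G_outside)
  qed
  have meas: "(\<lambda>x. indicator \<Omega> x * (M x * U x * (G x \<bullet> x))) \<in> borel_measurable lborel"
  proof -
    have "(\<lambda>x. indicator \<Omega> x * (M x * U x * (G x \<bullet> x))) = (\<lambda>x. ?z x * (indicator \<Omega> x * V x) * U x * (G x \<bullet> x))"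
      by (simp add: fun_eq_iff M_def mult_ac)
    then show ?thesis by simp
  qed
  have i3: "integrable lborel (\<lambda>x. indicator \<Omega> x * (M x * U x * (G x \<bullet> x)))"
    using integrable_cong_AE[OF borel_measurable_integrable[OF rhs] meas ae] rhs by simp
  have I3: "(LBINT x. indicator \<Omega> x * (M x * U x * (G x \<bullet> x))) = (LBINT x. L x * (?z x * (G x \<bullet> x)))
      + cR * (LBINT x. g x * (?z x * (spow (p - 1) (U x) * (G x \<bullet> x))))"
    using integral_cong_AE[OF borel_measurable_integrable[OF rhs] meas ae] Lw riesz_potential_radial(1)[OF e] by simp
  have DMx: "DM x \<bullet> x = ?z x * (gradV x \<bullet> x) - 2 * (\<epsilon> * (norm x)\<^sup>2 * ?z x) * V x" for x
    unfolding DM_def power2_norm_eq_inner by (simp add: inner_diff_left algebra_simps)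
  have q1: "indicator \<Omega> x * (M x * ((U x)\<^sup>2 / 2)) = 1/2 * (?z x * (indicator \<Omega> x * ((U x)\<^sup>2 * V x)))" for x
    unfolding M_def by (simp add: mult_ac)
  have q2: "indicator \<Omega> x * ((DM x \<bullet> x) * ((U x)\<^sup>2 / 2)) = 1/2 * (?z x * (indicator \<Omega> x * ((U x)\<^sup>2 * (gradV x \<bullet> x)))
      - 2 * ((\<epsilon> * (norm x)\<^sup>2 * ?z x) * (indicator \<Omega> x * ((U x)\<^sup>2 * V x))))" for x
    unfolding DMx by (simp add: algebra_simps)
  have "(LBINT x. indicator \<Omega> x * (M x * U x * (G x \<bullet> x)))
     = - (LBINT x. indicator \<Omega> x * ((?N * M x + DM x \<bullet> x) * ((U x)\<^sup>2 / 2)))"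
  proof (rule radial_integration_by_parts[where \<Theta> = "\<lambda>t. t\<^sup>2 / 2" and \<Theta>' = "\<lambda>t. t", OF dM DMc])
    show "((\<lambda>t. t\<^sup>2 / 2) has_real_derivative t) (at t)" for t :: real
      by (auto intro!: derivative_eq_intros)
    show "integrable lborel (\<lambda>x. indicator \<Omega> x * (M x * ((U x)\<^sup>2 / 2)))" unfolding q1 using j1 by auto
    show "integrable lborel (\<lambda>x. indicator \<Omega> x * ((DM x \<bullet> x) * ((U x)\<^sup>2 / 2)))" unfolding q2 using j1 by auto
    show "integrable lborel (\<lambda>x. indicator \<Omega> x * (M x * U x * (G x \<bullet> x)))" by (rule i3)
  qed auto
  moreover have "(LBINT x. indicator \<Omega> x * ((?N * M x + DM x \<bullet> x) * ((U x)\<^sup>2 / 2)))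
     = 1/2 * (LBINT x. ?z x * (?N * (indicator \<Omega> x * ((U x)\<^sup>2 * V x)) + indicator \<Omega> x * ((U x)\<^sup>2 * (gradV x \<bullet> x)))
            - 2 * (\<epsilon> * (norm x)\<^sup>2 * ?z x) * (indicator \<Omega> x * ((U x)\<^sup>2 * V x)))"
    unfolding integral_mult_right_zero[symmetric]
    by (rule Bochner_Integration.integral_cong[OF refl]) (simp add: M_def DMx algebra_simps)
  ultimately show ?thesis using I3 by (simp add: mult.assoc)
qed

text \<open>As \<epsilon> tends to 0 the bracket of \<open>choquard_identity\<close> tends to
  \<open>N - s / 2\<close>, which equals \<open>(N + \<alpha>) / 2\<close> because
  \<open>s = N - \<alpha>\<close>.\<close>

lemma choquard_limit:
  assumes d: "d \<longlonglongrightarrow> 0" "\<And>n. 0 < d n"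
  shows "(\<lambda>n. p * (LBINT x. g x * (gauss (d n) x * (spow (p - 1) (U x) * (G x \<bullet> x))))) \<longlonglongrightarrow> - ((real DIM('a) + \<alpha>) / 2 * D0)"
proof -
  let ?N = "real DIM('a)"
  define H where "H \<epsilon> = (\<lambda>(y, x). f y * f x * k (x - y) * ((?N - 2 * \<epsilon> * (norm x)\<^sup>2) * gauss \<epsilon> x
          - s / 2 * ((gauss \<epsilon> x *\<^sub>R x - gauss \<epsilon> y *\<^sub>R y) \<bullet> (x - y)) / (norm (x - y))\<^sup>2))" for \<epsilon>
  have [measurable]: "H \<epsilon> \<in> borel_measurable (lborel \<Otimes>\<^sub>M lborel)" for \<epsilon> unfolding H_def by measurable
  have "(\<lambda>n. \<integral>z. H (d n) z \<partial>(lborel \<Otimes>\<^sub>M lborel)) \<longlonglongrightarrow> (\<integral>z. (case z of (y, x) \<Rightarrow> f y * f x * k (x - y) * (?N - s / 2)) \<partial>(lborel \<Otimes>\<^sub>M lborel))"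
  \<comment> \<open>A bound uniform in \<epsilon>: \<open>N + 2\<close> for the first part of the
    bracket, by \<open>norm_sq_gauss_le\<close>, and \<open>s / 2\<close> times the Lipschitz
    constant 3 for the second.\<close>
  proof (rule pair_tendsto[where C = "?N + 2 + 3 * s / 2"])
    fix n and x y :: 'a assume xy: "x \<noteq> y"
    let ?e = "d n"
    have e: "0 < ?e" by (rule d)
    have "(?N - 2 * ?e * (norm x)\<^sup>2) * gauss ?e x = ?N * gauss ?e x - 2 * (?e * (norm x)\<^sup>2 * gauss ?e x)" by (simp add: algebra_simps)
    moreover have "0 \<le> ?e * (norm x)\<^sup>2 * gauss ?e x" using e gauss_pos[of ?e x] by simp
    moreover have "0 \<le> ?N * gauss ?e x" "?N * gauss ?e x \<le> ?N"
      using gauss_le_1[of ?e x] gauss_pos[of ?e x] e by (auto simp: mult_left_le)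
    ultimately have b1: "\<bar>(?N - 2 * ?e * (norm x)\<^sup>2) * gauss ?e x\<bar> \<le> ?N + 2" using norm_sq_gauss_le[of ?e x] by linarith
    have "\<bar>(gauss ?e x *\<^sub>R x - gauss ?e y *\<^sub>R y) \<bullet> (x - y)\<bar> \<le> 3 * norm (x - y) * norm (x - y)"
      by (rule order_trans[OF Cauchy_Schwarz_ineq2 mult_right_mono[OF gauss_scaleR_lipschitz]]) (use e in auto)
    then have b2: "\<bar>((gauss ?e x *\<^sub>R x - gauss ?e y *\<^sub>R y) \<bullet> (x - y)) / (norm (x - y))\<^sup>2\<bar> \<le> 3"
      using xy by (simp add: abs_div_pos[symmetric] divide_le_eq power2_eq_square)
    have b3: "\<bar>s / 2 * ((gauss ?e x *\<^sub>R x - gauss ?e y *\<^sub>R y) \<bullet> (x - y)) / (norm (x - y))\<^sup>2\<bar> \<le> s / 2 * 3"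
      using mult_left_mono[OF b2, of "s/2"] s_pos by (simp add: abs_mult)
    have "\<bar>(?N - 2 * ?e * (norm x)\<^sup>2) * gauss ?e x - s / 2 * ((gauss ?e x *\<^sub>R x - gauss ?e y *\<^sub>R y) \<bullet> (x - y)) / (norm (x - y))\<^sup>2\<bar> \<le> ?N + 2 + 3 * s / 2" (is "\<bar>?c\<bar> \<le> ?C")
      using b1 b3 by linarith
    then have "(f y * f x) * k (x - y) * \<bar>?c\<bar> \<le> (F y * F x) * k (x - y) * ?C"
      using f_nonneg f_le_F F_nonneg k_nonneg by (intro mult_mono mult_nonneg_nonneg) auto
    then show "\<bar>H ?e (y, x)\<bar> \<le> ?C * (F y * F x * k (x - y))"
      unfolding H_def using f_nonneg[of x] f_nonneg[of y] k_nonneg[of "x - y"] by (simp add: abs_mult mult_ac)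
  next
    fix x y :: 'a assume xy: "x \<noteq> y"
    have g1: "(\<lambda>n. gauss (d n) z) \<longlonglongrightarrow> 1" for z :: 'a by (rule tendsto_gauss_0[OF d(1)])
    have l1: "(\<lambda>n. (?N - 2 * d n * (norm x)\<^sup>2) * gauss (d n) x) \<longlonglongrightarrow> (?N - 2 * 0 * (norm x)\<^sup>2) * 1"
      by (intro tendsto_intros d g1)
    have "(\<lambda>n. ((gauss (d n) x *\<^sub>R x - gauss (d n) y *\<^sub>R y) \<bullet> (x - y))) \<longlonglongrightarrow> (1 *\<^sub>R x - 1 *\<^sub>R y) \<bullet> (x - y)"
      by (intro tendsto_intros g1)
    then have l2: "(\<lambda>n. s / 2 * ((gauss (d n) x *\<^sub>R x - gauss (d n) y *\<^sub>R y) \<bullet> (x - y)) / (norm (x - y))\<^sup>2) \<longlonglongrightarrow> s / 2 * ((1 *\<^sub>R x - 1 *\<^sub>R y) \<bullet> (x - y)) / (norm (x - y))\<^sup>2"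
      using xy by (intro tendsto_divide tendsto_mult tendsto_const) auto
    have n: "s / 2 * ((1 *\<^sub>R x - 1 *\<^sub>R y) \<bullet> (x - y)) / (norm (x - y))\<^sup>2 = s / 2"
      using xy by (simp add: power2_norm_eq_inner)
    show "(\<lambda>n. H (d n) (y, x)) \<longlonglongrightarrow> (case (y, x) of (y, x) \<Rightarrow> f y * f x * k (x - y) * (?N - s / 2))"
      unfolding H_def prod.case using tendsto_mult[OF tendsto_const tendsto_diff[OF l1 l2], of "f y * f x * k (x - y)"]
      unfolding n by simp
  qed measurable
  moreover have "(\<integral>z. (case z of (y, x) \<Rightarrow> f y * f x * k (x - y) * (?N - s / 2)) \<partial>(lborel \<Otimes>\<^sub>M lborel)) = (?N + \<alpha>) / 2 * D0"
  proof -
    have "?N - s / 2 = (?N + \<alpha>) / 2" by (simp add: s_def field_simps)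
    then have "(\<lambda>z. (case z of (y, x) \<Rightarrow> f y * f x * k (x - y) * (?N - s / 2))) = (\<lambda>z. (?N + \<alpha>) / 2 * (case z of (y, x) \<Rightarrow> f y * f x * k (x - y)))"
      by (auto simp: fun_eq_iff)
    then show ?thesis unfolding D0_def by simp
  qed
  ultimately have "(\<lambda>n. - (\<integral>z. H (d n) z \<partial>(lborel \<Otimes>\<^sub>M lborel))) \<longlonglongrightarrow> - ((?N + \<alpha>) / 2 * D0)"
    using tendsto_minus by fastforce
  moreover have "p * (LBINT x. g x * (gauss (d n) x * (spow (p - 1) (U x) * (G x \<bullet> x)))) = - (\<integral>z. H (d n) z \<partial>(lborel \<Otimes>\<^sub>M lborel))" for n
    unfolding riesz_potential_radial(2)[OF d(2)] choquard_identity(2)[OF d(2)] H_def ..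
  ultimately show ?thesis by simp
qed

text \<open>For each \<epsilon> the Laplacian term is bounded above by
  \<open>pohozaev_inequality_laplacian\<close> and evaluated by \<open>potential_identity\<close>.
  After the limit the double integral is removed by \<open>energy\<close>, which contributes the
  same amount \<open>- (N + \<alpha>) / (2 p)\<close> to both coefficients.\<close>

theorem pohozaev_inequality:
  "((real DIM('a) - 2) / 2 - (real DIM('a) + \<alpha>) / (2 * p)) * (LBINT x. (norm (G x))\<^sup>2)
   + (real DIM('a) / 2 - (real DIM('a) + \<alpha>) / (2 * p)) * (LBINT x. indicator \<Omega> x * ((U x)\<^sup>2 * V x))
   + 1/2 * (LBINT x. indicator \<Omega> x * ((U x)\<^sup>2 * (gradV x \<bullet> x))) \<le> 0"
proof -
  let ?N = "real DIM('a)"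
  define d where "d n = 1 / real (Suc n)" for n
  have d: "d \<longlonglongrightarrow> 0" "0 < d n" for n
    unfolding d_def using LIMSEQ_Suc[OF lim_1_over_n] by auto
  define I where "I n = (LBINT x. g x * (gauss (d n) x * (spow (p - 1) (U x) * (G x \<bullet> x))))" for n
  define a where "a x = indicator \<Omega> x * ((U x)\<^sup>2 * V x)" for x
  define b where "b x = indicator \<Omega> x * ((U x)\<^sup>2 * (gradV x \<bullet> x))" for x
  have ai: "integrable lborel a" and bi: "integrable lborel b" using UV UGV unfolding a_def b_def by auto
  have [measurable]: "a \<in> borel_measurable borel" "b \<in> borel_measurable borel" using ai bi by auto
  define R where "R n = (LBINT x. gauss (d n) x * (?N * a x + b x) - 2 * (d n * (norm x)\<^sup>2 * gauss (d n) x) * a x)" for n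
  define Q where "Q n = (LBINT x. ((1 - ?N / 2 + d n * (norm x)\<^sup>2) * gauss (d n) x) * (norm (G x))\<^sup>2)" for n
  have ineq: "cR * I n + 1/2 * R n \<le> Q n" for n
    using pohozaev_inequality_laplacian[OF d(2)[of n]] unfolding potential_identity[OF d(2)[of n]] I_def R_def Q_def a_def b_def .
  have "(\<lambda>n. 1/p * (p * I n)) \<longlonglongrightarrow> 1/p * (- ((?N + \<alpha>) / 2 * D0))"
    unfolding I_def by (intro tendsto_mult tendsto_const choquard_limit d)
  then have lI: "I \<longlonglongrightarrow> - ((?N + \<alpha>) / (2 * p) * D0)" using p_gt_1 by (simp add: field_simps)
  have z: "0 \<le> gauss (d n) x" "gauss (d n) x \<le> 1" "0 \<le> d n * (norm x)\<^sup>2 * gauss (d n) x" "d n * (norm x)\<^sup>2 * gauss (d n) x \<le> 1" for n and x :: 'a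
    using gauss_pos[of "d n" x] gauss_le_1[of "d n" x] norm_sq_gauss_le[of "d n" x] d(2)[of n] by auto
  have lg: "(\<lambda>n. gauss (d n) x) \<longlonglongrightarrow> 1" for x :: 'a by (rule tendsto_gauss_0[OF d(1)])
  have lg2: "(\<lambda>n. d n * (norm x)\<^sup>2 * gauss (d n) x) \<longlonglongrightarrow> 0" for x :: 'a
    using tendsto_mult[OF tendsto_mult[OF d(1) tendsto_const] lg, of "(norm x)\<^sup>2" x] by simp
  have lR: "R \<longlonglongrightarrow> (LBINT x. ?N * a x + b x)"
    unfolding R_def
  proof (rule integral_dominated_convergence[where w = "\<lambda>x. (?N + 2) * \<bar>a x\<bar> + \<bar>b x\<bar>"])
    show "AE x in lborel. (\<lambda>n. gauss (d n) x * (?N * a x + b x) - 2 * (d n * (norm x)\<^sup>2 * gauss (d n) x) * a x) \<longlonglongrightarrow> ?N * a x + b x"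
    proof (rule AE_I2)
      fix x :: 'a
      have "(\<lambda>n. gauss (d n) x * (?N * a x + b x) - 2 * (d n * (norm x)\<^sup>2 * gauss (d n) x) * a x) \<longlonglongrightarrow> 1 * (?N * a x + b x) - 2 * 0 * a x"
        by (intro tendsto_diff tendsto_mult tendsto_const lg lg2)
      then show "(\<lambda>n. gauss (d n) x * (?N * a x + b x) - 2 * (d n * (norm x)\<^sup>2 * gauss (d n) x) * a x) \<longlonglongrightarrow> ?N * a x + b x" by simp
    qed
    show "AE x in lborel. norm (gauss (d n) x * (?N * a x + b x) - 2 * (d n * (norm x)\<^sup>2 * gauss (d n) x) * a x) \<le> (?N + 2) * \<bar>a x\<bar> + \<bar>b x\<bar>" for n
    proof (rule AE_I2)
      fix x :: 'a
      have "\<bar>gauss (d n) x * (?N * a x + b x)\<bar> \<le> 1 * (?N * \<bar>a x\<bar> + \<bar>b x\<bar>)"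
        unfolding abs_mult[of "gauss _ _"] using z[of n x] by (intro mult_mono order_trans[OF abs_triangle_ineq]) (auto simp: abs_mult)
      moreover have "\<bar>(2 * (d n * (norm x)\<^sup>2 * gauss (d n) x)) * a x\<bar> \<le> 2 * \<bar>a x\<bar>"
        unfolding abs_mult[of "2 * _"] using z[of n x] by (intro mult_right_mono) auto
      ultimately have "\<bar>gauss (d n) x * (?N * a x + b x) - 2 * (d n * (norm x)\<^sup>2 * gauss (d n) x) * a x\<bar>
         \<le> 1 * (?N * \<bar>a x\<bar> + \<bar>b x\<bar>) + 2 * \<bar>a x\<bar>"
        by (rule order_trans[OF abs_triangle_ineq4 add_mono])
      then show "norm (gauss (d n) x * (?N * a x + b x) - 2 * (d n * (norm x)\<^sup>2 * gauss (d n) x) * a x) \<le> (?N + 2) * \<bar>a x\<bar> + \<bar>b x\<bar>"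
        by (simp add: distrib_right)
    qed
  qed (use ai bi in auto)
  have lQ: "Q \<longlonglongrightarrow> (LBINT x. (1 - ?N / 2) * (norm (G x))\<^sup>2)"
    unfolding Q_def
  proof (rule integral_dominated_convergence[where w = "\<lambda>x. (2 + ?N) * (norm (G x))\<^sup>2"])
    show "AE x in lborel. (\<lambda>n. ((1 - ?N / 2 + d n * (norm x)\<^sup>2) * gauss (d n) x) * (norm (G x))\<^sup>2) \<longlonglongrightarrow> (1 - ?N / 2) * (norm (G x))\<^sup>2"
    proof (rule AE_I2)
      fix x :: 'a
      have "(\<lambda>n. ((1 - ?N / 2) * gauss (d n) x + d n * (norm x)\<^sup>2 * gauss (d n) x) * (norm (G x))\<^sup>2) \<longlonglongrightarrow> ((1 - ?N / 2) * 1 + 0) * (norm (G x))\<^sup>2"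
        by (intro tendsto_add tendsto_mult tendsto_const lg lg2)
      then show "(\<lambda>n. ((1 - ?N / 2 + d n * (norm x)\<^sup>2) * gauss (d n) x) * (norm (G x))\<^sup>2) \<longlonglongrightarrow> (1 - ?N / 2) * (norm (G x))\<^sup>2"
        by (simp add: distrib_right)
    qed
    show "AE x in lborel. norm (((1 - ?N / 2 + d n * (norm x)\<^sup>2) * gauss (d n) x) * (norm (G x))\<^sup>2) \<le> (2 + ?N) * (norm (G x))\<^sup>2" for n
    proof (rule AE_I2)
      fix x :: 'a
      have X: "\<bar>(1 - ?N / 2) * gauss (d n) x\<bar> \<le> (1 + ?N / 2) * 1"
        unfolding abs_mult using z[of n x] by (intro mult_mono) auto
      have alg: "\<bar>X + Y\<bar> \<le> 2 + ?N" if "\<bar>X\<bar> \<le> (1 + ?N / 2) * 1" "0 \<le> Y" "Y \<le> 1" for X Y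
        using that by simp
      have "\<bar>(1 - ?N / 2 + d n * (norm x)\<^sup>2) * gauss (d n) x\<bar> \<le> 2 + ?N"
        unfolding distrib_right[of "1 - ?N / 2"] by (rule alg[OF X z(3,4)])
      then show "norm (((1 - ?N / 2 + d n * (norm x)\<^sup>2) * gauss (d n) x) * (norm (G x))\<^sup>2) \<le> (2 + ?N) * (norm (G x))\<^sup>2"
        unfolding real_norm_def abs_mult[of _ "(norm (G x))\<^sup>2"] abs_power2 by (rule mult_right_mono) simp
    qed
  qed (use G_L2 in auto)
  have "cR * (- ((?N + \<alpha>) / (2 * p) * D0)) + 1/2 * (LBINT x. ?N * a x + b x) \<le> (LBINT x. (1 - ?N / 2) * (norm (G x))\<^sup>2)"
    by (rule LIMSEQ_le[OF tendsto_add[OF tendsto_mult[OF tendsto_const lI] tendsto_mult[OF tendsto_const lR]] lQ])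
       (intro exI[of _ 0] allI impI ineq)
  then have "- ((?N + \<alpha>) / (2 * p) * (cR * D0)) + 1/2 * (?N * (LBINT x. a x) + (LBINT x. b x)) \<le> (1 - ?N / 2) * (LBINT x. (norm (G x))\<^sup>2)"
    using ai bi by (simp add: mult_ac)
  \<comment> \<open>Here \<open>q\<close> is \<open>(N + \<alpha>) / (2 p)\<close>, and
    \<open>A + B\<close> is the double integral as rewritten by \<open>energy\<close>.\<close>
  moreover have alg: "((n - 2) / 2 - q) * A + (n / 2 - q) * B + 1/2 * C \<le> 0"
    if "- (q * (A + B)) + 1/2 * (n * B + C) \<le> (1 - n / 2) * A" for n q A B C :: real
    using that by (simp add: algebra_simps add_divide_distrib diff_divide_distrib)
  ultimately show ?thesis
    unfolding energy[symmetric] a_def b_def by (intro alg) simp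
qed

end

subsection \<open>Passage to Borel representatives\<close>

text \<open>The hypotheses concern Lebesgue measurable functions, whereas dilations, polar
  coordinates and Fubini are carried out above for Borel functions. Replacing each function by a
  Borel one that vanishes off \<Omega> bridges the gap, since only equality almost everywhere
  matters.\<close>

lemma borel_representative:
  fixes u :: "'a::euclidean_space \<Rightarrow> real"
  assumes "u \<in> borel_measurable (lebesgue_on \<Omega>)" "open \<Omega>"
  obtains v where "v \<in> borel_measurable borel" "\<And>x. x \<notin> \<Omega> \<Longrightarrow> v x = 0" "AE x in lborel. x \<in> \<Omega> \<longrightarrow> v x = u x"
proof -
  have [measurable]: "\<Omega> \<in> sets borel" using assms(2) by simp
  have "(\<lambda>x. if x \<in> \<Omega> then u x else 0) \<in> borel_measurable lebesgue"
    by (rule borel_measurable_if_I[OF assms(1)]) simp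
  from completion_ex_borel_measurable_real[OF this]
  obtain w where w: "w \<in> borel_measurable lborel" "AE x in lborel. (if x \<in> \<Omega> then u x else 0) = w x" by blast
  have [measurable]: "w \<in> borel_measurable borel" using w(1) by simp
  show thesis
  proof (rule that[of "\<lambda>x. indicator \<Omega> x * w x"])
    show "AE x in lborel. x \<in> \<Omega> \<longrightarrow> indicator \<Omega> x * w x = u x"
      using w(2) by eventually_elim auto
  qed auto
qed

lemma lebesgue_on_eq_lborel:
  fixes h h' :: "'a::euclidean_space \<Rightarrow> real"
  assumes h: "h \<in> borel_measurable (lebesgue_on \<Omega>)" and \<Omega>: "open \<Omega>"
    and h': "h' \<in> borel_measurable borel" "\<And>x. x \<notin> \<Omega> \<Longrightarrow> h' x = 0" "AE x in lborel. x \<in> \<Omega> \<longrightarrow> h' x = h x"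
  shows "integrable (lebesgue_on \<Omega>) h \<longleftrightarrow> integrable lborel h'"
    and "integral\<^sup>L (lebesgue_on \<Omega>) h = integral\<^sup>L lborel h'"
proof -
  have \<Omega>s: "\<Omega> \<in> sets lebesgue" using \<Omega> by simp
  have hm: "(\<lambda>x. indicator \<Omega> x *\<^sub>R h x) \<in> borel_measurable lebesgue"
  proof -
    have "(\<lambda>x. indicator \<Omega> x *\<^sub>R h x) = (\<lambda>x. if x \<in> \<Omega> then h x else 0)" by (auto simp: fun_eq_iff)
    then show ?thesis using borel_measurable_if_I[OF h \<Omega>s] by simp
  qed
  have h'm: "h' \<in> borel_measurable lebesgue" using h'(1) by (simp add: measurable_completion)
  have ae: "AE x in lebesgue. indicator \<Omega> x *\<^sub>R h x = h' x"
    by (rule AE_completion, use h'(3) in eventually_elim) (use h'(2) in \<open>auto simp: indicator_def\<close>)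
  have "integrable (lebesgue_on \<Omega>) h \<longleftrightarrow> integrable lebesgue (\<lambda>x. indicator \<Omega> x *\<^sub>R h x)"
    by (rule integrable_restrict_space) (use \<Omega>s in simp)
  also have "\<dots> \<longleftrightarrow> integrable lebesgue h'" by (rule integrable_cong_AE[OF hm h'm ae])
  also have "\<dots> \<longleftrightarrow> integrable lborel h'" by (rule integrable_completion) (use h'(1) in simp)
  finally show "integrable (lebesgue_on \<Omega>) h \<longleftrightarrow> integrable lborel h'" .
  have "integral\<^sup>L (lebesgue_on \<Omega>) h = integral\<^sup>L lebesgue (\<lambda>x. indicator \<Omega> x *\<^sub>R h x)"
    by (rule integral_restrict_space) (use \<Omega>s in simp)
  also have "\<dots> = integral\<^sup>L lebesgue h'" by (rule integral_cong_AE[OF hm h'm ae])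
  also have "\<dots> = integral\<^sup>L lborel h'" by (rule integral_completion) (use h'(1) in simp)
  finally show "integral\<^sup>L (lebesgue_on \<Omega>) h = integral\<^sup>L lborel h'" .
qed

lemma borel_measurable_lebesgue_on:
  fixes h :: "'a::euclidean_space \<Rightarrow> 'b::topological_space"
  shows "h \<in> borel_measurable borel \<Longrightarrow> h \<in> borel_measurable (lebesgue_on \<Omega>)"
  by (intro measurable_restrict_space1 measurable_completion) simp

lemma AE_lebesgue_on_iff:
  assumes "open \<Omega>"
  shows "(AE x in lebesgue_on \<Omega>. P x) \<longleftrightarrow> (AE x in lebesgue. x \<in> \<Omega> \<longrightarrow> P x)"
  by (rule AE_restrict_space_iff) (use assms in simp)

section \<open>Translation of the hypotheses, and vanishing of the solution by signs\<close>

theorem theorem1p3: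
  fixes \<Omega> :: "'a::euclidean_space set"
    and \<alpha> p :: real
    and V :: "'a \<Rightarrow> real" and gradV :: "'a \<Rightarrow> 'a"
    and u :: "'a \<Rightarrow> real" and Du :: "'a \<Rightarrow> 'a \<Rightarrow> real" and D2u :: "'a \<Rightarrow> 'a \<Rightarrow> 'a \<Rightarrow> real"
  assumes N3: "DIM('a) \<ge> 3"
    and alpha: "0 < \<alpha>" "\<alpha> < real DIM('a)"
    and dom: "smooth_domain \<Omega>"
    and star: "strictly_star_shaped \<Omega>"
    and p: "p \<ge> (real DIM('a) + \<alpha>) / (real DIM('a) - 2)"
    and V_C1: "\<forall>x\<in>\<Omega>. (V has_derivative (\<lambda>h. gradV x \<bullet> h)) (at x)" "continuous_on \<Omega> gradV"
    and u_H10: "H10 \<Omega> u Du"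
    and u_H2: "H2 \<Omega> u Du D2u"
    and u_W1q: "W1q (2 * p * real DIM('a) / (real DIM('a) + \<alpha>)) \<Omega> u Du"
    and eq: "AE x in lebesgue_on \<Omega>.
               - (\<Sum>b\<in>Basis. D2u b b x) + V x * u x
               = riesz_conv \<alpha> \<Omega> (\<lambda>y. \<bar>u y\<bar> powr p) x * (sgn (u x) * \<bar>u x\<bar> powr (p - 1))"
    and uV: "integrable (lebesgue_on \<Omega>) (\<lambda>x. (u x)\<^sup>2 * V x)"
    and uGV: "integrable (lebesgue_on \<Omega>) (\<lambda>x. (u x)\<^sup>2 * (gradV x \<bullet> x))"
    and uGV_nonneg: "integral\<^sup>L (lebesgue_on \<Omega>) (\<lambda>x. (u x)\<^sup>2 * (gradV x \<bullet> x)) \<ge> 0"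
    and V_crit: "p = (real DIM('a) + \<alpha>) / (real DIM('a) - 2) \<Longrightarrow> \<forall>x\<in>\<Omega>. V x > 0"
    and V_super: "p > (real DIM('a) + \<alpha>) / (real DIM('a) - 2) \<Longrightarrow> \<forall>x\<in>\<Omega>. V x \<ge> 0"
  shows "AE x in lebesgue_on \<Omega>. u x = 0"
proof -
  let ?N = "real DIM('a)"
  let ?q = "2 * p * ?N / (?N + \<alpha>)"
  have \<Omega>: "open \<Omega>" "\<Omega> \<noteq> {}" using dom unfolding smooth_domain_def by auto
  have [measurable]: "\<Omega> \<in> sets borel" using \<Omega> by simp
  have Lu: "Lp_on 2 \<Omega> u" "Lp_on ?q \<Omega> u" using u_H10 u_W1q unfolding H10_def W1q_def by auto
  have LDu: "Lp_on 2 \<Omega> (Du b)" "Lp_on ?q \<Omega> (Du b)" if "b \<in> Basis" for b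
    using u_H10 u_W1q that unfolding H10_def W1q_def by auto
  have LD2u: "Lp_on 2 \<Omega> (D2u b b)" "weak_pdiff \<Omega> b (Du b) (D2u b b)" if "b \<in> Basis" for b
    using u_H2 that unfolding H2_def by auto
  have um: "u \<in> borel_measurable (lebesgue_on \<Omega>)" using Lu unfolding Lp_on_def by simp
  have Dum: "Du b \<in> borel_measurable (lebesgue_on \<Omega>)" "D2u b b \<in> borel_measurable (lebesgue_on \<Omega>)" if "b \<in> Basis" for b
    using LDu(1)[OF that] LD2u(1)[OF that] unfolding Lp_on_def by auto
  obtain \<phi> where \<phi>: "\<And>k. test_fun \<Omega> (\<phi> k)"
    and \<phi>u: "(\<lambda>k. integral\<^sup>L (lebesgue_on \<Omega>) (\<lambda>x. (\<phi> k x - u x)\<^sup>2)) \<longlonglongrightarrow> 0"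
    and \<phi>Du: "\<And>b. b \<in> Basis \<Longrightarrow> (\<lambda>k. integral\<^sup>L (lebesgue_on \<Omega>) (\<lambda>x. (pdiff b (\<phi> k) x - Du b x)\<^sup>2)) \<longlonglongrightarrow> 0"
    using u_H10 unfolding H10_def by blast
  obtain U where U[measurable]: "U \<in> borel_measurable borel" and U0: "\<And>x. x \<notin> \<Omega> \<Longrightarrow> U x = 0"
    and Uu: "AE x in lborel. x \<in> \<Omega> \<longrightarrow> U x = u x"
    using borel_representative[OF um \<Omega>(1)] by blast
  have "\<exists>v. v \<in> borel_measurable borel \<and> (\<forall>x. x \<notin> \<Omega> \<longrightarrow> v x = 0) \<and> (AE x in lborel. x \<in> \<Omega> \<longrightarrow> v x = Du b x)" if "b \<in> Basis" for b
    by (rule borel_representative[OF Dum(1)[OF that] \<Omega>(1)]) blast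
  then obtain g where g: "\<And>b. b \<in> Basis \<Longrightarrow> g b \<in> borel_measurable borel"
    "\<And>b x. b \<in> Basis \<Longrightarrow> x \<notin> \<Omega> \<Longrightarrow> g b x = 0" "\<And>b. b \<in> Basis \<Longrightarrow> AE x in lborel. x \<in> \<Omega> \<longrightarrow> g b x = Du b x"
    by metis
  have "\<exists>v. v \<in> borel_measurable borel \<and> (\<forall>x. x \<notin> \<Omega> \<longrightarrow> v x = 0) \<and> (AE x in lborel. x \<in> \<Omega> \<longrightarrow> v x = D2u b b x)" if "b \<in> Basis" for b
    by (rule borel_representative[OF Dum(2)[OF that] \<Omega>(1)]) blast
  then obtain l where l: "\<And>b. b \<in> Basis \<Longrightarrow> l b \<in> borel_measurable borel"
    "\<And>b x. b \<in> Basis \<Longrightarrow> x \<notin> \<Omega> \<Longrightarrow> l b x = 0" "\<And>b. b \<in> Basis \<Longrightarrow> AE x in lborel. x \<in> \<Omega> \<longrightarrow> l b x = D2u b b x"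
    by metis
  define G where "G x = (\<Sum>b\<in>Basis. g b x *\<^sub>R b)" for x
  define L where "L x = (\<Sum>b\<in>Basis. l b x)" for x
  have Gm[measurable]: "G \<in> borel_measurable borel" unfolding G_def
    by (intro borel_measurable_sum borel_measurable_scaleR g borel_measurable_const)
  have Lm[measurable]: "L \<in> borel_measurable borel" unfolding L_def by (intro borel_measurable_sum l)
  have Gb: "G x \<bullet> b = g b x" if "b \<in> Basis" for x b
    using that by (simp add: G_def inner_sum_left inner_Basis if_distrib sum.delta cong: if_cong)
  have norm2: "(norm w)\<^sup>2 = (\<Sum>b\<in>Basis. (w \<bullet> b)\<^sup>2)" for w :: 'a
    unfolding power2_norm_eq_inner by (subst euclidean_inner) (simp add: power2_eq_square)
  have tr2: "integrable lborel (\<lambda>x. (v x)\<^sup>2)" if "Lp_on 2 \<Omega> w" "v \<in> borel_measurable borel"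
    "\<And>x. x \<notin> \<Omega> \<Longrightarrow> v x = 0" "AE x in lborel. x \<in> \<Omega> \<longrightarrow> v x = w x" for v w
  proof -
    have w: "w \<in> borel_measurable (lebesgue_on \<Omega>)" "integrable (lebesgue_on \<Omega>) (\<lambda>x. \<bar>w x\<bar> powr 2)"
      using that(1) unfolding Lp_on_def by auto
    have "integrable (lebesgue_on \<Omega>) (\<lambda>x. (w x)\<^sup>2)" using w(2) by (simp add: powr_numeral)
    moreover have "integrable (lebesgue_on \<Omega>) (\<lambda>x. (w x)\<^sup>2) \<longleftrightarrow> integrable lborel (\<lambda>x. (v x)\<^sup>2)"
      by (rule lebesgue_on_eq_lborel(1)[OF _ \<Omega>(1)]) (use w(1) that(2,3,4) in \<open>auto elim: eventually_mono\<close>)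
    ultimately show ?thesis by simp
  qed
  have trq: "integrable lborel (\<lambda>x. \<bar>v x\<bar> powr ?q)" if "Lp_on ?q \<Omega> w" "v \<in> borel_measurable borel"
    "\<And>x. x \<notin> \<Omega> \<Longrightarrow> v x = 0" "AE x in lborel. x \<in> \<Omega> \<longrightarrow> v x = w x" for v w
  proof -
    have w[measurable]: "w \<in> borel_measurable (lebesgue_on \<Omega>)" "integrable (lebesgue_on \<Omega>) (\<lambda>x. \<bar>w x\<bar> powr ?q)"
      using that(1) unfolding Lp_on_def by auto
    have "integrable (lebesgue_on \<Omega>) (\<lambda>x. \<bar>w x\<bar> powr ?q) \<longleftrightarrow> integrable lborel (\<lambda>x. \<bar>v x\<bar> powr ?q)"
      by (rule lebesgue_on_eq_lborel(1)[OF _ \<Omega>(1)]) (use that(2,3,4) in \<open>auto elim: eventually_mono\<close>)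
    then show ?thesis using w(2) by simp
  qed
  have g2: "integrable lborel (\<lambda>x. (g b x)\<^sup>2)" "integrable lborel (\<lambda>x. \<bar>g b x\<bar> powr ?q)" "integrable lborel (\<lambda>x. (l b x)\<^sup>2)"
    if "b \<in> Basis" for b
    using tr2[OF LDu(1)[OF that] g(1,2,3)[OF that]] trq[OF LDu(2)[OF that] g(1,2,3)[OF that]] tr2[OF LD2u(1)[OF that] l(1,2,3)[OF that]]
      that by auto
  have star': "t *\<^sub>R x \<in> \<Omega>" if "x \<in> \<Omega>" "0 \<le> t" "t \<le> 1" for x t
    using strictly_star_shaped_scaleR[OF star that] .
  interpret star_H10 \<Omega> U G \<phi>
  proof
    show "integrable lborel (\<lambda>x. (U x)\<^sup>2)" by (rule tr2[OF Lu(1) U U0 Uu])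
    show "integrable lborel (\<lambda>x. (norm (G x))\<^sup>2)" unfolding norm2 using g2 by (auto simp: Gb)
    show "G x = 0" if "x \<notin> \<Omega>" for x unfolding G_def using g(2) that by simp
    show "(\<lambda>k. \<integral>x. (\<phi> k x - U x)\<^sup>2 \<partial>lborel) \<longlonglongrightarrow> 0"
    proof -
      have "integral\<^sup>L (lebesgue_on \<Omega>) (\<lambda>x. (\<phi> k x - u x)\<^sup>2) = (LBINT x. (\<phi> k x - U x)\<^sup>2)" for k
      proof (rule lebesgue_on_eq_lborel(2)[OF _ \<Omega>(1)])
        show "(\<lambda>x. (\<phi> k x - u x)\<^sup>2) \<in> borel_measurable (lebesgue_on \<Omega>)"
          using um borel_measurable_lebesgue_on[OF test_fun_borel(1)[OF \<phi>]] by measurable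
      qed (use U U0 Uu test_fun_borel(1)[OF \<phi>] test_fun_zero_outside(1)[OF \<phi>] in \<open>auto elim: eventually_mono\<close>)
      then show ?thesis using \<phi>u by simp
    qed
    show "(\<lambda>k. \<integral>x. (norm (grad (\<phi> k) x - G x))\<^sup>2 \<partial>lborel) \<longlonglongrightarrow> 0"
    proof -
      have e: "integral\<^sup>L (lebesgue_on \<Omega>) (\<lambda>x. (pdiff b (\<phi> k) x - Du b x)\<^sup>2) = (LBINT x. (pdiff b (\<phi> k) x - g b x)\<^sup>2)" if b: "b \<in> Basis" for k b
      proof (rule lebesgue_on_eq_lborel(2)[OF _ \<Omega>(1)])
        show "(\<lambda>x. (pdiff b (\<phi> k) x - Du b x)\<^sup>2) \<in> borel_measurable (lebesgue_on \<Omega>)"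
          using Dum(1)[OF b] borel_measurable_lebesgue_on[OF test_fun_borel(3)[OF \<phi>]] by measurable
      qed (use g[OF b] test_fun_borel(3)[OF \<phi>] test_fun_zero_outside(2)[OF \<phi>] in \<open>auto elim: eventually_mono\<close>)
      have i: "integrable lborel (\<lambda>x. (pdiff b (\<phi> k) x - g b x)\<^sup>2)" if b: "b \<in> Basis" for k b
      proof -
        have "integrable lborel (\<lambda>x. (norm (pdiff b (\<phi> k) x - g b x))\<^sup>2)"
        proof (rule integrable_power2_diff)
          have "integrable lborel (\<lambda>x. (pdiff b (\<phi> k) x)\<^sup>2)"
          proof (rule integrable_dominated[OF test_fun_integrable_square(2)[OF \<phi>[of k]]])
            show "\<bar>(pdiff b (\<phi> k) x)\<^sup>2\<bar> \<le> (norm (grad (\<phi> k) x))\<^sup>2" for x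
              unfolding norm2 grad_inner_Basis[OF b, symmetric] abs_power2 using b by (intro member_le_sum) auto
          qed (use test_fun_borel(3)[OF \<phi>] in simp)
          then show "integrable lborel (\<lambda>x. (norm (pdiff b (\<phi> k) x))\<^sup>2)" by simp
        qed (use test_fun_borel(3)[OF \<phi>] g(1)[OF b] g2(1)[OF b] in auto)
        then show ?thesis by simp
      qed
      have "(LBINT x. (norm (grad (\<phi> k) x - G x))\<^sup>2) = (\<Sum>b\<in>Basis. integral\<^sup>L (lebesgue_on \<Omega>) (\<lambda>x. (pdiff b (\<phi> k) x - Du b x)\<^sup>2))" for k
      proof -
        have "(norm (grad (\<phi> k) x - G x))\<^sup>2 = (\<Sum>b\<in>Basis. (pdiff b (\<phi> k) x - g b x)\<^sup>2)" for x
          unfolding norm2 inner_diff_left by (intro sum.cong) (auto simp: grad_inner_Basis Gb)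
        then show ?thesis using i by (simp add: e)
      qed
      moreover have "(\<lambda>k. \<Sum>b\<in>Basis. integral\<^sup>L (lebesgue_on \<Omega>) (\<lambda>x. (pdiff b (\<phi> k) x - Du b x)\<^sup>2)) \<longlonglongrightarrow> (\<Sum>b\<in>(Basis::'a set). 0)"
        by (intro tendsto_sum \<phi>Du)
      ultimately show ?thesis by simp
    qed
  qed (use \<Omega> star' U0 \<phi> in auto)
  interpret star_H2 \<Omega> U G \<phi> L
  proof
    show "integrable lborel (\<lambda>x. (L x)\<^sup>2)"
    proof -
      have "integrable lborel (\<lambda>x. L x * L x)"
        unfolding L_def sum_product
        by (intro Bochner_Integration.integrable_sum integrable_mult_L2) (use l(1) g2(3) in auto)
      then show ?thesis by (simp add: power2_eq_square)
    qed
    fix \<psi> assume \<psi>: "test_fun \<Omega> \<psi>"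
    have p2: "integrable lborel (\<lambda>x. (pdiff b \<psi> x)\<^sup>2)" if b: "b \<in> Basis" for b
    proof (rule integrable_dominated[OF test_fun_integrable_square(2)[OF \<psi>]])
      show "\<bar>(pdiff b \<psi> x)\<^sup>2\<bar> \<le> (norm (grad \<psi> x))\<^sup>2" for x
        unfolding norm2 grad_inner_Basis[OF b, symmetric] abs_power2 using b by (intro member_le_sum) auto
    qed (use test_fun_borel(3)[OF \<psi>] in simp)
    have ib: "integrable lborel (\<lambda>x. g b x * pdiff b \<psi> x)" "integrable lborel (\<lambda>x. l b x * \<psi> x)" if b: "b \<in> Basis" for b
      by (rule integrable_mult_L2[OF _ _ g2(1)[OF b] p2[OF b]], use g(1)[OF b] test_fun_borel(3)[OF \<psi>] in auto)
         (rule integrable_mult_L2[OF _ _ g2(3)[OF b] test_fun_integrable_square(1)[OF \<psi>]], use l(1)[OF b] test_fun_borel(1)[OF \<psi>] in auto)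
    have eqb: "(LBINT x. g b x * pdiff b \<psi> x) = - (LBINT x. l b x * \<psi> x)" if b: "b \<in> Basis" for b
    proof -
      have "integral\<^sup>L (lebesgue_on \<Omega>) (\<lambda>x. Du b x * pdiff b \<psi> x) = (LBINT x. g b x * pdiff b \<psi> x)"
      proof (rule lebesgue_on_eq_lborel(2)[OF _ \<Omega>(1)])
        show "(\<lambda>x. Du b x * pdiff b \<psi> x) \<in> borel_measurable (lebesgue_on \<Omega>)"
          using Dum(1)[OF b] borel_measurable_lebesgue_on[OF test_fun_borel(3)[OF \<psi>]] by measurable
      qed (use g[OF b] test_fun_borel(3)[OF \<psi>] in \<open>auto elim: eventually_mono\<close>)
      moreover have "integral\<^sup>L (lebesgue_on \<Omega>) (\<lambda>x. D2u b b x * \<psi> x) = (LBINT x. l b x * \<psi> x)"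
      proof (rule lebesgue_on_eq_lborel(2)[OF _ \<Omega>(1)])
        show "(\<lambda>x. D2u b b x * \<psi> x) \<in> borel_measurable (lebesgue_on \<Omega>)"
          using Dum(2)[OF b] borel_measurable_lebesgue_on[OF test_fun_borel(1)[OF \<psi>]] by measurable
      qed (use l[OF b] test_fun_borel(1)[OF \<psi>] in \<open>auto elim: eventually_mono\<close>)
      ultimately show ?thesis using LD2u(2)[OF b] \<psi> unfolding weak_pdiff_def by simp
    qed
    have "(LBINT x. G x \<bullet> grad \<psi> x) = (LBINT x. (\<Sum>b\<in>Basis. g b x * pdiff b \<psi> x))"
      by (subst euclidean_inner) (simp add: Gb grad_inner_Basis)
    also have "\<dots> = - (\<Sum>b\<in>Basis. \<integral>x. l b x * \<psi> x \<partial>lborel)" using ib eqb by (simp add: sum_negf)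
    also have "(\<Sum>b\<in>Basis. \<integral>x. l b x * \<psi> x \<partial>lborel) = (LBINT x. L x * \<psi> x)"
      unfolding L_def sum_distrib_right using ib by simp
    finally show "(LBINT x. G x \<bullet> grad \<psi> x) = - (LBINT x. L x * \<psi> x)" .
  qed (use N3 in auto)
  have N2: "0 < ?N - 2" using N3 by simp
  have p1: "1 < p"
  proof -
    have "1 < (?N + \<alpha>) / (?N - 2)" using N2 alpha by simp
    then show ?thesis using p by linarith
  qed
  have q0: "0 < ?q" using p1 N3 alpha by (intro divide_pos_pos mult_pos_pos add_pos_pos) auto
  interpret star_choquard \<Omega> U G \<phi> \<alpha> p
  proof
    show "integrable lborel (\<lambda>x. \<bar>U x\<bar> powr ?q)" by (rule trq[OF Lu(2) U U0 Uu])
    show "integrable lborel (\<lambda>x. norm (G x) powr ?q)"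
    proof (rule integrable_dominated)
      show "integrable lborel (\<lambda>x. ?N powr ?q * (\<Sum>b\<in>Basis. \<bar>g b x\<bar> powr ?q))" using g2(2) by auto
      fix x
      \<comment> \<open>The norm is at most \<open>N\<close> times the largest component, whose
        power is one summand of the majorant; this gives the constant
        \<open>N powr q\<close>.\<close>
      let ?m = "Max ((\<lambda>b. \<bar>g b x\<bar>) ` Basis)"
      have "?m \<in> (\<lambda>b. \<bar>g b x\<bar>) ` Basis" by (intro Max_in) auto
      then obtain b where b: "?m = \<bar>g b x\<bar>" "b \<in> Basis" by (rule imageE)
      have "norm (G x) \<le> (\<Sum>b\<in>Basis. \<bar>G x \<bullet> b\<bar>)" by (rule norm_le_l1)
      also have "\<dots> \<le> (\<Sum>b\<in>(Basis::'a set). ?m)" by (intro sum_mono) (simp add: Gb)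
      also have "\<dots> = ?N * \<bar>g b x\<bar>" using b by simp
      finally have "norm (G x) powr ?q \<le> (?N * \<bar>g b x\<bar>) powr ?q" using q0 by (intro powr_mono2) auto
      also have "\<dots> = ?N powr ?q * \<bar>g b x\<bar> powr ?q" by (simp add: powr_mult)
      also have "\<dots> \<le> ?N powr ?q * (\<Sum>b\<in>Basis. \<bar>g b x\<bar> powr ?q)"
        using b by (intro mult_left_mono member_le_sum) auto
      finally show "\<bar>norm (G x) powr ?q\<bar> \<le> ?N powr ?q * (\<Sum>b\<in>Basis. \<bar>g b x\<bar> powr ?q)" by simp
    qed measurable
  qed (use alpha p1 in auto)
  have Vc: "continuous_on \<Omega> V"
    using V_C1(1) has_derivative_continuous continuous_at_imp_continuous_on by blast
  have [measurable]: "(\<lambda>x. indicator \<Omega> x * V x) \<in> borel_measurable borel" "(\<lambda>x. indicator \<Omega> x * (gradV x \<bullet> x)) \<in> borel_measurable borel"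
    using borel_measurable_continuous_on_indicator[OF _ Vc] borel_measurable_continuous_on_indicator[OF _ continuous_on_inner[OF V_C1(2) continuous_on_id]]
    by auto
  have VU: "integrable (lebesgue_on \<Omega>) (\<lambda>x. (u x)\<^sup>2 * W x) \<longleftrightarrow> integrable lborel (\<lambda>x. indicator \<Omega> x * ((U x)\<^sup>2 * W x))"
    "integral\<^sup>L (lebesgue_on \<Omega>) (\<lambda>x. (u x)\<^sup>2 * W x) = (LBINT x. indicator \<Omega> x * ((U x)\<^sup>2 * W x))"
    if W: "(\<lambda>x. indicator \<Omega> x * W x) \<in> borel_measurable borel" "integrable (lebesgue_on \<Omega>) (\<lambda>x. (u x)\<^sup>2 * W x)" for W
  proof -
    have m: "(\<lambda>x. indicator \<Omega> x * ((U x)\<^sup>2 * W x)) \<in> borel_measurable borel"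
    proof -
      have "(\<lambda>x. indicator \<Omega> x * ((U x)\<^sup>2 * W x)) = (\<lambda>x. (U x)\<^sup>2 * (indicator \<Omega> x * W x))" by (simp add: fun_eq_iff mult_ac)
      moreover have "(\<lambda>x. (U x)\<^sup>2 * (indicator \<Omega> x * W x)) \<in> borel_measurable borel"
        by (intro borel_measurable_times W(1) borel_measurable_power U)
      ultimately show ?thesis by simp
    qed
    have ae: "AE x in lborel. x \<in> \<Omega> \<longrightarrow> indicator \<Omega> x * ((U x)\<^sup>2 * W x) = (u x)\<^sup>2 * W x"
      using Uu by eventually_elim auto
    show "integrable (lebesgue_on \<Omega>) (\<lambda>x. (u x)\<^sup>2 * W x) \<longleftrightarrow> integrable lborel (\<lambda>x. indicator \<Omega> x * ((U x)\<^sup>2 * W x))"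
      "integral\<^sup>L (lebesgue_on \<Omega>) (\<lambda>x. (u x)\<^sup>2 * W x) = (LBINT x. indicator \<Omega> x * ((U x)\<^sup>2 * W x))"
      using lebesgue_on_eq_lborel[OF borel_measurable_integrable[OF W(2)] \<Omega>(1) m _ ae] by auto
  qed
  have UV': "integrable lborel (\<lambda>x. indicator \<Omega> x * ((U x)\<^sup>2 * V x))" using VU(1)[OF _ uV] uV by simp
  have UGV': "integrable lborel (\<lambda>x. indicator \<Omega> x * ((U x)\<^sup>2 * (gradV x \<bullet> x)))"
    and UGV0: "0 \<le> (LBINT x. indicator \<Omega> x * ((U x)\<^sup>2 * (gradV x \<bullet> x)))"
    using VU[OF _ uGV] uGV uGV_nonneg by auto
  define cR where "cR = riesz_const DIM('a) \<alpha>"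
  have conv: "riesz_conv \<alpha> \<Omega> (\<lambda>y. \<bar>u y\<bar> powr p) x = cR * (LBINT y. k (x - y) * f y)" for x
  proof -
    \<comment> \<open>This holds at \<open>z = 0\<close> too, where both sides are 0 by the
      conventions for \<open>powr\<close> and division.\<close>
    have rz: "riesz \<alpha> z = cR * k z" for z :: 'a
      unfolding riesz_def cR_def k_def s_def powr_minus divide_inverse ..
    have "riesz_conv \<alpha> \<Omega> (\<lambda>y. \<bar>u y\<bar> powr p) x = (LBINT y. cR * (k (x - y) * f y))"
      unfolding riesz_conv_def rz
    proof (rule lebesgue_on_eq_lborel(2)[OF _ \<Omega>(1)])
      have [measurable]: "(\<lambda>y. cR * k (x - y)) \<in> borel_measurable (lebesgue_on \<Omega>)"
        by (rule borel_measurable_lebesgue_on) measurable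
      show "(\<lambda>y. cR * k (x - y) * \<bar>u y\<bar> powr p) \<in> borel_measurable (lebesgue_on \<Omega>)"
        using um by measurable
      show "AE y in lborel. y \<in> \<Omega> \<longrightarrow> cR * (k (x - y) * f y) = cR * k (x - y) * \<bar>u y\<bar> powr p"
        using Uu by eventually_elim (auto simp: f_def)
    qed (auto simp: f_def U0)
    then show ?thesis by simp
  qed
  interpret choquard_solution \<Omega> U G \<phi> L \<alpha> p V gradV cR
  proof
    have "AE x in lebesgue. x \<in> \<Omega> \<longrightarrow> - (\<Sum>b\<in>Basis. D2u b b x) + V x * u x
        = cR * (LBINT y. k (x - y) * f y) * spow (p - 1) (u x)"
      using eq unfolding AE_lebesgue_on_iff[OF \<Omega>(1)] conv spow_def .
    moreover have "AE x in lborel. \<forall>b\<in>Basis. x \<in> \<Omega> \<longrightarrow> l b x = D2u b b x"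
      by (rule AE_finite_allI) (use l(3) in auto)
    then have "AE x in lebesgue. \<forall>b\<in>Basis. x \<in> \<Omega> \<longrightarrow> l b x = D2u b b x" by (rule AE_completion)
    moreover have "AE x in lebesgue. x \<in> \<Omega> \<longrightarrow> U x = u x" using Uu by (rule AE_completion)
    ultimately have "AE x in lebesgue. x \<in> \<Omega> \<longrightarrow> - L x + V x * U x = cR * (LBINT y. k (x - y) * f y) * spow (p - 1) (U x)"
      by eventually_elim (auto simp: L_def)
    then show "AE x in lborel. x \<in> \<Omega> \<longrightarrow> - L x + V x * U x = cR * (LBINT y. k (x - y) * f y) * spow (p - 1) (U x)"
      by (simp add: AE_completion_iff)
  qed (use V_C1 UV' UGV' in auto)
  define A where "A = (LBINT x. (norm (G x))\<^sup>2)"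
  define B where "B = (LBINT x. indicator \<Omega> x * ((U x)\<^sup>2 * V x))"
  have A0: "0 \<le> A" unfolding A_def by simp
  have V0: "0 \<le> V x" if "x \<in> \<Omega>" for x
    using V_crit V_super p that by (cases "p = (?N + \<alpha>) / (?N - 2)") (force intro: less_imp_le)+
  have VUnn: "0 \<le> indicator \<Omega> x * ((U x)\<^sup>2 * V x)" for x using V0[of x] by (cases "x \<in> \<Omega>") auto
  have B0: "0 \<le> B" unfolding B_def using VUnn by (intro integral_nonneg_AE AE_I2)
  have main: "((?N - 2) / 2 - (?N + \<alpha>) / (2 * p)) * A + (?N / 2 - (?N + \<alpha>) / (2 * p)) * B \<le> 0"
    using pohozaev_inequality UGV0 unfolding A_def B_def by linarith
  have U_zero: "AE x in lborel. x \<in> \<Omega> \<longrightarrow> U x = 0"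
  proof (cases "p = (?N + \<alpha>) / (?N - 2)")
    case True
    \<comment> \<open>At the critical exponent the gradient term drops out and the potential term
      has coefficient 1. All information is then in the integral of \<open>V u^2\<close>, so strict
      positivity of \<open>V\<close> is what forces \<open>u\<close> to vanish.\<close>
    have c: "(?N + \<alpha>) / (2 * p) = (?N - 2) / 2" unfolding True using N2 alpha by (simp add: field_simps)
    have "?N / 2 - (?N - 2) / 2 = 1" by (simp add: field_simps)
    then have "B \<le> 0" using main unfolding c by simp
    then have "B = 0" using B0 by simp
    then have "AE x in lborel. indicator \<Omega> x * ((U x)\<^sup>2 * V x) = 0"
      using integral_nonneg_eq_0_iff_AE[OF UV' AE_I2[OF VUnn]] unfolding B_def by simp
    then show ?thesis
    proof eventually_elim
      case (elim x)
      then show ?case using V_crit[OF True] by force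
    qed
  next
    case False
    then have "(?N + \<alpha>) / (?N - 2) < p" using p by simp
    then have "?N + \<alpha> < p * (?N - 2)" using N2 by (simp add: divide_less_eq)
    \<comment> \<open>Above the critical exponent the gradient coefficient is positive, and the
      potential coefficient exceeds it by 1. With \<open>V >= 0\<close> the gradient must vanish,
      whatever the zeros of \<open>V\<close>.\<close>
    then have c: "(?N + \<alpha>) / (2 * p) < (?N - 2) / 2" using p1 by (simp add: divide_less_eq mult.commute)
    have "0 \<le> (?N / 2 - (?N + \<alpha>) / (2 * p)) * B" using c B0 by (intro mult_nonneg_nonneg) auto
    then have "((?N - 2) / 2 - (?N + \<alpha>) / (2 * p)) * A \<le> 0" using main by linarith
    then have "A = 0" using c A0 by (simp add: mult_le_0_iff)
    then have "AE x in lborel. (norm (G x))\<^sup>2 = 0"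
      using integral_nonneg_eq_0_iff_AE[OF G_L2] unfolding A_def by simp
    then have "AE x in lborel. G x = 0" by simp
    from AE_zero_if_gradient_zero[OF this] show ?thesis by eventually_elim simp
  qed
  have "AE x in lborel. x \<in> \<Omega> \<longrightarrow> u x = 0" using U_zero Uu by eventually_elim auto
  then show ?thesis unfolding AE_lebesgue_on_iff[OF \<Omega>(1)] by (rule AE_completion)
qed

end
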